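(* Let $\Lambda$ be an artin algebra and $\Phi:\mathrm{maps}(\mathrm{mod}\,\Lambda)\to\mathrm{mod}(\mathrm{mod}\,\Lambda)$ the functor $\Phi(A_1\xrightarrow{f}A_0)=\mathrm{Coker}\big((-,A_1)\xrightarrow{(-,f)}(-,A_0)\big)$. Classical tilting subcategories in $\mathrm{mod}(\mathrm{mod}\,\Lambda)$ correspond under $\Phi$ with relative tilting subcategories $\mathcal{T}_{\mathrm{mod}\,\Lambda}$ of $\mathrm{maps}(\mathrm{mod}\,\Lambda)$ such that the following statements hold: (i) the maps $f:T_0\to T_1$ that are objects of $\mathcal{T}_{\mathrm{mod}\,\Lambda}$ are monomorphisms; (ii) given $T:T_0\xrightarrow{f}T_1$ and $T':T_0'\xrightarrow{g}T_1'$ in $\mathcal{T}_{\mathrm{mod}\,\Lambda}$, one has $\mathrm{Ext}^1_F(T,T')=0$; (iii) for each object $C$ in $\mathrm{mod}\,\Lambda$ there exists an exact sequence in $\mathrm{maps}(\mathrm{mod}\,\Lambda)$ $$0\to(0\to C)\to(T_0\xrightarrow{f}T_1)\to(T_0\xrightarrow{g}T_1')\to0$$ such that the sequence $0\to C\to T_1\to T_1'\to0$ splits and both $T_0\xrightarrow{f}T_1$ and $T_0\xrightarrow{g}T_1'$ are in $\mathcal{T}_{\mathrm{mod}\,\Lambda}$.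
   Context: $\mathrm{mod}\,\Lambda$: finitely generated left $\Lambda$-modules. $\mathrm{mod}(\mathrm{mod}\,\Lambda)$: finitely presented contravariant functors from $\mathrm{mod}\,\Lambda$ to abelian groups; $(-,X)=\mathrm{Hom}_\Lambda(-,X)$. $\mathrm{maps}(\mathrm{mod}\,\Lambda)$: objects are maps $f:A_1\to A_0$ of finitely generated $\Lambda$-modules, morphisms are commutative squares (this is an abelian category, equivalent to finitely generated modules over $\begin{pmatrix}\Lambda&0\\ \Lambda&\Lambda\end{pmatrix}$). The correspondence is the one between a subcategory $\mathcal{T}$ of $\mathrm{maps}(\mathrm{mod}\,\Lambda)$ and its image $\Phi(\mathcal{T})$ in $\mathrm{mod}(\mathrm{mod}\,\Lambda)$, for which $\mathcal{T}$ is a relative tilting subcategory if and only if $\Phi(\mathcal{T})$ is a tilting subcategory. Exact structure $F$: an exact sequence $0\to(N_1\xrightarrow{g}N_2)\to(E_1\xrightarrow{h}E_2)\to(M_1\xrightarrow{f}M_2)\to0$ in $\mathrm{maps}(\mathrm{mod}\,\Lambda)$ is $F$-exact if the sequences $0\to N_i\to E_i\to M_i\to0$ are exact and split for $i=0,1,2$, where $N_0=\ker g$, $E_0=\ker h$, $M_0=\ker f$. There are enough $F$-projectives (built from the objects $1_M:M\to M$ and $0\to M$), and $\mathrm{Ext}^k_F$ denotes the corresponding relative Ext groups; $\mathrm{rpdim}$ is the length of a shortest $F$-exact resolution by $F$-projectives. A subcategory $\mathcal{T}$ of $\mathrm{maps}(\mathrm{mod}\,\Lambda)$ is relative tilting if: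 given $T\in\mathcal{T}$ there exists an integer $n$ with $\mathrm{rpdim}\,T\le n$; $\mathrm{Ext}^k_F(T,T')=0$ for all $T,T'\in\mathcal{T}$ and $k\ge1$; and for each $C\in\mathrm{mod}\,\Lambda$ there is a finite $F$-exact sequence $0\to(0\to C)\to T^0\to\cdots\to T^n\to0$ with $T^i\in\mathcal{T}$ (a long exact sequence is $F$-exact if it is spliced from $F$-exact short exact sequences). A subcategory $\mathcal{T}$ of $\mathrm{mod}(\mathrm{mod}\,\Lambda)$ is classical tilting if $\mathrm{pdim}\,T\le1$ for all $T\in\mathcal{T}$; $\mathrm{Ext}^1(T,T')=0$ for all $T,T'\in\mathcal{T}$; and for each $C\in\mathrm{mod}\,\Lambda$ there is an exact sequence $0\to(-,C)\to T^0\to T^1\to0$ with $T^0,T^1\in\mathcal{T}$.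
   Formalization: Since Φ kills 1_M and M→0, the correspondence holds only up to isomorphism and summands 1_M: that Φ(T) classical tilting makes T relative tilting with (i)–(iii) is stated for T made of monomorphisms and closed under adding/removing summands 1_M. *)

theory Defs
  imports "HOL-Algebra.Ideal" "HOL-Algebra.Module" "HOL-Algebra.Elementary_Groups"
    "HOL-Library.Extended_Nat"
begin

section \<open>Homological algebra relative to a class of short exact sequences\<close>

text \<open>
  An additive category with a chosen class \<open>Ses\<close> of short exact sequences
  \<open>0 \<rightarrow> N \<rightarrow> E \<rightarrow> M \<rightarrow> 0\<close>, written \<open>(N, i, E, p, M)\<close>. The abelian groups \<open>Mor\<close> are written
  multiplicatively, as in \<^theory>\<open>HOL-Algebra.Group\<close>, so the zero morphism is
  \<open>\<one>\<^bsub>Mor \<C> X Y\<^esub>\<close>. Morphisms do not record their domain; composition gets it as its first object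
  argument: \<open>Comp \<C> X g f\<close> is \<open>g \<circ> f\<close> for \<open>f\<close> with domain \<open>X\<close>.
\<close>

record ('o, 'h) ses_category =
  Ob :: "'o set"
  Mor :: "'o \<Rightarrow> 'o \<Rightarrow> 'h monoid"
  Id :: "'o \<Rightarrow> 'h"
  Comp :: "'o \<Rightarrow> 'h \<Rightarrow> 'h \<Rightarrow> 'h"
  Ses :: "('o \<times> 'h \<times> 'o \<times> 'h \<times> 'o) set"

definition isomorphic :: "('o, 'h) ses_category \<Rightarrow> 'o \<Rightarrow> 'o \<Rightarrow> bool" where
  "isomorphic \<C> X Y \<longleftrightarrow>
     (\<exists>f \<in> carrier (Mor \<C> X Y). \<exists>g \<in> carrier (Mor \<C> Y X).
        Comp \<C> X g f = Id \<C> X \<and> Comp \<C> Y f g = Id \<C> Y)"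

definition iso_closure :: "('o, 'h) ses_category \<Rightarrow> 'o set \<Rightarrow> 'o set" where
  "iso_closure \<C> \<U> = {X \<in> Ob \<C>. \<exists>U \<in> \<U>. isomorphic \<C> X U}"

definition zero_object :: "('o, 'h) ses_category \<Rightarrow> 'o \<Rightarrow> bool" where
  "zero_object \<C> Z \<longleftrightarrow> Z \<in> Ob \<C> \<and> Id \<C> Z = \<one>\<^bsub>Mor \<C> Z Z\<^esub>"

definition is_biproduct :: "('o, 'h) ses_category \<Rightarrow> 'o \<Rightarrow> 'o \<Rightarrow> 'o \<Rightarrow> bool" where
  "is_biproduct \<C> X Y Z \<longleftrightarrow> Z \<in> Ob \<C> \<and>
     (\<exists>i \<in> carrier (Mor \<C> X Z). \<exists>j \<in> carrier (Mor \<C> Y Z).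
      \<exists>p \<in> carrier (Mor \<C> Z X). \<exists>q \<in> carrier (Mor \<C> Z Y).
        Comp \<C> X p i = Id \<C> X \<and> Comp \<C> Y q j = Id \<C> Y \<and>
        Comp \<C> X q i = \<one>\<^bsub>Mor \<C> X Y\<^esub> \<and> Comp \<C> Y p j = \<one>\<^bsub>Mor \<C> Y X\<^esub> \<and>
        Comp \<C> Z i p \<otimes>\<^bsub>Mor \<C> Z Z\<^esub> Comp \<C> Z j q = Id \<C> Z)"

definition projective :: "('o, 'h) ses_category \<Rightarrow> 'o \<Rightarrow> bool" where
  "projective \<C> P \<longleftrightarrow> P \<in> Ob \<C> \<and>
     (\<forall>N i E p M. (N, i, E, p, M) \<in> Ses \<C> \<longrightarrow>
        (\<forall>h \<in> carrier (Mor \<C> P M). \<exists>g \<in> carrier (Mor \<C> P E). Comp \<C> P p g = h))"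

text \<open>
  Long exact sequences are spliced from members of \<open>Ses\<close>: in the following definitions the \<open>K m\<close>
  are the intermediate objects of the splicing. The condition that \<open>K (Suc n)\<close> is a zero object
  makes a sequence end with \<open>P n\<close>.
\<close>

definition finite_resolution :: "('o, 'h) ses_category \<Rightarrow> nat \<Rightarrow> 'o \<Rightarrow> bool" where
  "finite_resolution \<C> n X \<longleftrightarrow>
     (\<exists>P K i p. K 0 = X \<and>
        (\<forall>m\<le>n. projective \<C> (P m) \<and> (K (Suc m), i m, P m, p m, K m) \<in> Ses \<C>) \<and>
        zero_object \<C> (K (Suc n)))"

definition pdim :: "('o, 'h) ses_category \<Rightarrow> 'o \<Rightarrow> enat" where
  "pdim \<C> X = (INF n \<in> {n. finite_resolution \<C> n X}. enat n)"

definition finite_coresolution :: "('o, 'h) ses_category \<Rightarrow> 'o set \<Rightarrow> 'o \<Rightarrow> bool" where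
  "finite_coresolution \<C> \<T> X \<longleftrightarrow>
     (\<exists>n T K i p. K 0 = X \<and>
        (\<forall>m\<le>n. T m \<in> \<T> \<and> (K m, i m, T m, p m, K (Suc m)) \<in> Ses \<C>) \<and>
        zero_object \<C> (K (Suc n)))"

type_synonym ('o, 'h) resolution = "(nat \<Rightarrow> 'o) \<times> (nat \<Rightarrow> 'o) \<times> (nat \<Rightarrow> 'h) \<times> (nat \<Rightarrow> 'h)"

definition projective_resolution ::
    "('o, 'h) ses_category \<Rightarrow> 'o \<Rightarrow> ('o, 'h) resolution \<Rightarrow> bool" where
  "projective_resolution \<C> X = (\<lambda>(P, K, i, p). K 0 = X \<and>
     (\<forall>n. projective \<C> (P n) \<and> (K (Suc n), i n, P n, p n, K n) \<in> Ses \<C>))"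

text \<open>The \<open>k\<close>-th cohomology group of the complex \<open>Mor (P 0) Y \<rightarrow> Mor (P 1) Y \<rightarrow> \<dots>\<close>.\<close>

definition resolution_cohomology ::
    "('o, 'h) ses_category \<Rightarrow> ('o, 'h) resolution \<Rightarrow> nat \<Rightarrow> 'o \<Rightarrow> 'h set monoid" where
  "resolution_cohomology \<C> = (\<lambda>(P, K, i, p) k Y.
     let d = (\<lambda>n. Comp \<C> (P (Suc n)) (i n) (p (Suc n)));
         cocycles = {\<phi> \<in> carrier (Mor \<C> (P k) Y).
            Comp \<C> (P (Suc k)) \<phi> (d k) = \<one>\<^bsub>Mor \<C> (P (Suc k)) Y\<^esub>};
         coboundaries = (case k of
            0 \<Rightarrow> {\<one>\<^bsub>Mor \<C> (P 0) Y\<^esub>}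
          | Suc j \<Rightarrow> (\<lambda>\<psi>. Comp \<C> (P (Suc j)) \<psi> (d j)) ` carrier (Mor \<C> (P j) Y))
     in (Mor \<C> (P k) Y)\<lparr>carrier := cocycles\<rparr> Mod coboundaries)"

text \<open>
  Up to isomorphism this does not depend on the chosen resolution; it is meaningful because the two
  categories below have enough projectives.
\<close>

definition Ext :: "('o, 'h) ses_category \<Rightarrow> nat \<Rightarrow> 'o \<Rightarrow> 'o \<Rightarrow> 'h set monoid" where
  "Ext \<C> k X Y = resolution_cohomology \<C> (SOME r. projective_resolution \<C> X r) k Y"


section \<open>Artin algebras and finitely generated left modules\<close>

definition artinian_ring :: "('r, 's) ring_scheme \<Rightarrow> bool" where
  "artinian_ring R \<longleftrightarrow> cring R \<and>
     (\<forall>I :: nat \<Rightarrow> 'r set. (\<forall>n. ideal (I n) R \<and> I (Suc n) \<subseteq> I n) \<longrightarrow> (\<exists>n. \<forall>m\<ge>n. I m = I n))"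

text \<open>The \<open>R\<close>-algebra structure of \<open>\<Lambda>\<close> is given by a ring homomorphism \<open>\<sigma>\<close> from \<open>R\<close> to the centre
  of \<open>\<Lambda>\<close>.\<close>

definition artin_algebra ::
    "('r, 's) ring_scheme \<Rightarrow> ('r \<Rightarrow> 'a) \<Rightarrow> ('a, 'b) ring_scheme \<Rightarrow> bool" where
  "artin_algebra R \<sigma> \<Lambda> \<longleftrightarrow> artinian_ring R \<and> ring \<Lambda> \<and> \<sigma> \<in> ring_hom R \<Lambda> \<and>
     (\<forall>r \<in> carrier R. \<forall>a \<in> carrier \<Lambda>. \<sigma> r \<otimes>\<^bsub>\<Lambda>\<^esub> a = a \<otimes>\<^bsub>\<Lambda>\<^esub> \<sigma> r) \<and>
     (\<exists>S. finite S \<and> S \<subseteq> carrier \<Lambda> \<and>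
        (\<forall>a \<in> carrier \<Lambda>. \<exists>c \<in> S \<rightarrow> carrier R. a = (\<Oplus>\<^bsub>\<Lambda>\<^esub>s\<in>S. \<sigma> (c s) \<otimes>\<^bsub>\<Lambda>\<^esub> s)))"

text \<open>The library locale \<^locale>\<open>module\<close> is restricted to commutative rings. Its record type is used
  here; the fields \<open>mult\<close> and \<open>one\<close> of a module are ignored.\<close>

locale left_module = R?: ring R + M?: abelian_group M
  for R :: "('a, 'b) ring_scheme" (structure) and M :: "('a, 'm) module" (structure) +
  assumes lsmult_closed: "\<lbrakk>a \<in> carrier R; x \<in> carrier M\<rbrakk> \<Longrightarrow> a \<odot>\<^bsub>M\<^esub> x \<in> carrier M"
    and lsmult_l_distr: "\<lbrakk>a \<in> carrier R; b \<in> carrier R; x \<in> carrier M\<rbrakk> \<Longrightarrow>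
      (a \<oplus>\<^bsub>R\<^esub> b) \<odot>\<^bsub>M\<^esub> x = a \<odot>\<^bsub>M\<^esub> x \<oplus>\<^bsub>M\<^esub> b \<odot>\<^bsub>M\<^esub> x"
    and lsmult_r_distr: "\<lbrakk>a \<in> carrier R; x \<in> carrier M; y \<in> carrier M\<rbrakk> \<Longrightarrow>
      a \<odot>\<^bsub>M\<^esub> (x \<oplus>\<^bsub>M\<^esub> y) = a \<odot>\<^bsub>M\<^esub> x \<oplus>\<^bsub>M\<^esub> a \<odot>\<^bsub>M\<^esub> y"
    and lsmult_assoc: "\<lbrakk>a \<in> carrier R; b \<in> carrier R; x \<in> carrier M\<rbrakk> \<Longrightarrow>
      (a \<otimes>\<^bsub>R\<^esub> b) \<odot>\<^bsub>M\<^esub> x = a \<odot>\<^bsub>M\<^esub> (b \<odot>\<^bsub>M\<^esub> x)"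
    and lsmult_one: "x \<in> carrier M \<Longrightarrow> \<one>\<^bsub>R\<^esub> \<odot>\<^bsub>M\<^esub> x = x"

text \<open>
  The elements of a module in \<open>mod \<Lambda>\<close> are taken from the type \<^typ>\<open>(nat \<Rightarrow> 'a) set\<close>. This type
  contains the cosets of every submodule of every \<open>\<Lambda>\<^sup>n\<close>, so every finitely generated \<open>\<Lambda>\<close>-module,
  on whatever type, is isomorphic to one of this kind: the category below is equivalent to the
  category of all finitely generated left modules.
\<close>

type_synonym 'a elt = "(nat \<Rightarrow> 'a) set"
type_synonym 'a lmod = "('a, 'a elt) module"
type_synonym 'a lmap = "'a elt \<Rightarrow> 'a elt"

definition fg_mod :: "('a, 'b) ring_scheme \<Rightarrow> 'a lmod set" where
  "fg_mod \<Lambda> = {M. left_module \<Lambda> M \<and>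
     (\<exists>S. finite S \<and> S \<subseteq> carrier M \<and>
        (\<forall>x \<in> carrier M. \<exists>c \<in> S \<rightarrow> carrier \<Lambda>. x = (\<Oplus>\<^bsub>M\<^esub>s\<in>S. c s \<odot>\<^bsub>M\<^esub> s)))}"

text \<open>Module homomorphisms are extensional functions, so that equal homomorphisms are equal as
  elements of the type.\<close>

definition mod_hom :: "('a, 'b) ring_scheme \<Rightarrow> 'a lmod \<Rightarrow> 'a lmod \<Rightarrow> 'a lmap monoid" where
  "mod_hom \<Lambda> M N =
     \<lparr>carrier = {f \<in> carrier M \<rightarrow>\<^sub>E carrier N.
        (\<forall>x \<in> carrier M. \<forall>y \<in> carrier M. f (x \<oplus>\<^bsub>M\<^esub> y) = f x \<oplus>\<^bsub>N\<^esub> f y) \<and>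
        (\<forall>a \<in> carrier \<Lambda>. \<forall>x \<in> carrier M. f (a \<odot>\<^bsub>M\<^esub> x) = a \<odot>\<^bsub>N\<^esub> f x)},
      mult = (\<lambda>f g. \<lambda>x \<in> carrier M. f x \<oplus>\<^bsub>N\<^esub> g x),
      one = (\<lambda>x \<in> carrier M. \<zero>\<^bsub>N\<^esub>)\<rparr>"

definition mod_id :: "'a lmod \<Rightarrow> 'a lmap" where
  "mod_id M = (\<lambda>x \<in> carrier M. x)"

definition mod_zero :: "'a lmod" where
  "mod_zero = \<lparr>carrier = {undefined}, mult = (\<lambda>_ _. undefined), one = undefined,
     zero = undefined, add = (\<lambda>_ _. undefined), smult = (\<lambda>_ _. undefined)\<rparr>"

definition mod_ses :: "('a, 'b) ring_scheme \<Rightarrow>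
    'a lmod \<Rightarrow> 'a lmap \<Rightarrow> 'a lmod \<Rightarrow> 'a lmap \<Rightarrow> 'a lmod \<Rightarrow> bool" where
  "mod_ses \<Lambda> N i E p M \<longleftrightarrow> i \<in> carrier (mod_hom \<Lambda> N E) \<and> p \<in> carrier (mod_hom \<Lambda> E M) \<and>
     inj_on i (carrier N) \<and> p ` carrier E = carrier M \<and>
     i ` carrier N = {x \<in> carrier E. p x = \<zero>\<^bsub>M\<^esub>}"

definition mod_split_ses :: "('a, 'b) ring_scheme \<Rightarrow>
    'a lmod \<Rightarrow> 'a lmap \<Rightarrow> 'a lmod \<Rightarrow> 'a lmap \<Rightarrow> 'a lmod \<Rightarrow> bool" where
  "mod_split_ses \<Lambda> N i E p M \<longleftrightarrow> mod_ses \<Lambda> N i E p M \<and>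
     (\<exists>s \<in> carrier (mod_hom \<Lambda> M E). compose (carrier M) p s = mod_id M)"


section \<open>The category of maps and its exact structure \<open>F\<close>\<close>

text \<open>The triple \<open>(A1, A0, f)\<close> is the map \<open>f : A1 \<rightarrow> A0\<close>; a morphism is the pair of its components
  on domains and codomains.\<close>

type_synonym 'a mapobj = "'a lmod \<times> 'a lmod \<times> 'a lmap"
type_synonym 'a mapmor = "'a lmap \<times> 'a lmap"

definition maps_ob :: "('a, 'b) ring_scheme \<Rightarrow> 'a mapobj set" where
  "maps_ob \<Lambda> = {(A1, A0, f). A1 \<in> fg_mod \<Lambda> \<and> A0 \<in> fg_mod \<Lambda> \<and> f \<in> carrier (mod_hom \<Lambda> A1 A0)}"

definition maps_mor :: "('a, 'b) ring_scheme \<Rightarrow> 'a mapobj \<Rightarrow> 'a mapobj \<Rightarrow> 'a mapmor monoid" where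
  "maps_mor \<Lambda> = (\<lambda>(A1, A0, f) (B1, B0, g).
     \<lparr>carrier = {(u1, u0). u1 \<in> carrier (mod_hom \<Lambda> A1 B1) \<and> u0 \<in> carrier (mod_hom \<Lambda> A0 B0) \<and>
        compose (carrier A1) g u1 = compose (carrier A1) u0 f},
      mult = (\<lambda>(u1, u0) (v1, v0). (u1 \<otimes>\<^bsub>mod_hom \<Lambda> A1 B1\<^esub> v1, u0 \<otimes>\<^bsub>mod_hom \<Lambda> A0 B0\<^esub> v0)),
      one = (\<one>\<^bsub>mod_hom \<Lambda> A1 B1\<^esub>, \<one>\<^bsub>mod_hom \<Lambda> A0 B0\<^esub>)\<rparr>)"

definition maps_id :: "'a mapobj \<Rightarrow> 'a mapmor" where
  "maps_id = (\<lambda>(A1, A0, f). (mod_id A1, mod_id A0))"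

definition maps_comp :: "'a mapobj \<Rightarrow> 'a mapmor \<Rightarrow> 'a mapmor \<Rightarrow> 'a mapmor" where
  "maps_comp = (\<lambda>(A1, A0, f) (v1, v0) (u1, u0).
     (compose (carrier A1) v1 u1, compose (carrier A0) v0 u0))"

text \<open>Exactness in the abelian category of maps is exactness on domains and on codomains.\<close>

definition maps_ses :: "('a, 'b) ring_scheme \<Rightarrow>
    ('a mapobj \<times> 'a mapmor \<times> 'a mapobj \<times> 'a mapmor \<times> 'a mapobj) set" where
  "maps_ses \<Lambda> = {(N, i, E, p, M).
     N \<in> maps_ob \<Lambda> \<and> E \<in> maps_ob \<Lambda> \<and> M \<in> maps_ob \<Lambda> \<and>
     i \<in> carrier (maps_mor \<Lambda> N E) \<and> p \<in> carrier (maps_mor \<Lambda> E M) \<and>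
     mod_ses \<Lambda> (fst N) (fst i) (fst E) (fst p) (fst M) \<and>
     mod_ses \<Lambda> (fst (snd N)) (snd i) (fst (snd E)) (snd p) (fst (snd M))}"

definition map_ker :: "'a mapobj \<Rightarrow> 'a lmod" where
  "map_ker = (\<lambda>(A1, A0, f). A1\<lparr>carrier := {x \<in> carrier A1. f x = \<zero>\<^bsub>A0\<^esub>}\<rparr>)"

definition F_ses :: "('a, 'b) ring_scheme \<Rightarrow>
    ('a mapobj \<times> 'a mapmor \<times> 'a mapobj \<times> 'a mapmor \<times> 'a mapobj) set" where
  "F_ses \<Lambda> = {(N, i, E, p, M). (N, i, E, p, M) \<in> maps_ses \<Lambda> \<and>
     mod_split_ses \<Lambda> (map_ker N) (restrict (fst i) (carrier (map_ker N)))
       (map_ker E) (restrict (fst p) (carrier (map_ker E))) (map_ker M) \<and>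
     mod_split_ses \<Lambda> (fst N) (fst i) (fst E) (fst p) (fst M) \<and>
     mod_split_ses \<Lambda> (fst (snd N)) (snd i) (fst (snd E)) (snd p) (fst (snd M))}"

definition maps_F :: "('a, 'b) ring_scheme \<Rightarrow> ('a mapobj, 'a mapmor) ses_category" where
  "maps_F \<Lambda> = \<lparr>Ob = maps_ob \<Lambda>, Mor = maps_mor \<Lambda>, Id = maps_id, Comp = maps_comp,
     Ses = F_ses \<Lambda>\<rparr>"

definition zero_map_to :: "'a lmod \<Rightarrow> 'a mapobj" where
  "zero_map_to C = (mod_zero, C, \<lambda>x \<in> carrier mod_zero. \<zero>\<^bsub>C\<^esub>)"

definition identity_map :: "'a lmod \<Rightarrow> 'a mapobj" where
  "identity_map M = (M, M, mod_id M)"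


section \<open>Finitely presented functors\<close>

text \<open>\<open>far F X Y h\<close> is the action \<open>F Y \<rightarrow> F X\<close> of \<open>h : X \<rightarrow> Y\<close>. Values of a functor on arguments
  outside \<open>mod \<Lambda>\<close> are ignored.\<close>

record ('a, 'g) cfunctor =
  fob :: "'a lmod \<Rightarrow> 'g monoid"
  far :: "'a lmod \<Rightarrow> 'a lmod \<Rightarrow> 'a lmap \<Rightarrow> 'g \<Rightarrow> 'g"

definition contravariant_functor :: "('a, 'b) ring_scheme \<Rightarrow> ('a, 'g) cfunctor \<Rightarrow> bool" where
  "contravariant_functor \<Lambda> F \<longleftrightarrow>
     (\<forall>X \<in> fg_mod \<Lambda>. comm_group (fob F X) \<and>
        (\<forall>x \<in> carrier (fob F X). far F X X (mod_id X) x = x)) \<and>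
     (\<forall>X \<in> fg_mod \<Lambda>. \<forall>Y \<in> fg_mod \<Lambda>. \<forall>h \<in> carrier (mod_hom \<Lambda> X Y).
        far F X Y h \<in> hom (fob F Y) (fob F X)) \<and>
     (\<forall>X \<in> fg_mod \<Lambda>. \<forall>Y \<in> fg_mod \<Lambda>. \<forall>Z \<in> fg_mod \<Lambda>.
        \<forall>h \<in> carrier (mod_hom \<Lambda> X Y). \<forall>k \<in> carrier (mod_hom \<Lambda> Y Z).
        \<forall>z \<in> carrier (fob F Z).
          far F X Z (compose (carrier X) k h) z = far F X Y h (far F Y Z k z))"

definition nat_trans ::
    "('a, 'b) ring_scheme \<Rightarrow> ('a, 'g) cfunctor \<Rightarrow> ('a, 'h) cfunctor \<Rightarrow> ('a lmod \<Rightarrow> 'g \<Rightarrow> 'h) set" where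
  "nat_trans \<Lambda> F G = {\<eta> \<in> extensional (fg_mod \<Lambda>).
     (\<forall>X \<in> fg_mod \<Lambda>. \<eta> X \<in> hom (fob F X) (fob G X) \<inter> extensional (carrier (fob F X))) \<and>
     (\<forall>X \<in> fg_mod \<Lambda>. \<forall>Y \<in> fg_mod \<Lambda>. \<forall>h \<in> carrier (mod_hom \<Lambda> X Y). \<forall>y \<in> carrier (fob F Y).
        \<eta> X (far F X Y h y) = far G X Y h (\<eta> Y y))}"

text \<open>Exactness of sequences of functors is exactness at each module. The three functors may take
  values in groups on different types.\<close>

definition functor_ses :: "('a, 'b) ring_scheme \<Rightarrow> ('a, 'g) cfunctor \<Rightarrow> ('a lmod \<Rightarrow> 'g \<Rightarrow> 'h) \<Rightarrow>
    ('a, 'h) cfunctor \<Rightarrow> ('a lmod \<Rightarrow> 'h \<Rightarrow> 'k) \<Rightarrow> ('a, 'k) cfunctor \<Rightarrow> bool" where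
  "functor_ses \<Lambda> F \<alpha> G \<beta> H \<longleftrightarrow> \<alpha> \<in> nat_trans \<Lambda> F G \<and> \<beta> \<in> nat_trans \<Lambda> G H \<and>
     (\<forall>X \<in> fg_mod \<Lambda>. inj_on (\<alpha> X) (carrier (fob F X)) \<and>
        \<beta> X ` carrier (fob G X) = carrier (fob H X) \<and>
        \<alpha> X ` carrier (fob F X) = kernel (fob G X) (fob H X) (\<beta> X))"

definition representable :: "('a, 'b) ring_scheme \<Rightarrow> 'a lmod \<Rightarrow> ('a, 'a lmap) cfunctor" where
  "representable \<Lambda> C = \<lparr>fob = (\<lambda>X. mod_hom \<Lambda> X C), far = (\<lambda>X Y h \<phi>. compose (carrier X) \<phi> h)\<rparr>"

definition finitely_presented :: "('a, 'b) ring_scheme \<Rightarrow> ('a, 'g) cfunctor \<Rightarrow> bool" where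
  "finitely_presented \<Lambda> F \<longleftrightarrow>
     (\<exists>A1 \<in> fg_mod \<Lambda>. \<exists>A0 \<in> fg_mod \<Lambda>.
      \<exists>\<alpha> \<in> nat_trans \<Lambda> (representable \<Lambda> A1) (representable \<Lambda> A0).
      \<exists>\<beta> \<in> nat_trans \<Lambda> (representable \<Lambda> A0) F.
      \<forall>X \<in> fg_mod \<Lambda>. \<beta> X ` carrier (mod_hom \<Lambda> X A0) = carrier (fob F X) \<and>
        \<alpha> X ` carrier (mod_hom \<Lambda> X A1) = kernel (mod_hom \<Lambda> X A0) (fob F X) (\<beta> X))"

text \<open>
  The values of the functors in \<open>mod (mod \<Lambda>)\<close> are groups with elements of type
  \<^typ>\<open>'a lmap set\<close>. This type contains the cosets in the groups \<open>Hom(X, A)\<close>, hence all cokernels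
  of maps between representable functors, and so every finitely presented functor up to isomorphism.
\<close>

type_synonym 'a fpfun = "('a, 'a lmap set) cfunctor"
type_synonym 'a fpmor = "'a lmod \<Rightarrow> 'a lmap set \<Rightarrow> 'a lmap set"

definition mod_mod :: "('a, 'b) ring_scheme \<Rightarrow> ('a fpfun, 'a fpmor) ses_category" where
  "mod_mod \<Lambda> = (let Obj = {F. contravariant_functor \<Lambda> F \<and> finitely_presented \<Lambda> F} in
     \<lparr>Ob = Obj,
      Mor = (\<lambda>F G. \<lparr>carrier = nat_trans \<Lambda> F G,
        mult = (\<lambda>\<eta> \<theta>. \<lambda>X \<in> fg_mod \<Lambda>. \<lambda>x \<in> carrier (fob F X). \<eta> X x \<otimes>\<^bsub>fob G X\<^esub> \<theta> X x),
        one = (\<lambda>X \<in> fg_mod \<Lambda>. \<lambda>x \<in> carrier (fob F X). \<one>\<^bsub>fob G X\<^esub>)\<rparr>),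
      Id = (\<lambda>F. \<lambda>X \<in> fg_mod \<Lambda>. \<lambda>x \<in> carrier (fob F X). x),
      Comp = (\<lambda>F \<theta> \<eta>. \<lambda>X \<in> fg_mod \<Lambda>. compose (carrier (fob F X)) (\<theta> X) (\<eta> X)),
      Ses = {(F, \<alpha>, G, \<beta>, H). F \<in> Obj \<and> G \<in> Obj \<and> H \<in> Obj \<and> functor_ses \<Lambda> F \<alpha> G \<beta> H}\<rparr>)"

text \<open>\<open>Phi (A1, A0, f)\<close> is the cokernel of \<open>(-, f) : (-, A1) \<rightarrow> (-, A0)\<close>. A map \<open>h : X \<rightarrow> Y\<close> sends
  the coset of \<open>\<phi> : Y \<rightarrow> A0\<close> to the coset of \<open>\<phi> \<circ> h\<close>.\<close>

definition phi_image :: "('a, 'b) ring_scheme \<Rightarrow> 'a mapobj \<Rightarrow> 'a lmod \<Rightarrow> 'a lmap set" where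
  "phi_image \<Lambda> = (\<lambda>(A1, A0, f) X. (\<lambda>\<phi>. compose (carrier X) f \<phi>) ` carrier (mod_hom \<Lambda> X A1))"

definition Phi :: "('a, 'b) ring_scheme \<Rightarrow> 'a mapobj \<Rightarrow> 'a fpfun" where
  "Phi \<Lambda> A =
     \<lparr>fob = (\<lambda>X. mod_hom \<Lambda> X (fst (snd A)) Mod phi_image \<Lambda> A X),
      far = (\<lambda>X Y h U. \<Union>\<phi>\<in>U.
        phi_image \<Lambda> A X #>\<^bsub>mod_hom \<Lambda> X (fst (snd A))\<^esub> compose (carrier X) \<phi> h)\<rparr>"

definition Phi_image :: "('a, 'b) ring_scheme \<Rightarrow> 'a mapobj set \<Rightarrow> 'a fpfun set" where
  "Phi_image \<Lambda> \<T> = iso_closure (mod_mod \<Lambda>) (Phi \<Lambda> ` \<T>)"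


section \<open>Tilting subcategories\<close>

text \<open>Subcategories are full and given by their objects.\<close>

definition relative_tilting :: "('a, 'b) ring_scheme \<Rightarrow> 'a mapobj set \<Rightarrow> bool" where
  "relative_tilting \<Lambda> \<T> \<longleftrightarrow> \<T> \<subseteq> Ob (maps_F \<Lambda>) \<and>
     (\<forall>T \<in> \<T>. \<exists>n :: nat. pdim (maps_F \<Lambda>) T \<le> enat n) \<and>
     (\<forall>T \<in> \<T>. \<forall>T' \<in> \<T>. \<forall>k\<ge>1. trivial_group (Ext (maps_F \<Lambda>) k T T')) \<and>
     (\<forall>C \<in> fg_mod \<Lambda>. finite_coresolution (maps_F \<Lambda>) \<T> (zero_map_to C))"

definition classical_tilting :: "('a, 'b) ring_scheme \<Rightarrow> 'a fpfun set \<Rightarrow> bool" where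
  "classical_tilting \<Lambda> \<U> \<longleftrightarrow> \<U> \<subseteq> Ob (mod_mod \<Lambda>) \<and>
     (\<forall>T \<in> \<U>. pdim (mod_mod \<Lambda>) T \<le> 1) \<and>
     (\<forall>T \<in> \<U>. \<forall>T' \<in> \<U>. trivial_group (Ext (mod_mod \<Lambda>) 1 T T')) \<and>
     (\<forall>C \<in> fg_mod \<Lambda>. \<exists>T0 \<in> \<U>. \<exists>T1 \<in> \<U>. \<exists>\<alpha> \<beta>.
        functor_ses \<Lambda> (representable \<Lambda> C) \<alpha> T0 \<beta> T1)"

definition all_monomorphisms :: "'a mapobj set \<Rightarrow> bool" where
  "all_monomorphisms \<T> \<longleftrightarrow> (\<forall>(T0, T1, f) \<in> \<T>. inj_on f (carrier T0))"

definition ext1_F_vanishes :: "('a, 'b) ring_scheme \<Rightarrow> 'a mapobj set \<Rightarrow> bool" where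
  "ext1_F_vanishes \<Lambda> \<T> \<longleftrightarrow> (\<forall>T \<in> \<T>. \<forall>T' \<in> \<T>. trivial_group (Ext (maps_F \<Lambda>) 1 T T'))"

definition short_split_coresolutions :: "('a, 'b) ring_scheme \<Rightarrow> 'a mapobj set \<Rightarrow> bool" where
  "short_split_coresolutions \<Lambda> \<T> \<longleftrightarrow>
     (\<forall>C \<in> fg_mod \<Lambda>. \<exists>T0 T1 T1' f g i p.
        (T0, T1, f) \<in> \<T> \<and> (T0, T1', g) \<in> \<T> \<and>
        (zero_map_to C, i, (T0, T1, f), p, (T0, T1', g)) \<in> maps_ses \<Lambda> \<and>
        mod_split_ses \<Lambda> C (snd i) T1 (snd p) T1')"

text \<open>
  \<open>Phi\<close> sends the maps \<open>1\<^sub>M\<close> to zero, so \<open>f\<close> and \<open>f \<oplus> 1\<^sub>M\<close> have the same image. The following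
  closure consists of the \<open>g\<close> with \<open>g \<oplus> 1\<^sub>Y \<cong> f \<oplus> 1\<^sub>X\<close> for some \<open>f \<in> \<T>\<close> and some \<open>X\<close>, \<open>Y\<close>.
\<close>

definition identity_closure :: "('a, 'b) ring_scheme \<Rightarrow> 'a mapobj set \<Rightarrow> 'a mapobj set" where
  "identity_closure \<Lambda> \<T> = {g \<in> maps_ob \<Lambda>. \<exists>f \<in> \<T>. \<exists>X \<in> fg_mod \<Lambda>. \<exists>Y \<in> fg_mod \<Lambda>. \<exists>Z.
     is_biproduct (maps_F \<Lambda>) f (identity_map X) Z \<and>
     is_biproduct (maps_F \<Lambda>) g (identity_map Y) Z}"

definition relative_tilting_by_monos :: "('a, 'b) ring_scheme \<Rightarrow> 'a mapobj set \<Rightarrow> bool" where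
  "relative_tilting_by_monos \<Lambda> \<T> \<longleftrightarrow> relative_tilting \<Lambda> \<T> \<and>
     all_monomorphisms \<T> \<and> ext1_F_vanishes \<Lambda> \<T> \<and> short_split_coresolutions \<Lambda> \<T>"

end

theory Submission
  imports Defs "HOL-Algebra.Ring_Divisibility"
begin

text \<open>Both notions of tilting reduce to conditions on monomorphisms \<open>f : A1 \<rightarrow> A0\<close> of modules.

  A monomorphism has the relative projective resolution
  \<open>0 \<rightarrow> (0 \<rightarrow> A1) \<rightarrow> (A1 \<rightarrow> A0 \<oplus> A1) \<rightarrow> (A1 \<rightarrow> A0) \<rightarrow> 0\<close>, and its cokernel functor \<open>Phi f\<close> has the projective
  resolution \<open>0 \<rightarrow> (-, A1) \<rightarrow> (-, A0) \<rightarrow> Phi f \<rightarrow> 0\<close>. Hence \<open>f\<close> has relative projective dimension at most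
  one, its higher relative Ext groups vanish, and both resolutions give the same condition for the
  vanishing of the first Ext group of \<open>f\<close> and \<open>g : B1 \<rightarrow> B0\<close>, respectively of \<open>Phi f\<close> and \<open>Phi g\<close>: every
  map \<open>A1 \<rightarrow> B0\<close> is a sum \<open>\<psi> \<circ> f + g \<circ> \<theta>\<close> with \<open>\<psi> : A0 \<rightarrow> B0\<close> and \<open>\<theta> : A1 \<rightarrow> B1\<close> (\<open>ext_vanishes\<close>;
  \<open>Ext1_F_trivial_iff\<close>, \<open>Ext1_presented_by_mono\<close>). Since \<open>Ext\<close> is defined by an arbitrary choice of
  a resolution, it is first compared with a given resolution of length one, in an abstract category
  that has both categories as instances (\<open>trivial_Ext1_iff\<close>).

  The functors of projective dimension at most one are the cokernel functors of monomorphisms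
  (\<open>mono_presentation\<close>), because projective functors are representable (\<open>projective_representable\<close>).
  This is where the hypothesis on \<open>\<Lambda>\<close> enters: kernels of maps of finitely generated modules are
  again finitely generated, which rests on the theorem that commutative artinian rings are noetherian.

  The coresolutions correspond as well. Applying \<open>Phi\<close> to
  \<open>0 \<rightarrow> (0 \<rightarrow> C) \<rightarrow> (T0 \<rightarrow> T1) \<rightarrow> (T0 \<rightarrow> T1') \<rightarrow> 0\<close> gives an exact sequence that starts with \<open>(-, C)\<close>
  (\<open>coresolution_functor_ses\<close>). Conversely, given \<open>0 \<rightarrow> (-, C) \<rightarrow> F \<rightarrow> G \<rightarrow> 0\<close> and a monomorphism that
  presents \<open>G\<close>, the horseshoe lemma presents \<open>F\<close> by a monomorphism with the same domain (\<open>horseshoe\<close>).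

  Finally, by Schanuel's lemma (\<open>schanuel\<close>) the functor determines the monomorphism up to summands
  \<open>1\<^sub>X\<close>. So the identity closure of a subcategory of monomorphisms consists of all monomorphisms that
  present a functor in its image (\<open>identity_closure_eq\<close>), and the correspondence is a bijection between
  the relative tilting subcategories of this kind that equal their identity closure and the classical
  tilting subcategories that are closed under isomorphism.

  Throughout, a morphism from \<open>Phi f\<close> to a functor \<open>G\<close> is handled by the Yoneda lemma as an element
  of \<open>G A0\<close> that is annihilated by \<open>f\<close> (\<open>presents_yoneda\<close>).\<close>

section \<open>Ext in a category with short exact sequences\<close>

lemma (in comm_group) trivial_subquotient_iff:
  assumes Z: "subgroup Z G" and B: "subgroup B G" and "B \<subseteq> Z"
  shows "trivial_group (G\<lparr>carrier := Z\<rparr> Mod B) \<longleftrightarrow> Z \<subseteq> B"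
proof -
  let ?Z = "G\<lparr>carrier := Z\<rparr>"
  interpret Z: comm_group ?Z
    by (rule group.group_comm_groupI) (use Z in \<open>auto simp: subgroup.subgroup_is_group m_comm subgroup.mem_carrier\<close>)
  have sub: "subgroup B ?Z"
    using subgroup_incl[OF B Z \<open>B \<subseteq> Z\<close>] .
  interpret N: normal B ?Z
    using Z.subgroup_imp_normal[OF sub] .
  have carr: "carrier (?Z Mod B) = (\<lambda>x. B #>\<^bsub>?Z\<^esub> x) ` Z"
    by (simp add: carrier_FactGroup)
  interpret Q: group "?Z Mod B"
    by (rule N.factorgroup_is_group)
  have "trivial_group (?Z Mod B) \<longleftrightarrow> (\<forall>x\<in>Z. B #>\<^bsub>?Z\<^esub> x = B)"
    unfolding Q.trivial_group_subset carr by auto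
  also have "\<dots> \<longleftrightarrow> Z \<subseteq> B"
    using Z.coset_join1[OF _ _ sub] Z.coset_join2[OF _ sub] by auto
  finally show ?thesis .
qed

text \<open>What the category of maps and the category of functors have in common. The members of \<open>Ses\<close> are
  kernel-cokernel pairs: \<open>ses_mono\<close> and \<open>ses_kernel\<close> make \<open>i\<close> a kernel of \<open>p\<close>, and \<open>ses_epi\<close> and \<open>ses_cokernel\<close>
  make \<open>p\<close> a cokernel of \<open>i\<close>. The sequences in \<open>zero_ses\<close> prolong finite resolutions by zeros.\<close>

locale exact_category =
  fixes \<C> :: "('o, 'h) ses_category"
  assumes mor_group: "\<lbrakk>X \<in> Ob \<C>; Y \<in> Ob \<C>\<rbrakk> \<Longrightarrow> comm_group (Mor \<C> X Y)"
    and id_mor: "X \<in> Ob \<C> \<Longrightarrow> Id \<C> X \<in> carrier (Mor \<C> X X)"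
    and comp_mor: "\<lbrakk>X \<in> Ob \<C>; Y \<in> Ob \<C>; Z \<in> Ob \<C>;
        f \<in> carrier (Mor \<C> X Y); g \<in> carrier (Mor \<C> Y Z)\<rbrakk>
      \<Longrightarrow> Comp \<C> X g f \<in> carrier (Mor \<C> X Z)"
    and comp_id_left: "\<lbrakk>X \<in> Ob \<C>; Y \<in> Ob \<C>; f \<in> carrier (Mor \<C> X Y)\<rbrakk> \<Longrightarrow> Comp \<C> X (Id \<C> Y) f = f"
    and comp_id_right: "\<lbrakk>X \<in> Ob \<C>; Y \<in> Ob \<C>; f \<in> carrier (Mor \<C> X Y)\<rbrakk> \<Longrightarrow> Comp \<C> X f (Id \<C> X) = f"
    and comp_assoc: "\<lbrakk>X \<in> Ob \<C>; Y \<in> Ob \<C>; Z \<in> Ob \<C>; W \<in> Ob \<C>; f \<in> carrier (Mor \<C> X Y);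
        g \<in> carrier (Mor \<C> Y Z); h \<in> carrier (Mor \<C> Z W)\<rbrakk>
      \<Longrightarrow> Comp \<C> X (Comp \<C> Y h g) f = Comp \<C> X h (Comp \<C> X g f)"
    and comp_add_left: "\<lbrakk>X \<in> Ob \<C>; Y \<in> Ob \<C>; Z \<in> Ob \<C>; f \<in> carrier (Mor \<C> X Y);
        g \<in> carrier (Mor \<C> Y Z); g' \<in> carrier (Mor \<C> Y Z)\<rbrakk>
      \<Longrightarrow> Comp \<C> X (g \<otimes>\<^bsub>Mor \<C> Y Z\<^esub> g') f = Comp \<C> X g f \<otimes>\<^bsub>Mor \<C> X Z\<^esub> Comp \<C> X g' f"
    and comp_add_right: "\<lbrakk>X \<in> Ob \<C>; Y \<in> Ob \<C>; Z \<in> Ob \<C>; f \<in> carrier (Mor \<C> X Y);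
        f' \<in> carrier (Mor \<C> X Y); g \<in> carrier (Mor \<C> Y Z)\<rbrakk>
      \<Longrightarrow> Comp \<C> X g (f \<otimes>\<^bsub>Mor \<C> X Y\<^esub> f') = Comp \<C> X g f \<otimes>\<^bsub>Mor \<C> X Z\<^esub> Comp \<C> X g f'"
    and ses_typed: "(N, i, E, p, M) \<in> Ses \<C> \<Longrightarrow> N \<in> Ob \<C> \<and> E \<in> Ob \<C> \<and> M \<in> Ob \<C> \<and>
        i \<in> carrier (Mor \<C> N E) \<and> p \<in> carrier (Mor \<C> E M)"
    and ses_comp: "(N, i, E, p, M) \<in> Ses \<C> \<Longrightarrow> Comp \<C> N p i = \<one>\<^bsub>Mor \<C> N M\<^esub>"
    and ses_mono: "\<lbrakk>(N, i, E, p, M) \<in> Ses \<C>; X \<in> Ob \<C>; f \<in> carrier (Mor \<C> X N);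
        f' \<in> carrier (Mor \<C> X N); Comp \<C> X i f = Comp \<C> X i f'\<rbrakk> \<Longrightarrow> f = f'"
    and ses_epi: "\<lbrakk>(N, i, E, p, M) \<in> Ses \<C>; X \<in> Ob \<C>; f \<in> carrier (Mor \<C> M X);
        f' \<in> carrier (Mor \<C> M X); Comp \<C> E f p = Comp \<C> E f' p\<rbrakk> \<Longrightarrow> f = f'"
    and ses_kernel: "\<lbrakk>(N, i, E, p, M) \<in> Ses \<C>; X \<in> Ob \<C>; g \<in> carrier (Mor \<C> X E);
        Comp \<C> X p g = \<one>\<^bsub>Mor \<C> X M\<^esub>\<rbrakk> \<Longrightarrow> \<exists>h \<in> carrier (Mor \<C> X N). Comp \<C> X i h = g"
    and ses_cokernel: "\<lbrakk>(N, i, E, p, M) \<in> Ses \<C>; X \<in> Ob \<C>; g \<in> carrier (Mor \<C> E X);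
        Comp \<C> N g i = \<one>\<^bsub>Mor \<C> N X\<^esub>\<rbrakk> \<Longrightarrow> \<exists>h \<in> carrier (Mor \<C> M X). Comp \<C> E h p = g"
    and zero_ses: "\<exists>Z. zero_object \<C> Z \<and> (\<forall>X \<in> Ob \<C>. \<exists>z. (Z, z, X, Id \<C> X, X) \<in> Ses \<C>)"
begin

abbreviation mor where "mor X Y \<equiv> carrier (Mor \<C> X Y)"
abbreviation cmp where "cmp X g f \<equiv> Comp \<C> X g f"
abbreviation zero where "zero X Y \<equiv> \<one>\<^bsub>Mor \<C> X Y\<^esub>"
abbreviation plus where "plus X Y f g \<equiv> f \<otimes>\<^bsub>Mor \<C> X Y\<^esub> g"

lemma zero_mor: "\<lbrakk>X \<in> Ob \<C>; Y \<in> Ob \<C>\<rbrakk> \<Longrightarrow> zero X Y \<in> mor X Y"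
  by (rule monoid.one_closed[OF group.is_monoid[OF comm_group.axioms(2)[OF mor_group]]])

lemma comp_hom_left:
  assumes "X \<in> Ob \<C>" "Y \<in> Ob \<C>" "Z \<in> Ob \<C>" "f \<in> mor X Y"
  shows "group_hom (Mor \<C> Y Z) (Mor \<C> X Z) (\<lambda>g. cmp X g f)"
  using assms mor_group[THEN comm_group.axioms(2)]
  by (auto simp: group_hom_def group_hom_axioms_def hom_def comp_mor comp_add_left)

lemma comp_hom_right:
  assumes "X \<in> Ob \<C>" "Y \<in> Ob \<C>" "Z \<in> Ob \<C>" "g \<in> mor Y Z"
  shows "group_hom (Mor \<C> X Y) (Mor \<C> X Z) (\<lambda>f. cmp X g f)"
  using assms mor_group[THEN comm_group.axioms(2)]
  by (auto simp: group_hom_def group_hom_axioms_def hom_def comp_mor comp_add_right)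

lemma comp_zero_left:
  assumes "X \<in> Ob \<C>" "Y \<in> Ob \<C>" "Z \<in> Ob \<C>" "f \<in> mor X Y"
  shows "cmp X (zero Y Z) f = zero X Z"
  using group_hom.hom_one[OF comp_hom_left[OF assms]] .

lemma comp_zero_right:
  assumes "X \<in> Ob \<C>" "Y \<in> Ob \<C>" "Z \<in> Ob \<C>" "g \<in> mor Y Z"
  shows "cmp X g (zero X Y) = zero X Z"
  using group_hom.hom_one[OF comp_hom_right[OF assms]] .

lemma plus_mor: "\<lbrakk>X \<in> Ob \<C>; Y \<in> Ob \<C>; f \<in> mor X Y; g \<in> mor X Y\<rbrakk> \<Longrightarrow> plus X Y f g \<in> mor X Y"
  by (rule monoid.m_closed[OF group.is_monoid[OF comm_group.axioms(2)[OF mor_group]]])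

lemma projective_lift:
  assumes "projective \<C> P" "(N, i, E, p, M) \<in> Ses \<C>" "h \<in> mor P M"
  obtains g where "g \<in> mor P E" "cmp P p g = h"
  using assms unfolding projective_def by blast

lemma projective_Ob: "projective \<C> P \<Longrightarrow> P \<in> Ob \<C>"
  by (simp add: projective_def)

text \<open>The composite \<open>b a : P \<rightarrow> P' \<rightarrow> P\<close> of two lifts of the identity of \<open>X\<close> differs from the identity of
  \<open>P\<close> by a map \<open>s\<close> into the kernel \<open>K\<close>. On \<open>K\<close> this says that the identity is the sum of a map through
  \<open>K'\<close> and of a map through \<open>i\<close>. The following two lemmas transfer properties from \<open>K'\<close> to \<open>K\<close> by this
  decomposition.\<close>

lemma compare_presentations:
  assumes S: "(K, i, P, p, X) \<in> Ses \<C>" and S': "(K', i', P', p', X) \<in> Ses \<C>"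
    and P: "projective \<C> P" and P': "projective \<C> P'"
  obtains a u v s where "a \<in> mor P P'" "u \<in> mor K K'" "v \<in> mor K' K" "s \<in> mor P K"
    "cmp K i' u = cmp K a i" "plus K K (cmp K v u) (cmp K s i) = Id \<C> K"
proof -
  note t [simp] = ses_typed[OF S, simplified] ses_typed[OF S', simplified]
  obtain a where a [simp]: "a \<in> mor P P'" and pa: "cmp P p' a = p"
    using projective_lift[OF P S'] t by metis
  obtain b where b [simp]: "b \<in> mor P' P" and pb: "cmp P' p b = p'"
    using projective_lift[OF P' S] t by metis
  interpret PP: comm_group "Mor \<C> P P" by (simp add: mor_group)
  interpret PX: comm_group "Mor \<C> P X" by (simp add: mor_group)
  define ba where "ba = cmp P b a"
  have ba [simp]: "ba \<in> mor P P"
    unfolding ba_def by (rule comp_mor[where Y = P']) auto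
  have p_ba: "cmp P p ba = p"
    unfolding ba_def by (subst comp_assoc[of P P' P X, symmetric]) (simp_all add: pa pb)
  define d where "d = plus P P (Id \<C> P) (inv\<^bsub>Mor \<C> P P\<^esub> ba)"
  have d [simp]: "d \<in> mor P P"
    by (simp add: d_def id_mor)
  interpret h: group_hom "Mor \<C> P P" "Mor \<C> P X" "\<lambda>f. cmp P p f"
    by (rule comp_hom_right) auto
  have "cmp P p d = zero P X"
    by (simp add: d_def id_mor p_ba comp_id_right[where Y = X])
  then obtain s where s [simp]: "s \<in> mor P K" and i_s: "cmp P i s = d"
    using ses_kernel[OF S, of P d] by auto
  have ai [simp]: "cmp K a i \<in> mor K P'" by (rule comp_mor[where Y = P]) auto
  have "cmp K p' (cmp K a i) = zero K X"
    by (subst comp_assoc[of K P P' X, symmetric]) (simp_all add: pa ses_comp[OF S])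
  then obtain u where u [simp]: "u \<in> mor K K'" and iu: "cmp K i' u = cmp K a i"
    using ses_kernel[OF S' _ ai] by auto
  have bi [simp]: "cmp K' b i' \<in> mor K' P" by (rule comp_mor[where Y = P']) auto
  have "cmp K' p (cmp K' b i') = zero K' X"
    by (subst comp_assoc[of K' P' P X, symmetric]) (simp_all add: pb ses_comp[OF S'])
  then obtain v where v [simp]: "v \<in> mor K' K" and iv: "cmp K' i v = cmp K' b i'"
    using ses_kernel[OF S _ bi] by auto
  have vu [simp]: "cmp K v u \<in> mor K K" by (rule comp_mor[where Y = K']) auto
  have si [simp]: "cmp K s i \<in> mor K K" by (rule comp_mor[where Y = P]) auto
  have "cmp K i (plus K K (cmp K v u) (cmp K s i)) = plus K P (cmp K i (cmp K v u)) (cmp K i (cmp K s i))"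
    by (rule comp_add_right) auto
  also have "cmp K i (cmp K v u) = cmp K (cmp K' i v) u"
    by (rule comp_assoc[of K K' K P, symmetric]) auto
  also have "\<dots> = cmp K b (cmp K i' u)"
    by (simp add: iv comp_assoc[of K K' P' P])
  also have "\<dots> = cmp K ba i"
    unfolding ba_def iu by (rule comp_assoc[of K P P' P, symmetric]) auto
  also have "cmp K i (cmp K s i) = cmp K d i"
    unfolding i_s[symmetric] by (rule comp_assoc[of K P K P, symmetric]) auto
  also have "plus K P (cmp K ba i) (cmp K d i) = cmp K (plus P P ba d) i"
    by (rule comp_add_left[symmetric]) auto
  also have "plus P P ba d = Id \<C> P"
    using id_mor[of P] by (simp add: d_def PP.m_lcomm[of ba])
  also have "cmp K (Id \<C> P) i = cmp K i (Id \<C> K)"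
    by (simp add: comp_id_left comp_id_right[where Y=P])
  finally have "plus K K (cmp K v u) (cmp K s i) = Id \<C> K"
    by (rule ses_mono[OF S, rotated -1]) (auto simp: plus_mor id_mor)
  then show thesis
    using that a u v s iu by blast
qed

text \<open>For a projective presentation \<open>K \<rightarrow> P \<rightarrow> X\<close> with kernel \<open>i\<close>, this is the vanishing of the first Ext
  group of \<open>X\<close> and \<open>Y\<close>.\<close>

definition extends :: "'o \<Rightarrow> 'h \<Rightarrow> 'o \<Rightarrow> 'o \<Rightarrow> bool" where
  "extends K i P Y \<longleftrightarrow> (\<forall>\<phi> \<in> mor K Y. \<exists>\<psi> \<in> mor P Y. cmp K \<psi> i = \<phi>)"

lemma extends_if_extends:
  assumes S: "(K, i, P, p, X) \<in> Ses \<C>" and S': "(K', i', P', p', X) \<in> Ses \<C>"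
    and P: "projective \<C> P" and P': "projective \<C> P'" and Y [simp]: "Y \<in> Ob \<C>"
    and ext: "extends K' i' P' Y"
  shows "extends K i P Y"
  unfolding extends_def
proof
  fix \<phi> assume \<phi> [simp]: "\<phi> \<in> mor K Y"
  note t [simp] = ses_typed[OF S, simplified] ses_typed[OF S', simplified]
  obtain a u v s where [simp]: "a \<in> mor P P'" "u \<in> mor K K'" "v \<in> mor K' K" "s \<in> mor P K"
    and iu: "cmp K i' u = cmp K a i" and id: "plus K K (cmp K v u) (cmp K s i) = Id \<C> K"
    using compare_presentations[OF S S' P P'] .
  have [simp]: "cmp K v u \<in> mor K K" "cmp K s i \<in> mor K K" "cmp K' \<phi> v \<in> mor K' Y"
    "cmp P \<phi> s \<in> mor P Y"
    by (rule comp_mor[where Y = K'] comp_mor[where Y = P] comp_mor[where Y = K]; simp)+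
  obtain \<psi> where \<psi> [simp]: "\<psi> \<in> mor P' Y" and \<psi>i: "cmp K' \<psi> i' = cmp K' \<phi> v"
    using ext unfolding extends_def by (meson \<open>cmp K' \<phi> v \<in> mor K' Y\<close>)
  have [simp]: "cmp P \<psi> a \<in> mor P Y" by (rule comp_mor[where Y = P']; simp)
  have "\<phi> = cmp K \<phi> (plus K K (cmp K v u) (cmp K s i))"
    by (simp add: id comp_id_right[where Y=Y])
  also have "\<dots> = plus K Y (cmp K \<phi> (cmp K v u)) (cmp K \<phi> (cmp K s i))"
    by (rule comp_add_right) auto
  also have "cmp K \<phi> (cmp K v u) = cmp K (cmp K' \<phi> v) u"
    by (rule comp_assoc[of K K' K Y, symmetric]) auto
  also have "\<dots> = cmp K (cmp P \<psi> a) i"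
    by (simp add: \<psi>i[symmetric] comp_assoc[of K K' P' Y] comp_assoc[of K P P' Y] iu)
  also have "cmp K \<phi> (cmp K s i) = cmp K (cmp P \<phi> s) i"
    by (rule comp_assoc[of K P K Y, symmetric]) auto
  also have "plus K Y (cmp K (cmp P \<psi> a) i) (cmp K (cmp P \<phi> s) i)
      = cmp K (plus P Y (cmp P \<psi> a) (cmp P \<phi> s)) i"
    by (rule comp_add_left[symmetric]) auto
  finally show "\<exists>\<psi> \<in> mor P Y. cmp K \<psi> i = \<phi>"
    using plus_mor[of P Y "cmp P \<psi> a" "cmp P \<phi> s"] by force
qed

lemma kernel_projective:
  assumes S: "(K, i, P, p, X) \<in> Ses \<C>" and S': "(K', i', P', p', X) \<in> Ses \<C>"
    and P: "projective \<C> P" and P': "projective \<C> P'" and K': "projective \<C> K'"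
  shows "projective \<C> K"
  unfolding projective_def
proof (intro conjI allI impI ballI)
  note t [simp] = ses_typed[OF S, simplified] ses_typed[OF S', simplified]
  show "K \<in> Ob \<C>" by simp
  obtain a u v s where [simp]: "a \<in> mor P P'" "u \<in> mor K K'" "v \<in> mor K' K" "s \<in> mor P K"
    and id: "plus K K (cmp K v u) (cmp K s i) = Id \<C> K"
    using compare_presentations[OF S S' P P'] .
  fix N j E q M h
  assume T: "(N, j, E, q, M) \<in> Ses \<C>" and h [simp]: "h \<in> mor K M"
  note t' [simp] = ses_typed[OF T, simplified]
  have [simp]: "cmp K v u \<in> mor K K" "cmp K s i \<in> mor K K" "cmp K' h v \<in> mor K' M"
    "cmp P h s \<in> mor P M"
    by (rule comp_mor[where Y = K'] comp_mor[where Y = P] comp_mor[where Y = K]; simp)+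
  obtain g1 where g1 [simp]: "g1 \<in> mor K' E" "cmp K' q g1 = cmp K' h v"
    using projective_lift[OF K' T \<open>cmp K' h v \<in> _\<close>] .
  obtain g2 where g2 [simp]: "g2 \<in> mor P E" "cmp P q g2 = cmp P h s"
    using projective_lift[OF P T \<open>cmp P h s \<in> _\<close>] .
  have [simp]: "cmp K g1 u \<in> mor K E" "cmp K g2 i \<in> mor K E"
    by (rule comp_mor[where Y = K'] comp_mor[where Y = P]; simp)+
  have "cmp K q (plus K E (cmp K g1 u) (cmp K g2 i))
      = plus K M (cmp K q (cmp K g1 u)) (cmp K q (cmp K g2 i))"
    by (rule comp_add_right) auto
  also have "cmp K q (cmp K g1 u) = cmp K h (cmp K v u)"
    by (simp add: comp_assoc[of K K' E M, symmetric] comp_assoc[of K K' K M, symmetric])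
  also have "cmp K q (cmp K g2 i) = cmp K h (cmp K s i)"
    by (simp add: comp_assoc[of K P E M, symmetric] comp_assoc[of K P K M, symmetric])
  also have "plus K M (cmp K h (cmp K v u)) (cmp K h (cmp K s i))
      = cmp K h (plus K K (cmp K v u) (cmp K s i))"
    by (rule comp_add_right[symmetric]) auto
  also have "\<dots> = h"
    by (simp add: id comp_id_right[where Y=M])
  finally show "\<exists>g \<in> mor K E. cmp K q g = h"
    using plus_mor[of K E "cmp K g1 u" "cmp K g2 i"] by auto
qed

lemma retract_projective:
  assumes P: "projective \<C> P" and [simp]: "K \<in> Ob \<C>" "s \<in> mor K P" "r \<in> mor P K"
    and rs: "cmp K r s = Id \<C> K"
  shows "projective \<C> K"
  unfolding projective_def
proof (intro conjI allI impI ballI)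
  have [simp]: "P \<in> Ob \<C>" using P by (rule projective_Ob)
  fix N j E q M h
  assume T: "(N, j, E, q, M) \<in> Ses \<C>" and h [simp]: "h \<in> mor K M"
  note t' [simp] = ses_typed[OF T, simplified]
  have [simp]: "cmp P h r \<in> mor P M" by (rule comp_mor[where Y=K]; simp)
  obtain g where g [simp]: "g \<in> mor P E" "cmp P q g = cmp P h r"
    using projective_lift[OF P T \<open>cmp P h r \<in> _\<close>] .
  have "cmp K q (cmp K g s) = h"
    by (simp add: comp_assoc[of K P E M, symmetric]) (simp add: comp_assoc[of K P K M] rs comp_id_right[where Y=M])
  then show "\<exists>g \<in> mor K E. cmp K q g = h"
    using comp_mor[of K P E s g] by auto
qed simp

text \<open>A section \<open>s\<close> of \<open>q\<close> gives the endomorphism \<open>1 - s q\<close> of \<open>Q\<close>, which factors through the kernel.\<close>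

lemma split_kernel:
  assumes S: "(L, j, Q, q, K) \<in> Ses \<C>" and K: "projective \<C> K"
  obtains r where "r \<in> mor Q L" "cmp L r j = Id \<C> L"
proof -
  note t [simp] = ses_typed[OF S, simplified]
  interpret QQ: comm_group "Mor \<C> Q Q" by (simp add: mor_group)
  interpret QK: comm_group "Mor \<C> Q K" by (simp add: mor_group)
  obtain s where s [simp]: "s \<in> mor K Q" "cmp K q s = Id \<C> K"
    using projective_lift[OF K S id_mor] by auto
  have [simp]: "cmp Q s q \<in> mor Q Q" by (rule comp_mor[where Y=K]; simp)
  define d where "d = plus Q Q (Id \<C> Q) (inv\<^bsub>Mor \<C> Q Q\<^esub> cmp Q s q)"
  have d [simp]: "d \<in> mor Q Q" by (simp add: d_def id_mor)
  interpret h: group_hom "Mor \<C> Q Q" "Mor \<C> Q K" "\<lambda>f. cmp Q q f"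
    by (rule comp_hom_right) auto
  have "cmp Q q (cmp Q s q) = q"
    by (simp add: comp_assoc[of Q K Q K, symmetric] comp_id_left)
  then have "cmp Q q d = zero Q K"
    by (simp add: d_def id_mor comp_id_right[where Y=K])
  then obtain r where r [simp]: "r \<in> mor Q L" and jr: "cmp Q j r = d"
    using ses_kernel[OF S, of Q d] by auto
  interpret g: group_hom "Mor \<C> Q Q" "Mor \<C> L Q" "\<lambda>f. cmp L f j"
    by (rule comp_hom_left) auto
  interpret LQ: comm_group "Mor \<C> L Q" by (simp add: mor_group)
  have "cmp L j (cmp L r j) = cmp L d j"
    by (simp add: comp_assoc[of L Q L Q, symmetric] jr)
  also have "\<dots> = plus L Q j (inv\<^bsub>Mor \<C> L Q\<^esub> cmp L (cmp Q s q) j)"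
    by (simp add: d_def id_mor comp_id_left)
  also have "cmp L (cmp Q s q) j = zero L Q"
    by (simp add: comp_assoc[of L Q K Q] ses_comp[OF S] comp_zero_right)
  also have "plus L Q j (inv\<^bsub>Mor \<C> L Q\<^esub> zero L Q) = cmp L j (Id \<C> L)"
    by (simp add: comp_id_right[where Y=Q])
  finally have "cmp L r j = Id \<C> L"
    by (rule ses_mono[OF S, rotated -1]) (auto simp: id_mor intro: comp_mor[where Y=Q])
  then show thesis using that r by blast
qed

lemma zero_object_projective:
  assumes "zero_object \<C> Z"
  shows "projective \<C> Z"
  unfolding projective_def
proof (intro conjI allI impI ballI)
  show Z [simp]: "Z \<in> Ob \<C>" using assms by (auto simp: zero_object_def)
  fix N i E p M h assume S: "(N, i, E, p, M) \<in> Ses \<C>" and h: "h \<in> mor Z M"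
  note t [simp] = ses_typed[OF S, simplified]
  have "h = cmp Z h (Id \<C> Z)" using h by (simp add: comp_id_right[where Y=M])
  also have "\<dots> = zero Z M"
    using assms h by (simp add: zero_object_def comp_zero_right)
  finally show "\<exists>g \<in> mor Z E. cmp Z p g = h"
    by (intro bexI[of _ "zero Z E"]) (auto simp: comp_zero_right zero_mor)
qed

text \<open>The identity of \<open>P\<close> vanishes on \<open>Z\<close>, so it factors through \<open>p\<close>; thus \<open>K\<close> is isomorphic to \<open>P\<close>.\<close>

lemma zero_kernel_projective:
  assumes S: "(Z, i, P, p, K) \<in> Ses \<C>" and P: "projective \<C> P" and Z: "zero_object \<C> Z"
  shows "projective \<C> K"
proof -
  note t [simp] = ses_typed[OF S, simplified]
  have "i = cmp Z i (Id \<C> Z)" by (simp add: comp_id_right[where Y=P])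
  also have "\<dots> = zero Z P" using Z by (simp add: zero_object_def comp_zero_right)
  finally have "cmp Z (Id \<C> P) i = zero Z P"
    by (metis comp_id_left t)
  then obtain s where s [simp]: "s \<in> mor K P" "cmp P s p = Id \<C> P"
    using ses_cokernel[OF S, of P "Id \<C> P"] by (auto simp: id_mor)
  have "cmp P (cmp K p s) p = cmp P (Id \<C> K) p"
    by (simp add: comp_assoc[of P K P K] comp_id_left comp_id_right[where Y=K])
  then have "cmp K p s = Id \<C> K"
    by (rule ses_epi[OF S, of K, rotated -1]) (auto simp: id_mor intro: comp_mor[where Y=P])
  then show ?thesis
    by (rule retract_projective[OF P, rotated -1]) simp_all
qed

lemma projective_resolutionD:
  assumes "projective_resolution \<C> X (P, K, i, p)"
  shows "K 0 = X" "projective \<C> (P n)" "(K (Suc n), i n, P n, p n, K n) \<in> Ses \<C>"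
  using assms by (auto simp: projective_resolution_def)

text \<open>The cocycles of degree \<open>j + 1\<close> are the morphisms that factor through \<open>p (j + 1)\<close>, that is, the
  morphisms on \<open>K (j + 1)\<close>; the coboundaries are those that extend to \<open>P j\<close>.\<close>

lemma trivial_cohomology_iff:
  assumes res: "projective_resolution \<C> X (P, K, i, p)" and Y [simp]: "Y \<in> Ob \<C>"
  shows "trivial_group (resolution_cohomology \<C> (P, K, i, p) (Suc j) Y)
    \<longleftrightarrow> extends (K (Suc j)) (i j) (P j) Y"
proof -
  note S = projective_resolutionD(3)[OF res]
  have [simp]: "P n \<in> Ob \<C>" "K n \<in> Ob \<C>" "i n \<in> mor (K (Suc n)) (P n)" "p n \<in> mor (P n) (K n)" for n
    using ses_typed[OF S[of n]] by auto
  define d where "d n = cmp (P (Suc n)) (i n) (p (Suc n))" for n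
  have d [simp]: "d n \<in> mor (P (Suc n)) (P n)" for n
    unfolding d_def by (rule comp_mor[where Y = "K (Suc n)"]; simp)
  let ?k = "Suc j"
  let ?G = "Mor \<C> (P ?k) Y" and ?H = "Mor \<C> (P (Suc ?k)) Y" and ?G' = "Mor \<C> (P j) Y"
  define Z where "Z = {\<phi> \<in> carrier ?G. cmp (P (Suc ?k)) \<phi> (d ?k) = zero (P (Suc ?k)) Y}"
  define B where "B = (\<lambda>\<psi>. cmp (P ?k) \<psi> (d j)) ` carrier ?G'"
  interpret G: comm_group ?G by (simp add: mor_group)
  interpret h: group_hom ?G ?H "\<lambda>\<phi>. cmp (P (Suc ?k)) \<phi> (d ?k)"
    by (rule comp_hom_left) auto
  interpret h': group_hom ?G' ?G "\<lambda>\<phi>. cmp (P ?k) \<phi> (d j)"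
    by (rule comp_hom_left) auto
  have Zs: "subgroup Z ?G"
    using h.subgroup_kernel by (simp add: kernel_def Z_def)
  have Bs: "subgroup B ?G"
    unfolding B_def by (rule h'.img_is_subgroup)
  have Zc: "\<phi> \<in> Z \<longleftrightarrow> (\<exists>\<phi>' \<in> mor (K ?k) Y. \<phi> = cmp (P ?k) \<phi>' (p ?k))" for \<phi>
  proof
    assume "\<phi> \<in> Z"
    then have \<phi>: "\<phi> \<in> carrier ?G" and 0: "cmp (P (Suc ?k)) \<phi> (d ?k) = zero (P (Suc ?k)) Y"
      by (auto simp: Z_def)
    have "cmp (P (Suc ?k)) (cmp (K (Suc ?k)) \<phi> (i ?k)) (p (Suc ?k)) = cmp (P (Suc ?k)) \<phi> (d ?k)"
      unfolding d_def by (rule comp_assoc[of _ "K (Suc ?k)" "P ?k" Y]) (use \<phi> in auto)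
    also have "\<dots> = cmp (P (Suc ?k)) (zero (K (Suc ?k)) Y) (p (Suc ?k))"
      using 0 by (simp add: comp_zero_left)
    finally have "cmp (K (Suc ?k)) \<phi> (i ?k) = zero (K (Suc ?k)) Y"
      by (rule ses_epi[OF S[of "Suc ?k"] Y, rotated -1])
         (auto simp: zero_mor intro: comp_mor[where Y="P ?k"] \<phi>)
    then show "\<exists>\<phi>' \<in> mor (K ?k) Y. \<phi> = cmp (P ?k) \<phi>' (p ?k)"
      using ses_cokernel[OF S[of ?k] Y \<phi>] by auto
  next
    assume "\<exists>\<phi>' \<in> mor (K ?k) Y. \<phi> = cmp (P ?k) \<phi>' (p ?k)"
    then obtain \<phi>' where \<phi>' [simp]: "\<phi>' \<in> mor (K ?k) Y" and eq: "\<phi> = cmp (P ?k) \<phi>' (p ?k)" by auto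
    have "cmp (P (Suc ?k)) (p ?k) (d ?k) = cmp (P (Suc ?k)) (cmp (K (Suc ?k)) (p ?k) (i ?k)) (p (Suc ?k))"
      unfolding d_def by (rule comp_assoc[of _ "K (Suc ?k)" "P ?k" "K ?k", symmetric]) auto
    also have "\<dots> = zero (P (Suc ?k)) (K ?k)"
      unfolding ses_comp[OF S[of ?k]] by (rule comp_zero_left) auto
    finally have "cmp (P (Suc ?k)) (p ?k) (d ?k) = zero (P (Suc ?k)) (K ?k)" .
    then show "\<phi> \<in> Z"
      unfolding Z_def eq
      by (auto simp: comp_assoc[of _ "P ?k" "K ?k" Y] comp_zero_right intro: comp_mor[where Y="K ?k"])
  qed
  have Bc: "cmp (P ?k) \<psi> (d j) = cmp (P ?k) (cmp (K ?k) \<psi> (i j)) (p ?k)"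
    "cmp (K ?k) \<psi> (i j) \<in> mor (K ?k) Y" if "\<psi> \<in> mor (P j) Y" for \<psi>
    unfolding d_def using that
    by (auto intro!: comp_assoc[of _ "K ?k" "P j" Y, symmetric] comp_mor[where Y="P j"])
  have "B \<subseteq> Z"
    using Bc Zc unfolding B_def by auto
  have "resolution_cohomology \<C> (P, K, i, p) ?k Y = ?G\<lparr>carrier := Z\<rparr> Mod B"
    unfolding resolution_cohomology_def B_def Z_def d_def by (simp add: Let_def)
  then have "trivial_group (resolution_cohomology \<C> (P, K, i, p) ?k Y) \<longleftrightarrow> Z \<subseteq> B"
    using G.trivial_subquotient_iff[OF Zs Bs \<open>B \<subseteq> Z\<close>] by simp
  also have "\<dots> \<longleftrightarrow> extends (K ?k) (i j) (P j) Y"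
  proof
    assume ZB: "Z \<subseteq> B"
    show "extends (K ?k) (i j) (P j) Y"
      unfolding extends_def
    proof
      fix \<phi> assume \<phi>: "\<phi> \<in> mor (K ?k) Y"
      then have "cmp (P ?k) \<phi> (p ?k) \<in> B" using Zc ZB by blast
      then obtain \<psi> where \<psi>: "\<psi> \<in> mor (P j) Y" and "cmp (P ?k) \<phi> (p ?k) = cmp (P ?k) \<psi> (d j)"
        unfolding B_def by auto
      then have "cmp (P ?k) \<phi> (p ?k) = cmp (P ?k) (cmp (K ?k) \<psi> (i j)) (p ?k)"
        using Bc by simp
      then have "\<phi> = cmp (K ?k) \<psi> (i j)"
        using ses_epi[OF S[of ?k] Y \<phi> Bc(2)[OF \<psi>]] by simp
      then show "\<exists>\<psi> \<in> mor (P j) Y. cmp (K ?k) \<psi> (i j) = \<phi>" using \<psi> by auto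
    qed
  next
    assume "extends (K ?k) (i j) (P j) Y"
    then show "Z \<subseteq> B"
      using Bc(1) unfolding extends_def Zc B_def subset_iff image_iff by metis
  qed
  finally show ?thesis .
qed

lemma projective_resolution_exists:
  assumes S: "(Q1, i, Q0, p, X) \<in> Ses \<C>" and "projective \<C> Q1" "projective \<C> Q0"
  shows "\<exists>r. projective_resolution \<C> X r"
proof -
  obtain Z z where Z: "zero_object \<C> Z" and z: "\<And>X. X \<in> Ob \<C> \<Longrightarrow> (Z, z X, X, Id \<C> X, X) \<in> Ses \<C>"
    using zero_ses by metis
  have "Z \<in> Ob \<C>" "Q1 \<in> Ob \<C>" using Z ses_typed[OF S] by (auto simp: zero_object_def)
  define P where "P n = (case n of 0 \<Rightarrow> Q0 | Suc 0 \<Rightarrow> Q1 | _ \<Rightarrow> Z)" for n :: nat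
  define K where "K n = (case n of 0 \<Rightarrow> X | Suc 0 \<Rightarrow> Q1 | _ \<Rightarrow> Z)" for n :: nat
  define a where "a n = (case n of 0 \<Rightarrow> i | Suc 0 \<Rightarrow> z Q1 | _ \<Rightarrow> z Z)" for n :: nat
  define b where "b n = (case n of 0 \<Rightarrow> p | Suc 0 \<Rightarrow> Id \<C> Q1 | _ \<Rightarrow> Id \<C> Z)" for n :: nat
  have "projective_resolution \<C> X (P, K, a, b)"
    using assms zero_object_projective[OF Z] z[OF \<open>Z \<in> Ob \<C>\<close>] z[OF \<open>Q1 \<in> Ob \<C>\<close>]
    unfolding projective_resolution_def P_def K_def a_def b_def
    by (auto split: nat.splits)
  then show ?thesis by blast
qed

text \<open>\<open>Ext\<close> refers to an arbitrary resolution \<open>P\<close> of \<open>X\<close>. Comparison of its first step with the given short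
  resolution shows that \<open>K 1\<close> is projective. Then the later steps of \<open>P\<close> split, so that all \<open>K n\<close> with
  \<open>n > 0\<close> are projective and every morphism on \<open>K n\<close> with \<open>n > 1\<close> extends.\<close>

lemma
  assumes S: "(Q1, i, Q0, p, X) \<in> Ses \<C>" and Q1: "projective \<C> Q1" and Q0: "projective \<C> Q0"
    and Y: "Y \<in> Ob \<C>"
  shows trivial_Ext1_iff: "trivial_group (Ext \<C> 1 X Y) \<longleftrightarrow> extends Q1 i Q0 Y"
    and trivial_Ext_higher: "k \<ge> 2 \<Longrightarrow> trivial_group (Ext \<C> k X Y)"
proof -
  obtain P K a b where r: "(SOME r. projective_resolution \<C> X r) = (P, K, a, b)"
    by (metis prod_cases4)
  have res: "projective_resolution \<C> X (P, K, a, b)"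
    using projective_resolution_exists[OF S Q1 Q0] unfolding r[symmetric] by (rule someI_ex)
  note T = projective_resolutionD(3)[OF res] and P = projective_resolutionD(2)[OF res]
  have T0: "(K (Suc 0), a 0, P 0, b 0, X) \<in> Ses \<C>"
    using T[of 0] projective_resolutionD(1)[OF res] by simp
  have Ext: "trivial_group (Ext \<C> (Suc j) X Y) \<longleftrightarrow> extends (K (Suc j)) (a j) (P j) Y" for j
    unfolding Ext_def r using trivial_cohomology_iff[OF res Y] .
  show "trivial_group (Ext \<C> 1 X Y) \<longleftrightarrow> extends Q1 i Q0 Y"
    using Ext[of 0] extends_if_extends[OF S T0 Q0 P Y] extends_if_extends[OF T0 S P Q0 Y] by auto
  have K: "projective \<C> (K (Suc n))" for n
  proof (induction n)
    case 0
    show ?case using kernel_projective[OF T0 S P Q0 Q1] .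
  next
    case (Suc n)
    obtain r where "r \<in> mor (P (Suc n)) (K (Suc (Suc n)))"
        "cmp (K (Suc (Suc n))) r (a (Suc n)) = Id \<C> (K (Suc (Suc n)))"
      using split_kernel[OF T Suc] .
    then show ?case
      using ses_typed[OF T[of "Suc n"]] P by (auto intro: retract_projective)
  qed
  have "extends (K (Suc (Suc n))) (a (Suc n)) (P (Suc n)) Y" for n
    unfolding extends_def
  proof
    fix \<phi> assume \<phi>: "\<phi> \<in> mor (K (Suc (Suc n))) Y"
    note t = ses_typed[OF T[of "Suc n"]]
    obtain r where r: "r \<in> mor (P (Suc n)) (K (Suc (Suc n)))"
        "cmp (K (Suc (Suc n))) r (a (Suc n)) = Id \<C> (K (Suc (Suc n)))"
      using split_kernel[OF T K] .
    have "cmp (K (Suc (Suc n))) (cmp (P (Suc n)) \<phi> r) (a (Suc n)) = \<phi>"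
      using t r \<phi> Y by (subst comp_assoc) (auto simp: comp_id_right[where Y=Y])
    then show "\<exists>\<psi>\<in>mor (P (Suc n)) Y. cmp (K (Suc (Suc n))) \<psi> (a (Suc n)) = \<phi>"
      using t r(1) \<phi> Y by (intro bexI[of _ "cmp (P (Suc n)) \<phi> r"]) (auto intro: comp_mor[where Y="K (Suc (Suc n))"])
  qed
  then show "trivial_group (Ext \<C> k X Y)" if k: "k \<ge> 2"
  proof -
    obtain n where "k = Suc (Suc n)" using k by (metis add_2_eq_Suc le_Suc_ex)
    then show ?thesis
      using Ext[of "Suc n"] \<open>\<And>n. extends (K (Suc (Suc n))) (a (Suc n)) (P (Suc n)) Y\<close> by simp
  qed
qed

text \<open>A resolution of length zero has a zero object, hence a projective one, as its first kernel. In a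
  resolution of length one the first kernel is isomorphic to \<open>P 1\<close>.\<close>

lemma pdim_le_1_iff:
  "pdim \<C> X \<le> 1 \<longleftrightarrow> (\<exists>Q1 i Q0 p. (Q1, i, Q0, p, X) \<in> Ses \<C> \<and> projective \<C> Q1 \<and> projective \<C> Q0)"
proof
  assume le: "pdim \<C> X \<le> 1"
  let ?A = "enat ` {n. finite_resolution \<C> n X}"
  have "?A \<noteq> {}"
  proof
    assume "?A = {}"
    then have "pdim \<C> X = \<infinity>" unfolding pdim_def by (simp add: top_enat_def del: image_is_empty)
    then show False using le by simp
  qed
  then have "Inf ?A \<in> ?A" by (metis (no_types) LeastI_ex ex_in_conv Inf_enat_def)
  then obtain n where n: "finite_resolution \<C> n X" "enat n \<le> 1"
    using le unfolding pdim_def by auto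
  obtain P K i p where K0: "K 0 = X" and S: "\<And>m. m \<le> n \<Longrightarrow> (K (Suc m), i m, P m, p m, K m) \<in> Ses \<C>"
    and P: "\<And>m. m \<le> n \<Longrightarrow> projective \<C> (P m)" and Z: "zero_object \<C> (K (Suc n))"
    using n(1) unfolding finite_resolution_def by blast
  have "n = 0 \<or> n = 1" using n(2) by (auto simp: one_enat_def)
  moreover have "projective \<C> (K 1)" if "n = 1"
  proof -
    have "(K 2, i 1, P 1, p 1, K 1) \<in> Ses \<C>" "projective \<C> (P 1)" "zero_object \<C> (K 2)"
      using S[of 1] P[of 1] Z that by (simp_all add: numeral_2_eq_2)
    then show ?thesis by (rule zero_kernel_projective)
  qed
  moreover have "projective \<C> (K 1)" if "n = 0"
    using Z that zero_object_projective by simp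
  ultimately have "projective \<C> (K 1)" by blast
  moreover have "(K 1, i 0, P 0, p 0, X) \<in> Ses \<C>" "projective \<C> (P 0)"
    using S[of 0] P[of 0] K0 by auto
  ultimately show "\<exists>Q1 i Q0 p. (Q1, i, Q0, p, X) \<in> Ses \<C> \<and> projective \<C> Q1 \<and> projective \<C> Q0"
    by blast
next
  assume "\<exists>Q1 i Q0 p. (Q1, i, Q0, p, X) \<in> Ses \<C> \<and> projective \<C> Q1 \<and> projective \<C> Q0"
  then obtain Q1 i Q0 p where S: "(Q1, i, Q0, p, X) \<in> Ses \<C>" and Q: "projective \<C> Q1" "projective \<C> Q0"
    by blast
  obtain Z where Z: "zero_object \<C> Z" and "\<exists>z. (Z, z, Q1, Id \<C> Q1, Q1) \<in> Ses \<C>"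
    using zero_ses projective_Ob[OF Q(1)] by metis
  then obtain z where z: "(Z, z, Q1, Id \<C> Q1, Q1) \<in> Ses \<C>" by blast
  have "finite_resolution \<C> 1 X"
    unfolding finite_resolution_def
    by (rule exI[of _ "case_nat Q0 (\<lambda>_. Q1)"], rule exI[of _ "case_nat X (case_nat Q1 (\<lambda>_. Z))"],
        rule exI[of _ "case_nat i (\<lambda>_. z)"], rule exI[of _ "case_nat p (\<lambda>_. Id \<C> Q1)"])
      (use S Q Z z in \<open>auto split: nat.splits\<close>)
  then show "pdim \<C> X \<le> 1"
    unfolding pdim_def by (auto simp: one_enat_def intro: INF_lower)
qed

end

section \<open>Commutative artinian rings are noetherian\<close>

lemma (in cring) ideal_by_closure:
  assumes "I \<subseteq> carrier R" "\<zero> \<in> I" "\<And>a b. \<lbrakk>a \<in> I; b \<in> I\<rbrakk> \<Longrightarrow> a \<oplus> b \<in> I"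
    "\<And>r a. \<lbrakk>r \<in> carrier R; a \<in> I\<rbrakk> \<Longrightarrow> r \<otimes> a \<in> I"
  shows "ideal I R"
proof (rule idealI)
  show "subgroup I (add_monoid R)"
  proof (rule add.subgroupI)
    fix a assume "a \<in> I"
    then have "(\<ominus> \<one>) \<otimes> a \<in> I" using assms(4) by simp
    then show "\<ominus> a \<in> I" using \<open>a \<in> I\<close> assms(1) by (simp add: l_minus subset_iff)
  qed (use assms in auto)
  show "a \<otimes> x \<in> I" "x \<otimes> a \<in> I" if "a \<in> I" "x \<in> carrier R" for a x
    using assms(1,4) that m_comm by (metis subset_iff)+
qed (rule ring_axioms)

lemma (in ideal) minus_closed: "\<lbrakk>a \<in> I; b \<in> I\<rbrakk> \<Longrightarrow> a \<ominus> b \<in> I"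
  by (simp add: minus_eq)

definition finitely_generated_ideal :: "('r, 's) ring_scheme \<Rightarrow> 'r set \<Rightarrow> bool" where
  "finitely_generated_ideal R I \<longleftrightarrow> (\<exists>A. finite A \<and> A \<subseteq> carrier R \<and> I = genideal R A)"

lemma (in ring) Idl_eqI:
  assumes "ideal I R" "A \<subseteq> I" "\<And>J. \<lbrakk>ideal J R; A \<subseteq> J\<rbrakk> \<Longrightarrow> I \<subseteq> J"
  shows "I = Idl A"
  using assms by (meson additive_subgroup.a_subset genideal_ideal genideal_minimal genideal_self
      ideal.axioms(1) subset_antisym subset_trans)

lemma (in cring) ideal_image:
  assumes "ideal J R" and r: "r \<in> carrier R"
  shows "ideal ((\<lambda>x. r \<otimes> x) ` J) R"
proof -
  interpret J: ideal J R by fact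
  show ?thesis
  proof (rule ideal_by_closure)
    show "\<zero> \<in> (\<lambda>x. r \<otimes> x) ` J" using r by (intro image_eqI[of _ _ \<zero>]) auto
    show "a \<oplus> b \<in> (\<lambda>x. r \<otimes> x) ` J" if "a \<in> (\<lambda>x. r \<otimes> x) ` J" "b \<in> (\<lambda>x. r \<otimes> x) ` J" for a b
      using that r by (auto simp: r_distr[symmetric])
    show "s \<otimes> a \<in> (\<lambda>x. r \<otimes> x) ` J" if "s \<in> carrier R" "a \<in> (\<lambda>x. r \<otimes> x) ` J" for s a
      using that r J.I_l_closed by (auto simp: m_lcomm[of s r])
  qed (use r in auto)
qed

text \<open>If multiplication by \<open>r\<close> has finitely generated image and kernel on \<open>I\<close>, then \<open>I\<close> is finitely
  generated: lift generators of the image and add generators of the kernel.\<close>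

lemma (in cring) finitely_generated_by_multiplication:
  assumes I: "ideal I R" and r: "r \<in> carrier R"
    and im: "finitely_generated_ideal R ((\<lambda>x. r \<otimes> x) ` I)"
    and ker: "finitely_generated_ideal R {x \<in> I. r \<otimes> x = \<zero>}"
  shows "finitely_generated_ideal R I"
proof -
  interpret I: ideal I R by fact
  obtain A where A: "finite A" "A \<subseteq> carrier R" "(\<lambda>x. r \<otimes> x) ` I = Idl A"
    using im unfolding finitely_generated_ideal_def by auto
  have "A \<subseteq> (\<lambda>x. r \<otimes> x) ` I" using A genideal_self by simp
  then obtain B where B: "B \<subseteq> I" "finite B" "A = (\<lambda>x. r \<otimes> x) ` B"
    using finite_subset_image[OF A(1)] by metis
  obtain D where D: "finite D" "D \<subseteq> carrier R" "{x \<in> I. r \<otimes> x = \<zero>} = Idl D"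
    using ker unfolding finitely_generated_ideal_def by auto
  have DI: "D \<subseteq> I" using D genideal_self by blast
  have "I = Idl (B \<union> D)"
  proof (rule Idl_eqI)
    show "B \<union> D \<subseteq> I" using B DI by auto
    fix J assume J: "ideal J R" "B \<union> D \<subseteq> J"
    interpret J: ideal J R by fact
    have "ideal (I \<inter> J) R" using i_intersect I J(1) by blast
    from ideal_image[OF this r] have *: "(\<lambda>x. r \<otimes> x) ` I \<subseteq> (\<lambda>x. r \<otimes> x) ` (I \<inter> J)"
      unfolding A(3) using J B by (intro genideal_minimal) auto
    show "I \<subseteq> J"
    proof
      fix x assume x: "x \<in> I"
      then obtain y where y: "y \<in> J" "y \<in> I" "r \<otimes> x = r \<otimes> y" using * by blast
      have "r \<otimes> (x \<ominus> y) = \<zero>"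
        using x y r by (simp add: minus_eq r_distr r_minus r_neg)
      then have "x \<ominus> y \<in> Idl D" using x y D(3) I.minus_closed by auto
      then have "x \<ominus> y \<in> J" using J genideal_minimal[of J D] by auto
      moreover have "x = (x \<ominus> y) \<oplus> y"
        using x y by (simp add: minus_eq a_assoc l_neg)
      ultimately show "x \<in> J" using y(1) J.a_closed by metis
    qed
  qed (rule I)
  then show ?thesis
    unfolding finitely_generated_ideal_def using B D DI I.a_subset by (intro exI[of _ "B \<union> D"]) auto
qed

lemma artinian_minimal_ideal:
  assumes R: "artinian_ring R" and I0: "ideal I0 R" "P I0"
  obtains I where "ideal I R" "P I" "\<And>J. \<lbrakk>ideal J R; J \<subset> I\<rbrakk> \<Longrightarrow> \<not> P J"
proof (rule ccontr)
  assume no: "\<not> thesis"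
  have "\<exists>J. ideal J R \<and> P J \<and> J \<subset> I" if "ideal I R \<and> P I" for I
    using no that by (meson \<open>\<And>I. \<lbrakk>ideal I R; P I; \<And>J. \<lbrakk>ideal J R; J \<subset> I\<rbrakk> \<Longrightarrow> \<not> P J\<rbrakk> \<Longrightarrow> thesis\<close>)
  then obtain f where f: "\<And>I. ideal I R \<and> P I \<Longrightarrow> ideal (f I) R \<and> P (f I) \<and> f I \<subset> I"
    by metis
  define K where "K n = (f ^^ n) I0" for n
  have K: "ideal (K n) R \<and> P (K n)" for n
    by (induction n) (use I0 f in \<open>auto simp: K_def\<close>)
  have "K (Suc n) \<subset> K n" for n
    using f[OF K[of n]] by (simp add: K_def)
  then have "\<forall>n. ideal (K n) R \<and> K (Suc n) \<subseteq> K n" using K by blast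
  then obtain n where "\<forall>m\<ge>n. K m = K n"
    using R unfolding artinian_ring_def by meson
  then show False
    using \<open>K (Suc n) \<subset> K n\<close> by (metis le_SucI order_refl psubset_eq)
qed

text \<open>Suppose that \<open>I\<close> is minimal among the ideals that are not finitely generated. By
  \<open>finitely_generated_by_multiplication\<close> each \<open>r\<close> acts on \<open>I\<close> surjectively or as zero, and by the descending chain condition in the
  first case it acts bijectively. So \<open>I\<close> is a vector space over a field, and a hyperplane \<open>H\<close> of
  \<open>I\<close> together with one vector \<open>x\<close> generates \<open>I\<close>. But \<open>H\<close> is finitely generated by minimality.\<close>

theorem artinian_imp_noetherian:
  fixes R (structure)
  assumes R: "artinian_ring R"
  shows "noetherian_ring R"
proof (rule ccontr)
  interpret cring R using R by (simp add: artinian_ring_def)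
  let ?fg = "finitely_generated_ideal R"
  assume "\<not> noetherian_ring R"
  then obtain I0 where I0: "ideal I0 R" "\<not> ?fg I0"
    unfolding noetherian_ring_def noetherian_ring_axioms_def finitely_generated_ideal_def
    using ring_axioms by blast
  obtain I where I: "ideal I R" "\<not> ?fg I" and "\<And>J. \<lbrakk>ideal J R; J \<subset> I\<rbrakk> \<Longrightarrow> \<not> (\<not> ?fg J)"
    using artinian_minimal_ideal[of R I0 "\<lambda>I. \<not> ?fg I", OF R I0] by blast
  then have min: "?fg J" if "ideal J R" "J \<subseteq> I" "J \<noteq> I" for J
    using that by blast
  interpret I: ideal I R by fact
  have dich: "(\<lambda>x. r \<otimes> x) ` I = I" if r: "r \<in> carrier R" and y: "y \<in> I" "r \<otimes> y \<noteq> \<zero>" for r y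
  proof (rule ccontr)
    assume ne: "(\<lambda>x. r \<otimes> x) ` I \<noteq> I"
    have "?fg ((\<lambda>x. r \<otimes> x) ` I)"
      using ideal_image[OF I(1) r] ne r I.I_l_closed by (intro min) auto
    moreover have "ideal {x \<in> I. r \<otimes> x = \<zero>} R"
      by (rule ideal_by_closure) (use r I.I_l_closed in \<open>auto simp: r_distr m_lcomm[of r]\<close>)
    then have "?fg {x \<in> I. r \<otimes> x = \<zero>}"
      using y by (intro min) auto
    ultimately show False
      using finitely_generated_by_multiplication[OF I(1) r] I(2) by blast
  qed
  have inv: "\<exists>s \<in> carrier R. s \<otimes> (r \<otimes> y) = y"
    if r: "r \<in> carrier R" and y: "y \<in> I" "r \<otimes> y \<noteq> \<zero>" for r y
  proof -
    define K where "K n = (\<lambda>x. (r [^] n) \<otimes> x) ` carrier R" for n :: nat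
    have "ideal (K n) R" for n
      unfolding K_def using r by (intro ideal_image oneideal) auto
    moreover have "K (Suc n) \<subseteq> K n" for n
      unfolding K_def using r by (auto simp: m_assoc)
    ultimately obtain n where "\<forall>m\<ge>n. K m = K n"
      using R unfolding artinian_ring_def by meson
    then have "K (Suc n) = K n" by (meson le_SucI order_refl)
    moreover have "r [^] n \<in> K n" unfolding K_def using r by (intro image_eqI[of _ _ \<one>]) auto
    ultimately obtain s where s: "s \<in> carrier R" "r [^] n = r [^] (Suc n) \<otimes> s"
      unfolding K_def by blast
    have "\<exists>z \<in> I. y = (r [^] k) \<otimes> z" for k :: nat
    proof (induction k)
      case 0
      then show ?case using y by (intro bexI[of _ y]) auto
    next
      case (Suc k)
      then obtain z where z: "z \<in> I" "y = (r [^] k) \<otimes> z" by auto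
      then obtain z' where "z' \<in> I" "z = r \<otimes> z'" using dich[OF r y] by blast
      then show ?case using z r by (intro bexI[of _ z']) (auto simp: m_assoc)
    qed
    then obtain z where z: "z \<in> I" "y = (r [^] n) \<otimes> z" by blast
    \<comment> \<open>so \<open>s r y = s r r\<^sup>n z = r\<^sup>n z = y\<close>\<close>
    have *: "s \<otimes> (r \<otimes> (q \<otimes> z)) = (q \<otimes> r \<otimes> s) \<otimes> z" if "q \<in> carrier R" for q
      using s(1) z(1) r that by (simp add: m_ac)
    have "s \<otimes> (r \<otimes> y) = y"
      unfolding z(2) *[OF nat_pow_closed[OF r]] using s(2)[symmetric] by (simp only: nat_pow_Suc)
    then show ?thesis using s by blast
  qed
  have "\<exists>x \<in> I. x \<noteq> \<zero>"
  proof (rule ccontr)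
    assume "\<not> (\<exists>x \<in> I. x \<noteq> \<zero>)"
    then have "I = Idl {\<zero>}" using I.zero_closed genideal_zero by auto
    moreover have "?fg (Idl {\<zero>})"
      unfolding finitely_generated_ideal_def by (rule exI[of _ "{\<zero>}"]) simp
    ultimately show False using I(2) by metis
  qed
  then obtain x where x: "x \<in> I" "x \<noteq> \<zero>" by auto
  \<comment> \<open>the hyperplane is a maximal ideal in \<open>I\<close> that avoids \<open>x\<close>\<close>
  let ?A = "{H. ideal H R \<and> H \<subseteq> I \<and> x \<notin> H}"
  have "\<exists>M\<in>?A. \<forall>X\<in>?A. M \<subseteq> X \<longrightarrow> X = M"
  proof (rule subset_Zorn_nonempty)
    show "?A \<noteq> {}" using zeroideal x by (auto intro!: exI[of _ "{\<zero>}"])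
    fix \<C> assume ne: "\<C> \<noteq> {}" and ch: "subset.chain ?A \<C>"
    have C: "ideal H R" "H \<subseteq> I" "x \<notin> H" if "H \<in> \<C>" for H
      using ch that unfolding subset.chain_def by auto
    have "ideal (\<Union>\<C>) R"
    proof (rule ideal_by_closure)
      show "\<Union>\<C> \<subseteq> carrier R" using C(2) I.a_subset by blast
      show "\<zero> \<in> \<Union>\<C>" using ne C(1) additive_subgroup.zero_closed ideal.axioms(1) by blast
      fix a b assume "a \<in> \<Union>\<C>" "b \<in> \<Union>\<C>"
      then obtain H1 H2 where H12: "a \<in> H1" "b \<in> H2" "H1 \<in> \<C>" "H2 \<in> \<C>" by blast
      then have "H1 \<subseteq> H2 \<or> H2 \<subseteq> H1"
        using ch unfolding subset.chain_def by blast
      with H12 obtain H where H: "a \<in> H" "b \<in> H" "H \<in> \<C>" by blast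
      interpret H: ideal H R using C(1)[OF H(3)] .
      show "a \<oplus> b \<in> \<Union>\<C>" using H by blast
    next
      fix r a assume "r \<in> carrier R" "a \<in> \<Union>\<C>"
      then obtain H where H: "a \<in> H" "H \<in> \<C>" by blast
      interpret H: ideal H R using C(1)[OF H(2)] .
      show "r \<otimes> a \<in> \<Union>\<C>" using H H.I_l_closed \<open>r \<in> carrier R\<close> by blast
    qed
    then show "\<Union>\<C> \<in> ?A" using C by blast
  qed
  then obtain H where H: "ideal H R" "H \<subseteq> I" "x \<notin> H"
    and max: "\<And>X. \<lbrakk>ideal X R; X \<subseteq> I; x \<notin> X; H \<subseteq> X\<rbrakk> \<Longrightarrow> X = H" by auto
  interpret H: ideal H R by fact
  have "?fg H" using H x by (intro min) auto
  then obtain A where A: "finite A" "A \<subseteq> carrier R" "H = Idl A"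
    unfolding finitely_generated_ideal_def by auto
  have AH: "A \<subseteq> H" using A genideal_self by simp
  have "I = Idl (insert x A)"
  proof (rule Idl_eqI)
    show "insert x A \<subseteq> I" using x AH H by auto
    fix J assume J: "ideal J R" "insert x A \<subseteq> J"
    interpret J: ideal J R by fact
    have HJ: "H \<subseteq> J" using A J genideal_minimal by auto
    show "I \<subseteq> J"
    proof
      fix y assume y: "y \<in> I"
      show "y \<in> J"
      proof (cases "y \<in> H")
        case False
        let ?X = "{h \<oplus> c \<otimes> y | h c. h \<in> H \<and> c \<in> carrier R}"
        have X1: "ideal ?X R"
        proof (rule ideal_by_closure)
          show "?X \<subseteq> carrier R" using y by auto
          show "\<zero> \<in> ?X" using y by (auto intro!: exI[of _ \<zero>])
          fix a b assume "a \<in> ?X" "b \<in> ?X"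
          then obtain h c h' c' where "a = h \<oplus> c \<otimes> y" "b = h' \<oplus> c' \<otimes> y"
            and hc: "h \<in> H" "h' \<in> H" "c \<in> carrier R" "c' \<in> carrier R" by blast
          then have "a \<oplus> b = (h \<oplus> h') \<oplus> (c \<oplus> c') \<otimes> y"
            using y by (simp add: l_distr a_ac)
          then show "a \<oplus> b \<in> ?X"
            using hc H.a_closed add.m_closed by blast
        next
          fix r a assume r: "r \<in> carrier R" and "a \<in> ?X"
          then obtain h c where "a = h \<oplus> c \<otimes> y" and hc: "h \<in> H" "c \<in> carrier R" by blast
          then have "r \<otimes> a = r \<otimes> h \<oplus> (r \<otimes> c) \<otimes> y"
            using y r by (simp add: r_distr m_assoc)
          then show "r \<otimes> a \<in> ?X"
            using hc r H.I_l_closed m_closed by blast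
        qed
        have X2: "?X \<subseteq> I" using y H I.I_l_closed by auto
        have X3: "H \<subseteq> ?X"
        proof
          fix h assume "h \<in> H"
          moreover have "h = h \<oplus> \<zero> \<otimes> y" using \<open>h \<in> H\<close> y by simp
          ultimately show "h \<in> ?X" by blast
        qed
        have "y = \<zero> \<oplus> \<one> \<otimes> y" using y by simp
        then have X4: "y \<in> ?X" using H.zero_closed one_closed by blast
        have "x \<in> ?X" 
        proof (rule ccontr)
          assume "x \<notin> ?X"
          from max[OF X1 X2 this X3] X4 have "y \<in> H" by (rule subst)
          then show False using False by contradiction
        qed
        then obtain h c where hc: "x = h \<oplus> c \<otimes> y" "h \<in> H" "c \<in> carrier R" by blast
        then have "c \<otimes> y \<noteq> \<zero>" using H(3) by auto
        then obtain s where s: "s \<in> carrier R" "s \<otimes> (c \<otimes> y) = y" using inv[OF hc(3) y] by auto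
        have "c \<otimes> y = x \<ominus> h" using hc y by (simp add: minus_eq a_ac r_neg1 r_neg2)
        also have "\<dots> \<in> J" using J HJ hc by (intro J.minus_closed) auto
        finally show ?thesis using J.I_l_closed[OF _ s(1)] s(2) by metis
      qed (use HJ in auto)
    qed
  qed (rule I)
  moreover have "?fg (Idl (insert x A))"
    unfolding finitely_generated_ideal_def by (rule exI[of _ "insert x A"]) (use A x in auto)
  ultimately show False using I(2) by metis
qed

section \<open>Submodules of finitely generated modules\<close>

definition submod :: "('a, 'b) ring_scheme \<Rightarrow> ('a, 'c) module \<Rightarrow> 'c set \<Rightarrow> bool" where
  "submod R M H \<longleftrightarrow> H \<subseteq> carrier M \<and> \<zero>\<^bsub>M\<^esub> \<in> H \<and> (\<forall>x\<in>H. \<forall>y\<in>H. x \<oplus>\<^bsub>M\<^esub> y \<in> H) \<and>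
     (\<forall>a \<in> carrier R. \<forall>x\<in>H. a \<odot>\<^bsub>M\<^esub> x \<in> H)"

definition lspan :: "('a, 'b) ring_scheme \<Rightarrow> ('a, 'c) module \<Rightarrow> 'c set \<Rightarrow> 'c set" where
  "lspan R M A = \<Inter>{H. submod R M H \<and> A \<subseteq> H}"

context left_module
begin

lemma lsmult_l_null [simp]: "x \<in> carrier M \<Longrightarrow> \<zero> \<odot>\<^bsub>M\<^esub> x = \<zero>\<^bsub>M\<^esub>"
  using lsmult_l_distr[of \<zero> \<zero> x] lsmult_closed[of \<zero> x]
  by (metis M.add.r_cancel_one' R.zero_closed R.r_zero)

lemma lsmult_r_null [simp]: "a \<in> carrier R \<Longrightarrow> a \<odot>\<^bsub>M\<^esub> \<zero>\<^bsub>M\<^esub> = \<zero>\<^bsub>M\<^esub>"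
  using lsmult_r_distr[of a "\<zero>\<^bsub>M\<^esub>" "\<zero>\<^bsub>M\<^esub>"] lsmult_closed[of a "\<zero>\<^bsub>M\<^esub>"]
  by (metis M.add.r_cancel_one' M.zero_closed M.r_zero)

lemma lsmult_minus_one: "x \<in> carrier M \<Longrightarrow> (\<ominus> \<one>) \<odot>\<^bsub>M\<^esub> x = \<ominus>\<^bsub>M\<^esub> x"
proof -
  assume x: "x \<in> carrier M"
  have "(\<ominus> \<one>) \<odot>\<^bsub>M\<^esub> x \<oplus>\<^bsub>M\<^esub> x = (\<ominus> \<one> \<oplus> \<one>) \<odot>\<^bsub>M\<^esub> x"
    using x by (subst lsmult_l_distr) (auto simp: lsmult_one)
  also have "\<dots> = \<zero>\<^bsub>M\<^esub>" using x by (simp add: R.l_neg)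
  finally show ?thesis
    using x lsmult_closed by (intro M.minus_equality[symmetric]) auto
qed

lemma minus_module_zero [simp]: "\<ominus>\<^bsub>M\<^esub> \<zero>\<^bsub>M\<^esub> = \<zero>\<^bsub>M\<^esub>"
  by (simp add: a_inv_def)

lemma submodD:
  assumes "submod R M H"
  shows "H \<subseteq> carrier M" "\<zero>\<^bsub>M\<^esub> \<in> H" "\<lbrakk>x \<in> H; y \<in> H\<rbrakk> \<Longrightarrow> x \<oplus>\<^bsub>M\<^esub> y \<in> H"
    "\<lbrakk>a \<in> carrier R; x \<in> H\<rbrakk> \<Longrightarrow> a \<odot>\<^bsub>M\<^esub> x \<in> H" "x \<in> H \<Longrightarrow> x \<in> carrier M"
    "x \<in> H \<Longrightarrow> \<ominus>\<^bsub>M\<^esub> x \<in> H" "\<lbrakk>x \<in> H; y \<in> H\<rbrakk> \<Longrightarrow> x \<ominus>\<^bsub>M\<^esub> y \<in> H"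
proof -
  note H = assms[unfolded submod_def]
  show "H \<subseteq> carrier M" "\<zero>\<^bsub>M\<^esub> \<in> H" "\<lbrakk>x \<in> H; y \<in> H\<rbrakk> \<Longrightarrow> x \<oplus>\<^bsub>M\<^esub> y \<in> H"
    "\<lbrakk>a \<in> carrier R; x \<in> H\<rbrakk> \<Longrightarrow> a \<odot>\<^bsub>M\<^esub> x \<in> H" "x \<in> H \<Longrightarrow> x \<in> carrier M"
    using H by auto
  have *: "\<ominus>\<^bsub>M\<^esub> x \<in> H" if "x \<in> H" for x
    using H that lsmult_minus_one[of x] R.add.inv_closed[OF R.one_closed] by (metis a_inv_def subsetD)
  then show "x \<in> H \<Longrightarrow> \<ominus>\<^bsub>M\<^esub> x \<in> H" "\<lbrakk>x \<in> H; y \<in> H\<rbrakk> \<Longrightarrow> x \<ominus>\<^bsub>M\<^esub> y \<in> H"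
    using H by (auto simp: a_minus_def)
qed

lemma submod_carrier: "submod R M (carrier M)"
  using lsmult_closed by (simp add: submod_def)

lemma submod_span: "A \<subseteq> carrier M \<Longrightarrow> submod R M (lspan R M A)"
  unfolding lspan_def using submod_carrier by (auto simp: submod_def)

lemma span_superset: "A \<subseteq> lspan R M A"
  unfolding lspan_def by auto

lemma span_least: "\<lbrakk>submod R M H; A \<subseteq> H\<rbrakk> \<Longrightarrow> lspan R M A \<subseteq> H"
  unfolding lspan_def by auto

lemma span_eqI:
  assumes "submod R M N" "A \<subseteq> N" "\<And>H. \<lbrakk>submod R M H; A \<subseteq> H\<rbrakk> \<Longrightarrow> N \<subseteq> H"
  shows "N = lspan R M A"
  unfolding lspan_def using assms by blast

lemma submod_Int: "\<lbrakk>submod R M H; submod R M K\<rbrakk> \<Longrightarrow> submod R M (H \<inter> K)"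
  by (auto simp: submod_def)

lemma finsum_in_submod:
  assumes "submod R M H" "finite S" "f \<in> S \<rightarrow> H"
  shows "(\<Oplus>\<^bsub>M\<^esub>s\<in>S. f s) \<in> H"
  using assms(2,3)
proof (induction S rule: finite_induct)
  case empty then show ?case using submodD(2)[OF assms(1)] by simp
next
  case (insert x F)
  then show ?case
    using submodD(1,3)[OF assms(1)] by (subst M.finsum_insert) auto
qed

lemma lsmult_finsum:
  assumes "finite S" "a \<in> carrier R" "f \<in> S \<rightarrow> carrier M"
  shows "a \<odot>\<^bsub>M\<^esub> (\<Oplus>\<^bsub>M\<^esub>s\<in>S. f s) = (\<Oplus>\<^bsub>M\<^esub>s\<in>S. a \<odot>\<^bsub>M\<^esub> f s)"
  using assms(1,3)
proof (induction S rule: finite_induct)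
  case empty then show ?case using assms(2) by simp
next
  case (insert x F)
  then show ?case
    using assms(2) lsmult_closed by (simp add: Pi_def lsmult_r_distr)
qed

lemma span_finite:
  assumes S: "finite S" "S \<subseteq> carrier M"
  shows "lspan R M S = {x. \<exists>c \<in> S \<rightarrow> carrier R. x = (\<Oplus>\<^bsub>M\<^esub>s\<in>S. c s \<odot>\<^bsub>M\<^esub> s)}" (is "_ = ?C")
proof (rule span_eqI[symmetric])
  have in_M: "(\<lambda>s. c s \<odot>\<^bsub>M\<^esub> s) \<in> S \<rightarrow> carrier M" if "c \<in> S \<rightarrow> carrier R" for c
    using that S lsmult_closed by auto
  show "submod R M ?C"
    unfolding submod_def
  proof (intro conjI ballI)
    show "?C \<subseteq> carrier M" using in_M by auto
    have "(\<Oplus>\<^bsub>M\<^esub>s\<in>S. \<zero> \<odot>\<^bsub>M\<^esub> s) = (\<Oplus>\<^bsub>M\<^esub>s\<in>S. \<zero>\<^bsub>M\<^esub>)"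
      using S by (intro M.finsum_cong') auto
    then show "\<zero>\<^bsub>M\<^esub> \<in> ?C" by (auto intro!: bexI[of _ "\<lambda>_. \<zero>"])
    fix x y assume "x \<in> ?C" "y \<in> ?C"
    then obtain c d where c: "c \<in> S \<rightarrow> carrier R" "x = (\<Oplus>\<^bsub>M\<^esub>s\<in>S. c s \<odot>\<^bsub>M\<^esub> s)"
      and d: "d \<in> S \<rightarrow> carrier R" "y = (\<Oplus>\<^bsub>M\<^esub>s\<in>S. d s \<odot>\<^bsub>M\<^esub> s)" by auto
    have "x \<oplus>\<^bsub>M\<^esub> y = (\<Oplus>\<^bsub>M\<^esub>s\<in>S. c s \<odot>\<^bsub>M\<^esub> s \<oplus>\<^bsub>M\<^esub> d s \<odot>\<^bsub>M\<^esub> s)"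
      unfolding c(2) d(2) using in_M c d by (intro M.finsum_addf[symmetric]) auto
    also have "\<dots> = (\<Oplus>\<^bsub>M\<^esub>s\<in>S. (c s \<oplus> d s) \<odot>\<^bsub>M\<^esub> s)"
      using c d S by (intro M.finsum_cong') (auto simp: lsmult_l_distr Pi_def subset_iff lsmult_closed)
    finally show "x \<oplus>\<^bsub>M\<^esub> y \<in> ?C" using c d by (auto intro!: bexI[of _ "\<lambda>s. c s \<oplus> d s"])
  next
    fix a x assume a: "a \<in> carrier R" and "x \<in> ?C"
    then obtain c where c: "c \<in> S \<rightarrow> carrier R" "x = (\<Oplus>\<^bsub>M\<^esub>s\<in>S. c s \<odot>\<^bsub>M\<^esub> s)" by auto
    have "a \<odot>\<^bsub>M\<^esub> x = (\<Oplus>\<^bsub>M\<^esub>s\<in>S. a \<odot>\<^bsub>M\<^esub> (c s \<odot>\<^bsub>M\<^esub> s))"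
      unfolding c(2) using in_M c S a by (intro lsmult_finsum) auto
    also have "\<dots> = (\<Oplus>\<^bsub>M\<^esub>s\<in>S. (a \<otimes> c s) \<odot>\<^bsub>M\<^esub> s)"
      using c S a by (intro M.finsum_cong') (auto simp: lsmult_assoc Pi_def subset_iff lsmult_closed)
    finally show "a \<odot>\<^bsub>M\<^esub> x \<in> ?C" using c a by (auto intro!: bexI[of _ "\<lambda>s. a \<otimes> c s"])
  qed
  show "S \<subseteq> ?C"
  proof
    fix t assume t: "t \<in> S"
    have "(\<Oplus>\<^bsub>M\<^esub>s\<in>S. (if s = t then \<one> else \<zero>) \<odot>\<^bsub>M\<^esub> s) = (\<Oplus>\<^bsub>M\<^esub>s\<in>S. if t = s then s else \<zero>\<^bsub>M\<^esub>)"
      using S by (intro M.finsum_cong') (auto simp: lsmult_one)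
    also have "\<dots> = t"
      using M.finsum_singleton[OF t S(1), of "\<lambda>s. s"] S(2) by auto
    finally show "t \<in> ?C" using t
      by (auto intro!: bexI[of _ "\<lambda>s. if s = t then \<one> else \<zero>"])
  qed
  fix H assume H: "submod R M H" "S \<subseteq> H"
  show "?C \<subseteq> H"
  proof
    fix x assume "x \<in> ?C"
    then obtain c where c: "c \<in> S \<rightarrow> carrier R" "x = (\<Oplus>\<^bsub>M\<^esub>s\<in>S. c s \<odot>\<^bsub>M\<^esub> s)" by auto
    then have "(\<lambda>s. c s \<odot>\<^bsub>M\<^esub> s) \<in> S \<rightarrow> H"
      using submodD(4)[OF H(1)] H(2) by (auto simp: Pi_def)
    then show "x \<in> H" unfolding c(2) by (rule finsum_in_submod[OF H(1) S(1)])
  qed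
qed

text \<open>As in Hilbert's basis theorem, by induction on the number of generators: the coefficients at the
  new generator \<open>x\<close> of the elements of \<open>N\<close> form a finitely generated ideal. Elements of \<open>N\<close> with
  coefficients that generate this ideal, together with generators of the part of \<open>N\<close> in the span of \<open>A\<close>,
  generate \<open>N\<close>.\<close>

lemma submod_finitely_generated:
  assumes R: "cring R" "noetherian_ring R" and A: "finite A" "A \<subseteq> carrier M"
    and N: "submod R M N" "N \<subseteq> lspan R M A"
  shows "\<exists>B. finite B \<and> B \<subseteq> N \<and> N = lspan R M B"
  using A N
proof (induction A arbitrary: N rule: finite_induct)
  case empty
  have "lspan R M {} \<subseteq> N" by (rule span_least) (use empty in auto)
  then show ?case using empty by (intro exI[of _ "{}"]) auto
next
  case (insert x A)
  interpret cring R by fact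
  interpret noetherian_ring R by fact
  have x: "x \<in> carrier M" and A: "A \<subseteq> carrier M" using insert.prems by auto
  let ?A = "lspan R M A"
  note sA = submod_span[OF A] note A' = submodD[OF sA] note N' = submodD[OF insert.prems(2)]
  have decomp: "\<exists>r \<in> carrier R. n \<ominus>\<^bsub>M\<^esub> r \<odot>\<^bsub>M\<^esub> x \<in> ?A" if "n \<in> lspan R M (insert x A)" for n
  proof -
    let ?H = "{n \<in> carrier M. \<exists>r \<in> carrier R. n \<ominus>\<^bsub>M\<^esub> r \<odot>\<^bsub>M\<^esub> x \<in> ?A}"
    have "submod R M ?H"
      unfolding submod_def
    proof (intro conjI ballI)
      show "\<zero>\<^bsub>M\<^esub> \<in> ?H" using x A'(2,6) by (auto simp: M.minus_eq intro!: bexI[of _ \<zero>])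
      fix n m assume "n \<in> ?H" "m \<in> ?H"
      then obtain r s where r: "r \<in> carrier R" "n \<ominus>\<^bsub>M\<^esub> r \<odot>\<^bsub>M\<^esub> x \<in> ?A" "n \<in> carrier M"
        and s: "s \<in> carrier R" "m \<ominus>\<^bsub>M\<^esub> s \<odot>\<^bsub>M\<^esub> x \<in> ?A" "m \<in> carrier M" by auto
      have "(n \<oplus>\<^bsub>M\<^esub> m) \<ominus>\<^bsub>M\<^esub> (r \<oplus> s) \<odot>\<^bsub>M\<^esub> x = (n \<ominus>\<^bsub>M\<^esub> r \<odot>\<^bsub>M\<^esub> x) \<oplus>\<^bsub>M\<^esub> (m \<ominus>\<^bsub>M\<^esub> s \<odot>\<^bsub>M\<^esub> x)"
        using r s x by (simp add: lsmult_l_distr lsmult_closed M.minus_eq M.minus_add M.a_ac)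
      also have "\<dots> \<in> ?A" using r s A'(3) by blast
      finally show "n \<oplus>\<^bsub>M\<^esub> m \<in> ?H" using r s by auto
    next
      fix a n assume a: "a \<in> carrier R" and "n \<in> ?H"
      then obtain r where r: "r \<in> carrier R" "n \<ominus>\<^bsub>M\<^esub> r \<odot>\<^bsub>M\<^esub> x \<in> ?A" "n \<in> carrier M" by auto
      have "a \<odot>\<^bsub>M\<^esub> n = a \<odot>\<^bsub>M\<^esub> (n \<ominus>\<^bsub>M\<^esub> r \<odot>\<^bsub>M\<^esub> x) \<oplus>\<^bsub>M\<^esub> a \<odot>\<^bsub>M\<^esub> (r \<odot>\<^bsub>M\<^esub> x)"
        using a r x by (subst lsmult_r_distr[symmetric]) (auto simp: lsmult_closed M.minus_eq M.a_assoc M.l_neg)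
      then have "a \<odot>\<^bsub>M\<^esub> n \<ominus>\<^bsub>M\<^esub> (a \<otimes> r) \<odot>\<^bsub>M\<^esub> x = a \<odot>\<^bsub>M\<^esub> (n \<ominus>\<^bsub>M\<^esub> r \<odot>\<^bsub>M\<^esub> x)"
        using a r x by (simp add: lsmult_closed lsmult_assoc M.minus_eq M.a_assoc M.r_neg)
      also have "\<dots> \<in> ?A" using a r A'(4) by blast
      finally show "a \<odot>\<^bsub>M\<^esub> n \<in> ?H" using a r lsmult_closed by auto
    qed auto
    moreover have "insert x A \<subseteq> ?H"
    proof -
      have "x \<ominus>\<^bsub>M\<^esub> \<one> \<odot>\<^bsub>M\<^esub> x \<in> ?A" using x A'(2) by (simp add: lsmult_one M.minus_eq M.r_neg)
      moreover have "a \<ominus>\<^bsub>M\<^esub> \<zero> \<odot>\<^bsub>M\<^esub> x \<in> ?A" if "a \<in> A" for a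
        using x A that span_superset[of A] by (auto simp: M.minus_eq subset_iff)
      ultimately show ?thesis using x A R.one_closed R.zero_closed by blast
    qed
    ultimately show ?thesis using span_least that by blast
  qed
  define coeffs where "coeffs K = {r \<in> carrier R. \<exists>n\<in>K. n \<ominus>\<^bsub>M\<^esub> r \<odot>\<^bsub>M\<^esub> x \<in> ?A}" for K
  have coeffs: "ideal (coeffs K) R" if K: "submod R M K" for K
  proof (rule ideal_by_closure)
    note K = submodD[OF K]
    show "coeffs K \<subseteq> carrier R" by (auto simp: coeffs_def)
    show "\<zero> \<in> coeffs K" using K(2) A'(2) x by (auto simp: coeffs_def M.minus_eq intro!: bexI[of _ "\<zero>\<^bsub>M\<^esub>"])
    fix r s assume "r \<in> coeffs K" "s \<in> coeffs K"
    then obtain n m where r: "r \<in> carrier R" "n \<in> K" "n \<ominus>\<^bsub>M\<^esub> r \<odot>\<^bsub>M\<^esub> x \<in> ?A"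
      and s: "s \<in> carrier R" "m \<in> K" "m \<ominus>\<^bsub>M\<^esub> s \<odot>\<^bsub>M\<^esub> x \<in> ?A" by (auto simp: coeffs_def)
    have "(n \<oplus>\<^bsub>M\<^esub> m) \<ominus>\<^bsub>M\<^esub> (r \<oplus> s) \<odot>\<^bsub>M\<^esub> x = (n \<ominus>\<^bsub>M\<^esub> r \<odot>\<^bsub>M\<^esub> x) \<oplus>\<^bsub>M\<^esub> (m \<ominus>\<^bsub>M\<^esub> s \<odot>\<^bsub>M\<^esub> x)"
      using r s x K(5) by (simp add: lsmult_l_distr lsmult_closed M.minus_eq M.minus_add M.a_ac)
    also have "\<dots> \<in> ?A" using r s A'(3) by blast
    finally show "r \<oplus> s \<in> coeffs K" using r s K(3) by (auto simp: coeffs_def)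
  next
    note K = submodD[OF K]
    fix a r assume a: "a \<in> carrier R" and "r \<in> coeffs K"
    then obtain n where r: "r \<in> carrier R" "n \<in> K" "n \<ominus>\<^bsub>M\<^esub> r \<odot>\<^bsub>M\<^esub> x \<in> ?A" by (auto simp: coeffs_def)
    have "a \<odot>\<^bsub>M\<^esub> n = a \<odot>\<^bsub>M\<^esub> (n \<ominus>\<^bsub>M\<^esub> r \<odot>\<^bsub>M\<^esub> x) \<oplus>\<^bsub>M\<^esub> a \<odot>\<^bsub>M\<^esub> (r \<odot>\<^bsub>M\<^esub> x)"
      using a r x K(5) by (subst lsmult_r_distr[symmetric]) (auto simp: lsmult_closed M.minus_eq M.a_assoc M.l_neg)
    then have "a \<odot>\<^bsub>M\<^esub> n \<ominus>\<^bsub>M\<^esub> (a \<otimes> r) \<odot>\<^bsub>M\<^esub> x = a \<odot>\<^bsub>M\<^esub> (n \<ominus>\<^bsub>M\<^esub> r \<odot>\<^bsub>M\<^esub> x)"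
      using a r x K(5) by (simp add: lsmult_closed lsmult_assoc M.minus_eq M.a_assoc M.r_neg)
    also have "\<dots> \<in> ?A" using a r A'(4) by blast
    finally show "a \<otimes> r \<in> coeffs K" using a r K(4) by (auto simp: coeffs_def)
  qed
  obtain D where D: "D \<subseteq> carrier R" "finite D" "coeffs N = Idl D"
    using finetely_gen[OF coeffs[OF insert.prems(2)]] by metis
  have "D \<subseteq> coeffs N" using D genideal_self by simp
  then have "\<forall>d\<in>D. \<exists>n\<in>N. n \<ominus>\<^bsub>M\<^esub> d \<odot>\<^bsub>M\<^esub> x \<in> ?A" by (auto simp: coeffs_def)
  then obtain w where w: "\<And>d. d \<in> D \<Longrightarrow> w d \<in> N \<and> w d \<ominus>\<^bsub>M\<^esub> d \<odot>\<^bsub>M\<^esub> x \<in> ?A" by metis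
  obtain B where B: "finite B" "B \<subseteq> N \<inter> ?A" "N \<inter> ?A = lspan R M B"
    using insert.IH[OF A submod_Int[OF insert.prems(2) sA]] by auto
  have "N = lspan R M (B \<union> w ` D)"
  proof (rule span_eqI)
    show "submod R M N" by fact
    show "B \<union> w ` D \<subseteq> N" using B w by auto
    fix H assume H: "submod R M H" "B \<union> w ` D \<subseteq> H"
    note K = submodD[OF submod_Int[OF insert.prems(2) H(1)]]
    have "coeffs N \<subseteq> coeffs (N \<inter> H)"
      unfolding D(3)
    proof (intro genideal_minimal coeffs submod_Int insert.prems H(1) subsetI)
      fix d assume d: "d \<in> D"
      then have "w d \<in> N \<inter> H" using w H(2) by auto
      then show "d \<in> coeffs (N \<inter> H)" using w d D(1) unfolding coeffs_def by blast
    qed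
    have BH: "N \<inter> ?A \<subseteq> H" unfolding B(3) using H by (intro span_least) auto
    show "N \<subseteq> H"
    proof
      fix n assume n: "n \<in> N"
      then obtain r where "r \<in> carrier R" "n \<ominus>\<^bsub>M\<^esub> r \<odot>\<^bsub>M\<^esub> x \<in> ?A"
        using decomp insert.prems(3) by blast
      then have r: "r \<in> coeffs N" "n \<ominus>\<^bsub>M\<^esub> r \<odot>\<^bsub>M\<^esub> x \<in> ?A" "r \<in> carrier R" using n by (auto simp: coeffs_def)
      then obtain m where m: "m \<in> N" "m \<in> H" "m \<ominus>\<^bsub>M\<^esub> r \<odot>\<^bsub>M\<^esub> x \<in> ?A"
        using \<open>coeffs N \<subseteq> coeffs (N \<inter> H)\<close> by (auto simp: coeffs_def)
      have "n \<ominus>\<^bsub>M\<^esub> m = (n \<ominus>\<^bsub>M\<^esub> r \<odot>\<^bsub>M\<^esub> x) \<ominus>\<^bsub>M\<^esub> (m \<ominus>\<^bsub>M\<^esub> r \<odot>\<^bsub>M\<^esub> x)"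
        using n m r x N'(5) by (simp add: lsmult_closed M.minus_eq M.minus_add M.a_ac M.r_neg M.r_neg1 M.r_neg2)
      also have "\<dots> \<in> ?A" using r m A'(7) by blast
      finally have "n \<ominus>\<^bsub>M\<^esub> m \<in> H" using n m N'(7) BH by blast
      moreover have "n = (n \<ominus>\<^bsub>M\<^esub> m) \<oplus>\<^bsub>M\<^esub> m" using n m N'(5) by (simp add: M.minus_eq M.a_assoc M.l_neg)
      ultimately show "n \<in> H" using m submodD(3)[OF H(1)] by metis
    qed
  qed
  then show ?case using B D w by (intro exI[of _ "B \<union> w ` D"]) auto
qed

end

lemma fg_mod_iff:
  "M \<in> fg_mod \<Lambda> \<longleftrightarrow> left_module \<Lambda> M \<and>
     (\<exists>S. finite S \<and> S \<subseteq> carrier M \<and> lspan \<Lambda> M S = carrier M)"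
proof -
  have "(\<forall>x \<in> carrier M. \<exists>c \<in> S \<rightarrow> carrier \<Lambda>. x = (\<Oplus>\<^bsub>M\<^esub>s\<in>S. c s \<odot>\<^bsub>M\<^esub> s))
      \<longleftrightarrow> lspan \<Lambda> M S = carrier M" if "left_module \<Lambda> M" "finite S" "S \<subseteq> carrier M" for S
  proof -
    interpret left_module \<Lambda> M by fact
    have "lspan \<Lambda> M S \<subseteq> carrier M" using submodD(1) submod_span that by blast
    then show ?thesis unfolding span_finite[OF that(2,3)] by auto
  qed
  then show ?thesis unfolding fg_mod_def by auto
qed

lemma (in left_module) left_module_submod:
  assumes H: "submod R M H"
  shows "left_module R (M\<lparr>carrier := H\<rparr>)"
proof -
  note H' = submodD[OF H]
  have "abelian_group (M\<lparr>carrier := H\<rparr>)"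
  proof (rule abelian_groupI, goal_cases)
    case (6 x)
    then have "\<ominus>\<^bsub>M\<^esub> x \<in> H" "\<ominus>\<^bsub>M\<^esub> x \<oplus>\<^bsub>M\<^esub> x = \<zero>\<^bsub>M\<^esub>" using H'(5,6) M.l_neg by simp_all
    then show ?case by auto
  qed (use H' in \<open>auto simp: M.a_ac\<close>)
  then show ?thesis
    using R.ring_axioms H' unfolding left_module_def left_module_axioms_def
    by (auto simp: lsmult_l_distr lsmult_r_distr lsmult_assoc lsmult_one)
qed

text \<open>As a module over \<open>R\<close>, \<open>M\<close> is generated by the products of generators of \<open>\<Lambda>\<close> over \<open>R\<close> with generators
  of \<open>M\<close> over \<open>\<Lambda>\<close>. A \<open>\<Lambda>\<close>-submodule is an \<open>R\<close>-submodule, so it is finitely generated over the noetherian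
  ring \<open>R\<close>, and the same generators work over \<open>\<Lambda>\<close>.\<close>

lemma submod_fg_mod:
  assumes art: "artin_algebra R \<sigma> \<Lambda>" and M: "M \<in> fg_mod \<Lambda>" and N: "submod \<Lambda> M N"
  shows "M\<lparr>carrier := N\<rparr> \<in> fg_mod \<Lambda>"
proof -
  interpret M: left_module \<Lambda> M using M by (simp add: fg_mod_def)
  have R: "artinian_ring R" "cring R" "noetherian_ring R"
    using art artinian_imp_noetherian by (auto simp: artin_algebra_def artinian_ring_def)
  interpret R: cring R by fact
  have \<sigma>: "\<sigma> \<in> ring_hom R \<Lambda>" using art by (simp add: artin_algebra_def)
  note \<sigma>' = ring_hom_closed[OF \<sigma>] ring_hom_mult[OF \<sigma>] ring_hom_add[OF \<sigma>] ring_hom_one[OF \<sigma>]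
  \<comment> \<open>\<open>M\<close> with scalars restricted along \<open>\<sigma>\<close>\<close>
  define MR where "MR = \<lparr>carrier = carrier M, monoid.mult = monoid.mult M, one = \<one>\<^bsub>M\<^esub>, zero = \<zero>\<^bsub>M\<^esub>, add = add M,
    smult = \<lambda>r x. \<sigma> r \<odot>\<^bsub>M\<^esub> x\<rparr>"
  have [simp]: "carrier MR = carrier M" "add MR = add M" "zero MR = zero M" "smult MR r x = \<sigma> r \<odot>\<^bsub>M\<^esub> x" for r x
    by (simp_all add: MR_def)
  have "abelian_group MR"
  proof (rule abelian_groupI, goal_cases)
    case (6 x)
    then have "\<ominus>\<^bsub>M\<^esub> x \<in> carrier M" "\<ominus>\<^bsub>M\<^esub> x \<oplus>\<^bsub>M\<^esub> x = \<zero>\<^bsub>M\<^esub>" using M.M.l_neg by simp_all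
    then show ?case by auto
  qed (auto simp: M.M.a_ac)
  then interpret MR: left_module R MR
    unfolding left_module_def left_module_axioms_def using R.ring_axioms \<sigma>'
    by (auto simp: M.lsmult_closed M.lsmult_l_distr M.lsmult_r_distr M.lsmult_assoc M.lsmult_one)
  have restr: "submod R MR H" if "submod \<Lambda> M H" for H
    using that \<sigma>' by (auto simp: submod_def)
  obtain S where S: "finite S" "S \<subseteq> carrier M" "lspan \<Lambda> M S = carrier M"
    using M by (auto simp: fg_mod_iff)
  obtain T where T: "finite T" "T \<subseteq> carrier \<Lambda>"
      "\<And>a. a \<in> carrier \<Lambda> \<Longrightarrow> \<exists>c \<in> T \<rightarrow> carrier R. a = (\<Oplus>\<^bsub>\<Lambda>\<^esub>s\<in>T. \<sigma> (c s) \<otimes>\<^bsub>\<Lambda>\<^esub> s)"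
    using art unfolding artin_algebra_def by blast
  define A where "A = (\<lambda>(t, s). t \<odot>\<^bsub>M\<^esub> s) ` (T \<times> S)"
  have A: "finite A" "A \<subseteq> carrier MR" unfolding A_def using S(1,2) T(1,2) M.lsmult_closed by (auto simp: subset_iff)
  note sp = MR.submodD[OF MR.submod_span[OF A(2)]]
  have as: "a \<odot>\<^bsub>M\<^esub> s \<in> lspan R MR A" if a: "a \<in> carrier \<Lambda>" and s: "s \<in> S" for a s
  proof -
    have "(\<Oplus>\<^bsub>\<Lambda>\<^esub>t\<in>U. \<sigma> (c t) \<otimes>\<^bsub>\<Lambda>\<^esub> t) \<odot>\<^bsub>M\<^esub> s \<in> lspan R MR A"
      if U: "finite U" "U \<subseteq> T" and c: "c \<in> U \<rightarrow> carrier R" for U c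
      using U c
    proof (induction U rule: finite_induct)
      case empty then show ?case using sp(2) s S by auto
    next
      case (insert t U)
      have t: "t \<in> carrier \<Lambda>" "\<sigma> (c t) \<in> carrier \<Lambda>" and c: "c t \<in> carrier R" using insert T \<sigma>' by auto
      have f: "(\<lambda>t. \<sigma> (c t) \<otimes>\<^bsub>\<Lambda>\<^esub> t) \<in> U \<rightarrow> carrier \<Lambda>"
      proof
        fix u assume "u \<in> U"
        then have "c u \<in> carrier R" "u \<in> carrier \<Lambda>" using insert.prems T(2) by auto
        then show "\<sigma> (c u) \<otimes>\<^bsub>\<Lambda>\<^esub> u \<in> carrier \<Lambda>" using \<sigma>'(1) by simp
      qed
      have "t \<odot>\<^bsub>M\<^esub> s \<in> A" using insert s by (auto simp: A_def)
      then have "smult MR (c t) (t \<odot>\<^bsub>M\<^esub> s) \<in> lspan R MR A"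
        using MR.span_superset sp(4) c by blast
      then have "(\<sigma> (c t) \<otimes>\<^bsub>\<Lambda>\<^esub> t) \<odot>\<^bsub>M\<^esub> s \<in> lspan R MR A"
        using t s S by (simp add: M.lsmult_assoc subset_iff)
      moreover have "(\<Oplus>\<^bsub>\<Lambda>\<^esub>t\<in>U. \<sigma> (c t) \<otimes>\<^bsub>\<Lambda>\<^esub> t) \<odot>\<^bsub>M\<^esub> s \<in> lspan R MR A" using insert by auto
      ultimately show ?case
        using insert(1,2) t f s S sp(3) by (subst M.R.finsum_insert) (auto simp: M.lsmult_l_distr subset_iff)
    qed
    then show ?thesis using T(1) T(3)[OF a] by blast
  qed
  have "carrier M \<subseteq> lspan R MR A"
  proof
    fix x assume "x \<in> carrier M"
    then have "x \<in> lspan \<Lambda> M S" using S by simp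
    then obtain c where c: "c \<in> S \<rightarrow> carrier \<Lambda>" "x = (\<Oplus>\<^bsub>M\<^esub>s\<in>S. c s \<odot>\<^bsub>M\<^esub> s)"
      unfolding M.span_finite[OF S(1,2)] by blast
    have "(\<Oplus>\<^bsub>M\<^esub>s\<in>U. c s \<odot>\<^bsub>M\<^esub> s) \<in> lspan R MR A" if "finite U" "U \<subseteq> S" for U
      using that
    proof (induction U rule: finite_induct)
      case empty then show ?case using sp(2) by simp
    next
      case (insert s U)
      have cl: "c u \<odot>\<^bsub>M\<^esub> u \<in> carrier M" "c u \<odot>\<^bsub>M\<^esub> u \<in> lspan R MR A" if "u \<in> S" for u
        using that c(1) S(2) as M.lsmult_closed by (auto simp: Pi_def subset_iff)
      then have "(\<lambda>s. c s \<odot>\<^bsub>M\<^esub> s) \<in> U \<rightarrow> carrier M" "c s \<odot>\<^bsub>M\<^esub> s \<in> carrier M" "c s \<odot>\<^bsub>M\<^esub> s \<in> lspan R MR A"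
        using insert.prems by auto
      then show ?case using insert sp(3) by (subst M.M.finsum_insert) auto
    qed
    then show "x \<in> lspan R MR A" using c S by auto
  qed
  then have "N \<subseteq> lspan R MR A" using N by (auto simp: submod_def)
  then obtain B where B: "finite B" "B \<subseteq> N" "N = lspan R MR B"
    using MR.submod_finitely_generated[OF R(2,3) A restr[OF N]] by auto
  interpret N: left_module \<Lambda> "M\<lparr>carrier := N\<rparr>" by (rule M.left_module_submod[OF N])
  have "N \<subseteq> lspan \<Lambda> (M\<lparr>carrier := N\<rparr>) B"
  proof -
    have "submod \<Lambda> M (lspan \<Lambda> (M\<lparr>carrier := N\<rparr>) B)"
      using N.submod_span[of B] B N by (auto simp: submod_def)
    then show ?thesis
      using MR.span_least[OF restr] N.span_superset[of B] B(3) by blast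
  qed
  then have "lspan \<Lambda> (M\<lparr>carrier := N\<rparr>) B = carrier (M\<lparr>carrier := N\<rparr>)"
    using N.submodD(1)[OF N.submod_span[of B]] B by auto
  then show ?thesis
    using B N.left_module_axioms by (auto simp: fg_mod_iff)
qed

section \<open>The additive category of finitely generated modules\<close>

locale artin_algebra_modules =
  fixes R :: "('r, 's) ring_scheme" and \<sigma> :: "'r \<Rightarrow> 'a" and \<Lambda> :: "('a, 'b) ring_scheme"
  assumes artin: "artin_algebra R \<sigma> \<Lambda>"
begin

abbreviation Hom :: "'a lmod \<Rightarrow> 'a lmod \<Rightarrow> 'a lmap set" where
  "Hom X Y \<equiv> carrier (mod_hom \<Lambda> X Y)"

abbreviation comp :: "'a lmod \<Rightarrow> 'a lmap \<Rightarrow> 'a lmap \<Rightarrow> 'a lmap" where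
  "comp X g f \<equiv> compose (carrier X) g f"

abbreviation fg :: "'a lmod set" where "fg \<equiv> fg_mod \<Lambda>"

abbreviation hadd :: "'a lmod \<Rightarrow> 'a lmod \<Rightarrow> 'a lmap \<Rightarrow> 'a lmap \<Rightarrow> 'a lmap" where
  "hadd X Y f g \<equiv> f \<otimes>\<^bsub>mod_hom \<Lambda> X Y\<^esub> g"

abbreviation hneg :: "'a lmod \<Rightarrow> 'a lmod \<Rightarrow> 'a lmap \<Rightarrow> 'a lmap" where
  "hneg X Y f \<equiv> inv\<^bsub>mod_hom \<Lambda> X Y\<^esub> f"

abbreviation hzero :: "'a lmod \<Rightarrow> 'a lmod \<Rightarrow> 'a lmap" where
  "hzero X Y \<equiv> \<one>\<^bsub>mod_hom \<Lambda> X Y\<^esub>"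

lemma fg_left_module: "X \<in> fg \<Longrightarrow> left_module \<Lambda> X"
  by (simp add: fg_mod_def)

lemma fg_abelian_group: "X \<in> fg \<Longrightarrow> abelian_group X"
  by (rule left_module.axioms(2)[OF fg_left_module])

lemma fg_zero [simp]: "X \<in> fg \<Longrightarrow> \<zero>\<^bsub>X\<^esub> \<in> carrier X"
  by (rule abelian_groupE(2)[OF fg_abelian_group])

lemma fg_add [simp]: "\<lbrakk>X \<in> fg; x \<in> carrier X; y \<in> carrier X\<rbrakk> \<Longrightarrow> x \<oplus>\<^bsub>X\<^esub> y \<in> carrier X"
  by (rule abelian_groupE(1)[OF fg_abelian_group])

lemma fg_minus [simp]: "\<lbrakk>X \<in> fg; x \<in> carrier X\<rbrakk> \<Longrightarrow> \<ominus>\<^bsub>X\<^esub> x \<in> carrier X"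
  by (rule abelian_group.a_inv_closed[OF fg_abelian_group])

lemma fg_smult [simp]: "\<lbrakk>X \<in> fg; a \<in> carrier \<Lambda>; x \<in> carrier X\<rbrakk> \<Longrightarrow> a \<odot>\<^bsub>X\<^esub> x \<in> carrier X"
  by (rule left_module.lsmult_closed[OF fg_left_module])

lemma fg_smult_add: "\<lbrakk>X \<in> fg; a \<in> carrier \<Lambda>; x \<in> carrier X; y \<in> carrier X\<rbrakk>
    \<Longrightarrow> a \<odot>\<^bsub>X\<^esub> (x \<oplus>\<^bsub>X\<^esub> y) = a \<odot>\<^bsub>X\<^esub> x \<oplus>\<^bsub>X\<^esub> a \<odot>\<^bsub>X\<^esub> y"
  by (rule left_module.lsmult_r_distr[OF fg_left_module])

lemma fg_smult_zero: "\<lbrakk>X \<in> fg; a \<in> carrier \<Lambda>\<rbrakk> \<Longrightarrow> a \<odot>\<^bsub>X\<^esub> \<zero>\<^bsub>X\<^esub> = \<zero>\<^bsub>X\<^esub>"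
  by (rule left_module.lsmult_r_null[OF fg_left_module])

lemma fg_simps [simp]:
  assumes "X \<in> fg" and "x \<in> carrier X"
  shows "\<zero>\<^bsub>X\<^esub> \<oplus>\<^bsub>X\<^esub> x = x" "x \<oplus>\<^bsub>X\<^esub> \<zero>\<^bsub>X\<^esub> = x" "\<ominus>\<^bsub>X\<^esub> x \<oplus>\<^bsub>X\<^esub> x = \<zero>\<^bsub>X\<^esub>"
    "x \<oplus>\<^bsub>X\<^esub> \<ominus>\<^bsub>X\<^esub> x = \<zero>\<^bsub>X\<^esub>" "\<ominus>\<^bsub>X\<^esub> (\<ominus>\<^bsub>X\<^esub> x) = x"
proof -
  interpret abelian_group X using assms(1) by (rule fg_abelian_group)
  show "\<zero>\<^bsub>X\<^esub> \<oplus>\<^bsub>X\<^esub> x = x" "x \<oplus>\<^bsub>X\<^esub> \<zero>\<^bsub>X\<^esub> = x" "\<ominus>\<^bsub>X\<^esub> x \<oplus>\<^bsub>X\<^esub> x = \<zero>\<^bsub>X\<^esub>"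
    "x \<oplus>\<^bsub>X\<^esub> \<ominus>\<^bsub>X\<^esub> x = \<zero>\<^bsub>X\<^esub>" "\<ominus>\<^bsub>X\<^esub> (\<ominus>\<^bsub>X\<^esub> x) = x"
    using assms(2) by (simp_all add: l_neg r_neg)
qed

lemma fg_minus_zero [simp]: "X \<in> fg \<Longrightarrow> \<ominus>\<^bsub>X\<^esub> \<zero>\<^bsub>X\<^esub> = \<zero>\<^bsub>X\<^esub>"
  by (rule left_module.minus_module_zero[OF fg_left_module])

lemma fg_add_assoc: "\<lbrakk>X \<in> fg; x \<in> carrier X; y \<in> carrier X; z \<in> carrier X\<rbrakk>
    \<Longrightarrow> (x \<oplus>\<^bsub>X\<^esub> y) \<oplus>\<^bsub>X\<^esub> z = x \<oplus>\<^bsub>X\<^esub> (y \<oplus>\<^bsub>X\<^esub> z)"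
  by (rule abelian_groupE(3)[OF fg_abelian_group])

lemma fg_add_comm: "\<lbrakk>X \<in> fg; x \<in> carrier X; y \<in> carrier X\<rbrakk> \<Longrightarrow> x \<oplus>\<^bsub>X\<^esub> y = y \<oplus>\<^bsub>X\<^esub> x"
  by (rule abelian_groupE(4)[OF fg_abelian_group])

lemma fg_add_lcomm: "\<lbrakk>X \<in> fg; x \<in> carrier X; y \<in> carrier X; z \<in> carrier X\<rbrakk>
    \<Longrightarrow> x \<oplus>\<^bsub>X\<^esub> (y \<oplus>\<^bsub>X\<^esub> z) = y \<oplus>\<^bsub>X\<^esub> (x \<oplus>\<^bsub>X\<^esub> z)"
  by (metis fg_add_assoc fg_add_comm)

lemmas fg_add_ac = fg_add_assoc fg_add_comm fg_add_lcomm

lemma fg_eq_if_minus: "\<lbrakk>X \<in> fg; x \<in> carrier X; y \<in> carrier X; x \<oplus>\<^bsub>X\<^esub> \<ominus>\<^bsub>X\<^esub> y = \<zero>\<^bsub>X\<^esub>\<rbrakk> \<Longrightarrow> x = y"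
  by (metis fg_add_assoc fg_minus fg_simps(1,2,3))

lemma fg_minus_add: "\<lbrakk>X \<in> fg; x \<in> carrier X; y \<in> carrier X\<rbrakk>
    \<Longrightarrow> \<ominus>\<^bsub>X\<^esub> (x \<oplus>\<^bsub>X\<^esub> y) = \<ominus>\<^bsub>X\<^esub> x \<oplus>\<^bsub>X\<^esub> \<ominus>\<^bsub>X\<^esub> y"
  by (rule abelian_group.minus_add[OF fg_abelian_group])

lemma fg_cancel:
  assumes "X \<in> fg" and "x \<in> carrier X" "y \<in> carrier X"
  shows "\<ominus>\<^bsub>X\<^esub> x \<oplus>\<^bsub>X\<^esub> (x \<oplus>\<^bsub>X\<^esub> y) = y" "x \<oplus>\<^bsub>X\<^esub> (\<ominus>\<^bsub>X\<^esub> x \<oplus>\<^bsub>X\<^esub> y) = y"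
proof -
  interpret abelian_group X using assms(1) by (rule fg_abelian_group)
  show "\<ominus>\<^bsub>X\<^esub> x \<oplus>\<^bsub>X\<^esub> (x \<oplus>\<^bsub>X\<^esub> y) = y" "x \<oplus>\<^bsub>X\<^esub> (\<ominus>\<^bsub>X\<^esub> x \<oplus>\<^bsub>X\<^esub> y) = y"
    using assms(2-) by (simp_all add: r_neg1 r_neg2)
qed

lemma Hom_iff: "f \<in> Hom X Y \<longleftrightarrow> f \<in> carrier X \<rightarrow>\<^sub>E carrier Y \<and>
    (\<forall>x \<in> carrier X. \<forall>y \<in> carrier X. f (x \<oplus>\<^bsub>X\<^esub> y) = f x \<oplus>\<^bsub>Y\<^esub> f y) \<and>
    (\<forall>a \<in> carrier \<Lambda>. \<forall>x \<in> carrier X. f (a \<odot>\<^bsub>X\<^esub> x) = a \<odot>\<^bsub>Y\<^esub> f x)"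
  by (simp add: mod_hom_def)

lemma HomI:
  assumes "\<And>x. x \<in> carrier X \<Longrightarrow> f x \<in> carrier Y" "f \<in> extensional (carrier X)"
    "\<And>x y. \<lbrakk>x \<in> carrier X; y \<in> carrier X\<rbrakk> \<Longrightarrow> f (x \<oplus>\<^bsub>X\<^esub> y) = f x \<oplus>\<^bsub>Y\<^esub> f y"
    "\<And>a x. \<lbrakk>a \<in> carrier \<Lambda>; x \<in> carrier X\<rbrakk> \<Longrightarrow> f (a \<odot>\<^bsub>X\<^esub> x) = a \<odot>\<^bsub>Y\<^esub> f x"
  shows "f \<in> Hom X Y"
  using assms by (auto simp: Hom_iff PiE_iff)

lemma Hom_restrictI:
  assumes "X \<in> fg" "\<And>x. x \<in> carrier X \<Longrightarrow> f x \<in> carrier Y"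
    "\<And>x y. \<lbrakk>x \<in> carrier X; y \<in> carrier X\<rbrakk> \<Longrightarrow> f (x \<oplus>\<^bsub>X\<^esub> y) = f x \<oplus>\<^bsub>Y\<^esub> f y"
    "\<And>a x. \<lbrakk>a \<in> carrier \<Lambda>; x \<in> carrier X\<rbrakk> \<Longrightarrow> f (a \<odot>\<^bsub>X\<^esub> x) = a \<odot>\<^bsub>Y\<^esub> f x"
  shows "(\<lambda>x \<in> carrier X. f x) \<in> Hom X Y"
  using assms by (intro HomI) auto

lemma Hom_closed [simp]: "\<lbrakk>f \<in> Hom X Y; x \<in> carrier X\<rbrakk> \<Longrightarrow> f x \<in> carrier Y"
  by (auto simp: Hom_iff)

lemma Hom_extensional: "f \<in> Hom X Y \<Longrightarrow> f \<in> extensional (carrier X)"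
  by (auto simp: Hom_iff PiE_iff)

lemma Hom_add: "\<lbrakk>f \<in> Hom X Y; x \<in> carrier X; y \<in> carrier X\<rbrakk> \<Longrightarrow> f (x \<oplus>\<^bsub>X\<^esub> y) = f x \<oplus>\<^bsub>Y\<^esub> f y"
  by (simp add: Hom_iff)

lemma Hom_smult: "\<lbrakk>f \<in> Hom X Y; a \<in> carrier \<Lambda>; x \<in> carrier X\<rbrakk> \<Longrightarrow> f (a \<odot>\<^bsub>X\<^esub> x) = a \<odot>\<^bsub>Y\<^esub> f x"
  by (simp add: Hom_iff)

lemma Hom_zero [simp]:
  assumes "f \<in> Hom X Y" "X \<in> fg" "Y \<in> fg" shows "f \<zero>\<^bsub>X\<^esub> = \<zero>\<^bsub>Y\<^esub>"
proof -
  interpret Y: abelian_group Y using assms(3) by (rule fg_abelian_group)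
  have "f \<zero>\<^bsub>X\<^esub> \<oplus>\<^bsub>Y\<^esub> f \<zero>\<^bsub>X\<^esub> = f \<zero>\<^bsub>X\<^esub>"
    using Hom_add[OF assms(1), of "\<zero>\<^bsub>X\<^esub>" "\<zero>\<^bsub>X\<^esub>"] assms by simp
  then show ?thesis using assms by (metis Hom_closed Y.add.r_cancel_one' fg_zero)
qed

lemma Hom_minus:
  assumes "f \<in> Hom X Y" "X \<in> fg" "Y \<in> fg" "x \<in> carrier X" shows "f (\<ominus>\<^bsub>X\<^esub> x) = \<ominus>\<^bsub>Y\<^esub> f x"
proof -
  interpret Y: abelian_group Y using assms(3) by (rule fg_abelian_group)
  have "f (\<ominus>\<^bsub>X\<^esub> x) \<oplus>\<^bsub>Y\<^esub> f x = \<zero>\<^bsub>Y\<^esub>"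
    using Hom_add[OF assms(1), of "\<ominus>\<^bsub>X\<^esub> x" x] assms by simp
  then show ?thesis using assms by (intro Y.minus_equality[symmetric]) auto
qed

lemma Hom_eqI: "\<lbrakk>f \<in> Hom X Y; g \<in> Hom X Z; \<And>x. x \<in> carrier X \<Longrightarrow> f x = g x\<rbrakk> \<Longrightarrow> f = g"
  by (rule extensionalityI[of _ "carrier X"]) (auto simp: Hom_extensional)

lemma comp_Hom [simp]: "\<lbrakk>X \<in> fg; f \<in> Hom X Y; g \<in> Hom Y Z\<rbrakk> \<Longrightarrow> comp X g f \<in> Hom X Z"
  by (rule HomI) (simp_all add: compose_eq Hom_add Hom_smult)

lemma comp_eqD: "comp X g f = h \<Longrightarrow> x \<in> carrier X \<Longrightarrow> g (f x) = h x"
  by (auto simp: compose_eq)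

lemma mod_id_Hom [simp]: "X \<in> fg \<Longrightarrow> mod_id X \<in> Hom X X"
  unfolding mod_id_def by (rule Hom_restrictI) auto

lemma mod_id_apply [simp]: "x \<in> carrier X \<Longrightarrow> mod_id X x = x"
  by (simp add: mod_id_def)

lemma comp_id [simp]: "f \<in> Hom X Y \<Longrightarrow> comp X (mod_id Y) f = f"
  "f \<in> Hom X Y \<Longrightarrow> comp X f (mod_id X) = f"
  by (auto intro!: extensionalityI[of _ "carrier X"] simp: compose_eq Hom_extensional)

lemma comp_comp: "f \<in> Hom X Y \<Longrightarrow> comp X (comp Y h g) f = comp X h (comp X g f)"
  by (auto intro!: extensionalityI[of _ "carrier X"] simp: compose_eq)

lemma hzero_apply [simp]: "x \<in> carrier X \<Longrightarrow> hzero X Y x = \<zero>\<^bsub>Y\<^esub>"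
  by (simp add: mod_hom_def)

lemma hadd_apply [simp]: "x \<in> carrier X \<Longrightarrow> hadd X Y f g x = f x \<oplus>\<^bsub>Y\<^esub> g x"
  by (simp add: mod_hom_def)

lemma hadd_extensional [simp]: "hadd X Y f g \<in> extensional (carrier X)"
  and hzero_extensional [simp]: "hzero X Y \<in> extensional (carrier X)"
  by (simp_all add: mod_hom_def)

lemma hzero_Hom [simp]: "\<lbrakk>X \<in> fg; Y \<in> fg\<rbrakk> \<Longrightarrow> hzero X Y \<in> Hom X Y"
  by (rule HomI) (auto simp: mod_hom_def fg_smult_zero)

lemma hadd_Hom [simp]: "\<lbrakk>X \<in> fg; Y \<in> fg; f \<in> Hom X Y; g \<in> Hom X Y\<rbrakk> \<Longrightarrow> hadd X Y f g \<in> Hom X Y"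
proof (rule HomI)
  show "hadd X Y f g \<in> extensional (carrier X)" by (simp add: mod_hom_def)
qed (auto simp: Hom_add Hom_smult fg_smult_add fg_add_ac)

lemma Hom_comm_group: assumes X: "X \<in> fg" and Y: "Y \<in> fg" shows "comm_group (mod_hom \<Lambda> X Y)"
proof (rule comm_groupI, goal_cases)
  case (3 f g h)
  then show ?case by (intro Hom_eqI[of _ X Y _ Y]) (simp_all add: X Y fg_add_ac)
next
  case (4 f g)
  then show ?case by (intro Hom_eqI[of _ X Y _ Y]) (simp_all add: X Y fg_add_ac)
next
  case (5 f)
  then show ?case by (intro Hom_eqI[of _ X Y _ Y]) (simp_all add: X Y)
next
  case (6 f)
  have Y_lm: "left_module \<Lambda> Y" using Y by (rule fg_left_module)
  have "a \<odot>\<^bsub>Y\<^esub> (\<ominus>\<^bsub>Y\<^esub> y) = \<ominus>\<^bsub>Y\<^esub> (a \<odot>\<^bsub>Y\<^esub> y)" if "a \<in> carrier \<Lambda>" "y \<in> carrier Y" for a y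
    by (rule fg_eq_if_minus[OF Y])
      (use that Y in \<open>auto simp: fg_smult_add[symmetric] fg_smult_zero\<close>)
  then have "(\<lambda>x \<in> carrier X. \<ominus>\<^bsub>Y\<^esub> f x) \<in> Hom X Y"
    using 6 X Y by (intro Hom_restrictI) (auto simp: Hom_add Hom_smult fg_minus_add)
  moreover from this have "hadd X Y (\<lambda>x \<in> carrier X. \<ominus>\<^bsub>Y\<^esub> f x) f = hzero X Y"
    using 6 X Y by (intro Hom_eqI[of _ X Y _ Y]) auto
  ultimately show ?case by blast
qed (use X Y in auto)

lemma hneg_Hom [simp]: "\<lbrakk>X \<in> fg; Y \<in> fg; f \<in> Hom X Y\<rbrakk> \<Longrightarrow> hneg X Y f \<in> Hom X Y"
  by (rule group.inv_closed[OF comm_group.axioms(2)[OF Hom_comm_group]])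

lemma hneg_apply [simp]:
  assumes "X \<in> fg" "Y \<in> fg" "f \<in> Hom X Y" "x \<in> carrier X" shows "hneg X Y f x = \<ominus>\<^bsub>Y\<^esub> f x"
proof -
  interpret comm_group "mod_hom \<Lambda> X Y" using assms by (simp add: Hom_comm_group)
  interpret Y: abelian_group Y using assms(2) by (rule fg_abelian_group)
  have "hneg X Y f x \<oplus>\<^bsub>Y\<^esub> f x = \<zero>\<^bsub>Y\<^esub>"
    using l_inv[OF assms(3)] assms by (metis hadd_apply hzero_apply)
  then show ?thesis using assms Hom_closed[OF hneg_Hom] by (intro Y.minus_equality[symmetric]) auto
qed

lemma comp_hadd_left: "\<lbrakk>X \<in> fg; Y \<in> fg; Z \<in> fg; f \<in> Hom X Y; g \<in> Hom Y Z; g' \<in> Hom Y Z\<rbrakk>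
  \<Longrightarrow> comp X (hadd Y Z g g') f = hadd X Z (comp X g f) (comp X g' f)"
  by (rule extensionalityI[of _ "carrier X"]) (simp_all add: Hom_extensional compose_eq)

lemma comp_hadd_right: "\<lbrakk>X \<in> fg; Y \<in> fg; Z \<in> fg; f \<in> Hom X Y; f' \<in> Hom X Y; g \<in> Hom Y Z\<rbrakk>
  \<Longrightarrow> comp X g (hadd X Y f f') = hadd X Z (comp X g f) (comp X g f')"
  by (rule extensionalityI[of _ "carrier X"]) (simp_all add: Hom_extensional compose_eq Hom_add)

lemma comp_hzero [simp]: "\<lbrakk>X \<in> fg; Y \<in> fg; Z \<in> fg; f \<in> Hom X Y\<rbrakk> \<Longrightarrow> comp X (hzero Y Z) f = hzero X Z"
  "\<lbrakk>X \<in> fg; Y \<in> fg; Z \<in> fg; g \<in> Hom Y Z\<rbrakk> \<Longrightarrow> comp X g (hzero X Y) = hzero X Z"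
  by (rule extensionalityI[of _ "carrier X"]; simp add: Hom_extensional compose_eq)+

lemma Hom_injective: assumes "f \<in> Hom X Y" "X \<in> fg" "Y \<in> fg"
    "\<And>x. \<lbrakk>x \<in> carrier X; f x = \<zero>\<^bsub>Y\<^esub>\<rbrakk> \<Longrightarrow> x = \<zero>\<^bsub>X\<^esub>"
  shows "inj_on f (carrier X)"
proof (rule inj_onI)
  fix x y assume xy: "x \<in> carrier X" "y \<in> carrier X" "f x = f y"
  then have "f (x \<oplus>\<^bsub>X\<^esub> \<ominus>\<^bsub>X\<^esub> y) = \<zero>\<^bsub>Y\<^esub>" using assms(1-3) by (simp add: Hom_add Hom_minus)
  then have "x \<oplus>\<^bsub>X\<^esub> \<ominus>\<^bsub>X\<^esub> y = \<zero>\<^bsub>X\<^esub>" using assms(1-3) xy(1,2) by (intro assms(4)) simp_all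
  then show "x = y" using fg_eq_if_minus assms(2) xy by blast
qed

lemma injective_zero: "\<lbrakk>f \<in> Hom X Y; X \<in> fg; Y \<in> fg; inj_on f (carrier X); x \<in> carrier X; f x = \<zero>\<^bsub>Y\<^esub>\<rbrakk>
  \<Longrightarrow> x = \<zero>\<^bsub>X\<^esub>"
  by (metis Hom_zero fg_zero inj_onD)

lemma injective_comp_cancel: "\<lbrakk>inj_on f (carrier Y); u \<in> Hom X Y; v \<in> Hom X Y; comp X f u = comp X f v\<rbrakk> \<Longrightarrow> u = v"
proof (rule Hom_eqI)
  fix x assume "inj_on f (carrier Y)" "u \<in> Hom X Y" "v \<in> Hom X Y" "comp X f u = comp X f v" "x \<in> carrier X"
  then have "f (u x) = f (v x)" by (metis compose_eq)
  then show "u x = v x" using \<open>inj_on f (carrier Y)\<close> \<open>u \<in> Hom X Y\<close> \<open>v \<in> Hom X Y\<close> \<open>x \<in> carrier X\<close>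
    by (meson Hom_closed inj_onD)
qed

subsection \<open>Submodules, kernels and images of idempotents\<close>

lemma submodI:
  assumes "X \<in> fg" "H \<subseteq> carrier X" "\<zero>\<^bsub>X\<^esub> \<in> H" "\<And>x y. \<lbrakk>x \<in> H; y \<in> H\<rbrakk> \<Longrightarrow> x \<oplus>\<^bsub>X\<^esub> y \<in> H"
    "\<And>a x. \<lbrakk>a \<in> carrier \<Lambda>; x \<in> H\<rbrakk> \<Longrightarrow> a \<odot>\<^bsub>X\<^esub> x \<in> H"
  shows "X\<lparr>carrier := H\<rparr> \<in> fg"
  using assms by (intro submod_fg_mod[OF artin]) (auto simp: submod_def)

lemma kernel_fg:
  assumes "X \<in> fg" "Y \<in> fg" "f \<in> Hom X Y"
  shows "X\<lparr>carrier := {x \<in> carrier X. f x = \<zero>\<^bsub>Y\<^esub>}\<rparr> \<in> fg"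
  using assms by (intro submodI) (auto simp: Hom_add Hom_smult fg_smult_zero)

lemma image_fg:
  assumes "X \<in> fg" "Y \<in> fg" "f \<in> Hom X Y"
  shows "Y\<lparr>carrier := f ` carrier X\<rparr> \<in> fg"
proof (rule submodI)
  show "\<zero>\<^bsub>Y\<^esub> \<in> f ` carrier X" using assms by (intro image_eqI[of _ _ "\<zero>\<^bsub>X\<^esub>"]) auto
  fix x y assume "x \<in> f ` carrier X" "y \<in> f ` carrier X"
  then show "x \<oplus>\<^bsub>Y\<^esub> y \<in> f ` carrier X" using assms by (auto simp: Hom_add[symmetric])
next
  fix a x assume "a \<in> carrier \<Lambda>" "x \<in> f ` carrier X"
  then show "a \<odot>\<^bsub>Y\<^esub> x \<in> f ` carrier X" using assms by (auto simp: Hom_smult[symmetric])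
qed (use assms in auto)

lemma inclusion_Hom:
  assumes "H \<subseteq> carrier X" "X\<lparr>carrier := H\<rparr> \<in> fg"
  shows "(\<lambda>x \<in> H. x) \<in> Hom (X\<lparr>carrier := H\<rparr>) X"
proof -
  have "(\<lambda>x \<in> carrier (X\<lparr>carrier := H\<rparr>). x) \<in> Hom (X\<lparr>carrier := H\<rparr>) X"
    by (rule Hom_restrictI) (use assms fg_add[OF assms(2)] fg_smult[OF assms(2)] in auto)
  then show ?thesis by simp
qed

lemma corestrict_Hom:
  assumes "f \<in> Hom W X" "\<And>x. x \<in> carrier W \<Longrightarrow> f x \<in> H"
  shows "f \<in> Hom W (X\<lparr>carrier := H\<rparr>)"
  using assms by (intro HomI) (auto simp: Hom_add Hom_smult Hom_extensional)

subsection \<open>Direct sums\<close>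

definition dsum :: "'a lmod \<Rightarrow> 'a lmod \<Rightarrow> 'a lmod \<Rightarrow> 'a lmap \<Rightarrow> 'a lmap \<Rightarrow> 'a lmap \<Rightarrow> 'a lmap \<Rightarrow> bool" where
  "dsum X Y Z i j p q \<longleftrightarrow> Z \<in> fg \<and> i \<in> Hom X Z \<and> j \<in> Hom Y Z \<and> p \<in> Hom Z X \<and> q \<in> Hom Z Y \<and>
     (\<forall>x \<in> carrier X. p (i x) = x \<and> q (i x) = \<zero>\<^bsub>Y\<^esub>) \<and>
     (\<forall>y \<in> carrier Y. q (j y) = y \<and> p (j y) = \<zero>\<^bsub>X\<^esub>) \<and>
     (\<forall>z \<in> carrier Z. i (p z) \<oplus>\<^bsub>Z\<^esub> j (q z) = z)"

text \<open>The elements of a direct sum have to be of the fixed type of module elements, the sets of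
  sequences. A pair of such sets is encoded by marking the sequences of the two components with \<open>0\<close>
  and \<open>1\<close> of \<open>\<Lambda>\<close>. This fails to be injective only when \<open>0 = 1\<close>, and then all modules are zero.\<close>

definition pair_code :: "'a elt \<times> 'a elt \<Rightarrow> 'a elt" where
  "pair_code = (\<lambda>(A, B). case_nat \<zero>\<^bsub>\<Lambda>\<^esub> ` A \<union> case_nat \<one>\<^bsub>\<Lambda>\<^esub> ` B)"

lemma pair_code_inj:
  assumes "X \<in> fg" "Y \<in> fg"
  shows "inj_on pair_code (carrier X \<times> carrier Y)"
proof (cases "\<zero>\<^bsub>\<Lambda>\<^esub> = \<one>\<^bsub>\<Lambda>\<^esub>")
  case True
  have zero: "x = \<zero>\<^bsub>X\<^esub>" if "X \<in> fg" "x \<in> carrier X" for X x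
  proof -
    interpret left_module \<Lambda> X using that by (simp add: fg_left_module)
    show ?thesis using lsmult_one[OF that(2)] lsmult_l_null[OF that(2)] True by metis
  qed
  show ?thesis
  proof (rule inj_onI)
    fix u v assume "u \<in> carrier X \<times> carrier Y" "v \<in> carrier X \<times> carrier Y"
    then show "u = v" using zero[OF assms(1)] zero[OF assms(2)] by (metis mem_Times_iff prod_eqI)
  qed
next
  case False
  have inj: "c = d \<and> f = g" if "(case_nat c f :: nat \<Rightarrow> 'a) = case_nat d g" for c d f g
    using fun_cong[OF that, of 0] fun_cong[OF that, of "Suc _"] by auto
  have 1: "A = {f. case_nat \<zero>\<^bsub>\<Lambda>\<^esub> f \<in> pair_code (A, B)}" "B = {f. case_nat \<one>\<^bsub>\<Lambda>\<^esub> f \<in> pair_code (A, B)}" for A B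
    using False by (auto simp: pair_code_def dest: inj)
  show ?thesis
    by (rule inj_onI) (metis 1 prod.collapse)
qed

lemma dsum_exists:
  assumes X: "X \<in> fg" and Y: "Y \<in> fg"
  obtains Z i j p q where "dsum X Y Z i j p q"
proof -
  let ?P = "carrier X \<times> carrier Y"
  define d where "d = inv_into ?P pair_code"
  have d [simp]: "d (pair_code (x, y)) = (x, y)" if "x \<in> carrier X" "y \<in> carrier Y" for x y
    unfolding d_def using inv_into_f_f[OF pair_code_inj[OF X Y]] that by simp
  define Z :: "'a lmod" where "Z = \<lparr>carrier = pair_code ` ?P, monoid.mult = undefined, one = undefined,
     zero = pair_code (\<zero>\<^bsub>X\<^esub>, \<zero>\<^bsub>Y\<^esub>),
     add = \<lambda>u v. pair_code (fst (d u) \<oplus>\<^bsub>X\<^esub> fst (d v), snd (d u) \<oplus>\<^bsub>Y\<^esub> snd (d v)),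
     smult = \<lambda>a u. pair_code (a \<odot>\<^bsub>X\<^esub> fst (d u), a \<odot>\<^bsub>Y\<^esub> snd (d u))\<rparr>"
  have Z [simp]: "carrier Z = pair_code ` ?P" "\<zero>\<^bsub>Z\<^esub> = pair_code (\<zero>\<^bsub>X\<^esub>, \<zero>\<^bsub>Y\<^esub>)"
     "u \<oplus>\<^bsub>Z\<^esub> v = pair_code (fst (d u) \<oplus>\<^bsub>X\<^esub> fst (d v), snd (d u) \<oplus>\<^bsub>Y\<^esub> snd (d v))"
     "a \<odot>\<^bsub>Z\<^esub> u = pair_code (a \<odot>\<^bsub>X\<^esub> fst (d u), a \<odot>\<^bsub>Y\<^esub> snd (d u))" for a u v
    by (simp_all add: Z_def)
  interpret X: left_module \<Lambda> X using X by (rule fg_left_module)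
  interpret Y: left_module \<Lambda> Y using Y by (rule fg_left_module)
  have "abelian_group Z"
  proof (rule abelian_groupI, goal_cases)
    case (6 u)
    then obtain x y where u: "u = pair_code (x, y)" "x \<in> carrier X" "y \<in> carrier Y" by auto
    then show ?case using X Y by (intro bexI[of _ "pair_code (\<ominus>\<^bsub>X\<^esub> x, \<ominus>\<^bsub>Y\<^esub> y)"]) auto
  qed (use X Y in \<open>auto simp: fg_add_ac\<close>)
  then interpret Z: left_module \<Lambda> Z
    using X.R.ring_axioms X Y unfolding left_module_def left_module_axioms_def
    by (auto simp: fg_smult_add X.lsmult_l_distr Y.lsmult_l_distr X.lsmult_assoc Y.lsmult_assoc X.lsmult_one Y.lsmult_one)
  obtain S where S: "finite S" "S \<subseteq> carrier X" "lspan \<Lambda> X S = carrier X" using X by (auto simp: fg_mod_iff)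
  obtain T where T: "finite T" "T \<subseteq> carrier Y" "lspan \<Lambda> Y T = carrier Y" using Y by (auto simp: fg_mod_iff)
  define i where "i x = pair_code (x, \<zero>\<^bsub>Y\<^esub>)" for x
  define j where "j y = pair_code (\<zero>\<^bsub>X\<^esub>, y)" for y
  have i_hom: "i (x \<oplus>\<^bsub>X\<^esub> x') = i x \<oplus>\<^bsub>Z\<^esub> i x'" "i (a \<odot>\<^bsub>X\<^esub> x) = a \<odot>\<^bsub>Z\<^esub> i x" "i \<zero>\<^bsub>X\<^esub> = \<zero>\<^bsub>Z\<^esub>"
    if "x \<in> carrier X" "x' \<in> carrier X" "a \<in> carrier \<Lambda>" for x x' a
    using that X Y by (simp_all add: i_def fg_smult_zero)
  have j_hom: "j (x \<oplus>\<^bsub>Y\<^esub> x') = j x \<oplus>\<^bsub>Z\<^esub> j x'" "j (a \<odot>\<^bsub>Y\<^esub> x) = a \<odot>\<^bsub>Z\<^esub> j x" "j \<zero>\<^bsub>Y\<^esub> = \<zero>\<^bsub>Z\<^esub>"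
    if "x \<in> carrier Y" "x' \<in> carrier Y" "a \<in> carrier \<Lambda>" for x x' a
    using that X Y by (simp_all add: j_def fg_smult_zero)
  have "carrier Z \<subseteq> N" if N: "submod \<Lambda> Z N" "i ` S \<union> j ` T \<subseteq> N" for N
  proof -
    note N' = Z.submodD[OF N(1)]
    have "submod \<Lambda> X {x \<in> carrier X. i x \<in> N}"
      unfolding submod_def
    proof (intro conjI ballI)
      show "\<zero>\<^bsub>X\<^esub> \<in> {x \<in> carrier X. i x \<in> N}" using N'(2) X by (simp add: i_def)
    next
      fix u w assume "u \<in> {x \<in> carrier X. i x \<in> N}" "w \<in> {x \<in> carrier X. i x \<in> N}"
      then show "u \<oplus>\<^bsub>X\<^esub> w \<in> {x \<in> carrier X. i x \<in> N}"
        using N'(3)[of "i u" "i w"] i_hom(1)[of u w "\<one>\<^bsub>\<Lambda>\<^esub>"] X by (simp del: Z)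
    next
      fix a u assume "a \<in> carrier \<Lambda>" "u \<in> {x \<in> carrier X. i x \<in> N}"
      then show "a \<odot>\<^bsub>X\<^esub> u \<in> {x \<in> carrier X. i x \<in> N}"
        using N'(4)[of a "i u"] i_hom(2)[of u u a] X by (simp del: Z)
    qed auto
    then have "lspan \<Lambda> X S \<subseteq> {x \<in> carrier X. i x \<in> N}"
      using S(2) N(2) by (intro X.span_least) auto
    then have i_N: "carrier X \<subseteq> {x \<in> carrier X. i x \<in> N}" by (simp only: S(3))
    have "submod \<Lambda> Y {y \<in> carrier Y. j y \<in> N}"
      unfolding submod_def
    proof (intro conjI ballI)
      show "\<zero>\<^bsub>Y\<^esub> \<in> {y \<in> carrier Y. j y \<in> N}" using N'(2) Y by (simp add: j_def)
    next
      fix u w assume "u \<in> {y \<in> carrier Y. j y \<in> N}" "w \<in> {y \<in> carrier Y. j y \<in> N}"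
      then show "u \<oplus>\<^bsub>Y\<^esub> w \<in> {y \<in> carrier Y. j y \<in> N}"
        using N'(3)[of "j u" "j w"] j_hom(1)[of u w "\<one>\<^bsub>\<Lambda>\<^esub>"] Y by (simp del: Z)
    next
      fix a u assume "a \<in> carrier \<Lambda>" "u \<in> {y \<in> carrier Y. j y \<in> N}"
      then show "a \<odot>\<^bsub>Y\<^esub> u \<in> {y \<in> carrier Y. j y \<in> N}"
        using N'(4)[of a "j u"] j_hom(2)[of u u a] Y by (simp del: Z)
    qed auto
    then have "lspan \<Lambda> Y T \<subseteq> {y \<in> carrier Y. j y \<in> N}"
      using T(2) N(2) by (intro Y.span_least) auto
    then have j_N: "carrier Y \<subseteq> {y \<in> carrier Y. j y \<in> N}" by (simp only: T(3))
    then have ij: "i x \<in> N" "j y \<in> N" if "x \<in> carrier X" "y \<in> carrier Y" for x y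
      using that i_N by auto
    have "pair_code (x, y) = i x \<oplus>\<^bsub>Z\<^esub> j y" if "x \<in> carrier X" "y \<in> carrier Y" for x y
      using that X Y by (simp add: i_def j_def)
    then show ?thesis using ij N'(3) by auto
  qed
  moreover have ST: "i ` S \<union> j ` T \<subseteq> carrier Z" using S T X Y by (auto simp: i_def j_def)
  ultimately have "lspan \<Lambda> Z (i ` S \<union> j ` T) = carrier Z"
    using Z.span_eqI[OF Z.submod_carrier ST] by auto
  then have Zfg: "Z \<in> fg"
    using S(1) T(1) ST Z.left_module_axioms by (auto simp: fg_mod_iff intro!: exI[of _ "i ` S \<union> j ` T"])
  have "dsum X Y Z (restrict i (carrier X)) (restrict j (carrier Y))
     (\<lambda>u \<in> carrier Z. fst (d u)) (\<lambda>u \<in> carrier Z. snd (d u))"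
    unfolding dsum_def
  proof (intro conjI Hom_restrictI Zfg X Y)
  qed (use X Y in \<open>auto simp: i_def j_def fg_smult_zero simp del: restrict_apply simp: restrict_apply'\<close>)
  then show thesis by (rule that)
qed

end

section \<open>The category of maps\<close>

context artin_algebra_modules
begin

lemma mod_zero_simps: "carrier mod_zero = {undefined}" "\<zero>\<^bsub>mod_zero\<^esub> = undefined"
  "x \<oplus>\<^bsub>mod_zero\<^esub> y = undefined" "a \<odot>\<^bsub>mod_zero\<^esub> x = undefined"
  by (simp_all add: mod_zero_def)

lemma mod_zero_fg [simp]: "mod_zero \<in> fg"
proof -
  have "abelian_group mod_zero" by (rule abelian_groupI) (auto simp: mod_zero_simps)
  moreover have "ring \<Lambda>" using artin by (simp add: artin_algebra_def)
  ultimately interpret left_module \<Lambda> "mod_zero :: 'a lmod"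
    unfolding left_module_def left_module_axioms_def by (auto simp: mod_zero_simps)
  have "lspan \<Lambda> (mod_zero :: 'a lmod) {} = carrier mod_zero"
    using submodD(2)[OF submod_span[of "{}"]] submodD(1)[OF submod_span[of "{}"]] by (auto simp: mod_zero_simps)
  then show ?thesis
    unfolding fg_mod_iff using left_module_axioms by (auto intro!: exI[of _ "{}"])
qed

lemma mod_zero_carrier: "carrier mod_zero = {\<zero>\<^bsub>mod_zero\<^esub>}"
  by (simp add: mod_zero_simps)

lemma Hom_from_zero: "\<lbrakk>X \<in> fg; Y \<in> fg; carrier X = {\<zero>\<^bsub>X\<^esub>}\<rbrakk> \<Longrightarrow> f \<in> Hom X Y \<longleftrightarrow> f = hzero X Y"
  by (auto intro!: Hom_eqI[of _ X Y _ Y])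

lemma mod_ses_kernel:
  assumes S: "mod_ses \<Lambda> N i E p M" and fg: "N \<in> fg" "E \<in> fg" "M \<in> fg" "X \<in> fg"
    and g: "g \<in> Hom X E" "comp X p g = hzero X M"
  shows "\<exists>h \<in> Hom X N. comp X i h = g"
proof -
  have i: "i \<in> Hom N E" and inj: "inj_on i (carrier N)"
    and im: "i ` carrier N = {x \<in> carrier E. p x = \<zero>\<^bsub>M\<^esub>}"
    using S by (simp_all add: mod_ses_def)
  define h where "h = (\<lambda>x \<in> carrier X. inv_into (carrier N) i (g x))"
  have "g x \<in> i ` carrier N" if "x \<in> carrier X" for x
    unfolding im using that g comp_eqD[OF g(2) that] by simp
  then have h: "h x \<in> carrier N" "i (h x) = g x" if "x \<in> carrier X" for x
    using that by (simp_all add: h_def inv_into_into f_inv_into_f)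
  have "h \<in> Hom X N"
  proof (rule HomI)
    fix x y assume xy: "x \<in> carrier X" "y \<in> carrier X"
    show "h (x \<oplus>\<^bsub>X\<^esub> y) = h x \<oplus>\<^bsub>N\<^esub> h y"
      using inj by (rule inj_onD) (use xy h fg Hom_add[OF i] Hom_add[OF g(1)] in simp_all)
  next
    fix a x assume ax: "a \<in> carrier \<Lambda>" "x \<in> carrier X"
    show "h (a \<odot>\<^bsub>X\<^esub> x) = a \<odot>\<^bsub>N\<^esub> h x"
      using inj by (rule inj_onD) (use ax h fg Hom_smult[OF i] Hom_smult[OF g(1)] in simp_all)
  qed (use h in \<open>simp_all add: h_def\<close>)
  moreover have "comp X i h = g"
    using h Hom_extensional[OF g(1)] by (intro extensionalityI[of _ "carrier X"]) (simp_all add: compose_eq)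
  ultimately show ?thesis by blast
qed

lemma mod_ses_cokernel:
  assumes S: "mod_ses \<Lambda> N i E p M" and fg: "N \<in> fg" "E \<in> fg" "M \<in> fg" "X \<in> fg"
    and g: "g \<in> Hom E X" "comp N g i = hzero N X"
  shows "\<exists>h \<in> Hom M X. comp E h p = g"
proof -
  have p: "p \<in> Hom E M" and i: "i \<in> Hom N E" and onto: "p ` carrier E = carrier M"
    and im: "i ` carrier N = {x \<in> carrier E. p x = \<zero>\<^bsub>M\<^esub>}"
    using S by (simp_all add: mod_ses_def)
  have wd: "g x = g y" if xy: "x \<in> carrier E" "y \<in> carrier E" "p x = p y" for x y
  proof -
    have "p (x \<oplus>\<^bsub>E\<^esub> \<ominus>\<^bsub>E\<^esub> y) = \<zero>\<^bsub>M\<^esub>"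
      using xy fg p by (simp add: Hom_add Hom_minus)
    then have "x \<oplus>\<^bsub>E\<^esub> \<ominus>\<^bsub>E\<^esub> y \<in> i ` carrier N" unfolding im using xy fg by simp
    then obtain n where n: "n \<in> carrier N" "x \<oplus>\<^bsub>E\<^esub> \<ominus>\<^bsub>E\<^esub> y = i n" by blast
    then have "g (x \<oplus>\<^bsub>E\<^esub> \<ominus>\<^bsub>E\<^esub> y) = \<zero>\<^bsub>X\<^esub>" using comp_eqD[OF g(2) n(1)] n by simp
    then show ?thesis
      using xy fg g(1) by (rule_tac fg_eq_if_minus[of X]) (simp_all add: Hom_add Hom_minus)
  qed
  define h where "h = (\<lambda>m \<in> carrier M. g (inv_into (carrier E) p m))"
  have hp: "h (p x) = g x" if x: "x \<in> carrier E" for x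
  proof -
    have "p x \<in> p ` carrier E" using x by simp
    then have *: "inv_into (carrier E) p (p x) \<in> carrier E" "p (inv_into (carrier E) p (p x)) = p x"
      by (simp_all only: inv_into_into f_inv_into_f)
    show ?thesis using wd[OF *(1) x *(2)] x p by (simp add: h_def)
  qed
  have pre: "\<exists>x \<in> carrier E. m = p x" if "m \<in> carrier M" for m using that onto by blast
  have "h \<in> Hom M X"
  proof (rule HomI)
    fix m assume "m \<in> carrier M"
    then obtain x where "x \<in> carrier E" "m = p x" using pre by blast
    then show "h m \<in> carrier X" using hp g by simp
  next
    fix m n assume "m \<in> carrier M" "n \<in> carrier M"
    then obtain x y where "x \<in> carrier E" "m = p x" "y \<in> carrier E" "n = p y" using pre by blast
    then show "h (m \<oplus>\<^bsub>M\<^esub> n) = h m \<oplus>\<^bsub>X\<^esub> h n"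
      using hp g fg by (simp add: Hom_add[OF p, symmetric]) (simp add: Hom_add)
  next
    fix a m assume a: "a \<in> carrier \<Lambda>" and "m \<in> carrier M"
    then obtain x where "x \<in> carrier E" "m = p x" using pre by blast
    then show "h (a \<odot>\<^bsub>M\<^esub> m) = a \<odot>\<^bsub>X\<^esub> h m"
      using hp g fg a by (simp add: Hom_smult[OF p, symmetric]) (simp add: Hom_smult)
  qed (simp add: h_def)
  moreover have "comp E h p = g"
    using hp Hom_extensional[OF g(1)] by (intro extensionalityI[of _ "carrier E"]) (simp_all add: compose_eq)
  ultimately show ?thesis by blast
qed

lemma epi_comp_cancel:
  assumes "p ` carrier E = carrier M" "u \<in> Hom M X" "v \<in> Hom M X" "comp E u p = comp E v p"
  shows "u = v"
proof (rule Hom_eqI[OF assms(2,3)])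
  fix m assume "m \<in> carrier M"
  then obtain e where "e \<in> carrier E" "m = p e" using assms(1) by blast
  then show "u m = v m" using assms(4) by (metis compose_eq)
qed

subsection \<open>Objects and morphisms\<close>

lemma maps_ob_iff [simp]: "(A1, A0, f) \<in> maps_ob \<Lambda> \<longleftrightarrow> A1 \<in> fg \<and> A0 \<in> fg \<and> f \<in> Hom A1 A0"
  by (simp add: maps_ob_def)

lemma maps_mor_iff [simp]: "(u1, u0) \<in> carrier (maps_mor \<Lambda> (A1, A0, f) (B1, B0, g)) \<longleftrightarrow>
    u1 \<in> Hom A1 B1 \<and> u0 \<in> Hom A0 B0 \<and> comp A1 g u1 = comp A1 u0 f"
  by (simp add: maps_mor_def)

lemma maps_mor_simps [simp]:
  "\<one>\<^bsub>maps_mor \<Lambda> (A1, A0, f) (B1, B0, g)\<^esub> = (hzero A1 B1, hzero A0 B0)"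
  "(u1, u0) \<otimes>\<^bsub>maps_mor \<Lambda> (A1, A0, f) (B1, B0, g)\<^esub> (v1, v0) = (hadd A1 B1 u1 v1, hadd A0 B0 u0 v0)"
  by (simp_all add: maps_mor_def)

lemma maps_F_simps [simp]: "Ob (maps_F \<Lambda>) = maps_ob \<Lambda>" "Mor (maps_F \<Lambda>) = maps_mor \<Lambda>"
  "Id (maps_F \<Lambda>) = maps_id" "Comp (maps_F \<Lambda>) = maps_comp" "Ses (maps_F \<Lambda>) = F_ses \<Lambda>"
  by (simp_all add: maps_F_def)

lemma maps_id_simp [simp]: "maps_id (A1, A0, f) = (mod_id A1, mod_id A0)"
  by (simp add: maps_id_def)

lemma maps_comp_simp [simp]: "maps_comp (A1, A0, f) (v1, v0) (u1, u0) = (comp A1 v1 u1, comp A0 v0 u0)"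
  by (simp add: maps_comp_def)

lemma maps_mor_comm_group:
  assumes "A \<in> maps_ob \<Lambda>" "B \<in> maps_ob \<Lambda>"
  shows "comm_group (maps_mor \<Lambda> A B)"
proof -
  obtain A1 A0 f B1 B0 g where A: "A = (A1, A0, f)" and B: "B = (B1, B0, g)" by (metis prod_cases3)
  have ob [simp]: "A1 \<in> fg" "A0 \<in> fg" "f \<in> Hom A1 A0" "B1 \<in> fg" "B0 \<in> fg" "g \<in> Hom B1 B0"
    using assms by (simp_all add: A B)
  interpret H1: comm_group "mod_hom \<Lambda> A1 B1" by (simp add: Hom_comm_group)
  interpret H0: comm_group "mod_hom \<Lambda> A0 B0" by (simp add: Hom_comm_group)
  show ?thesis
    unfolding A B
  proof (rule comm_groupI, goal_cases)
    case (1 u v)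
    then show ?case by (cases u; cases v) (simp add: comp_hadd_left[of A1 A0 B0] comp_hadd_right[of A1 B1 B0])
  next
    case 2
    then show ?case by simp
  next
    case (3 u v w)
    then show ?case by (cases u; cases v; cases w) (simp add: H1.m_assoc H0.m_assoc)
  next
    case (4 u v)
    then show ?case by (cases u; cases v) (simp add: H1.m_comm H0.m_comm)
  next
    case (5 u)
    then show ?case by (cases u) simp
  next
    case (6 u)
    obtain u1 u0 where u: "u = (u1, u0)" by (cases u)
    then have u': "u1 \<in> Hom A1 B1" "u0 \<in> Hom A0 B0" "comp A1 g u1 = comp A1 u0 f" using 6 by simp_all
    have "comp A1 g (hneg A1 B1 u1) = comp A1 (hneg A0 B0 u0) f"
    proof (rule extensionalityI[of _ "carrier A1"])
      fix x assume x: "x \<in> carrier A1"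
      then have "g (u1 x) = u0 (f x)" using u'(3) by (metis compose_eq)
      then show "comp A1 g (hneg A1 B1 u1) x = comp A1 (hneg A0 B0 u0) f x"
        using x u' by (simp add: compose_eq Hom_minus[of g B1 B0] hneg_apply[of A0 B0] Hom_closed[of f A1 A0] Hom_closed[of u1 A1 B1])
    qed simp_all
    then show ?case using u' by (intro bexI[of _ "(hneg A1 B1 u1, hneg A0 B0 u0)"]) (simp_all add: u)
  qed
qed

lemma maps_sesD:
  assumes "((N1, N0, n), (i1, i0), (E1, E0, e), (p1, p0), (M1, M0, m)) \<in> maps_ses \<Lambda>"
  shows "N1 \<in> fg" "N0 \<in> fg" "n \<in> Hom N1 N0" "E1 \<in> fg" "E0 \<in> fg" "e \<in> Hom E1 E0"
    "M1 \<in> fg" "M0 \<in> fg" "m \<in> Hom M1 M0" "i1 \<in> Hom N1 E1" "i0 \<in> Hom N0 E0"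
    "comp N1 e i1 = comp N1 i0 n" "p1 \<in> Hom E1 M1" "p0 \<in> Hom E0 M0" "comp E1 m p1 = comp E1 p0 e"
    "mod_ses \<Lambda> N1 i1 E1 p1 M1" "mod_ses \<Lambda> N0 i0 E0 p0 M0"
  using assms by (simp_all add: maps_ses_def)

lemma mod_ses_zero: "\<lbrakk>mod_ses \<Lambda> N i E p M; N \<in> fg; E \<in> fg; M \<in> fg\<rbrakk> \<Longrightarrow> comp N p i = hzero N M"
  by (rule extensionalityI[of _ "carrier N"]) (auto simp: mod_ses_def compose_eq)

subsection \<open>Criteria for \<open>F\<close>-exactness\<close>

lemma split_zero_left:
  assumes "N \<in> fg" "X \<in> fg" "carrier N = {\<zero>\<^bsub>N\<^esub>}" "i \<in> Hom N X"
  shows "mod_split_ses \<Lambda> N i X (mod_id X) X"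
  unfolding mod_split_ses_def mod_ses_def
proof (intro conjI bexI[of _ "mod_id X"])
  show "i ` carrier N = {x \<in> carrier X. mod_id X x = \<zero>\<^bsub>X\<^esub>}" using assms by auto
  show "mod_id X ` carrier X = carrier X" by (auto simp: image_iff)
qed (use assms in simp_all)

lemma split_zero_right:
  assumes "Z \<in> fg" "X \<in> fg" "carrier Z = {\<zero>\<^bsub>Z\<^esub>}" "q \<in> Hom X Z"
  shows "mod_split_ses \<Lambda> X (mod_id X) X q Z"
  unfolding mod_split_ses_def mod_ses_def
proof (intro conjI bexI[of _ "hzero Z X"])
  have q: "q x = \<zero>\<^bsub>Z\<^esub>" if "x \<in> carrier X" for x using Hom_closed[OF assms(4) that] assms(3) by simp
  show "mod_id X ` carrier X = {x \<in> carrier X. q x = \<zero>\<^bsub>Z\<^esub>}" using q by (auto simp: image_iff)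
  show "q ` carrier X = carrier Z" unfolding assms(3) using q fg_zero[OF assms(2)] by (auto simp: image_iff)
  show "inj_on (mod_id X) (carrier X)" by (auto simp: inj_on_def)
  show "comp Z q (hzero Z X) = mod_id Z"
    by (rule extensionalityI[of _ "carrier Z"]) (use assms q in \<open>simp_all add: mod_id_def compose_eq\<close>)
qed (use assms in simp_all)

lemma split_zero_zero:
  assumes "N \<in> fg" "E \<in> fg" "M \<in> fg" "carrier N = {\<zero>\<^bsub>N\<^esub>}" "carrier E = {\<zero>\<^bsub>E\<^esub>}" "carrier M = {\<zero>\<^bsub>M\<^esub>}"
    "i \<in> Hom N E" "p \<in> Hom E M"
  shows "mod_split_ses \<Lambda> N i E p M"
  unfolding mod_split_ses_def mod_ses_def
proof (intro conjI bexI[of _ "hzero M E"])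
  show "comp M p (hzero M E) = mod_id M"
    by (rule extensionalityI[of _ "carrier M"]) (use assms in \<open>simp_all add: mod_id_def compose_eq\<close>)
  show "i ` carrier N = {x \<in> carrier E. p x = \<zero>\<^bsub>M\<^esub>}" using assms Hom_zero[OF assms(8)] by force
qed (use assms in \<open>simp_all add: inj_on_def\<close>)

lemma map_ker_simps: "map_ker (A1, A0, f) = A1\<lparr>carrier := {x \<in> carrier A1. f x = \<zero>\<^bsub>A0\<^esub>}\<rparr>"
  by (simp add: map_ker_def)

lemma map_ker_fg: "(A1, A0, f) \<in> maps_ob \<Lambda> \<Longrightarrow> map_ker (A1, A0, f) \<in> fg"
  unfolding map_ker_simps by (rule kernel_fg) simp_all

lemma map_ker_restrict_Hom:
  assumes u: "(u1, u0) \<in> carrier (maps_mor \<Lambda> (A1, A0, f) (B1, B0, g))"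
    and A: "(A1, A0, f) \<in> maps_ob \<Lambda>" and B: "(B1, B0, g) \<in> maps_ob \<Lambda>"
  shows "restrict u1 (carrier (map_ker (A1, A0, f))) \<in> Hom (map_ker (A1, A0, f)) (map_ker (B1, B0, g))"
proof (rule Hom_restrictI)
  show "map_ker (A1, A0, f) \<in> fg" using A by (rule map_ker_fg)
  fix x assume "x \<in> carrier (map_ker (A1, A0, f))"
  then have x: "x \<in> carrier A1" "f x = \<zero>\<^bsub>A0\<^esub>" by (simp_all add: map_ker_simps)
  have "comp A1 g u1 = comp A1 u0 f" using u by simp
  from comp_eqD[OF this x(1)] have "g (u1 x) = u0 (f x)" using x by (simp add: compose_eq)
  then show "u1 x \<in> carrier (map_ker (B1, B0, g))" using x u A B by (simp add: map_ker_simps Hom_closed[of u1 A1 B1])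
qed (use u in \<open>simp_all add: map_ker_simps Hom_add[of u1 A1 B1] Hom_smult[of u1 A1 B1]\<close>)

text \<open>For monomorphisms, the kernels vanish, so that \<open>F\<close>-exactness is splitting on domains and
  codomains.\<close>

lemma F_ses_mono:
  assumes ob: "(N1, N0, n) \<in> maps_ob \<Lambda>" "(E1, E0, e) \<in> maps_ob \<Lambda>" "(M1, M0, m) \<in> maps_ob \<Lambda>"
    and inj: "inj_on n (carrier N1)" "inj_on e (carrier E1)" "inj_on m (carrier M1)"
    and i: "(i1, i0) \<in> carrier (maps_mor \<Lambda> (N1, N0, n) (E1, E0, e))"
    and p: "(p1, p0) \<in> carrier (maps_mor \<Lambda> (E1, E0, e) (M1, M0, m))"
    and split: "mod_split_ses \<Lambda> N1 i1 E1 p1 M1" "mod_split_ses \<Lambda> N0 i0 E0 p0 M0"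
  shows "((N1, N0, n), (i1, i0), (E1, E0, e), (p1, p0), (M1, M0, m)) \<in> F_ses \<Lambda>"
proof -
  have ker: "carrier (map_ker (A1, A0, f)) = {\<zero>\<^bsub>map_ker (A1, A0, f)\<^esub>}"
    if "(A1, A0, f) \<in> maps_ob \<Lambda>" "inj_on f (carrier A1)" for A1 A0 f
    using that injective_zero[of f A1 A0] by (simp add: map_ker_simps) auto
  have "mod_split_ses \<Lambda> (map_ker (N1, N0, n)) (restrict i1 (carrier (map_ker (N1, N0, n))))
       (map_ker (E1, E0, e)) (restrict p1 (carrier (map_ker (E1, E0, e)))) (map_ker (M1, M0, m))"
    by (intro split_zero_zero ker ob inj map_ker_fg map_ker_restrict_Hom[OF i ob(1,2)]
        map_ker_restrict_Hom[OF p ob(2,3)])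
  then show ?thesis
    using assms unfolding F_ses_def maps_ses_def by (simp add: mod_split_ses_def)
qed

lemma F_ses_maps_ses: "S \<in> F_ses \<Lambda> \<Longrightarrow> S \<in> maps_ses \<Lambda>"
  unfolding F_ses_def by auto

lemma zero_map_to_simps [simp]: "zero_map_to C = (mod_zero, C, hzero mod_zero C)"
  by (simp add: zero_map_to_def mod_hom_def)

lemma zero_object_maps: "zero_object (maps_F \<Lambda>) (zero_map_to mod_zero)"
proof -
  have "mod_id mod_zero = hzero mod_zero mod_zero"
    by (rule ext) (simp add: mod_id_def mod_hom_def restrict_def mod_zero_simps)
  then show ?thesis by (simp add: zero_object_def)
qed

lemma F_ses_zero:
  assumes "X \<in> maps_ob \<Lambda>"
  shows "\<exists>z. (zero_map_to mod_zero, z, X, maps_id X, X) \<in> F_ses \<Lambda>"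
proof -
  obtain X1 X0 f where X: "X = (X1, X0, f)" by (metis prod_cases3)
  let ?Z = "(mod_zero, mod_zero, hzero mod_zero mod_zero)"
  let ?z = "(hzero mod_zero X1, hzero mod_zero X0)"
  have ob: "?Z \<in> maps_ob \<Lambda>" "(X1, X0, f) \<in> maps_ob \<Lambda>" and [simp]: "X1 \<in> fg" "X0 \<in> fg" "f \<in> Hom X1 X0"
    using assms by (simp_all add: X)
  have mor: "?z \<in> carrier (maps_mor \<Lambda> ?Z (X1, X0, f))"
    "(mod_id X1, mod_id X0) \<in> carrier (maps_mor \<Lambda> (X1, X0, f) (X1, X0, f))"
    using ob by (simp_all add: comp_hzero[of _ X1] comp_id[of f X1 X0])
  have id: "restrict (mod_id X1) (carrier (map_ker (X1, X0, f))) = mod_id (map_ker (X1, X0, f))"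
    by (rule ext) (simp add: mod_id_def map_ker_simps restrict_def)
  have "mod_split_ses \<Lambda> (map_ker ?Z) (restrict (hzero mod_zero X1) (carrier (map_ker ?Z))) (map_ker (X1, X0, f))
      (restrict (mod_id X1) (carrier (map_ker (X1, X0, f)))) (map_ker (X1, X0, f))"
    unfolding id
    by (intro split_zero_left map_ker_fg ob map_ker_restrict_Hom[OF mor(1) ob]) (auto simp: map_ker_simps mod_zero_simps mod_hom_def)
  moreover have "mod_split_ses \<Lambda> mod_zero (hzero mod_zero X1) X1 (mod_id X1) X1"
    "mod_split_ses \<Lambda> mod_zero (hzero mod_zero X0) X0 (mod_id X0) X0"
    by (intro split_zero_left; simp add: mod_zero_simps)+
  ultimately show ?thesis
    using ob mor unfolding X zero_map_to_simps
    by (intro exI[of _ ?z]) (simp add: F_ses_def maps_ses_def mod_split_ses_def)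
qed

sublocale maps: exact_category "maps_F \<Lambda>"
proof (rule exact_category.intro, goal_cases)
  case (1 X Y)
  then show ?case by (simp add: maps_mor_comm_group)
next
  case (2 X)
  then show ?case by (cases X) clarsimp
next
  case (3 X Y Z f g)
  obtain X1 X0 x Y1 Y0 y Z1 Z0 z f1 f0 g1 g0 where
    eq: "X = (X1, X0, x)" "Y = (Y1, Y0, y)" "Z = (Z1, Z0, z)" "f = (f1, f0)" "g = (g1, g0)" by (metis prod_cases3 surj_pair)
  have h: "comp X1 y f1 = comp X1 f0 x" "comp Y1 z g1 = comp Y1 g0 y" 
    and t: "f1 \<in> Hom X1 Y1" "f0 \<in> Hom X0 Y0" "g1 \<in> Hom Y1 Z1" "g0 \<in> Hom Y0 Z0" "x \<in> Hom X1 X0" "X1 \<in> fg" "X0 \<in> fg"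
    using 3 by (simp_all add: eq)
  have "comp X1 z (comp X1 g1 f1) = comp X1 (comp Y1 z g1) f1" using t by (simp add: comp_comp)
  also have "\<dots> = comp X1 g0 (comp X1 y f1)" using t h by (simp add: comp_comp)
  also have "\<dots> = comp X1 (comp X0 g0 f0) x" using t h by (simp add: comp_comp)
  finally show ?case using t by (simp add: eq comp_Hom[of X1 f1 Y1] comp_Hom[of X0 f0 Y0])
next
  case (4 X Y f)
  then show ?case by (cases X; cases Y; cases f) clarsimp
next
  case (5 X Y f)
  then show ?case by (cases X; cases Y; cases f) clarsimp
next
  case (6 X Y Z W f g h)
  then show ?case by (cases X; cases Y; cases Z; cases W; cases f; cases g; cases h) (clarsimp simp: comp_comp)
next
  case (7 X Y Z f g g')
  then show ?case by (cases X; cases Y; cases Z; cases f; cases g; cases g') (clarsimp simp: comp_hadd_left)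
next
  case (8 X Y Z f f' g)
  then show ?case by (cases X; cases Y; cases Z; cases f; cases f'; cases g) (clarsimp simp: comp_hadd_right)
next
  case (9 N i E p M)
  then show ?case by (simp add: F_ses_def maps_ses_def)
next
  case (10 N i E p M)
  obtain N1 N0 n i1 i0 E1 E0 e p1 p0 M1 M0 m  where
    eq: "N = (N1, N0, n)" "i = (i1, i0)" "E = (E1, E0, e)" "p = (p1, p0)" "M = (M1, M0, m)" by (metis prod_cases3 surj_pair)
  note S = maps_sesD[OF F_ses_maps_ses[OF 10(1)[simplified eq maps_F_simps]]]
  show ?case
    using mod_ses_zero[OF S(16)] mod_ses_zero[OF S(17)] S by (simp add: eq)
next
  case (11 N i E p M X f f')
  obtain N1 N0 n i1 i0 E1 E0 e p1 p0 M1 M0 m X1 X0 x f1 f0 f1' f0' where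
    eq: "N = (N1, N0, n)" "i = (i1, i0)" "E = (E1, E0, e)" "p = (p1, p0)" "M = (M1, M0, m)"
      "X = (X1, X0, x)" "f = (f1, f0)" "f' = (f1', f0')" by (metis prod_cases3 surj_pair)
  note S = maps_sesD[OF F_ses_maps_ses[OF 11(1)[simplified eq maps_F_simps]]]
  have "inj_on i1 (carrier N1)" "inj_on i0 (carrier N0)" using S(16,17) by (simp_all add: mod_ses_def)
  moreover have "f1 \<in> Hom X1 N1" "f1' \<in> Hom X1 N1" "f0 \<in> Hom X0 N0" "f0' \<in> Hom X0 N0"
    "comp X1 i1 f1 = comp X1 i1 f1'" "comp X0 i0 f0 = comp X0 i0 f0'" using 11 by (simp_all add: eq)
  ultimately show ?case using injective_comp_cancel by (simp add: eq)
next
  case (12 N i E p M X f f')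
  obtain N1 N0 n i1 i0 E1 E0 e p1 p0 M1 M0 m X1 X0 x f1 f0 f1' f0' where
    eq: "N = (N1, N0, n)" "i = (i1, i0)" "E = (E1, E0, e)" "p = (p1, p0)" "M = (M1, M0, m)"
      "X = (X1, X0, x)" "f = (f1, f0)" "f' = (f1', f0')" by (metis prod_cases3 surj_pair)
  note S = maps_sesD[OF F_ses_maps_ses[OF 12(1)[simplified eq maps_F_simps]]]
  have "p1 ` carrier E1 = carrier M1" "p0 ` carrier E0 = carrier M0" using S(16,17) by (simp_all add: mod_ses_def)
  moreover have "f1 \<in> Hom M1 X1" "f1' \<in> Hom M1 X1" "f0 \<in> Hom M0 X0" "f0' \<in> Hom M0 X0"
    "comp E1 f1 p1 = comp E1 f1' p1" "comp E0 f0 p0 = comp E0 f0' p0" using 12 by (simp_all add: eq)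
  ultimately show ?case using epi_comp_cancel by (simp add: eq; blast)
next
  case (13 N i E p M X g)
  obtain N1 N0 n i1 i0 E1 E0 e p1 p0 M1 M0 m X1 X0 x g1 g0 where
    eq: "N = (N1, N0, n)" "i = (i1, i0)" "E = (E1, E0, e)" "p = (p1, p0)" "M = (M1, M0, m)"
      "X = (X1, X0, x)" "g = (g1, g0)" by (metis prod_cases3 surj_pair)
  note S = maps_sesD[OF F_ses_maps_ses[OF 13(1)[simplified eq maps_F_simps]]]
  have X: "X1 \<in> fg" "X0 \<in> fg" "x \<in> Hom X1 X0" and g: "g1 \<in> Hom X1 E1" "g0 \<in> Hom X0 E0" "comp X1 e g1 = comp X1 g0 x"
    and pg: "comp X1 p1 g1 = hzero X1 M1" "comp X0 p0 g0 = hzero X0 M0"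
    using 13 by (simp_all add: eq)
  obtain h1 where h1: "h1 \<in> Hom X1 N1" "comp X1 i1 h1 = g1"
    using mod_ses_kernel[OF S(16) S(1,4,7) X(1) g(1) pg(1)] by blast
  obtain h0 where h0: "h0 \<in> Hom X0 N0" "comp X0 i0 h0 = g0"
    using mod_ses_kernel[OF S(17) S(2,5,8) X(2) g(2) pg(2)] by blast
  have "comp X1 i0 (comp X1 n h1) = comp X1 (comp N1 i0 n) h1" using h1 by (simp add: comp_comp)
  also have "\<dots> = comp X1 e g1" using h1 S(12)[symmetric] by (simp add: comp_comp)
  also have "\<dots> = comp X1 i0 (comp X1 h0 x)" using g h0 X by (simp add: comp_comp[symmetric])
  finally have eq': "comp X1 i0 (comp X1 n h1) = comp X1 i0 (comp X1 h0 x)" .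
  have "comp X1 n h1 = comp X1 h0 x"
    using S(17) injective_comp_cancel[OF _ comp_Hom[OF X(1) h1(1) S(3)] comp_Hom[OF X(1) X(3) h0(1)] eq']
    by (simp add: mod_ses_def)
  then show ?case using h1 h0 by (intro bexI[of _ "(h1, h0)"]) (simp_all add: eq)
next
  case (14 N i E p M X g)
  obtain N1 N0 n i1 i0 E1 E0 e p1 p0 M1 M0 m X1 X0 x g1 g0 where
    eq: "N = (N1, N0, n)" "i = (i1, i0)" "E = (E1, E0, e)" "p = (p1, p0)" "M = (M1, M0, m)"
      "X = (X1, X0, x)" "g = (g1, g0)" by (metis prod_cases3 surj_pair)
  note S = maps_sesD[OF F_ses_maps_ses[OF 14(1)[simplified eq maps_F_simps]]]
  have X: "X1 \<in> fg" "X0 \<in> fg" "x \<in> Hom X1 X0" and g: "g1 \<in> Hom E1 X1" "g0 \<in> Hom E0 X0" "comp E1 x g1 = comp E1 g0 e"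
    and gi: "comp N1 g1 i1 = hzero N1 X1" "comp N0 g0 i0 = hzero N0 X0"
    using 14 by (simp_all add: eq)
  obtain h1 where h1: "h1 \<in> Hom M1 X1" "comp E1 h1 p1 = g1"
    using mod_ses_cokernel[OF S(16) S(1,4,7) X(1) g(1) gi(1)] by blast
  obtain h0 where h0: "h0 \<in> Hom M0 X0" "comp E0 h0 p0 = g0"
    using mod_ses_cokernel[OF S(17) S(2,5,8) X(2) g(2) gi(2)] by blast
  have "comp E1 (comp M1 x h1) p1 = comp E1 x g1" using S(13) h1 by (simp add: comp_comp)
  also have "\<dots> = comp E1 h0 (comp E1 p0 e)" using g h0 S by (simp add: comp_comp[symmetric])
  also have "\<dots> = comp E1 (comp M1 h0 m) p1" using S(13,15) by (simp add: comp_comp)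
  finally have eq': "comp E1 (comp M1 x h1) p1 = comp E1 (comp M1 h0 m) p1" .
  have "comp M1 x h1 = comp M1 h0 m"
    using S(16) epi_comp_cancel[OF _ comp_Hom[OF S(7) h1(1) X(3)] comp_Hom[OF S(7) S(9) h0(1)] eq']
    by (simp add: mod_ses_def)
  then show ?case using h1 h0 by (intro bexI[of _ "(h1, h0)"]) (simp_all add: eq)
next
  case 15
  show ?case
    using zero_object_maps F_ses_zero by (intro exI[of _ "zero_map_to mod_zero"]) (simp del: zero_map_to_simps)
qed

end

section \<open>Relative Ext groups of monomorphisms\<close>

context artin_algebra_modules
begin

text \<open>\<open>F\<close>-exact sequences split on domains and on codomains, by sections \<open>s1\<close> and \<open>s0\<close>. Of a morphism
  \<open>(u1, u0)\<close>, lift the first component to \<open>a = s1 u1\<close>. Compatibility with \<open>a\<close> determines the lift of \<open>u0\<close>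
  on the image of \<open>f\<close>, where it is \<open>e a r\<close>; on the complement given by the retraction \<open>r\<close>, use \<open>s0 u0\<close>.\<close>

lemma split_mono_projective:
  assumes A: "A1 \<in> fg" "A0 \<in> fg" and f: "f \<in> Hom A1 A0" and r: "r \<in> Hom A0 A1"
    and rf: "\<And>x. x \<in> carrier A1 \<Longrightarrow> r (f x) = x"
  shows "projective (maps_F \<Lambda>) (A1, A0, f)"
  unfolding projective_def
proof (intro conjI allI impI ballI)
  show "(A1, A0, f) \<in> Ob (maps_F \<Lambda>)" using A f by simp
  fix N i E p M h
  assume SES: "(N, i, E, p, M) \<in> Ses (maps_F \<Lambda>)" and h: "h \<in> carrier (Mor (maps_F \<Lambda>) (A1, A0, f) M)"
  obtain N1 N0 n i1 i0 E1 E0 e p1 p0 M1 M0 m u1 u0 where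
    eq: "N = (N1, N0, n)" "i = (i1, i0)" "E = (E1, E0, e)" "p = (p1, p0)" "M = (M1, M0, m)"
      "h = (u1, u0)" by (metis prod_cases3 surj_pair)
  note S = maps_sesD[OF F_ses_maps_ses[OF SES[simplified eq maps_F_simps]]]
  have u: "u1 \<in> Hom A1 M1" "u0 \<in> Hom A0 M0" "comp A1 m u1 = comp A1 u0 f" using h by (simp_all add: eq)
  have "mod_split_ses \<Lambda> N1 i1 E1 p1 M1" "mod_split_ses \<Lambda> N0 i0 E0 p0 M0"
    using SES by (simp_all add: eq F_ses_def)
  then obtain s1 s0 where s: "s1 \<in> Hom M1 E1" "comp M1 p1 s1 = mod_id M1" "s0 \<in> Hom M0 E0" "comp M0 p0 s0 = mod_id M0"
    by (auto simp: mod_split_ses_def)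
  note [simp] = A Hom_closed[OF f] Hom_closed[OF r] S(1,2,4,5,7,8) Hom_closed[OF S(6)] Hom_closed[OF S(13)] Hom_closed[OF S(14)]
    Hom_closed[OF u(1)] Hom_closed[OF u(2)] Hom_closed[OF s(1)] Hom_closed[OF s(3)]
  have ps: "p1 (s1 x) = x" if "x \<in> carrier M1" for x using comp_eqD[OF s(2) that] that by simp
  have ps0: "p0 (s0 x) = x" if "x \<in> carrier M0" for x using comp_eqD[OF s(4) that] that by simp
  have mu: "m (u1 x) = u0 (f x)" if "x \<in> carrier A1" for x using u(3) that by (metis compose_eq)
  have me: "p0 (e x) = m (p1 x)" if "x \<in> carrier E1" for x using S(15) that by (metis compose_eq)
  define a where "a = comp A1 s1 u1"
  have a: "a \<in> Hom A1 E1" unfolding a_def using u s by (simp add: comp_Hom[of A1 u1 M1])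
  define b where "b = hadd A0 E0 (comp A0 s0 (hadd A0 M0 u0 (hneg A0 M0 (comp A0 u0 (comp A0 f r)))))
     (comp A0 e (comp A0 a r))"
  have fr: "comp A0 f r \<in> Hom A0 A0" using f r by (simp add: comp_Hom[of A0 r A1])
  have ufr: "comp A0 u0 (comp A0 f r) \<in> Hom A0 M0" using fr u by (simp add: comp_Hom[of A0 _ A0])
  have ar: "comp A0 a r \<in> Hom A0 E1" using a r by (simp add: comp_Hom[of A0 _ A1])
  have b: "b \<in> Hom A0 E0"
    unfolding b_def
    by (rule hadd_Hom[OF A(2) S(5) comp_Hom[OF A(2) hadd_Hom[OF A(2) S(8) u(2) hneg_Hom[OF A(2) S(8) ufr]] s(3)]
          comp_Hom[OF A(2) ar S(6)]])
  have bx: "b x = s0 (u0 x \<oplus>\<^bsub>M0\<^esub> \<ominus>\<^bsub>M0\<^esub> u0 (f (r x))) \<oplus>\<^bsub>E0\<^esub> e (s1 (u1 (r x)))" if "x \<in> carrier A0" for x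
    using that ufr by (simp add: b_def a_def compose_eq)
  have "comp A1 e a = comp A1 b f"
    by (rule extensionalityI[of _ "carrier A1"])
      (simp_all add: compose_eq bx rf Hom_zero[OF s(3)] a_def)
  moreover have "comp A1 p1 a = u1"
    by (rule extensionalityI[of _ "carrier A1"])
      (simp_all add: compose_eq a_def ps Hom_extensional[OF u(1)])
  moreover have "comp A0 p0 b = u0"
    by (rule extensionalityI[of _ "carrier A0"])
      (simp_all add: compose_eq bx Hom_add[OF S(14)] ps0 me ps mu Hom_extensional[OF u(2)] fg_add_assoc)
  ultimately show "\<exists>g \<in> carrier (Mor (maps_F \<Lambda>) (A1, A0, f) E). Comp (maps_F \<Lambda>) (A1, A0, f) p g = h"
    using a b by (intro bexI[of _ "(a, b)"]) (simp_all add: eq)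
qed

lemma dsumD:
  assumes "dsum X Y Z i j p q"
  shows "Z \<in> fg" "i \<in> Hom X Z" "j \<in> Hom Y Z" "p \<in> Hom Z X" "q \<in> Hom Z Y"
    "x \<in> carrier X \<Longrightarrow> p (i x) = x" "x \<in> carrier X \<Longrightarrow> q (i x) = \<zero>\<^bsub>Y\<^esub>"
    "y \<in> carrier Y \<Longrightarrow> q (j y) = y" "y \<in> carrier Y \<Longrightarrow> p (j y) = \<zero>\<^bsub>X\<^esub>"
    "z \<in> carrier Z \<Longrightarrow> i (p z) \<oplus>\<^bsub>Z\<^esub> j (q z) = z"
  using assms by (simp_all add: dsum_def)

text \<open>For monomorphisms \<open>f\<close> and \<open>g\<close> this is the vanishing of the first Ext group of \<open>f\<close> and \<open>g\<close> in the
  category of maps relative to \<open>F\<close>, and also of the first Ext group of \<open>Phi f\<close> and \<open>Phi g\<close>.\<close>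

definition ext_vanishes :: "'a mapobj \<Rightarrow> 'a mapobj \<Rightarrow> bool" where
  "ext_vanishes = (\<lambda>(A1, A0, f) (B1, B0, g). \<forall>\<phi> \<in> Hom A1 B0. \<exists>\<psi> \<in> Hom A0 B0. \<exists>\<theta> \<in> Hom A1 B1.
     \<phi> = hadd A1 B0 (comp A1 \<psi> f) (comp A1 g \<theta>))"

lemma zero_map_to_projective: "X \<in> fg \<Longrightarrow> projective (maps_F \<Lambda>) (zero_map_to X)"
  unfolding zero_map_to_simps
  by (rule split_mono_projective[of _ _ _ "hzero X mod_zero"]) (simp_all add: mod_zero_simps)

text \<open>The projective resolution
  \<open>0 \<rightarrow> (0 \<rightarrow> A1) \<rightarrow> (A1 \<rightarrow> A0 \<oplus> A1) \<rightarrow> (A1 \<rightarrow> A0) \<rightarrow> 0\<close> of a monomorphism \<open>f\<close>. The middle term \<open>Q\<close> is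
  the inclusion \<open>j\<close> of the second summand, and the two maps are \<open>(0, (f, -1))\<close> and \<open>(1, (1, f))\<close>.
  Morphisms from \<open>Q\<close> to \<open>b : B1 \<rightarrow> B0\<close> are given by arbitrary maps \<open>A0 \<rightarrow> B0\<close> and \<open>A1 \<rightarrow> B1\<close>; the
  restriction of \<open>(\<psi>, \<theta>)\<close> to \<open>0 \<rightarrow> A1\<close> is \<open>\<psi> f - b \<theta>\<close>.\<close>

lemma mono_resolution:
  assumes ob: "(A1, A0, f) \<in> maps_ob \<Lambda>" and inj: "inj_on f (carrier A1)"
  obtains \<iota> Q \<pi> where "(zero_map_to A1, \<iota>, Q, \<pi>, (A1, A0, f)) \<in> F_ses \<Lambda>"
    "projective (maps_F \<Lambda>) Q"
    "\<And>g. g \<in> maps_ob \<Lambda> \<Longrightarrow> maps.extends (zero_map_to A1) \<iota> Q g \<longleftrightarrow> ext_vanishes (A1, A0, f) g"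
proof -
  have A [simp]: "A1 \<in> fg" "A0 \<in> fg" and f: "f \<in> Hom A1 A0" using ob by simp_all
  obtain Z i j p q where D: "dsum A0 A1 Z i j p q" using dsum_exists[of A0 A1] A by blast
  note D' = dsumD[OF D] and Z [simp] = dsumD(1)[OF D]
  note [simp] = Hom_closed[OF f] Hom_closed[OF D'(2)] Hom_closed[OF D'(3)] Hom_closed[OF D'(4)] Hom_closed[OF D'(5)]
    D'(6-9) Hom_zero[OF f] Hom_zero[OF D'(2)] Hom_zero[OF D'(3)] Hom_zero[OF D'(4)] Hom_zero[OF D'(5)]
  have m [simp]: "f (\<ominus>\<^bsub>A1\<^esub> x) = \<ominus>\<^bsub>A0\<^esub> f x" "j (\<ominus>\<^bsub>A1\<^esub> x) = \<ominus>\<^bsub>Z\<^esub> j x" if "x \<in> carrier A1" for x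
    using that Hom_minus[OF f] Hom_minus[OF D'(3)] by simp_all
  have mp [simp]: "p (\<ominus>\<^bsub>Z\<^esub> z) = \<ominus>\<^bsub>A0\<^esub> p z" "q (\<ominus>\<^bsub>Z\<^esub> z) = \<ominus>\<^bsub>A1\<^esub> q z" if "z \<in> carrier Z" for z
    using that Hom_minus[OF D'(4)] Hom_minus[OF D'(5)] by simp_all
  note add = Hom_add[OF D'(2)] Hom_add[OF D'(3)] Hom_add[OF D'(4)] Hom_add[OF D'(5)] Hom_add[OF f]
  define k where "k = hadd A1 Z (comp A1 i f) (hneg A1 Z j)"
  define t where "t = hadd Z A0 p (comp Z f q)"
  have if_Hom: "comp A1 i f \<in> Hom A1 Z" using f D' by (simp add: comp_Hom[of A1 f A0])
  have fq_Hom: "comp Z f q \<in> Hom Z A0" using f D' by (simp add: comp_Hom[of Z q A1])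
  have k: "k \<in> Hom A1 Z" unfolding k_def using if_Hom D' by simp
  have t: "t \<in> Hom Z A0" unfolding t_def using fq_Hom D' by simp
  have kx: "k x = i (f x) \<oplus>\<^bsub>Z\<^esub> \<ominus>\<^bsub>Z\<^esub> j x" if "x \<in> carrier A1" for x
    using that D' by (simp add: k_def compose_eq)
  have tz: "t z = p z \<oplus>\<^bsub>A0\<^esub> f (q z)" if "z \<in> carrier Z" for z
    using that by (simp add: t_def compose_eq)
  have qk: "q (k x) = \<ominus>\<^bsub>A1\<^esub> x" if "x \<in> carrier A1" for x
    using that by (simp add: kx add)
  let ?K = "(mod_zero, A1, hzero mod_zero A1)" and ?Q = "(A1, Z, j)" and ?f = "(A1, A0, f)"
  let ?\<iota> = "(hzero mod_zero A1, k)" and ?\<pi> = "(mod_id A1, t)"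
  have inj_k: "inj_on k (carrier A1)"
    by (rule inj_on_inverseI[of _ "\<lambda>z. \<ominus>\<^bsub>A1\<^esub> q z"]) (simp add: qk)
  have inj_j: "inj_on j (carrier A1)"
    by (rule inj_on_inverseI[of _ q]) simp
  have i0: "?\<iota> \<in> carrier (maps_mor \<Lambda> ?K ?Q)"
    by (simp add: k D'(3) comp_hzero(2)[OF mod_zero_fg A(1) Z D'(3)] comp_hzero(2)[OF mod_zero_fg A(1) Z k])
  have p0: "?\<pi> \<in> carrier (maps_mor \<Lambda> ?Q ?f)"
    using t by (auto intro!: extensionalityI[of _ "carrier A1"] simp: compose_eq tz)
  have "mod_split_ses \<Lambda> A1 k Z t A0"
    unfolding mod_split_ses_def mod_ses_def
  proof (intro conjI bexI[of _ i])
    have ti: "t (i x) = x" if "x \<in> carrier A0" for x using that by (simp add: tz)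
    show "t ` carrier Z = carrier A0"
    proof (intro subset_antisym subsetI)
      fix x assume "x \<in> carrier A0"
      then show "x \<in> t ` carrier Z" by (intro image_eqI[of _ _ "i x"]) (simp_all add: ti)
    qed (use Hom_closed[OF t] in blast)
    show "comp A0 t i = mod_id A0"
      by (rule extensionalityI[of _ "carrier A0"]) (simp_all add: mod_id_def compose_eq ti)
    have "t (k x) = \<zero>\<^bsub>A0\<^esub>" if "x \<in> carrier A1" for x
      using that k by (simp add: tz qk) (simp add: kx add)
    moreover have "\<exists>x \<in> carrier A1. z = k x" if "z \<in> carrier Z" "t z = \<zero>\<^bsub>A0\<^esub>" for z
    proof (rule bexI)
      show x: "\<ominus>\<^bsub>A1\<^esub> q z \<in> carrier A1" using that by simp
      have "p z = \<ominus>\<^bsub>A0\<^esub> f (q z)"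
        using that tz[of z] by (intro fg_eq_if_minus[of A0 "p z"]) simp_all
      then show "z = k (\<ominus>\<^bsub>A1\<^esub> q z)" using D'(10)[of z] that by (simp add: kx)
    qed
    ultimately show "k ` carrier A1 = {z \<in> carrier Z. t z = \<zero>\<^bsub>A0\<^esub>}" using Hom_closed[OF k] by blast
  qed (use k t inj_k D' in simp_all)
  moreover have "mod_split_ses \<Lambda> mod_zero (hzero mod_zero A1) A1 (mod_id A1) A1"
    by (rule split_zero_left) (simp_all add: mod_zero_simps)
  ultimately have S: "(?K, ?\<iota>, ?Q, ?\<pi>, ?f) \<in> F_ses \<Lambda>"
    using ob D' by (intro F_ses_mono i0 p0 inj inj_j) (simp_all add: mod_zero_simps)
  have Q: "projective (maps_F \<Lambda>) ?Q"
    by (rule split_mono_projective[of _ _ _ q]) (use D' in simp_all)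
  have ext: "maps.extends ?K ?\<iota> ?Q g \<longleftrightarrow> ext_vanishes ?f g" if g: "g \<in> maps_ob \<Lambda>" for g
  proof -
    obtain B1 B0 b where eq: "g = (B1, B0, b)" by (metis prod_cases3)
    have B [simp]: "B1 \<in> fg" "B0 \<in> fg" and b: "b \<in> Hom B1 B0" using g by (simp_all add: eq)
    have mor: "\<phi> \<in> carrier (maps_mor \<Lambda> ?K g) \<longleftrightarrow> (\<exists>\<phi>0 \<in> Hom A1 B0. \<phi> = (hzero mod_zero B1, \<phi>0))" for \<phi>
    proof (cases \<phi>)
      case (Pair \<phi>1 \<phi>0)
      then show ?thesis
        by (auto simp: eq Hom_from_zero[OF mod_zero_fg B(1) mod_zero_carrier]
            comp_hzero(2)[OF mod_zero_fg B b] comp_hzero(2)[OF mod_zero_fg A(1) B(2)])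
    qed
    show ?thesis
      unfolding maps.extends_def ext_vanishes_def eq prod.case
    proof (intro iffI ballI)
      fix \<phi> assume ext: "\<forall>\<phi>\<in>carrier (Mor (maps_F \<Lambda>) ?K (B1, B0, b)). \<exists>\<psi>\<in>carrier (Mor (maps_F \<Lambda>) ?Q (B1, B0, b)).
          Comp (maps_F \<Lambda>) ?K \<psi> ?\<iota> = \<phi>" and \<phi>: "\<phi> \<in> Hom A1 B0"
      then have "(hzero mod_zero B1, \<phi>) \<in> carrier (Mor (maps_F \<Lambda>) ?K (B1, B0, b))"
        using mor by (simp add: eq)
      with ext obtain w where w: "w \<in> carrier (Mor (maps_F \<Lambda>) ?Q (B1, B0, b))"
        "Comp (maps_F \<Lambda>) ?K w ?\<iota> = (hzero mod_zero B1, \<phi>)" by blast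
      obtain w1 w0 where "w = (w1, w0)" by (cases w)
      then have w1: "w1 \<in> Hom A1 B1" and w0: "w0 \<in> Hom Z B0" and wj: "comp A1 b w1 = comp A1 w0 j"
        and wk: "comp A1 w0 k = \<phi>" using w by simp_all
      note [simp] = Hom_closed[OF w1] Hom_closed[OF w0] Hom_closed[OF b]
      have wj': "w0 (j x) = b (w1 x)" if "x \<in> carrier A1" for x using wj that by (metis compose_eq)
      have wi: "comp A0 w0 i \<in> Hom A0 B0" using w0 D' by (simp add: comp_Hom[of A0 i Z])
      have "\<phi> = hadd A1 B0 (comp A1 (comp A0 w0 i) f) (comp A1 b (hneg A1 B1 w1))"
      proof (rule extensionalityI[of _ "carrier A1"])
        fix x assume x: "x \<in> carrier A1"
        have "\<phi> x = w0 (k x)" using wk x by (metis compose_eq)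
        also have "\<dots> = w0 (i (f x)) \<oplus>\<^bsub>B0\<^esub> \<ominus>\<^bsub>B0\<^esub> b (w1 x)"
          using x by (simp add: kx Hom_add[OF w0] Hom_minus[OF w0] wj')
        finally show "\<phi> x = hadd A1 B0 (comp A1 (comp A0 w0 i) f) (comp A1 b (hneg A1 B1 w1)) x"
          using x w1 by (simp add: compose_eq Hom_minus[OF b])
      qed (use \<phi> in \<open>simp_all add: Hom_extensional\<close>)
      then show "\<exists>\<psi>\<in>Hom A0 B0. \<exists>\<theta>\<in>Hom A1 B1. \<phi> = hadd A1 B0 (comp A1 \<psi> f) (comp A1 b \<theta>)"
        using wi w1 by (metis B(1) A(1) hneg_Hom)
    next
      fix \<phi> assume ext: "\<forall>\<phi>\<in>Hom A1 B0. \<exists>\<psi>\<in>Hom A0 B0. \<exists>\<theta>\<in>Hom A1 B1. \<phi> = hadd A1 B0 (comp A1 \<psi> f) (comp A1 b \<theta>)"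
        and "\<phi> \<in> carrier (Mor (maps_F \<Lambda>) ?K (B1, B0, b))"
      then obtain \<phi>0 where \<phi>0: "\<phi>0 \<in> Hom A1 B0" "\<phi> = (hzero mod_zero B1, \<phi>0)" using mor by (auto simp: eq)
      obtain \<psi> \<theta> where \<psi>: "\<psi> \<in> Hom A0 B0" and \<theta>: "\<theta> \<in> Hom A1 B1"
        and \<phi>: "\<phi>0 = hadd A1 B0 (comp A1 \<psi> f) (comp A1 b \<theta>)" using ext \<phi>0 by blast
      note [simp] = Hom_closed[OF \<psi>] Hom_closed[OF \<theta>] Hom_closed[OF b]
      define w1 where "w1 = hneg A1 B1 \<theta>"
      have w1: "w1 \<in> Hom A1 B1" using \<theta> by (simp add: w1_def)
      define w0 where "w0 = hadd Z B0 (comp Z \<psi> p) (comp Z b (comp Z w1 q))"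
      have "comp Z \<psi> p \<in> Hom Z B0" "comp Z w1 q \<in> Hom Z B1"
        using w1 \<psi> D' by (simp_all add: comp_Hom[of Z p A0] comp_Hom[of Z q A1])
      then have w0: "w0 \<in> Hom Z B0"
        unfolding w0_def using b by (simp add: comp_Hom[of Z _ B1])
      have "comp A1 b w1 = comp A1 w0 j"
        by (rule extensionalityI[of _ "carrier A1"])
          (use w1 \<psi> in \<open>simp_all add: compose_eq w0_def Hom_closed[OF w1]\<close>)
      moreover have "comp A1 w0 k = \<phi>0"
      proof (rule extensionalityI[of _ "carrier A1"])
        fix x assume x: "x \<in> carrier A1"
        have pk: "p (k x) = f x" using x by (simp add: kx add)
        have "b (w1 (\<ominus>\<^bsub>A1\<^esub> x)) = b (\<theta> x)"
          using x \<theta> by (simp add: w1_def Hom_minus[OF \<theta>])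
        then show "comp A1 w0 k x = \<phi>0 x"
          using x by (simp add: compose_eq w0_def Hom_closed[OF k] pk qk \<phi>)
      qed (simp_all add: \<phi>)
      ultimately show "\<exists>\<psi>\<in>carrier (Mor (maps_F \<Lambda>) ?Q (B1, B0, b)). Comp (maps_F \<Lambda>) ?K \<psi> ?\<iota> = \<phi>"
        using w0 w1
        by (intro bexI[of _ "(w1, w0)"]) (simp_all add: \<phi>0(2) comp_hzero(2)[OF mod_zero_fg A(1) B(1) w1])
    qed
  qed
  show thesis
    using that[of ?\<iota> ?Q ?\<pi>] S Q ext by (simp only: zero_map_to_simps)
qed

lemma
  assumes f: "(A1, A0, f) \<in> maps_ob \<Lambda>" and inj: "inj_on f (carrier A1)" 
  shows Ext1_F_trivial_iff: "g \<in> maps_ob \<Lambda> \<Longrightarrow>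
      trivial_group (Ext (maps_F \<Lambda>) 1 (A1, A0, f) g) \<longleftrightarrow> ext_vanishes (A1, A0, f) g"
    and Ext_F_trivial: "\<lbrakk>g \<in> maps_ob \<Lambda>; k \<ge> 2\<rbrakk> \<Longrightarrow> trivial_group (Ext (maps_F \<Lambda>) k (A1, A0, f) g)"
    and pdim_F_le_1: "pdim (maps_F \<Lambda>) (A1, A0, f) \<le> 1"
proof -
  obtain \<iota> Q \<pi> where S: "(zero_map_to A1, \<iota>, Q, \<pi>, (A1, A0, f)) \<in> F_ses \<Lambda>"
    and Q: "projective (maps_F \<Lambda>) Q"
    and ext: "\<And>g. g \<in> maps_ob \<Lambda> \<Longrightarrow> maps.extends (zero_map_to A1) \<iota> Q g \<longleftrightarrow> ext_vanishes (A1, A0, f) g"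
    using mono_resolution[OF f inj] by metis
  have P: "projective (maps_F \<Lambda>) (zero_map_to A1)" using f by (intro zero_map_to_projective) simp
  note S' = S[folded maps_F_simps(5)]
  show "trivial_group (Ext (maps_F \<Lambda>) 1 (A1, A0, f) g) \<longleftrightarrow> ext_vanishes (A1, A0, f) g" if "g \<in> maps_ob \<Lambda>"
    using maps.trivial_Ext1_iff[OF S' P Q, of g] ext that by simp
  show "trivial_group (Ext (maps_F \<Lambda>) k (A1, A0, f) g)" if "g \<in> maps_ob \<Lambda>" "k \<ge> 2"
    using maps.trivial_Ext_higher[OF S' P Q, of g k] that by simp
  show "pdim (maps_F \<Lambda>) (A1, A0, f) \<le> 1"
    unfolding maps.pdim_le_1_iff using S' P Q by blast
qed

end

section \<open>Functors and their presentations\<close>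

context artin_algebra_modules
begin

abbreviation val :: "('a, 'g) cfunctor \<Rightarrow> 'a lmod \<Rightarrow> 'g set" where
  "val F X \<equiv> carrier (fob F X)"

abbreviation presheaf :: "('a, 'g) cfunctor \<Rightarrow> bool" where
  "presheaf F \<equiv> contravariant_functor \<Lambda> F"

lemma val_comm_group: "\<lbrakk>presheaf F; X \<in> fg\<rbrakk> \<Longrightarrow> comm_group (fob F X)"
  by (simp add: contravariant_functor_def)

lemma val_group: "\<lbrakk>presheaf F; X \<in> fg\<rbrakk> \<Longrightarrow> group (fob F X)"
  by (simp add: val_comm_group comm_group.axioms(2))

lemma val_one [simp]: "\<lbrakk>presheaf F; X \<in> fg\<rbrakk> \<Longrightarrow> \<one>\<^bsub>fob F X\<^esub> \<in> val F X"
  by (rule monoid.one_closed[OF group.is_monoid[OF val_group]])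

lemma val_mult [simp]: "\<lbrakk>presheaf F; X \<in> fg; x \<in> val F X; y \<in> val F X\<rbrakk> \<Longrightarrow> x \<otimes>\<^bsub>fob F X\<^esub> y \<in> val F X"
  by (rule monoid.m_closed[OF group.is_monoid[OF val_group]])

lemma val_inv [simp]: "\<lbrakk>presheaf F; X \<in> fg; x \<in> val F X\<rbrakk> \<Longrightarrow> inv\<^bsub>fob F X\<^esub> x \<in> val F X"
  by (rule group.inv_closed[OF val_group])

lemma val_eq_if: assumes "presheaf F" "X \<in> fg" "x \<in> val F X" "y \<in> val F X" "x \<otimes>\<^bsub>fob F X\<^esub> inv\<^bsub>fob F X\<^esub> y = \<one>\<^bsub>fob F X\<^esub>"
  shows "x = y"
proof -
  interpret group "fob F X" using assms by (simp add: val_group)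
  show ?thesis using assms by (metis inv_closed inv_equality inv_inv)
qed

lemma far_hom: "\<lbrakk>presheaf F; X \<in> fg; Y \<in> fg; h \<in> Hom X Y\<rbrakk> \<Longrightarrow> group_hom (fob F Y) (fob F X) (far F X Y h)"
  unfolding group_hom_def group_hom_axioms_def using val_group
  by (simp add: contravariant_functor_def comm_group.axioms(2))

lemma far_closed [simp]: "\<lbrakk>presheaf F; X \<in> fg; Y \<in> fg; h \<in> Hom X Y; y \<in> val F Y\<rbrakk> \<Longrightarrow> far F X Y h y \<in> val F X"
  using group_hom.hom_closed[OF far_hom] .

lemma far_mult: "\<lbrakk>presheaf F; X \<in> fg; Y \<in> fg; h \<in> Hom X Y; y \<in> val F Y; z \<in> val F Y\<rbrakk>
    \<Longrightarrow> far F X Y h (y \<otimes>\<^bsub>fob F Y\<^esub> z) = far F X Y h y \<otimes>\<^bsub>fob F X\<^esub> far F X Y h z"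
  using group_hom.hom_mult[OF far_hom] .

lemma far_one: "\<lbrakk>presheaf F; X \<in> fg; Y \<in> fg; h \<in> Hom X Y\<rbrakk> \<Longrightarrow> far F X Y h \<one>\<^bsub>fob F Y\<^esub> = \<one>\<^bsub>fob F X\<^esub>"
  using group_hom.hom_one[OF far_hom] .

lemma far_inv: "\<lbrakk>presheaf F; X \<in> fg; Y \<in> fg; h \<in> Hom X Y; y \<in> val F Y\<rbrakk>
    \<Longrightarrow> far F X Y h (inv\<^bsub>fob F Y\<^esub> y) = inv\<^bsub>fob F X\<^esub> far F X Y h y"
  using group_hom.hom_inv[OF far_hom] .

lemma far_id: "\<lbrakk>presheaf F; X \<in> fg; x \<in> val F X\<rbrakk> \<Longrightarrow> far F X X (mod_id X) x = x"
  by (simp add: contravariant_functor_def)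

lemma far_comp: "\<lbrakk>presheaf F; X \<in> fg; Y \<in> fg; Z \<in> fg; h \<in> Hom X Y; k \<in> Hom Y Z; z \<in> val F Z\<rbrakk>
    \<Longrightarrow> far F X Z (comp X k h) z = far F X Y h (far F Y Z k z)"
  by (simp add: contravariant_functor_def)

lemma nat_transD:
  assumes "\<eta> \<in> nat_trans \<Lambda> F G"
  shows "\<eta> \<in> extensional fg" "X \<in> fg \<Longrightarrow> \<eta> X \<in> extensional (val F X)"
    "\<lbrakk>X \<in> fg; x \<in> val F X\<rbrakk> \<Longrightarrow> \<eta> X x \<in> val G X"
    "\<lbrakk>X \<in> fg; x \<in> val F X; y \<in> val F X\<rbrakk> \<Longrightarrow> \<eta> X (x \<otimes>\<^bsub>fob F X\<^esub> y) = \<eta> X x \<otimes>\<^bsub>fob G X\<^esub> \<eta> X y"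
    "\<lbrakk>X \<in> fg; Y \<in> fg; h \<in> Hom X Y; y \<in> val F Y\<rbrakk> \<Longrightarrow> \<eta> X (far F X Y h y) = far G X Y h (\<eta> Y y)"
  using assms by (auto simp: nat_trans_def hom_def)

lemma nat_trans_group_hom:
  assumes "presheaf F" "presheaf G" "\<eta> \<in> nat_trans \<Lambda> F G" "X \<in> fg"
  shows "group_hom (fob F X) (fob G X) (\<eta> X)"
  unfolding group_hom_def group_hom_axioms_def using assms nat_transD[OF assms(3)]
  by (auto simp: hom_def val_group)

lemma nat_trans_one: "\<lbrakk>presheaf F; presheaf G; \<eta> \<in> nat_trans \<Lambda> F G; X \<in> fg\<rbrakk> \<Longrightarrow> \<eta> X \<one>\<^bsub>fob F X\<^esub> = \<one>\<^bsub>fob G X\<^esub>"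
  using group_hom.hom_one[OF nat_trans_group_hom] .

lemma nat_trans_inv: "\<lbrakk>presheaf F; presheaf G; \<eta> \<in> nat_trans \<Lambda> F G; X \<in> fg; x \<in> val F X\<rbrakk>
    \<Longrightarrow> \<eta> X (inv\<^bsub>fob F X\<^esub> x) = inv\<^bsub>fob G X\<^esub> \<eta> X x"
  using group_hom.hom_inv[OF nat_trans_group_hom] .

lemma nat_transI:
  assumes "\<And>X x. \<lbrakk>X \<in> fg; x \<in> val F X\<rbrakk> \<Longrightarrow> e X x \<in> val G X"
    "\<And>X x y. \<lbrakk>X \<in> fg; x \<in> val F X; y \<in> val F X\<rbrakk> \<Longrightarrow> e X (x \<otimes>\<^bsub>fob F X\<^esub> y) = e X x \<otimes>\<^bsub>fob G X\<^esub> e X y"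
    "\<And>X Y h y. \<lbrakk>X \<in> fg; Y \<in> fg; h \<in> Hom X Y; y \<in> val F Y\<rbrakk> \<Longrightarrow> e X (far F X Y h y) = far G X Y h (e Y y)"
    and F: "presheaf F"
  shows "(\<lambda>X \<in> fg. \<lambda>x \<in> val F X. e X x) \<in> nat_trans \<Lambda> F G"
  using assms(1-3) F unfolding nat_trans_def hom_def by simp

lemma nat_trans_eqI:
  assumes "\<eta> \<in> nat_trans \<Lambda> F G" "\<theta> \<in> nat_trans \<Lambda> F H"
    "\<And>X x. \<lbrakk>X \<in> fg; x \<in> val F X\<rbrakk> \<Longrightarrow> \<eta> X x = \<theta> X x"
  shows "\<eta> = \<theta>"
proof (rule extensionalityI[of _ fg])
  fix X assume X: "X \<in> fg"
  show "\<eta> X = \<theta> X"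
    by (rule extensionalityI[of _ "val F X"])
      (simp_all add: assms(3) X nat_transD(2)[OF assms(1)] nat_transD(2)[OF assms(2)])
qed (rule nat_transD(1)[OF assms(1)] nat_transD(1)[OF assms(2)])+

definition ncomp :: "('a, 'g) cfunctor \<Rightarrow> ('a lmod \<Rightarrow> 'h \<Rightarrow> 'k) \<Rightarrow> ('a lmod \<Rightarrow> 'g \<Rightarrow> 'h) \<Rightarrow> 'a lmod \<Rightarrow> 'g \<Rightarrow> 'k" where
  "ncomp F \<theta> \<eta> = (\<lambda>X \<in> fg. compose (val F X) (\<theta> X) (\<eta> X))"

lemma ncomp_apply [simp]: "\<lbrakk>X \<in> fg; x \<in> val F X\<rbrakk> \<Longrightarrow> ncomp F \<theta> \<eta> X x = \<theta> X (\<eta> X x)"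
  by (simp add: ncomp_def compose_eq)

lemma ncomp_nat_trans:
  assumes F: "presheaf F" and \<eta>: "\<eta> \<in> nat_trans \<Lambda> F G" and \<theta>: "\<theta> \<in> nat_trans \<Lambda> G H"
  shows "ncomp F \<theta> \<eta> \<in> nat_trans \<Lambda> F H"
proof -
  note h = nat_transD[OF \<eta>] and t = nat_transD[OF \<theta>]
  have "ncomp F \<theta> \<eta> = (\<lambda>X \<in> fg. \<lambda>x \<in> val F X. \<theta> X (\<eta> X x))"
    by (simp add: ncomp_def compose_def)
  moreover have "\<dots> \<in> nat_trans \<Lambda> F H"
    by (rule nat_transI) (simp_all add: F h t)
  ultimately show ?thesis by simp
qed

definition nadd :: "('a, 'g) cfunctor \<Rightarrow> ('a, 'h) cfunctor \<Rightarrow> ('a lmod \<Rightarrow> 'g \<Rightarrow> 'h) \<Rightarrow> ('a lmod \<Rightarrow> 'g \<Rightarrow> 'h) \<Rightarrow> 'a lmod \<Rightarrow> 'g \<Rightarrow> 'h" where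
  "nadd F G \<eta> \<theta> = (\<lambda>X \<in> fg. \<lambda>x \<in> val F X. \<eta> X x \<otimes>\<^bsub>fob G X\<^esub> \<theta> X x)"

definition nzero :: "('a, 'g) cfunctor \<Rightarrow> ('a, 'h) cfunctor \<Rightarrow> 'a lmod \<Rightarrow> 'g \<Rightarrow> 'h" where
  "nzero F G = (\<lambda>X \<in> fg. \<lambda>x \<in> val F X. \<one>\<^bsub>fob G X\<^esub>)"

definition nid :: "('a, 'g) cfunctor \<Rightarrow> 'a lmod \<Rightarrow> 'g \<Rightarrow> 'g" where
  "nid F = (\<lambda>X \<in> fg. \<lambda>x \<in> val F X. x)"

lemma nadd_apply [simp]: "\<lbrakk>X \<in> fg; x \<in> val F X\<rbrakk> \<Longrightarrow> nadd F G \<eta> \<theta> X x = \<eta> X x \<otimes>\<^bsub>fob G X\<^esub> \<theta> X x"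
  and nzero_apply [simp]: "\<lbrakk>X \<in> fg; x \<in> val F X\<rbrakk> \<Longrightarrow> nzero F G X x = \<one>\<^bsub>fob G X\<^esub>"
  and nid_apply [simp]: "\<lbrakk>X \<in> fg; x \<in> val F X\<rbrakk> \<Longrightarrow> nid F X x = x"
  by (simp_all add: nadd_def nzero_def nid_def)

lemma nadd_nat_trans:
  assumes F: "presheaf F" and G: "presheaf G" and \<eta>: "\<eta> \<in> nat_trans \<Lambda> F G" and \<theta>: "\<theta> \<in> nat_trans \<Lambda> F G"
  shows "nadd F G \<eta> \<theta> \<in> nat_trans \<Lambda> F G"
  unfolding nadd_def
proof (rule nat_transI[OF _ _ _ F])
  note h = nat_transD[OF \<eta>] and t = nat_transD[OF \<theta>]
  fix X x y assume *: "X \<in> fg" "x \<in> val F X" "y \<in> val F X"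
  interpret comm_group "fob G X" using G *(1) by (rule val_comm_group)
  show "\<eta> X (x \<otimes>\<^bsub>fob F X\<^esub> y) \<otimes>\<^bsub>fob G X\<^esub> \<theta> X (x \<otimes>\<^bsub>fob F X\<^esub> y) =
       \<eta> X x \<otimes>\<^bsub>fob G X\<^esub> \<theta> X x \<otimes>\<^bsub>fob G X\<^esub> (\<eta> X y \<otimes>\<^bsub>fob G X\<^esub> \<theta> X y)"
    using * by (simp add: h t m_ac)
qed (simp_all add: G far_mult nat_transD[OF \<eta>] nat_transD[OF \<theta>])

lemma nzero_nat_trans: assumes F: "presheaf F" and G: "presheaf G" shows "nzero F G \<in> nat_trans \<Lambda> F G"
  unfolding nzero_def
proof (rule nat_transI[OF _ _ _ F])
  fix X x y assume *: "X \<in> fg"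
  interpret comm_group "fob G X" using G *(1) by (rule val_comm_group)
  show "\<one>\<^bsub>fob G X\<^esub> = \<one>\<^bsub>fob G X\<^esub> \<otimes>\<^bsub>fob G X\<^esub> \<one>\<^bsub>fob G X\<^esub>" by simp
qed (simp_all add: G far_one)

lemma nid_nat_trans: "presheaf F \<Longrightarrow> nid F \<in> nat_trans \<Lambda> F F"
  unfolding nid_def by (rule nat_transI) simp_all

lemma nneg_nat_trans:
  assumes F: "presheaf F" and G: "presheaf G" and \<eta>: "\<eta> \<in> nat_trans \<Lambda> F G"
  shows "(\<lambda>X \<in> fg. \<lambda>x \<in> val F X. inv\<^bsub>fob G X\<^esub> \<eta> X x) \<in> nat_trans \<Lambda> F G"
proof (rule nat_transI[OF _ _ _ F])
  note h = nat_transD[OF \<eta>]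
  fix X x y assume *: "X \<in> fg" "x \<in> val F X" "y \<in> val F X"
  interpret comm_group "fob G X" using G *(1) by (rule val_comm_group)
  show "inv\<^bsub>fob G X\<^esub> \<eta> X (x \<otimes>\<^bsub>fob F X\<^esub> y) = inv\<^bsub>fob G X\<^esub> \<eta> X x \<otimes>\<^bsub>fob G X\<^esub> inv\<^bsub>fob G X\<^esub> \<eta> X y"
    using * by (simp add: h inv_mult)
qed (simp_all add: G far_inv nat_transD[OF \<eta>])

subsection \<open>Exactness\<close>

lemma functor_sesD:
  assumes "functor_ses \<Lambda> N \<alpha> E \<beta> M"
  shows "\<alpha> \<in> nat_trans \<Lambda> N E" "\<beta> \<in> nat_trans \<Lambda> E M" "X \<in> fg \<Longrightarrow> inj_on (\<alpha> X) (val N X)"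
    "X \<in> fg \<Longrightarrow> \<beta> X ` val E X = val M X"
    "X \<in> fg \<Longrightarrow> \<alpha> X ` val N X = {x \<in> val E X. \<beta> X x = \<one>\<^bsub>fob M X\<^esub>}"
    "\<lbrakk>X \<in> fg; x \<in> val N X\<rbrakk> \<Longrightarrow> \<beta> X (\<alpha> X x) = \<one>\<^bsub>fob M X\<^esub>"
    "\<lbrakk>X \<in> fg; z \<in> val M X\<rbrakk> \<Longrightarrow> \<exists>y \<in> val E X. \<beta> X y = z"
    "\<lbrakk>X \<in> fg; y \<in> val E X; \<beta> X y = \<one>\<^bsub>fob M X\<^esub>\<rbrakk> \<Longrightarrow> \<exists>x \<in> val N X. \<alpha> X x = y"
proof -
  show *: "\<alpha> \<in> nat_trans \<Lambda> N E" "\<beta> \<in> nat_trans \<Lambda> E M" "X \<in> fg \<Longrightarrow> inj_on (\<alpha> X) (val N X)"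
    "X \<in> fg \<Longrightarrow> \<beta> X ` val E X = val M X"
    "X \<in> fg \<Longrightarrow> \<alpha> X ` val N X = {x \<in> val E X. \<beta> X x = \<one>\<^bsub>fob M X\<^esub>}" for X
    using assms by (auto simp: functor_ses_def kernel_def)
  show "\<beta> X (\<alpha> X x) = \<one>\<^bsub>fob M X\<^esub>" if "X \<in> fg" "x \<in> val N X"
    using *(5)[OF that(1)] that(2) by blast
  show "\<exists>y \<in> val E X. \<beta> X y = z" if "X \<in> fg" "z \<in> val M X"
    using that(2) unfolding *(4)[OF that(1), symmetric] by blast
  show "\<exists>x \<in> val N X. \<alpha> X x = y" if "X \<in> fg" "y \<in> val E X" "\<beta> X y = \<one>\<^bsub>fob M X\<^esub>"
  proof -
    have "y \<in> \<alpha> X ` val N X" unfolding *(5)[OF that(1)] using that by simp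
    then show ?thesis by blast
  qed
qed

lemma functor_sesI:
  assumes "\<alpha> \<in> nat_trans \<Lambda> N E" "\<beta> \<in> nat_trans \<Lambda> E M" "presheaf N" "presheaf E" "presheaf M"
    "\<And>X x. \<lbrakk>X \<in> fg; x \<in> val N X; \<alpha> X x = \<one>\<^bsub>fob E X\<^esub>\<rbrakk> \<Longrightarrow> x = \<one>\<^bsub>fob N X\<^esub>"
    "\<And>X x. \<lbrakk>X \<in> fg; x \<in> val N X\<rbrakk> \<Longrightarrow> \<beta> X (\<alpha> X x) = \<one>\<^bsub>fob M X\<^esub>"
    "\<And>X z. \<lbrakk>X \<in> fg; z \<in> val M X\<rbrakk> \<Longrightarrow> \<exists>y \<in> val E X. \<beta> X y = z"
    "\<And>X y. \<lbrakk>X \<in> fg; y \<in> val E X; \<beta> X y = \<one>\<^bsub>fob M X\<^esub>\<rbrakk> \<Longrightarrow> \<exists>x \<in> val N X. \<alpha> X x = y"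
  shows "functor_ses \<Lambda> N \<alpha> E \<beta> M"
  unfolding functor_ses_def
proof (intro conjI ballI assms(1,2))
  fix X assume X: "X \<in> fg"
  interpret a: group_hom "fob N X" "fob E X" "\<alpha> X"
    by (rule nat_trans_group_hom) (use assms X in simp_all)
  show "inj_on (\<alpha> X) (val N X)"
    by (rule a.inj_on_one_iff[THEN iffD2]) (use assms(6)[OF X] in blast)
  show "\<beta> X ` val E X = val M X" using assms(8)[OF X] nat_transD(3)[OF assms(2) X] by blast
  show "\<alpha> X ` val N X = kernel (fob E X) (fob M X) (\<beta> X)"
    unfolding kernel_def using assms(7)[OF X] assms(9)[OF X] nat_transD(3)[OF assms(1) X] by blast
qed

lemma functor_ses_kernel:
  assumes S: "functor_ses \<Lambda> N \<alpha> E \<beta> M" and F: "presheaf N" "presheaf E" "presheaf W"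
    and \<eta>: "\<eta> \<in> nat_trans \<Lambda> W E" and 0: "\<And>X x. \<lbrakk>X \<in> fg; x \<in> val W X\<rbrakk> \<Longrightarrow> \<beta> X (\<eta> X x) = \<one>\<^bsub>fob M X\<^esub>"
  obtains \<theta> where "\<theta> \<in> nat_trans \<Lambda> W N" "\<And>X x. \<lbrakk>X \<in> fg; x \<in> val W X\<rbrakk> \<Longrightarrow> \<alpha> X (\<theta> X x) = \<eta> X x"
proof -
  note S' = functor_sesD[OF S] and h = nat_transD[OF \<eta>] and a = nat_transD[OF S'(1)]
  have "\<exists>n \<in> val N X. \<alpha> X n = \<eta> X x" if "X \<in> fg" "x \<in> val W X" for X x
    using S'(8)[OF that(1) h(3)[OF that] 0[OF that]] .
  then obtain t where t: "\<And>X x. \<lbrakk>X \<in> fg; x \<in> val W X\<rbrakk> \<Longrightarrow> t X x \<in> val N X"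
    "\<And>X x. \<lbrakk>X \<in> fg; x \<in> val W X\<rbrakk> \<Longrightarrow> \<alpha> X (t X x) = \<eta> X x" by metis
  have "(\<lambda>X \<in> fg. \<lambda>x \<in> val W X. t X x) \<in> nat_trans \<Lambda> W N"
  proof (rule nat_transI[OF _ _ _ F(3)])
    fix X x y assume *: "X \<in> fg" "x \<in> val W X" "y \<in> val W X"
    show "t X (x \<otimes>\<^bsub>fob W X\<^esub> y) = t X x \<otimes>\<^bsub>fob N X\<^esub> t X y"
      by (rule inj_onD[OF S'(3)[OF *(1)]]) (use * F in \<open>simp_all add: t a h\<close>)
  next
    fix X Y f y assume *: "X \<in> fg" "Y \<in> fg" "f \<in> Hom X Y" "y \<in> val W Y"
    show "t X (far W X Y f y) = far N X Y f (t Y y)"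
      by (rule inj_onD[OF S'(3)[OF *(1)]]) (use * F in \<open>simp_all add: t a h\<close>)
  qed (rule t)
  then show thesis by (rule that) (simp add: t)
qed

lemma functor_ses_cokernel:
  assumes S: "functor_ses \<Lambda> N \<alpha> E \<beta> M" and F: "presheaf E" "presheaf M" "presheaf W"
    and \<eta>: "\<eta> \<in> nat_trans \<Lambda> E W" and 0: "\<And>X x. \<lbrakk>X \<in> fg; x \<in> val N X\<rbrakk> \<Longrightarrow> \<eta> X (\<alpha> X x) = \<one>\<^bsub>fob W X\<^esub>"
  obtains \<theta> where "\<theta> \<in> nat_trans \<Lambda> M W" "\<And>X x. \<lbrakk>X \<in> fg; x \<in> val E X\<rbrakk> \<Longrightarrow> \<theta> X (\<beta> X x) = \<eta> X x"
proof -
  note S' = functor_sesD[OF S] and h = nat_transD[OF \<eta>] and b = nat_transD[OF S'(2)]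
  have wd: "\<eta> X x = \<eta> X y" if *: "X \<in> fg" "x \<in> val E X" "y \<in> val E X" "\<beta> X x = \<beta> X y" for X x y
  proof -
    interpret M: group "fob M X" using F *(1) by (simp add: val_group)
    let ?d = "x \<otimes>\<^bsub>fob E X\<^esub> inv\<^bsub>fob E X\<^esub> y"
    have "\<beta> X ?d = \<one>\<^bsub>fob M X\<^esub>"
      using * F by (simp add: b nat_trans_inv[OF F(1,2) S'(2)])
    then obtain n where "n \<in> val N X" "\<alpha> X n = ?d" using S'(8)[OF *(1), of ?d] * F by auto
    then have "\<eta> X ?d = \<one>\<^bsub>fob W X\<^esub>" using 0[OF *(1)] by metis
    then show ?thesis
      using * F by - (rule val_eq_if[OF F(3) *(1)], simp_all add: h nat_trans_inv[OF F(1,3) \<eta>])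
  qed
  obtain s where s: "\<And>X z. \<lbrakk>X \<in> fg; z \<in> val M X\<rbrakk> \<Longrightarrow> s X z \<in> val E X"
    "\<And>X z. \<lbrakk>X \<in> fg; z \<in> val M X\<rbrakk> \<Longrightarrow> \<beta> X (s X z) = z" using S'(7) by metis
  have sb: "\<eta> X (s X (\<beta> X x)) = \<eta> X x" if "X \<in> fg" "x \<in> val E X" for X x
    by (rule wd) (use that s b in simp_all)
  have "(\<lambda>X \<in> fg. \<lambda>z \<in> val M X. \<eta> X (s X z)) \<in> nat_trans \<Lambda> M W"
  proof (rule nat_transI[OF _ _ _ F(2)])
    fix X z w assume *: "X \<in> fg" "z \<in> val M X" "w \<in> val M X"
    have "\<eta> X (s X (z \<otimes>\<^bsub>fob M X\<^esub> w)) = \<eta> X (s X z \<otimes>\<^bsub>fob E X\<^esub> s X w)"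
      by (rule wd) (use * F s in \<open>simp_all add: b\<close>)
    then show "\<eta> X (s X (z \<otimes>\<^bsub>fob M X\<^esub> w)) = \<eta> X (s X z) \<otimes>\<^bsub>fob W X\<^esub> \<eta> X (s X w)"
      using * s by (simp add: h)
  next
    fix X Y f z assume *: "X \<in> fg" "Y \<in> fg" "f \<in> Hom X Y" "z \<in> val M Y"
    have "\<eta> X (s X (far M X Y f z)) = \<eta> X (far E X Y f (s Y z))"
      by (rule wd) (use * F s in \<open>simp_all add: b\<close>)
    then show "\<eta> X (s X (far M X Y f z)) = far W X Y f (\<eta> Y (s Y z))"
      using * s by (simp add: h)
  qed (use s h in simp_all)
  then show thesis by (rule that) (simp add: sb b)
qed

subsection \<open>Presentations\<close>

text \<open>By the Yoneda lemma, an exact sequence \<open>(-, A1) \<rightarrow> (-, A0) \<rightarrow> F \<rightarrow> 0\<close> amounts to a map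
  \<open>f : A1 \<rightarrow> A0\<close> and an element \<open>x\<close> of \<open>F A0\<close>, the image of the identity, which generates \<open>F\<close>.\<close>

definition presents :: "'a mapobj \<Rightarrow> ('a, 'g) cfunctor \<Rightarrow> 'g \<Rightarrow> bool" where
  "presents = (\<lambda>(A1, A0, f) F x. x \<in> val F A0 \<and> (\<forall>X \<in> fg.
     (\<forall>z \<in> val F X. \<exists>\<phi> \<in> Hom X A0. z = far F X A0 \<phi> x) \<and>
     (\<forall>\<phi> \<in> Hom X A0. \<forall>\<psi> \<in> Hom X A0.
        far F X A0 (hadd X A0 \<phi> \<psi>) x = far F X A0 \<phi> x \<otimes>\<^bsub>fob F X\<^esub> far F X A0 \<psi> x) \<and>
     (\<forall>\<phi> \<in> Hom X A0. far F X A0 \<phi> x = \<one>\<^bsub>fob F X\<^esub> \<longleftrightarrow> (\<exists>\<theta> \<in> Hom X A1. \<phi> = comp X f \<theta>))))"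

lemma presentsD:
  assumes "presents (A1, A0, f) F x"
  shows "x \<in> val F A0" "\<lbrakk>X \<in> fg; z \<in> val F X\<rbrakk> \<Longrightarrow> \<exists>\<phi> \<in> Hom X A0. z = far F X A0 \<phi> x"
    "\<lbrakk>X \<in> fg; \<phi> \<in> Hom X A0; \<psi> \<in> Hom X A0\<rbrakk>
      \<Longrightarrow> far F X A0 (hadd X A0 \<phi> \<psi>) x = far F X A0 \<phi> x \<otimes>\<^bsub>fob F X\<^esub> far F X A0 \<psi> x"
    "\<lbrakk>X \<in> fg; \<phi> \<in> Hom X A0\<rbrakk> \<Longrightarrow> far F X A0 \<phi> x = \<one>\<^bsub>fob F X\<^esub> \<longleftrightarrow> (\<exists>\<theta> \<in> Hom X A1. \<phi> = comp X f \<theta>)"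
  using assms by (simp_all add: presents_def)

definition additive :: "('a, 'g) cfunctor \<Rightarrow> bool" where
  "additive F \<longleftrightarrow> (\<forall>X \<in> fg. \<forall>Y \<in> fg. \<forall>\<phi> \<in> Hom X Y. \<forall>\<psi> \<in> Hom X Y. \<forall>y \<in> val F Y.
     far F X Y (hadd X Y \<phi> \<psi>) y = far F X Y \<phi> y \<otimes>\<^bsub>fob F X\<^esub> far F X Y \<psi> y)"

lemma additiveD: "\<lbrakk>additive F; X \<in> fg; Y \<in> fg; \<phi> \<in> Hom X Y; \<psi> \<in> Hom X Y; y \<in> val F Y\<rbrakk>
  \<Longrightarrow> far F X Y (hadd X Y \<phi> \<psi>) y = far F X Y \<phi> y \<otimes>\<^bsub>fob F X\<^esub> far F X Y \<psi> y"
  by (simp add: additive_def)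

lemma presents_additive:
  assumes F: "presheaf F" and A: "(A1, A0, f) \<in> maps_ob \<Lambda>" and x: "presents (A1, A0, f) F x"
  shows "additive F"
  unfolding additive_def
proof (intro ballI)
  note x' = presentsD[OF x]
  fix X Y \<phi> \<psi> y assume *: "X \<in> fg" "Y \<in> fg" "\<phi> \<in> Hom X Y" "\<psi> \<in> Hom X Y" "y \<in> val F Y"
  have A0: "A0 \<in> fg" using A by simp
  obtain \<chi> where \<chi>: "\<chi> \<in> Hom Y A0" "y = far F Y A0 \<chi> x" using x'(2)[OF *(2,5)] by blast
  have t: "comp X \<chi> \<phi> \<in> Hom X A0" "comp X \<chi> \<psi> \<in> Hom X A0" using * \<chi>(1) by (auto intro: comp_Hom)
  have "far F X Y (hadd X Y \<phi> \<psi>) y = far F X A0 (comp X \<chi> (hadd X Y \<phi> \<psi>)) x"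
    unfolding \<chi>(2) by (rule far_comp[symmetric]) (use F * \<chi>(1) A0 x'(1) in simp_all)
  also have "comp X \<chi> (hadd X Y \<phi> \<psi>) = hadd X A0 (comp X \<chi> \<phi>) (comp X \<chi> \<psi>)"
    by (rule comp_hadd_right) (use * \<chi>(1) A0 in simp_all)
  also have "far F X A0 \<dots> x = far F X A0 (comp X \<chi> \<phi>) x \<otimes>\<^bsub>fob F X\<^esub> far F X A0 (comp X \<chi> \<psi>) x"
    by (rule x'(3)[OF *(1) t])
  also have "\<dots> = far F X Y \<phi> y \<otimes>\<^bsub>fob F X\<^esub> far F X Y \<psi> y"
    using far_comp[OF F *(1,2) A0 *(3) \<chi>(1) x'(1)] far_comp[OF F *(1,2) A0 *(4) \<chi>(1) x'(1)] by (simp add: \<chi>(2))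
  finally show "far F X Y (hadd X Y \<phi> \<psi>) y = far F X Y \<phi> y \<otimes>\<^bsub>fob F X\<^esub> far F X Y \<psi> y" .
qed

lemma additive_far_hom:
  assumes "presheaf F" "additive F" "X \<in> fg" "Y \<in> fg" "y \<in> val F Y"
  shows "group_hom (mod_hom \<Lambda> X Y) (fob F X) (\<lambda>\<phi>. far F X Y \<phi> y)"
  unfolding group_hom_def group_hom_axioms_def
  using assms Hom_comm_group comm_group.axioms(2) val_group additiveD by (auto simp: hom_def)

lemma additive_far_neg:
  assumes "presheaf F" "additive F" "X \<in> fg" "Y \<in> fg" "y \<in> val F Y" "\<phi> \<in> Hom X Y"
  shows "far F X Y (hneg X Y \<phi>) y = inv\<^bsub>fob F X\<^esub> far F X Y \<phi> y"
  using group_hom.hom_inv[OF additive_far_hom[OF assms(1-5)] assms(6)] .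

lemma additive_far_zero:
  assumes "presheaf F" "additive F" "X \<in> fg" "Y \<in> fg" "y \<in> val F Y"
  shows "far F X Y (hzero X Y) y = \<one>\<^bsub>fob F X\<^esub>"
  using group_hom.hom_one[OF additive_far_hom[OF assms(1-5)]] .

text \<open>The Yoneda lemma for presented functors: morphisms out of \<open>F\<close> correspond to the elements of \<open>G A0\<close>
  annihilated by \<open>f\<close>, the images of the generator \<open>x\<close>. This lemma gives existence, the next one uniqueness.\<close>

lemma presents_yoneda:
  assumes F: "presheaf F" and A: "(A1, A0, f) \<in> maps_ob \<Lambda>" and x: "presents (A1, A0, f) F x"
    and G: "presheaf G" "additive G" and y: "y \<in> val G A0" "far G A1 A0 f y = \<one>\<^bsub>fob G A1\<^esub>"
  obtains \<eta> where "\<eta> \<in> nat_trans \<Lambda> F G" "\<eta> A0 x = y"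
    "\<And>X \<phi>. \<lbrakk>X \<in> fg; \<phi> \<in> Hom X A0\<rbrakk> \<Longrightarrow> \<eta> X (far F X A0 \<phi> x) = far G X A0 \<phi> y"
proof -
  note x' = presentsD[OF x]
  have A' [simp]: "A1 \<in> fg" "A0 \<in> fg" and f: "f \<in> Hom A1 A0" using A by simp_all
  have addF: "additive F" using presents_additive[OF F A x] .
  have wd: "far G X A0 \<phi> y = far G X A0 \<psi> y"
    if *: "X \<in> fg" "\<phi> \<in> Hom X A0" "\<psi> \<in> Hom X A0" "far F X A0 \<phi> x = far F X A0 \<psi> x" for X \<phi> \<psi>
  proof -
    interpret FX: group "fob F X" using F *(1) by (rule val_group)
    let ?d = "hadd X A0 \<phi> (hneg X A0 \<psi>)"
    have d: "?d \<in> Hom X A0" using * by simp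
    have "far F X A0 ?d x = \<one>\<^bsub>fob F X\<^esub>"
      using * F x'(1) by (simp add: additiveD[OF addF] additive_far_neg[OF F addF])
    then obtain \<theta> where \<theta>: "\<theta> \<in> Hom X A1" "?d = comp X f \<theta>" using x'(4)[OF *(1) d] by blast
    have "far G X A0 ?d y = \<one>\<^bsub>fob G X\<^esub>"
      unfolding \<theta>(2) using \<theta>(1) * f G y by (simp add: far_comp[of G X A1 A0] far_one)
    then show ?thesis
      using * G y by - (rule val_eq_if[OF G(1) *(1)], simp_all add: additiveD[OF G(2)] additive_far_neg[OF G])
  qed
  obtain c where c: "\<And>X z. \<lbrakk>X \<in> fg; z \<in> val F X\<rbrakk> \<Longrightarrow> c X z \<in> Hom X A0"
    "\<And>X z. \<lbrakk>X \<in> fg; z \<in> val F X\<rbrakk> \<Longrightarrow> far F X A0 (c X z) x = z" using x'(2) by metis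
  define \<eta> where "\<eta> = (\<lambda>X \<in> fg. \<lambda>z \<in> val F X. far G X A0 (c X z) y)"
  have "\<eta> \<in> nat_trans \<Lambda> F G"
    unfolding \<eta>_def
  proof (rule nat_transI[OF _ _ _ F])
    fix X z w assume *: "X \<in> fg" "z \<in> val F X" "w \<in> val F X"
    have "far G X A0 (c X (z \<otimes>\<^bsub>fob F X\<^esub> w)) y = far G X A0 (hadd X A0 (c X z) (c X w)) y"
      by (rule wd) (use * F x'(1) in \<open>simp_all add: c additiveD[OF addF]\<close>)
    then show "far G X A0 (c X (z \<otimes>\<^bsub>fob F X\<^esub> w)) y = far G X A0 (c X z) y \<otimes>\<^bsub>fob G X\<^esub> far G X A0 (c X w) y"
      using * y c by (simp add: additiveD[OF G(2)])
  next
    fix X Y h z assume *: "X \<in> fg" "Y \<in> fg" "h \<in> Hom X Y" "z \<in> val F Y"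
    have "far G X A0 (c X (far F X Y h z)) y = far G X A0 (comp X (c Y z) h) y"
      by (rule wd) (use * F x'(1) in \<open>simp_all add: c far_comp[of F X Y A0] comp_Hom[of X h Y]\<close>)
    then show "far G X A0 (c X (far F X Y h z)) y = far G X Y h (far G Y A0 (c Y z) y)"
      using * y G c by (simp add: far_comp[of G X Y A0])
  qed (use G y c in simp_all)
  moreover have \<eta>: "\<eta> X (far F X A0 \<phi> x) = far G X A0 \<phi> y" if *: "X \<in> fg" "\<phi> \<in> Hom X A0" for X \<phi>
    using * F x'(1) by (simp add: \<eta>_def) (rule wd, simp_all add: c)
  moreover have "\<eta> A0 x = y"
    using \<eta>[of A0 "mod_id A0"] F G x'(1) y(1) by (simp add: far_id)
  ultimately show thesis using that by blast
qed

lemma nat_trans_presented_eq: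
  assumes F: "presheaf F" and A: "(A1, A0, f) \<in> maps_ob \<Lambda>" and x: "presents (A1, A0, f) F x"
    and \<eta>: "\<eta> \<in> nat_trans \<Lambda> F G" and \<theta>: "\<theta> \<in> nat_trans \<Lambda> F G" and eq: "\<eta> A0 x = \<theta> A0 x"
  shows "\<eta> = \<theta>"
proof (rule nat_trans_eqI[OF \<eta> \<theta>])
  fix X z assume *: "X \<in> fg" "z \<in> val F X"
  then obtain \<phi> where \<phi>: "\<phi> \<in> Hom X A0" "z = far F X A0 \<phi> x" using presentsD(2)[OF x] by blast
  have "A0 \<in> fg" using A by simp
  then show "\<eta> X z = \<theta> X z"
    using nat_transD(5)[OF \<eta> *(1) _ \<phi>(1) presentsD(1)[OF x]] nat_transD(5)[OF \<theta> *(1) _ \<phi>(1) presentsD(1)[OF x]] eq \<phi>(2) by simp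
qed

lemma representable_simps [simp]: "fob (representable \<Lambda> C) X = mod_hom \<Lambda> X C"
  "far (representable \<Lambda> C) X Y h \<phi> = comp X \<phi> h"
  by (simp_all add: representable_def)

lemma representable_functor: assumes C: "C \<in> fg" shows "presheaf (representable \<Lambda> C)"
  unfolding contravariant_functor_def
proof (intro conjI ballI)
  fix X Y h assume "X \<in> fg" "Y \<in> fg" "h \<in> Hom X Y"
  then show "far (representable \<Lambda> C) X Y h \<in> hom (fob (representable \<Lambda> C) Y) (fob (representable \<Lambda> C) X)"
    using C by (auto simp: hom_def comp_hadd_left intro: comp_Hom)
next
  fix X Y Z h k z assume "h \<in> Hom X Y"
  then show "far (representable \<Lambda> C) X Z (comp X k h) z = far (representable \<Lambda> C) X Y h (far (representable \<Lambda> C) Y Z k z)"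
    by (simp add: comp_comp)
qed (use C in \<open>simp_all add: Hom_comm_group\<close>)

lemma representable_presents: assumes C: "C \<in> fg" shows "presents (zero_map_to C) (representable \<Lambda> C) (mod_id C)"
proof -
  have "(\<exists>\<theta> \<in> Hom X mod_zero. \<phi> = comp X (hzero mod_zero C) \<theta>) \<longleftrightarrow> \<phi> = hzero X C" if "X \<in> fg" for X \<phi>
    using C that exI[of "\<lambda>\<theta>. \<theta> \<in> Hom X mod_zero", OF hzero_Hom[OF that mod_zero_fg]] by auto
  then show ?thesis using C by (auto simp: presents_def)
qed

lemma finitely_presented_presents:
  assumes F: "presheaf F" and fp: "finitely_presented \<Lambda> F"
  obtains A x where "A \<in> maps_ob \<Lambda>" "presents A F x"
proof -
  obtain A1 A0 \<alpha> \<beta> where A: "A1 \<in> fg" "A0 \<in> fg"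
    and \<alpha>: "\<alpha> \<in> nat_trans \<Lambda> (representable \<Lambda> A1) (representable \<Lambda> A0)"
    and \<beta>: "\<beta> \<in> nat_trans \<Lambda> (representable \<Lambda> A0) F"
    and ex: "\<forall>X \<in> fg. \<beta> X ` Hom X A0 = val F X \<and> \<alpha> X ` Hom X A1 = kernel (mod_hom \<Lambda> X A0) (fob F X) (\<beta> X)"
    using fp unfolding finitely_presented_def by (elim bexE) (rule that)
  define f where "f = \<alpha> A1 (mod_id A1)"
  define x where "x = \<beta> A0 (mod_id A0)"
  have f: "f \<in> Hom A1 A0" using nat_transD(3)[OF \<alpha> A(1)] A by (simp add: f_def)
  have x: "x \<in> val F A0" using nat_transD(3)[OF \<beta> A(2)] A by (simp add: x_def)
  have a: "\<alpha> X \<theta> = comp X f \<theta>" if "X \<in> fg" "\<theta> \<in> Hom X A1" for X \<theta>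
    using nat_transD(5)[OF \<alpha> that(1) A(1) that(2), of "mod_id A1"] A that by (simp add: f_def)
  have b: "\<beta> X \<phi> = far F X A0 \<phi> x" if "X \<in> fg" "\<phi> \<in> Hom X A0" for X \<phi>
    using nat_transD(5)[OF \<beta> that(1) A(2) that(2), of "mod_id A0"] A that by (simp add: x_def)
  have "presents (A1, A0, f) F x"
    unfolding presents_def prod.case
  proof (intro conjI ballI x)
    fix X assume X: "X \<in> fg"
    note ex = ex[rule_format, OF X]
    show "\<exists>\<phi> \<in> Hom X A0. z = far F X A0 \<phi> x" if "z \<in> val F X" for z
    proof -
      have "z \<in> \<beta> X ` Hom X A0" using ex that by simp
      then obtain \<phi> where \<phi>: "\<phi> \<in> Hom X A0" "z = \<beta> X \<phi>" by (rule imageE)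
      then show ?thesis using b[OF X \<phi>(1)] by (intro bexI[of _ \<phi>]) simp_all
    qed
    show "far F X A0 (hadd X A0 \<phi> \<psi>) x = far F X A0 \<phi> x \<otimes>\<^bsub>fob F X\<^esub> far F X A0 \<psi> x"
      if "\<phi> \<in> Hom X A0" "\<psi> \<in> Hom X A0" for \<phi> \<psi>
      using nat_transD(4)[OF \<beta> X, of \<phi> \<psi>] that X A by (simp add: b)
    show "far F X A0 \<phi> x = \<one>\<^bsub>fob F X\<^esub> \<longleftrightarrow> (\<exists>\<theta> \<in> Hom X A1. \<phi> = comp X f \<theta>)" if \<phi>: "\<phi> \<in> Hom X A0" for \<phi>
    proof -
      have "far F X A0 \<phi> x = \<one>\<^bsub>fob F X\<^esub> \<longleftrightarrow> \<phi> \<in> kernel (mod_hom \<Lambda> X A0) (fob F X) (\<beta> X)"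
        using b[OF X \<phi>] \<phi> by (simp add: kernel_def)
      also have "\<dots> \<longleftrightarrow> \<phi> \<in> \<alpha> X ` Hom X A1" using ex by simp
      also have "\<dots> \<longleftrightarrow> (\<exists>\<theta> \<in> Hom X A1. \<phi> = comp X f \<theta>)" using a[OF X] by (auto simp: image_iff)
      finally show ?thesis .
    qed
  qed
  then show thesis using that[of "(A1, A0, f)" x] A f by simp
qed

lemma presents_finitely_presented:
  assumes F: "presheaf F" and A: "A \<in> maps_ob \<Lambda>" and x: "presents A F x"
  shows "finitely_presented \<Lambda> F"
proof -
  obtain A1 A0 f where A_eq: "A = (A1, A0, f)" by (metis prod_cases3)
  have A' [simp]: "A1 \<in> fg" "A0 \<in> fg" and f: "f \<in> Hom A1 A0" using A by (simp_all add: A_eq)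
  note x' = presentsD[OF x[unfolded A_eq]]
  define \<alpha> where "\<alpha> = (\<lambda>X \<in> fg. \<lambda>\<phi> \<in> val (representable \<Lambda> A1) X. comp X f \<phi>)"
  define \<beta> where "\<beta> = (\<lambda>X \<in> fg. \<lambda>\<phi> \<in> val (representable \<Lambda> A0) X. far F X A0 \<phi> x)"
  have "\<alpha> \<in> nat_trans \<Lambda> (representable \<Lambda> A1) (representable \<Lambda> A0)"
    unfolding \<alpha>_def
    by (rule nat_transI[OF _ _ _ representable_functor])
      (use f in \<open>auto simp: comp_comp comp_hadd_right[of _ A1 A0] intro: comp_Hom\<close>)
  moreover have "\<beta> \<in> nat_trans \<Lambda> (representable \<Lambda> A0) F"
    unfolding \<beta>_def
    by (rule nat_transI[OF _ _ _ representable_functor])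
      (use F x' in \<open>auto simp: far_comp\<close>)
  moreover have "\<beta> X ` Hom X A0 = val F X" if X: "X \<in> fg" for X
    using x'(1) x'(2)[OF X] X F by (auto simp: \<beta>_def image_iff)
  moreover have "\<alpha> X ` Hom X A1 = kernel (mod_hom \<Lambda> X A0) (fob F X) (\<beta> X)" if X: "X \<in> fg" for X
  proof -
    have "\<alpha> X ` Hom X A1 = {\<phi> \<in> Hom X A0. \<exists>\<theta> \<in> Hom X A1. \<phi> = comp X f \<theta>}"
      using X f by (auto simp: \<alpha>_def intro: comp_Hom)
    also have "\<dots> = kernel (mod_hom \<Lambda> X A0) (fob F X) (\<beta> X)"
      using x'(4)[OF X] X by (auto simp: kernel_def \<beta>_def)
    finally show ?thesis .
  qed
  ultimately show ?thesis
    unfolding finitely_presented_def using A' by blast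
qed

end

section \<open>The functor category\<close>

context artin_algebra_modules
begin

subsection \<open>The cokernel functors\<close>

lemma phi_image_iff: "\<phi> \<in> phi_image \<Lambda> (A1, A0, f) X \<longleftrightarrow> (\<exists>\<theta> \<in> Hom X A1. \<phi> = comp X f \<theta>)"
  by (auto simp: phi_image_def)

lemma phi_image_subgroup:
  assumes "(A1, A0, f) \<in> maps_ob \<Lambda>" "X \<in> fg"
  shows "subgroup (phi_image \<Lambda> (A1, A0, f) X) (mod_hom \<Lambda> X A0)"
proof -
  have A: "A1 \<in> fg" "A0 \<in> fg" "f \<in> Hom A1 A0" using assms by simp_all
  have "group_hom (mod_hom \<Lambda> X A1) (mod_hom \<Lambda> X A0) (\<lambda>\<theta>. comp X f \<theta>)"
    unfolding group_hom_def group_hom_axioms_def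
    using A assms(2) Hom_comm_group comm_group.axioms(2)
    by (auto simp: hom_def comp_hadd_right[of X A1 A0] intro: comp_Hom)
  from group_hom.img_is_subgroup[OF this] show ?thesis by (simp add: phi_image_def)
qed

definition cls :: "'a mapobj \<Rightarrow> 'a lmod \<Rightarrow> 'a lmap \<Rightarrow> 'a lmap set" where
  "cls A X \<phi> = phi_image \<Lambda> A X #>\<^bsub>mod_hom \<Lambda> X (fst (snd A))\<^esub> \<phi>"

lemma Phi_cls:
  assumes A: "(A1, A0, f) \<in> maps_ob \<Lambda>" and X: "X \<in> fg"
  shows "val (Phi \<Lambda> (A1, A0, f)) X = cls (A1, A0, f) X ` Hom X A0"
    and "\<lbrakk>\<phi> \<in> Hom X A0; \<psi> \<in> Hom X A0\<rbrakk> \<Longrightarrow> cls (A1, A0, f) X \<phi> \<otimes>\<^bsub>fob (Phi \<Lambda> (A1, A0, f)) X\<^esub> cls (A1, A0, f) X \<psi>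
      = cls (A1, A0, f) X (hadd X A0 \<phi> \<psi>)"
    and "\<phi> \<in> Hom X A0 \<Longrightarrow> cls (A1, A0, f) X \<phi> = \<one>\<^bsub>fob (Phi \<Lambda> (A1, A0, f)) X\<^esub> \<longleftrightarrow> (\<exists>\<theta> \<in> Hom X A1. \<phi> = comp X f \<theta>)"
    and "comm_group (fob (Phi \<Lambda> (A1, A0, f)) X)"
proof -
  let ?A = "(A1, A0, f)" and ?H = "phi_image \<Lambda> (A1, A0, f) X"
  interpret G: comm_group "mod_hom \<Lambda> X A0" using A X by (simp add: Hom_comm_group)
  have fob: "fob (Phi \<Lambda> ?A) X = mod_hom \<Lambda> X A0 Mod ?H" by (simp add: Phi_def)
  interpret H: normal ?H "mod_hom \<Lambda> X A0"
    using G.subgroup_imp_normal[OF phi_image_subgroup[OF A X]] .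
  show "val (Phi \<Lambda> ?A) X = cls ?A X ` Hom X A0"
    unfolding fob carrier_FactGroup cls_def by simp
  show "cls ?A X \<phi> \<otimes>\<^bsub>fob (Phi \<Lambda> ?A) X\<^esub> cls ?A X \<psi> = cls ?A X (hadd X A0 \<phi> \<psi>)"
    if "\<phi> \<in> Hom X A0" "\<psi> \<in> Hom X A0"
    using H.rcos_sum[OF that] by (simp add: fob cls_def)
  show "cls ?A X \<phi> = \<one>\<^bsub>fob (Phi \<Lambda> ?A) X\<^esub> \<longleftrightarrow> (\<exists>\<theta> \<in> Hom X A1. \<phi> = comp X f \<theta>)" if \<phi>: "\<phi> \<in> Hom X A0"
    using G.coset_join1[OF _ \<phi> H.subgroup_axioms] G.coset_join2[OF \<phi> H.subgroup_axioms]
    by (auto simp: fob cls_def phi_image_iff)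
  show "comm_group (fob (Phi \<Lambda> ?A) X)"
    unfolding fob by (rule G.abelian_FactGroup[OF H.subgroup_axioms])
qed

lemma Phi_far_cls:
  assumes A: "(A1, A0, f) \<in> maps_ob \<Lambda>" and XY: "X \<in> fg" "Y \<in> fg" and h: "h \<in> Hom X Y" and \<phi>: "\<phi> \<in> Hom Y A0"
  shows "far (Phi \<Lambda> (A1, A0, f)) X Y h (cls (A1, A0, f) Y \<phi>) = cls (A1, A0, f) X (comp X \<phi> h)"
proof -
  let ?A = "(A1, A0, f)"
  have A' [simp]: "A1 \<in> fg" "A0 \<in> fg" and f: "f \<in> Hom A1 A0" using A by simp_all
  interpret GX: comm_group "mod_hom \<Lambda> X A0" using XY by (simp add: Hom_comm_group)
  interpret GY: comm_group "mod_hom \<Lambda> Y A0" using XY by (simp add: Hom_comm_group)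
  interpret HX: subgroup "phi_image \<Lambda> ?A X" "mod_hom \<Lambda> X A0" by (rule phi_image_subgroup[OF A XY(1)])
  interpret HY: subgroup "phi_image \<Lambda> ?A Y" "mod_hom \<Lambda> Y A0" by (rule phi_image_subgroup[OF A XY(2)])
  have \<phi>h: "comp X \<phi> h \<in> Hom X A0" using \<phi> h XY by (simp add: comp_Hom[of X h Y])
  have eq: "cls ?A X (comp X \<chi> h) = cls ?A X (comp X \<phi> h)" if \<chi>: "\<chi> \<in> cls ?A Y \<phi>" for \<chi>
  proof -
    obtain \<theta> where \<theta>: "\<theta> \<in> Hom Y A1" "\<chi> = hadd Y A0 (comp Y f \<theta>) \<phi>"
      using \<chi> by (auto simp: cls_def r_coset_def phi_image_def)
    have f\<theta>: "comp Y f \<theta> \<in> Hom Y A0" using XY \<theta> f by (simp add: comp_Hom[of Y \<theta> A1])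
    have "comp X \<chi> h = hadd X A0 (comp X f (comp X \<theta> h)) (comp X \<phi> h)"
      using h \<theta>(1) f XY f\<theta> \<phi> by (simp add: \<theta>(2) comp_hadd_left comp_comp)
    moreover have "comp X f (comp X \<theta> h) \<in> phi_image \<Lambda> ?A X"
      using h \<theta>(1) XY by (auto simp: phi_image_iff intro!: comp_Hom[of X h Y])
    ultimately have "comp X \<chi> h \<in> cls ?A X (comp X \<phi> h)"
      by (auto simp: cls_def r_coset_def)
    then show ?thesis
      using GX.repr_independence[OF _ _ HX.subgroup_axioms, of "comp X \<chi> h" "comp X \<phi> h"] \<phi>h by (simp add: cls_def)
  qed
  have "\<phi> \<in> cls ?A Y \<phi>"
    using GY.rcos_self[OF \<phi> HY.subgroup_axioms] by (simp add: cls_def)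
  then have "(\<Union>\<chi>\<in>cls ?A Y \<phi>. cls ?A X (comp X \<chi> h)) = cls ?A X (comp X \<phi> h)"
    using eq by blast
  then show ?thesis by (simp add: Phi_def cls_def)
qed

lemma Phi_presheaf:
  assumes "A \<in> maps_ob \<Lambda>"
  shows "presheaf (Phi \<Lambda> A)"
proof -
  obtain A1 A0 f where A: "A = (A1, A0, f)" by (metis prod_cases3)
  note ob = assms[unfolded A]
  have A': "A0 \<in> fg" using ob by simp
  note c = Phi_cls[OF ob] Phi_far_cls[OF ob]
  have el: "\<exists>\<phi> \<in> Hom X A0. x = cls A X \<phi>" if "X \<in> fg" "x \<in> val (Phi \<Lambda> A) X" for X x
    using that c(1)[OF that(1)] by (auto simp: A)
  show ?thesis
    unfolding contravariant_functor_def
  proof (intro conjI ballI)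
    fix X x assume X: "X \<in> fg" and "x \<in> val (Phi \<Lambda> A) X"
    then obtain \<phi> where "\<phi> \<in> Hom X A0" "x = cls A X \<phi>" using el by blast
    then show "far (Phi \<Lambda> A) X X (mod_id X) x = x" using X by (simp add: A c)
  next
    fix X Y h assume *: "X \<in> fg" "Y \<in> fg" "h \<in> Hom X Y"
    show "far (Phi \<Lambda> A) X Y h \<in> hom (fob (Phi \<Lambda> A) Y) (fob (Phi \<Lambda> A) X)"
    proof (rule homI)
      fix x assume "x \<in> val (Phi \<Lambda> A) Y"
      then obtain \<phi> where "\<phi> \<in> Hom Y A0" "x = cls A Y \<phi>" using el * by blast
      then show "far (Phi \<Lambda> A) X Y h x \<in> val (Phi \<Lambda> A) X"
        using * c(1)[OF *(1)] comp_Hom[OF *(1,3)] by (simp add: A c(5))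
    next
      fix x y assume "x \<in> val (Phi \<Lambda> A) Y" "y \<in> val (Phi \<Lambda> A) Y"
      then obtain \<phi> \<psi> where x: "\<phi> \<in> Hom Y A0" "x = cls A Y \<phi>" and y: "\<psi> \<in> Hom Y A0" "y = cls A Y \<psi>" using el * by metis
      then show "far (Phi \<Lambda> A) X Y h (x \<otimes>\<^bsub>fob (Phi \<Lambda> A) Y\<^esub> y) =
          far (Phi \<Lambda> A) X Y h x \<otimes>\<^bsub>fob (Phi \<Lambda> A) X\<^esub> far (Phi \<Lambda> A) X Y h y"
        using * A' comp_Hom[OF *(1,3) x(1)] comp_Hom[OF *(1,3) y(1)] by (simp add: A c comp_hadd_left)
    qed
  next
    fix X Y Z h k z assume *: "X \<in> fg" "Y \<in> fg" "Z \<in> fg" "h \<in> Hom X Y" "k \<in> Hom Y Z" and "z \<in> val (Phi \<Lambda> A) Z"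
    then obtain \<phi> where "\<phi> \<in> Hom Z A0" "z = cls A Z \<phi>" using el by blast
    then show "far (Phi \<Lambda> A) X Z (comp X k h) z = far (Phi \<Lambda> A) X Y h (far (Phi \<Lambda> A) Y Z k z)"
      using * comp_Hom[OF *(1,4,5)] comp_Hom[OF *(2,5)] by (simp add: A c comp_comp)
  qed (simp add: A c)
qed

text \<open>The generator is the class of the identity of \<open>A0\<close>.\<close>

lemma Phi_presents:
  assumes "(A1, A0, f) \<in> maps_ob \<Lambda>"
  shows "presents (A1, A0, f) (Phi \<Lambda> (A1, A0, f)) (cls (A1, A0, f) A0 (mod_id A0))"
proof -
  have A: "A0 \<in> fg" using assms by simp
  note c = Phi_cls[OF assms] Phi_far_cls[OF assms]
  have far: "far (Phi \<Lambda> (A1, A0, f)) X A0 \<phi> (cls (A1, A0, f) A0 (mod_id A0)) = cls (A1, A0, f) X \<phi>"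
    if "X \<in> fg" "\<phi> \<in> Hom X A0" for X \<phi>
    using that A by (simp add: c)
  show ?thesis
    unfolding presents_def prod.case
  proof (intro conjI ballI)
    show "cls (A1, A0, f) A0 (mod_id A0) \<in> val (Phi \<Lambda> (A1, A0, f)) A0" using A by (simp add: c)
    fix X z assume X: "X \<in> fg" and "z \<in> val (Phi \<Lambda> (A1, A0, f)) X"
    then obtain \<phi> where "\<phi> \<in> Hom X A0" "z = cls (A1, A0, f) X \<phi>" by (auto simp: c)
    then show "\<exists>\<phi>\<in>Hom X A0. z = far (Phi \<Lambda> (A1, A0, f)) X A0 \<phi> (cls (A1, A0, f) A0 (mod_id A0))"
      using far[OF X] by blast
  qed (use A in \<open>simp_all add: far c\<close>)
qed

subsection \<open>Finitely presented functors form a category with short exact sequences\<close>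

abbreviation "fun_ob \<equiv> Ob (mod_mod \<Lambda>)"

lemma mod_mod_simps: "F \<in> fun_ob \<longleftrightarrow> presheaf F \<and> finitely_presented \<Lambda> F"
  "carrier (Mor (mod_mod \<Lambda>) F G) = nat_trans \<Lambda> F G"
  "\<eta> \<otimes>\<^bsub>Mor (mod_mod \<Lambda>) F G\<^esub> \<theta> = nadd F G \<eta> \<theta>"
  "\<one>\<^bsub>Mor (mod_mod \<Lambda>) F G\<^esub> = nzero F G"
  "Id (mod_mod \<Lambda>) F = nid F"
  "Comp (mod_mod \<Lambda>) F \<theta> \<eta> = ncomp F \<theta> \<eta>"
  "(F, \<alpha>, G, \<beta>, H) \<in> Ses (mod_mod \<Lambda>) \<longleftrightarrow> F \<in> fun_ob \<and> G \<in> fun_ob \<and> H \<in> fun_ob \<and> functor_ses \<Lambda> F \<alpha> G \<beta> H"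
  by (simp_all add: mod_mod_def Let_def nadd_def nzero_def nid_def ncomp_def)

lemma fun_ob_presheaf [simp]: "F \<in> fun_ob \<Longrightarrow> presheaf F"
  by (simp add: mod_mod_simps)

lemma fun_ob_presents:
  assumes "F \<in> fun_ob" obtains A1 A0 f x where "(A1, A0, f) \<in> maps_ob \<Lambda>" "presents (A1, A0, f) F x"
  using finitely_presented_presents[of F] assms by (metis mod_mod_simps(1) prod_cases3)

lemma fun_ob_additive: "F \<in> fun_ob \<Longrightarrow> additive F"
  by (metis fun_ob_presents fun_ob_presheaf presents_additive)

lemma fun_obI: "\<lbrakk>presheaf F; A \<in> maps_ob \<Lambda>; presents A F x\<rbrakk> \<Longrightarrow> F \<in> fun_ob"
  using presents_finitely_presented by (simp add: mod_mod_simps)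

lemma Phi_fun_ob: "A \<in> maps_ob \<Lambda> \<Longrightarrow> Phi \<Lambda> A \<in> fun_ob"
  by (cases A) (metis Phi_presents Phi_presheaf fun_obI)

lemma Phi_presents_ex: "A \<in> maps_ob \<Lambda> \<Longrightarrow> \<exists>x. presents A (Phi \<Lambda> A) x"
  by (cases A) (use Phi_presents in blast)

lemma nat_trans_comm_group:
  assumes F: "presheaf F" and G: "presheaf G"
  shows "comm_group (Mor (mod_mod \<Lambda>) F G)"
proof (rule comm_groupI, unfold mod_mod_simps)
  show "nzero F G \<in> nat_trans \<Lambda> F G" by (rule nzero_nat_trans[OF F G])
next
  fix \<eta> \<theta> assume *: "\<eta> \<in> nat_trans \<Lambda> F G" "\<theta> \<in> nat_trans \<Lambda> F G"
  show "nadd F G \<eta> \<theta> \<in> nat_trans \<Lambda> F G" by (rule nadd_nat_trans[OF F G *])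
  show "nadd F G \<eta> \<theta> = nadd F G \<theta> \<eta>"
  proof (rule nat_trans_eqI[OF nadd_nat_trans[OF F G *] nadd_nat_trans[OF F G *(2,1)]])
    fix X x assume X: "X \<in> fg" "x \<in> val F X"
    interpret comm_group "fob G X" using G X(1) by (rule val_comm_group)
    show "nadd F G \<eta> \<theta> X x = nadd F G \<theta> \<eta> X x"
      using X nat_transD(3)[OF *(1) X] nat_transD(3)[OF *(2) X] by (simp add: m_comm)
  qed
next
  fix \<eta> \<theta> \<zeta> assume *: "\<eta> \<in> nat_trans \<Lambda> F G" "\<theta> \<in> nat_trans \<Lambda> F G" "\<zeta> \<in> nat_trans \<Lambda> F G"
  show "nadd F G (nadd F G \<eta> \<theta>) \<zeta> = nadd F G \<eta> (nadd F G \<theta> \<zeta>)"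
  proof (rule nat_trans_eqI[of _ F G _ G])
    fix X x assume X: "X \<in> fg" "x \<in> val F X"
    interpret comm_group "fob G X" using G X(1) by (rule val_comm_group)
    show "nadd F G (nadd F G \<eta> \<theta>) \<zeta> X x = nadd F G \<eta> (nadd F G \<theta> \<zeta>) X x"
      using X nat_transD(3)[OF *(1) X] nat_transD(3)[OF *(2) X] nat_transD(3)[OF *(3) X] by (simp add: m_assoc)
  qed (intro nadd_nat_trans F G *)+
next
  fix \<eta> assume \<eta>: "\<eta> \<in> nat_trans \<Lambda> F G"
  show "nadd F G (nzero F G) \<eta> = \<eta>"
  proof (rule nat_trans_eqI[OF nadd_nat_trans[OF F G nzero_nat_trans[OF F G] \<eta>] \<eta>])
    fix X x assume X: "X \<in> fg" "x \<in> val F X"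
    interpret comm_group "fob G X" using G X(1) by (rule val_comm_group)
    show "nadd F G (nzero F G) \<eta> X x = \<eta> X x" using X nat_transD(3)[OF \<eta> X] by simp
  qed
  show "\<exists>\<theta> \<in> nat_trans \<Lambda> F G. nadd F G \<theta> \<eta> = nzero F G"
  proof (rule bexI[OF _ nneg_nat_trans[OF F G \<eta>]],
      rule nat_trans_eqI[OF nadd_nat_trans[OF F G nneg_nat_trans[OF F G \<eta>] \<eta>] nzero_nat_trans[OF F G]])
    fix X x assume X: "X \<in> fg" "x \<in> val F X"
    interpret comm_group "fob G X" using G X(1) by (rule val_comm_group)
    show "nadd F G (\<lambda>X \<in> fg. \<lambda>x \<in> val F X. inv\<^bsub>fob G X\<^esub> \<eta> X x) \<eta> X x = nzero F G X x"
      using X nat_transD(3)[OF \<eta> X] by simp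
  qed
qed

lemma zero_presented:
  assumes "presheaf F" "presents (zero_map_to mod_zero) F x" "X \<in> fg"
  shows "val F X = {\<one>\<^bsub>fob F X\<^esub>}"
proof -
  note x = presentsD[OF assms(2)[unfolded zero_map_to_simps]]
  have "z = \<one>\<^bsub>fob F X\<^esub>" if z: "z \<in> val F X" for z
  proof -
    obtain \<phi> where \<phi>: "\<phi> \<in> Hom X mod_zero" "z = far F X mod_zero \<phi> x" using x(2)[OF assms(3) z] by blast
    have "\<phi> = comp X (hzero mod_zero mod_zero) \<phi>"
    proof (rule extensionalityI[of _ "carrier X"])
      fix t assume "t \<in> carrier X"
      then show "\<phi> t = comp X (hzero mod_zero mod_zero) \<phi> t"
        using Hom_closed[OF \<phi>(1), of t] by (simp add: compose_eq mod_zero_simps)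
    qed (use \<phi> in \<open>simp_all add: Hom_extensional\<close>)
    then show ?thesis using x(4)[OF assms(3) \<phi>(1)] \<phi> by blast
  qed
  then show ?thesis using assms by auto
qed

sublocale funs: exact_category "mod_mod \<Lambda>"
proof (rule exact_category.intro, goal_cases)
  case (1 X Y)
  then show ?case by (simp add: nat_trans_comm_group)
next
  case (2 X)
  then show ?case by (simp add: mod_mod_simps nid_nat_trans)
next
  case (3 X Y Z f g)
  then show ?case by (auto simp: mod_mod_simps intro: ncomp_nat_trans)
next
  case (4 F G \<eta>)
  then have \<eta>: "\<eta> \<in> nat_trans \<Lambda> F G" and F: "presheaf F" "presheaf G" by (simp_all add: mod_mod_simps)
  show ?case
    unfolding mod_mod_simps
    by (rule nat_trans_eqI[OF ncomp_nat_trans[OF F(1) \<eta> nid_nat_trans[OF F(2)]] \<eta>]) (simp add: nat_transD(3)[OF \<eta>])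
next
  case (5 F G \<eta>)
  then have \<eta>: "\<eta> \<in> nat_trans \<Lambda> F G" and F: "presheaf F" by (simp_all add: mod_mod_simps)
  show ?case
    unfolding mod_mod_simps
    by (rule nat_trans_eqI[OF ncomp_nat_trans[OF F(1) nid_nat_trans[OF F] \<eta>] \<eta>]) simp
next
  case (6 F G H K \<eta> \<theta> \<zeta>)
  then have h: "\<eta> \<in> nat_trans \<Lambda> F G" "\<theta> \<in> nat_trans \<Lambda> G H" "\<zeta> \<in> nat_trans \<Lambda> H K"
    and F: "presheaf F" "presheaf G" by (simp_all add: mod_mod_simps)
  show ?case
    unfolding mod_mod_simps
    by (rule nat_trans_eqI[of _ F K _ K]; (intro ncomp_nat_trans[OF F(1) h(1)] ncomp_nat_trans[OF F(2) h(2,3)]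
          ncomp_nat_trans[OF F(1) ncomp_nat_trans[OF F(1) h(1,2)] h(3)])?) (simp add: nat_transD(3)[OF h(1)])
next
  case (7 F G H \<eta> \<theta> \<theta>')
  then have h: "\<eta> \<in> nat_trans \<Lambda> F G" "\<theta> \<in> nat_trans \<Lambda> G H" "\<theta>' \<in> nat_trans \<Lambda> G H"
    and F: "presheaf F" "presheaf G" "presheaf H" by (simp_all add: mod_mod_simps)
  show ?case
    unfolding mod_mod_simps
    by (rule nat_trans_eqI[of _ F H _ H]; (intro ncomp_nat_trans[OF F(1) h(1)] nadd_nat_trans F h)?)
       (simp add: nat_transD(3)[OF h(1)])
next
  case (8 F G H \<eta> \<eta>' \<theta>)
  then have h: "\<eta> \<in> nat_trans \<Lambda> F G" "\<eta>' \<in> nat_trans \<Lambda> F G" "\<theta> \<in> nat_trans \<Lambda> G H"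
    and F: "presheaf F" "presheaf G" "presheaf H" by (simp_all add: mod_mod_simps)
  show ?case
    unfolding mod_mod_simps
    by (rule nat_trans_eqI[of _ F H _ H];
        (intro ncomp_nat_trans[OF F(1) nadd_nat_trans[OF F(1,2) h(1,2)] h(3)] ncomp_nat_trans[OF F(1) h(1,3)]
          ncomp_nat_trans[OF F(1) h(2,3)] nadd_nat_trans F h)?)
       (simp add: nat_transD(3)[OF h(1)] nat_transD(3)[OF h(2)] nat_transD(4)[OF h(3)])
next
  case (9 N i E p M)
  then show ?case using functor_sesD(1,2) by (simp add: mod_mod_simps) blast
next
  case (10 N i E p M)
  then have S: "functor_ses \<Lambda> N i E p M" and F: "presheaf N" "presheaf M" by (simp_all add: mod_mod_simps)
  show ?case
    unfolding mod_mod_simps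
    by (rule nat_trans_eqI[OF ncomp_nat_trans[OF F(1) functor_sesD(1,2)[OF S]] nzero_nat_trans[OF F]])
      (simp add: functor_sesD(6)[OF S])
next
  case (11 N i E p M X f f')
  then have S: "functor_ses \<Lambda> N i E p M" and h: "f \<in> nat_trans \<Lambda> X N" "f' \<in> nat_trans \<Lambda> X N"
    and eq: "ncomp X i f = ncomp X i f'" by (simp_all add: mod_mod_simps)
  show ?case
  proof (rule nat_trans_eqI[OF h])
    fix Y x assume x: "Y \<in> fg" "x \<in> val X Y"
    have "i Y (f Y x) = i Y (f' Y x)" using eq x by (metis ncomp_apply)
    then show "f Y x = f' Y x"
      by (rule inj_onD[OF functor_sesD(3)[OF S x(1)]]) (simp_all add: nat_transD(3)[OF h(1) x] nat_transD(3)[OF h(2) x])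
  qed
next
  case (12 N i E p M X f f')
  then have S: "functor_ses \<Lambda> N i E p M" and h: "f \<in> nat_trans \<Lambda> M X" "f' \<in> nat_trans \<Lambda> M X"
    and eq: "ncomp E f p = ncomp E f' p" by (simp_all add: mod_mod_simps)
  show ?case
  proof (rule nat_trans_eqI[OF h])
    fix Y x assume x: "Y \<in> fg" "x \<in> val M Y"
    then obtain y where "y \<in> val E Y" "p Y y = x" using functor_sesD(7)[OF S x] by blast
    then show "f Y x = f' Y x" using eq x(1) by (metis ncomp_apply)
  qed
next
  case (13 N i E p M X g)
  then have S: "functor_ses \<Lambda> N i E p M" and F: "presheaf N" "presheaf E" "presheaf X" and g: "g \<in> nat_trans \<Lambda> X E"
    and eq: "ncomp X p g = nzero X M" by (simp_all add: mod_mod_simps)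
  have "p Y (g Y x) = \<one>\<^bsub>fob M Y\<^esub>" if "Y \<in> fg" "x \<in> val X Y" for Y x
    using eq that by (metis ncomp_apply nzero_apply)
  then obtain \<theta> where \<theta>: "\<theta> \<in> nat_trans \<Lambda> X N" "\<And>Y x. \<lbrakk>Y \<in> fg; x \<in> val X Y\<rbrakk> \<Longrightarrow> i Y (\<theta> Y x) = g Y x"
    using functor_ses_kernel[OF S F g] by blast
  have "ncomp X i \<theta> = g"
    by (rule nat_trans_eqI[OF ncomp_nat_trans[OF F(3) \<theta>(1) functor_sesD(1)[OF S]] g]) (simp add: \<theta>)
  then show ?case unfolding mod_mod_simps using \<theta>(1) by blast
next
  case (14 N i E p M X g)
  then have S: "functor_ses \<Lambda> N i E p M" and F: "presheaf E" "presheaf M" "presheaf X" and g: "g \<in> nat_trans \<Lambda> E X"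
    and eq: "ncomp N g i = nzero N X" by (simp_all add: mod_mod_simps)
  have "g Y (i Y x) = \<one>\<^bsub>fob X Y\<^esub>" if "Y \<in> fg" "x \<in> val N Y" for Y x
    using eq that by (metis ncomp_apply nzero_apply)
  then obtain \<theta> where \<theta>: "\<theta> \<in> nat_trans \<Lambda> M X" "\<And>Y x. \<lbrakk>Y \<in> fg; x \<in> val E Y\<rbrakk> \<Longrightarrow> \<theta> Y (p Y x) = g Y x"
    using functor_ses_cokernel[OF S F g] by blast
  have "ncomp E \<theta> p = g"
    by (rule nat_trans_eqI[OF ncomp_nat_trans[OF F(1) functor_sesD(2)[OF S] \<theta>(1)] g]) (simp add: \<theta>)
  then show ?case unfolding mod_mod_simps using \<theta>(1) by blast
next
  case 15
  let ?Z = "Phi \<Lambda> (zero_map_to mod_zero)"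
  have ob: "zero_map_to mod_zero \<in> maps_ob \<Lambda>" by simp
  obtain x where "presents (zero_map_to mod_zero) ?Z x" using Phi_presents_ex[OF ob] by blast
  then have Z: "val ?Z X = {\<one>\<^bsub>fob ?Z X\<^esub>}" if "X \<in> fg" for X
    using zero_presented[OF Phi_presheaf[OF ob]] that by blast
  have pZ: "presheaf ?Z" and Zob: "?Z \<in> fun_ob" using ob Phi_presheaf Phi_fun_ob by blast+
  have "zero_object (mod_mod \<Lambda>) ?Z"
    unfolding zero_object_def mod_mod_simps(4,5)
    using Zob nat_trans_eqI[OF nid_nat_trans[OF pZ] nzero_nat_trans[OF pZ pZ]] Z by simp
  moreover have "(?Z, nzero ?Z X, X, nid X, X) \<in> Ses (mod_mod \<Lambda>)" if X: "X \<in> fun_ob" for X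
    unfolding mod_mod_simps(7)
  proof (intro conjI X Zob functor_sesI)
    have pX: "presheaf X" using X by simp
    show "nzero ?Z X \<in> nat_trans \<Lambda> ?Z X" "nid X \<in> nat_trans \<Lambda> X X" "presheaf ?Z" "presheaf X" "presheaf X"
      using pZ pX nzero_nat_trans nid_nat_trans by blast+
    fix Y assume Y: "Y \<in> fg"
    show "z = \<one>\<^bsub>fob ?Z Y\<^esub>" if "z \<in> val ?Z Y" for z using Z[OF Y] that by simp
    show "nid X Y (nzero ?Z X Y z) = \<one>\<^bsub>fob X Y\<^esub>" if "z \<in> val ?Z Y" for z using Y that pX by simp
    show "\<exists>y \<in> val X Y. nid X Y y = z" if "z \<in> val X Y" for z using Y that by auto
    show "\<exists>x \<in> val ?Z Y. nzero ?Z X Y x = y" if "y \<in> val X Y" "nid X Y y = \<one>\<^bsub>fob X Y\<^esub>" for y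
      using Y that pZ by (intro bexI[of _ "\<one>\<^bsub>fob ?Z Y\<^esub>"]) simp_all
  qed
  ultimately show ?case unfolding mod_mod_simps(5) by blast
qed

end

section \<open>Functors of projective dimension at most one\<close>

context artin_algebra_modules
begin

text \<open>The hypotheses on \<open>\<eta>\<close> make it an isomorphism at each module.\<close>

lemma presents_transfer:
  assumes F: "presheaf F" and G: "presheaf G" and A: "(A1, A0, f) \<in> maps_ob \<Lambda>" and x: "presents (A1, A0, f) F x"
    and \<eta>: "\<eta> \<in> nat_trans \<Lambda> F G" and inj: "\<And>X z. \<lbrakk>X \<in> fg; z \<in> val F X; \<eta> X z = \<one>\<^bsub>fob G X\<^esub>\<rbrakk> \<Longrightarrow> z = \<one>\<^bsub>fob F X\<^esub>"
    and onto: "\<And>X w. \<lbrakk>X \<in> fg; w \<in> val G X\<rbrakk> \<Longrightarrow> \<exists>z \<in> val F X. \<eta> X z = w"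
  shows "presents (A1, A0, f) G (\<eta> A0 x)"
proof -
  note x' = presentsD[OF x] and h = nat_transD[OF \<eta>]
  have A0: "A0 \<in> fg" using A by simp
  have far: "far G X A0 \<phi> (\<eta> A0 x) = \<eta> X (far F X A0 \<phi> x)" if "X \<in> fg" "\<phi> \<in> Hom X A0" for X \<phi>
    using h(5)[OF that(1) A0 that(2) x'(1)] by simp
  have cl: "far F X A0 \<phi> x \<in> val F X" if "X \<in> fg" "\<phi> \<in> Hom X A0" for X \<phi>
    using far_closed[OF F that(1) A0 that(2) x'(1)] .
  show ?thesis
    unfolding presents_def prod.case
  proof (intro conjI ballI)
    show "\<eta> A0 x \<in> val G A0" using h(3)[OF A0 x'(1)] .
    fix X assume X: "X \<in> fg"
    show "\<exists>\<phi> \<in> Hom X A0. w = far G X A0 \<phi> (\<eta> A0 x)" if "w \<in> val G X" for w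
    proof -
      obtain z where z: "z \<in> val F X" "\<eta> X z = w" using onto[OF X \<open>w \<in> _\<close>] by blast
      obtain \<phi> where "\<phi> \<in> Hom X A0" "z = far F X A0 \<phi> x" using x'(2)[OF X z(1)] by blast
      then show ?thesis using z far[OF X] by auto
    qed
    fix \<phi> assume \<phi>: "\<phi> \<in> Hom X A0"
    show "far G X A0 \<phi> (\<eta> A0 x) = \<one>\<^bsub>fob G X\<^esub> \<longleftrightarrow> (\<exists>\<theta> \<in> Hom X A1. \<phi> = comp X f \<theta>)"
      unfolding far[OF X \<phi>] x'(4)[OF X \<phi>, symmetric]
      using inj[OF X cl[OF X \<phi>]] nat_trans_one[OF F G \<eta> X] by auto
    fix \<psi> assume \<psi>: "\<psi> \<in> Hom X A0"
    show "far G X A0 (hadd X A0 \<phi> \<psi>) (\<eta> A0 x) = far G X A0 \<phi> (\<eta> A0 x) \<otimes>\<^bsub>fob G X\<^esub> far G X A0 \<psi> (\<eta> A0 x)"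
      using far[OF X] \<phi> \<psi> X A0 x'(3)[OF X \<phi> \<psi>] h(4)[OF X cl[OF X \<phi>] cl[OF X \<psi>]] by simp
  qed
qed

lemma isomorphic_presents:
  assumes F: "presheaf F" and G: "presheaf G" and iso: "isomorphic (mod_mod \<Lambda>) F G"
    and A: "A \<in> maps_ob \<Lambda>" and x: "presents A F x"
  shows "\<exists>y. presents A G y"
proof -
  obtain A1 A0 f where A_eq: "A = (A1, A0, f)" by (metis prod_cases3)
  obtain \<eta> \<theta> where \<eta>: "\<eta> \<in> nat_trans \<Lambda> F G" and \<theta>: "\<theta> \<in> nat_trans \<Lambda> G F"
    and eq: "ncomp F \<theta> \<eta> = nid F" "ncomp G \<eta> \<theta> = nid G"
    using iso unfolding isomorphic_def mod_mod_simps by blast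
  have 1: "\<theta> X (\<eta> X z) = z" if "X \<in> fg" "z \<in> val F X" for X z using eq(1) that by (metis ncomp_apply nid_apply)
  have 2: "\<eta> X (\<theta> X z) = z" if "X \<in> fg" "z \<in> val G X" for X z using eq(2) that by (metis ncomp_apply nid_apply)
  have "presents (A1, A0, f) G (\<eta> A0 x)"
  proof (rule presents_transfer[OF F G A[unfolded A_eq] x[unfolded A_eq] \<eta>])
    fix X z assume X: "X \<in> fg" "z \<in> val F X" and "\<eta> X z = \<one>\<^bsub>fob G X\<^esub>"
    then show "z = \<one>\<^bsub>fob F X\<^esub>" using 1[OF X] nat_trans_one[OF G F \<theta> X(1)] by simp
  next
    fix X w assume X: "X \<in> fg" "w \<in> val G X"
    then show "\<exists>z \<in> val F X. \<eta> X z = w" using 2[OF X] nat_transD(3)[OF \<theta> X] by blast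
  qed
  then show ?thesis unfolding A_eq by blast
qed

text \<open>By the Yoneda lemma there are morphisms that exchange the two generators. Their composites fix the
  generators, so they are identities.\<close>

lemma presents_isomorphic:
  assumes F: "F \<in> fun_ob" and G: "G \<in> fun_ob" and A: "A \<in> maps_ob \<Lambda>" and x: "presents A F x" and y: "presents A G y"
  shows "isomorphic (mod_mod \<Lambda>) F G"
proof -
  obtain A1 A0 f where A_eq: "A = (A1, A0, f)" by (metis prod_cases3)
  note A = A[unfolded A_eq] and x = x[unfolded A_eq] and y = y[unfolded A_eq]
  have A': "A1 \<in> fg" "A0 \<in> fg" "f \<in> Hom A1 A0" using A by simp_all
  have pF: "presheaf F" and pG: "presheaf G" using F G by simp_all
  have 1: "far F A1 A0 f x = \<one>\<^bsub>fob F A1\<^esub>" "far G A1 A0 f y = \<one>\<^bsub>fob G A1\<^esub>"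
    using presentsD(4)[OF x A'(1,3)] presentsD(4)[OF y A'(1,3)] comp_id(2)[OF A'(3)] mod_id_Hom[OF A'(1)] by metis+
  obtain \<eta> where \<eta>: "\<eta> \<in> nat_trans \<Lambda> F G" "\<eta> A0 x = y"
    using presents_yoneda[OF pF A x pG fun_ob_additive[OF G] presentsD(1)[OF y] 1(2)] by metis
  obtain \<theta> where \<theta>: "\<theta> \<in> nat_trans \<Lambda> G F" "\<theta> A0 y = x"
    using presents_yoneda[OF pG A y pF fun_ob_additive[OF F] presentsD(1)[OF x] 1(1)] by metis
  have "ncomp F \<theta> \<eta> = nid F"
    by (rule nat_trans_presented_eq[OF pF A x ncomp_nat_trans[OF pF \<eta>(1) \<theta>(1)] nid_nat_trans[OF pF]])
      (use A' presentsD(1)[OF x] \<eta> \<theta> in simp)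
  moreover have "ncomp G \<eta> \<theta> = nid G"
    by (rule nat_trans_presented_eq[OF pG A y ncomp_nat_trans[OF pG \<theta>(1) \<eta>(1)] nid_nat_trans[OF pG]])
      (use A' presentsD(1)[OF y] \<eta> \<theta> in simp)
  ultimately show ?thesis
    unfolding isomorphic_def mod_mod_simps using \<eta>(1) \<theta>(1) by blast
qed

text \<open>The values of \<open>(-, A)\<close> are groups of maps, whereas the values of the functors in \<open>mod (mod \<Lambda>)\<close> are
  groups of sets of maps. A functor presented by \<open>0 \<rightarrow> A\<close> takes the place of \<open>(-, A)\<close> there.\<close>

lemma free_zero_iff:
  assumes "presents (zero_map_to A) Q q" "A \<in> fg" "X \<in> fg" "\<phi> \<in> Hom X A"
  shows "far Q X A \<phi> q = \<one>\<^bsub>fob Q X\<^esub> \<longleftrightarrow> \<phi> = hzero X A"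
proof -
  have "comp X (hzero mod_zero A) \<theta> = hzero X A" if "\<theta> \<in> Hom X mod_zero" for \<theta>
    using that assms by simp
  then show ?thesis
    using presentsD(4)[OF assms(1)[unfolded zero_map_to_simps] assms(3,4)] hzero_Hom[OF assms(3) mod_zero_fg] by metis
qed

lemma free_projective:
  assumes Q: "Q \<in> fun_ob" and A: "A \<in> fg" and q: "presents (zero_map_to A) Q q"
  shows "projective (mod_mod \<Lambda>) Q"
  unfolding projective_def mod_mod_simps(2,6)
proof (intro conjI allI impI ballI Q)
  fix N i E p M h
  assume "(N, i, E, p, M) \<in> Ses (mod_mod \<Lambda>)" and h: "h \<in> nat_trans \<Lambda> Q M"
  then have E: "E \<in> fun_ob" and SES: "functor_ses \<Lambda> N i E p M" by (simp_all only: mod_mod_simps(7))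
  have pQ: "presheaf Q" and pE: "presheaf E" using Q E by simp_all
  have ob: "(mod_zero, A, hzero mod_zero A) \<in> maps_ob \<Lambda>" using A by simp
  note q' = q[unfolded zero_map_to_simps]
  have hq: "h A q \<in> val M A" using nat_transD(3)[OF h A presentsD(1)[OF q']] .
  obtain e where e: "e \<in> val E A" "p A e = h A q" using functor_sesD(7)[OF SES A hq] by blast
  obtain g where g: "g \<in> nat_trans \<Lambda> Q E" "g A q = e"
    using presents_yoneda[OF pQ ob q' pE fun_ob_additive[OF E] e(1)
        additive_far_zero[OF pE fun_ob_additive[OF E] mod_zero_fg A e(1)]] by metis
  have "ncomp Q p g = h"
    by (rule nat_trans_presented_eq[OF pQ ob q' ncomp_nat_trans[OF pQ g(1) functor_sesD(2)[OF SES]] h])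
      (use A presentsD(1)[OF q'] g e in simp)
  then show "\<exists>g \<in> nat_trans \<Lambda> Q E. ncomp Q p g = h" using g by blast
qed

text \<open>The kernel of the epimorphism \<open>(-, A0) \<rightarrow> P\<close> is the image of \<open>(-, f)\<close>, the quotient of \<open>(-, A1)\<close> by
  the maps that \<open>f\<close> annihilates. If \<open>k\<close> is a weak kernel of \<open>f\<close>, these are the maps that factor through
  \<open>k\<close>, so the quotient is presented by \<open>k\<close>.\<close>

lemma ses_of_presentations:
  assumes P: "presheaf P" "(A1, A0, f) \<in> maps_ob \<Lambda>" "presents (A1, A0, f) P x"
    and Q: "presheaf Q" "presents (zero_map_to A0) Q q"
    and N: "presheaf N" "(K1, A1, k) \<in> maps_ob \<Lambda>" "presents (K1, A1, k) N n"
    and ker: "\<And>X \<phi>. \<lbrakk>X \<in> fg; \<phi> \<in> Hom X A1\<rbrakk> \<Longrightarrow> comp X f \<phi> = hzero X A0 \<longleftrightarrow> (\<exists>\<theta> \<in> Hom X K1. \<phi> = comp X k \<theta>)"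
  obtains \<iota> \<beta> where "functor_ses \<Lambda> N \<iota> Q \<beta> P" "\<beta> A0 q = x" "\<iota> A1 n = far Q A1 A0 f q"
proof -
  have A: "A1 \<in> fg" "A0 \<in> fg" and f: "f \<in> Hom A1 A0" and K: "K1 \<in> fg" and k: "k \<in> Hom K1 A1" using P(2) N(2) by simp_all
  have obQ: "(mod_zero, A0, hzero mod_zero A0) \<in> maps_ob \<Lambda>" using A by simp
  note x' = presentsD[OF P(3)] and q0 = Q(2)[unfolded zero_map_to_simps] and n' = presentsD[OF N(3)]
  note q' = presentsD[OF q0]
  have addP: "additive P" using presents_additive[OF P] .
  have addQ: "additive Q" using presents_additive[OF Q(1) obQ q0] .
  obtain \<beta> where \<beta>: "\<beta> \<in> nat_trans \<Lambda> Q P" "\<beta> A0 q = x"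
    and bx: "\<And>X \<phi>. \<lbrakk>X \<in> fg; \<phi> \<in> Hom X A0\<rbrakk> \<Longrightarrow> \<beta> X (far Q X A0 \<phi> q) = far P X A0 \<phi> x"
    using presents_yoneda[OF Q(1) obQ q0 P(1) addP x'(1) additive_far_zero[OF P(1) addP mod_zero_fg A(2) x'(1)]] by metis
  have fk: "comp K1 f k = hzero K1 A0"
    using ker[OF K k] comp_id(2)[OF k] mod_id_Hom[OF K] by metis
  let ?y = "far Q A1 A0 f q"
  have y: "?y \<in> val Q A1" using far_closed[OF Q(1) A f q'(1)] .
  have yk: "far Q X A1 \<phi> ?y = far Q X A0 (comp X f \<phi>) q" if "X \<in> fg" "\<phi> \<in> Hom X A1" for X \<phi>
    using far_comp[OF Q(1) that(1) A that(2) f q'(1)] by simp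
  have "far Q K1 A1 k ?y = \<one>\<^bsub>fob Q K1\<^esub>"
    using yk[OF K k] fk additive_far_zero[OF Q(1) addQ K A(2) q'(1)] by simp
  then obtain \<iota> where \<iota>: "\<iota> \<in> nat_trans \<Lambda> N Q" "\<iota> A1 n = ?y"
    and ix: "\<And>X \<phi>. \<lbrakk>X \<in> fg; \<phi> \<in> Hom X A1\<rbrakk> \<Longrightarrow> \<iota> X (far N X A1 \<phi> n) = far Q X A1 \<phi> ?y"
    using presents_yoneda[OF N Q(1) addQ y] by metis
  have f_Hom: "comp X f \<phi> \<in> Hom X A0" if "X \<in> fg" "\<phi> \<in> Hom X A1" for X \<phi>
    using comp_Hom[OF that f] .
  have "functor_ses \<Lambda> N \<iota> Q \<beta> P"
  proof (rule functor_sesI[OF \<iota>(1) \<beta>(1) N(1) Q(1) P(1)])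
    fix X z assume X: "X \<in> fg" and z: "z \<in> val N X"
    obtain \<phi> where \<phi>: "\<phi> \<in> Hom X A1" "z = far N X A1 \<phi> n" using n'(2)[OF X z] by blast
    have \<iota>z: "\<iota> X z = far Q X A0 (comp X f \<phi>) q" using ix[OF X \<phi>(1)] yk[OF X \<phi>(1)] \<phi>(2) by simp
    show "\<beta> X (\<iota> X z) = \<one>\<^bsub>fob P X\<^esub>"
      unfolding \<iota>z bx[OF X f_Hom[OF X \<phi>(1)]] using x'(4)[OF X f_Hom[OF X \<phi>(1)]] \<phi>(1) by blast
    assume "\<iota> X z = \<one>\<^bsub>fob Q X\<^esub>"
    then have "comp X f \<phi> = hzero X A0"
      using free_zero_iff[OF Q(2) A(2) X f_Hom[OF X \<phi>(1)]] \<iota>z by simp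
    then show "z = \<one>\<^bsub>fob N X\<^esub>" using ker[OF X \<phi>(1)] n'(4)[OF X \<phi>(1)] \<phi>(2) by simp
  next
    fix X z assume X: "X \<in> fg" and z: "z \<in> val P X"
    obtain \<phi> where \<phi>: "\<phi> \<in> Hom X A0" "z = far P X A0 \<phi> x" using x'(2)[OF X z] by blast
    then show "\<exists>y \<in> val Q X. \<beta> X y = z" using bx[OF X \<phi>(1)] far_closed[OF Q(1) X A(2) \<phi>(1) q'(1)] by blast
  next
    fix X z assume X: "X \<in> fg" and z: "z \<in> val Q X" and 1: "\<beta> X z = \<one>\<^bsub>fob P X\<^esub>"
    obtain \<phi> where \<phi>: "\<phi> \<in> Hom X A0" "z = far Q X A0 \<phi> q" using q'(2)[OF X z] by blast
    then obtain \<theta> where \<theta>: "\<theta> \<in> Hom X A1" "\<phi> = comp X f \<theta>" using x'(4)[OF X \<phi>(1)] bx[OF X \<phi>(1)] 1 by auto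
    have "\<iota> X (far N X A1 \<theta> n) = z" using ix[OF X \<theta>(1)] yk[OF X \<theta>(1)] \<theta>(2) \<phi>(2) by simp
    then show "\<exists>x \<in> val N X. \<iota> X x = z" using far_closed[OF N(1) X A(1) \<theta>(1) n'(1)] by blast
  qed
  then show thesis using that \<beta>(2) \<iota>(2) by blast
qed

lemma free_exists:
  assumes "A \<in> fg" obtains Q q where "Q \<in> fun_ob" "presents (zero_map_to A) Q q"
proof -
  have "zero_map_to A \<in> maps_ob \<Lambda>" using assms by simp
  then show thesis using that Phi_fun_ob Phi_presents_ex by blast
qed

lemma mono_kernel_zero:
  assumes A: "(A1, A0, f) \<in> maps_ob \<Lambda>" and inj: "inj_on f (carrier A1)" and X: "X \<in> fg" and \<phi>: "\<phi> \<in> Hom X A1"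
  shows "comp X f \<phi> = hzero X A0 \<longleftrightarrow> \<phi> = hzero X A1"
proof
  have A': "A1 \<in> fg" "A0 \<in> fg" "f \<in> Hom A1 A0" using A by simp_all
  show "\<phi> = hzero X A1" if "comp X f \<phi> = hzero X A0"
    by (rule injective_comp_cancel[OF inj \<phi> hzero_Hom[OF X A'(1)]]) (use that A' X in simp)
  show "comp X f \<phi> = hzero X A0" if "\<phi> = hzero X A1" using that A' X by simp
qed

lemma mono_presented_resolution:
  assumes F: "F \<in> fun_ob" and A: "(A1, A0, f) \<in> maps_ob \<Lambda>" and inj: "inj_on f (carrier A1)"
    and x: "presents (A1, A0, f) F x"
  obtains N n Q q \<iota> \<beta> where "N \<in> fun_ob" "presents (zero_map_to A1) N n" "Q \<in> fun_ob" "presents (zero_map_to A0) Q q"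
    "functor_ses \<Lambda> N \<iota> Q \<beta> F" "\<beta> A0 q = x" "\<iota> A1 n = far Q A1 A0 f q"
proof -
  have A': "A1 \<in> fg" "A0 \<in> fg" using A by simp_all
  have ob: "(mod_zero, A1, hzero mod_zero A1) \<in> maps_ob \<Lambda>" using A' by simp
  obtain N n where N: "N \<in> fun_ob" and n: "presents (zero_map_to A1) N n" using free_exists[OF A'(1)] .
  obtain Q q where Q: "Q \<in> fun_ob" and q: "presents (zero_map_to A0) Q q" using free_exists[OF A'(2)] .
  have ker: "comp X f \<phi> = hzero X A0 \<longleftrightarrow> (\<exists>\<theta> \<in> Hom X mod_zero. \<phi> = comp X (hzero mod_zero A1) \<theta>)"
    if X: "X \<in> fg" and \<phi>: "\<phi> \<in> Hom X A1" for X \<phi>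
  proof -
    have "comp X (hzero mod_zero A1) \<theta> = hzero X A1" if "\<theta> \<in> Hom X mod_zero" for \<theta> using that A' X by simp
    then show ?thesis
      unfolding mono_kernel_zero[OF A inj X \<phi>] using hzero_Hom[OF X mod_zero_fg] by metis
  qed
  obtain \<iota> \<beta> where "functor_ses \<Lambda> N \<iota> Q \<beta> F" "\<beta> A0 q = x" "\<iota> A1 n = far Q A1 A0 f q"
    using ses_of_presentations[OF fun_ob_presheaf[OF F] A x fun_ob_presheaf[OF Q] q fun_ob_presheaf[OF N]
        ob n[unfolded zero_map_to_simps] ker] by blast
  then show thesis using that N n Q q by blast
qed

text \<open>\<open>0 \<rightarrow> (-, A1) \<rightarrow> (-, A0) \<rightarrow> F \<rightarrow> 0\<close> is a projective resolution. By the Yoneda lemma, the first Ext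
  group of \<open>F\<close> and \<open>G\<close> vanishes if and only if \<open>f\<close> acts as a surjection \<open>G A0 \<rightarrow> G A1\<close>. Representing
  the elements of \<open>G A0\<close> and \<open>G A1\<close> by maps into \<open>B0\<close>, unique up to maps that factor through \<open>g\<close>, turns
  this into the stated condition.\<close>

lemma
  assumes F: "F \<in> fun_ob" and A: "(A1, A0, f) \<in> maps_ob \<Lambda>" and inj: "inj_on f (carrier A1)"
    and x: "presents (A1, A0, f) F x"
  shows pdim_presented_by_mono: "pdim (mod_mod \<Lambda>) F \<le> 1"
    and Ext1_presented_by_mono: "\<lbrakk>G \<in> fun_ob; (B1, B0, g) \<in> maps_ob \<Lambda>; presents (B1, B0, g) G y\<rbrakk>
      \<Longrightarrow> trivial_group (Ext (mod_mod \<Lambda>) 1 F G) \<longleftrightarrow> ext_vanishes (A1, A0, f) (B1, B0, g)"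
proof -
  have A' [simp]: "A1 \<in> fg" "A0 \<in> fg" and f: "f \<in> Hom A1 A0" using A by simp_all
  obtain N n Q q \<iota> \<beta> where N: "N \<in> fun_ob" and n: "presents (zero_map_to A1) N n" and Q: "Q \<in> fun_ob"
    and q: "presents (zero_map_to A0) Q q" and S: "functor_ses \<Lambda> N \<iota> Q \<beta> F" and \<iota>n: "\<iota> A1 n = far Q A1 A0 f q"
    using mono_presented_resolution[OF F A inj x] by metis
  have SES: "(N, \<iota>, Q, \<beta>, F) \<in> Ses (mod_mod \<Lambda>)" using N Q F S by (simp add: mod_mod_simps)
  have PN: "projective (mod_mod \<Lambda>) N" and PQ: "projective (mod_mod \<Lambda>) Q"
    using free_projective[OF N A'(1) n] free_projective[OF Q A'(2) q] by auto
  show "pdim (mod_mod \<Lambda>) F \<le> 1"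
    unfolding funs.pdim_le_1_iff using SES PN PQ by blast
  assume G: "G \<in> fun_ob" and B: "(B1, B0, g) \<in> maps_ob \<Lambda>" and y: "presents (B1, B0, g) G y"
  have B' [simp]: "B1 \<in> fg" "B0 \<in> fg" and g: "g \<in> Hom B1 B0" using B by simp_all
  have pN: "presheaf N" and pQ: "presheaf Q" and pG: "presheaf G" using N Q G by simp_all
  have addG: "additive G" using fun_ob_additive[OF G] .
  have obN: "(mod_zero, A1, hzero mod_zero A1) \<in> maps_ob \<Lambda>" and obQ: "(mod_zero, A0, hzero mod_zero A0) \<in> maps_ob \<Lambda>" by simp_all
  note n0 = n[unfolded zero_map_to_simps] and q0 = q[unfolded zero_map_to_simps] and y' = presentsD[OF y]
  note n' = presentsD[OF n0] and q' = presentsD[OF q0]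
  have "funs.extends N \<iota> Q G \<longleftrightarrow> (\<forall>w \<in> val G A1. \<exists>w' \<in> val G A0. far G A1 A0 f w' = w)"
    unfolding funs.extends_def mod_mod_simps
  proof (intro iffI ballI)
    fix w assume ext: "\<forall>\<phi> \<in> nat_trans \<Lambda> N G. \<exists>\<psi> \<in> nat_trans \<Lambda> Q G. ncomp N \<psi> \<iota> = \<phi>" and w: "w \<in> val G A1"
    obtain \<phi> where \<phi>: "\<phi> \<in> nat_trans \<Lambda> N G" "\<phi> A1 n = w"
      using presents_yoneda[OF pN obN n0 pG addG w additive_far_zero[OF pG addG mod_zero_fg A'(1) w]] by metis
    obtain \<psi> where \<psi>: "\<psi> \<in> nat_trans \<Lambda> Q G" "ncomp N \<psi> \<iota> = \<phi>" using ext \<phi>(1) by blast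
    have "w = \<psi> A1 (\<iota> A1 n)" using \<psi>(2) \<phi>(2) n'(1) by (metis A'(1) ncomp_apply)
    also have "\<dots> = far G A1 A0 f (\<psi> A0 q)"
      unfolding \<iota>n by (rule nat_transD(5)[OF \<psi>(1) A' f q'(1)])
    finally show "\<exists>w' \<in> val G A0. far G A1 A0 f w' = w" using nat_transD(3)[OF \<psi>(1) A'(2) q'(1)] by auto
  next
    fix \<phi> assume ext: "\<forall>w \<in> val G A1. \<exists>w' \<in> val G A0. far G A1 A0 f w' = w" and \<phi>: "\<phi> \<in> nat_trans \<Lambda> N G"
    obtain w' where w': "w' \<in> val G A0" "far G A1 A0 f w' = \<phi> A1 n"
      using ext nat_transD(3)[OF \<phi> A'(1) n'(1)] by blast
    obtain \<psi> where \<psi>: "\<psi> \<in> nat_trans \<Lambda> Q G" "\<psi> A0 q = w'"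
      using presents_yoneda[OF pQ obQ q0 pG addG w'(1) additive_far_zero[OF pG addG mod_zero_fg A'(2) w'(1)]] by metis
    have "ncomp N \<psi> \<iota> = \<phi>"
      by (rule nat_trans_presented_eq[OF pN obN n0 ncomp_nat_trans[OF pN functor_sesD(1)[OF S] \<psi>(1)] \<phi>])
        (use n'(1) \<iota>n nat_transD(5)[OF \<psi>(1) A' f q'(1)] \<psi>(2) w' in simp)
    then show "\<exists>\<psi> \<in> nat_trans \<Lambda> Q G. ncomp N \<psi> \<iota> = \<phi>" using \<psi>(1) by blast
  qed
  also have "\<dots> \<longleftrightarrow> ext_vanishes (A1, A0, f) (B1, B0, g)"
    unfolding ext_vanishes_def prod.case
  proof (intro iffI ballI)
    fix \<phi> assume ext: "\<forall>w \<in> val G A1. \<exists>w' \<in> val G A0. far G A1 A0 f w' = w" and \<phi>: "\<phi> \<in> Hom A1 B0"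
    have "far G A1 B0 \<phi> y \<in> val G A1" using far_closed[OF pG A'(1) B'(2) \<phi> y'(1)] .
    then obtain w' where w': "w' \<in> val G A0" "far G A1 A0 f w' = far G A1 B0 \<phi> y" using ext by blast
    obtain \<psi> where \<psi>: "\<psi> \<in> Hom A0 B0" "w' = far G A0 B0 \<psi> y" using y'(2)[OF A'(2) w'(1)] by blast
    have \<psi>f: "comp A1 \<psi> f \<in> Hom A1 B0" using comp_Hom[OF A'(1) f \<psi>(1)] .
    have eq: "far G A1 B0 (comp A1 \<psi> f) y = far G A1 B0 \<phi> y"
      using far_comp[OF pG A' B'(2) f \<psi>(1) y'(1)] w' \<psi>(2) by simp
    let ?d = "hadd A1 B0 \<phi> (hneg A1 B0 (comp A1 \<psi> f))"
    have d: "?d \<in> Hom A1 B0" using \<phi> \<psi>f by simp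
    interpret GA: group "fob G A1" using pG by (simp add: val_group)
    have "far G A1 B0 ?d y = \<one>\<^bsub>fob G A1\<^esub>"
      using \<phi> \<psi>f y'(1) eq pG by (simp add: additiveD[OF addG] additive_far_neg[OF pG addG])
    then obtain \<theta> where \<theta>: "\<theta> \<in> Hom A1 B1" "?d = comp A1 g \<theta>" using y'(4)[OF A'(1) d] by blast
    interpret H: comm_group "mod_hom \<Lambda> A1 B0" by (simp add: Hom_comm_group)
    have "\<phi> = hadd A1 B0 (comp A1 \<psi> f) ?d" using \<phi> \<psi>f by (simp add: H.m_lcomm[of "comp A1 \<psi> f" \<phi>])
    then show "\<exists>\<psi> \<in> Hom A0 B0. \<exists>\<theta> \<in> Hom A1 B1. \<phi> = hadd A1 B0 (comp A1 \<psi> f) (comp A1 g \<theta>)"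
      using \<psi>(1) \<theta> by metis
  next
    fix w assume ext: "\<forall>\<phi> \<in> Hom A1 B0. \<exists>\<psi> \<in> Hom A0 B0. \<exists>\<theta> \<in> Hom A1 B1. \<phi> = hadd A1 B0 (comp A1 \<psi> f) (comp A1 g \<theta>)"
      and w: "w \<in> val G A1"
    obtain \<phi> where \<phi>: "\<phi> \<in> Hom A1 B0" "w = far G A1 B0 \<phi> y" using y'(2)[OF A'(1) w] by blast
    obtain \<psi> \<theta> where \<psi>: "\<psi> \<in> Hom A0 B0" and \<theta>: "\<theta> \<in> Hom A1 B1"
      and eq: "\<phi> = hadd A1 B0 (comp A1 \<psi> f) (comp A1 g \<theta>)" using ext \<phi>(1) by blast
    have \<psi>f: "comp A1 \<psi> f \<in> Hom A1 B0" and g\<theta>: "comp A1 g \<theta> \<in> Hom A1 B0"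
      using comp_Hom[OF A'(1) f \<psi>(1)] comp_Hom[OF A'(1) \<theta> g] .
    have "far G A1 B0 (comp A1 g \<theta>) y = \<one>\<^bsub>fob G A1\<^esub>" using y'(4)[OF A'(1) g\<theta>] \<theta> by blast
    then have "w = far G A1 B0 (comp A1 \<psi> f) y"
      using additiveD[OF addG A'(1) B'(2) \<psi>f g\<theta> y'(1)] \<phi>(2) eq far_closed[OF pG A'(1) B'(2) \<psi>f y'(1)]
        group.is_monoid[OF val_group[OF pG A'(1)]] by (simp add: monoid.r_one)
    also have "\<dots> = far G A1 A0 f (far G A0 B0 \<psi> y)" using far_comp[OF pG A' B'(2) f \<psi>(1) y'(1)] .
    finally show "\<exists>w' \<in> val G A0. far G A1 A0 f w' = w"
      using far_closed[OF pG A'(2) B'(2) \<psi> y'(1)] by auto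
  qed
  finally show "trivial_group (Ext (mod_mod \<Lambda>) 1 F G) \<longleftrightarrow> ext_vanishes (A1, A0, f) (B1, B0, g)"
    using funs.trivial_Ext1_iff[OF SES PN PQ G] by simp
qed

subsection \<open>Projective functors are representable\<close>

text \<open>A projective functor \<open>P\<close> is a direct summand of some \<open>(-, A0)\<close>, so it is given by an idempotent
  endomorphism \<open>e\<close> of \<open>A0\<close>, and is represented by the image of \<open>e\<close>. The summand splits off because
  \<open>(-, A0) \<rightarrow> P\<close> is part of a short exact sequence of finitely presented functors: its kernel is presented
  by the inclusion of the kernel of \<open>f\<close>, which is finitely generated.\<close>

lemma projective_representable:
  assumes proj: "projective (mod_mod \<Lambda>) P"
  obtains M y where "M \<in> fg" "presents (zero_map_to M) P y"
proof -
  have P: "P \<in> fun_ob" using proj by (rule funs.projective_Ob)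
  have pP: "presheaf P" using P by simp
  obtain A1 A0 f x where A: "(A1, A0, f) \<in> maps_ob \<Lambda>" and x: "presents (A1, A0, f) P x"
    using fun_ob_presents[OF P] .
  have A' [simp]: "A1 \<in> fg" "A0 \<in> fg" and f: "f \<in> Hom A1 A0" using A by simp_all
  define K where "K = {a \<in> carrier A1. f a = \<zero>\<^bsub>A0\<^esub>}"
  define K1 where "K1 = A1\<lparr>carrier := K\<rparr>"
  have K1: "K1 \<in> fg" unfolding K1_def K_def by (rule kernel_fg[OF A' f])
  define k where "k = (\<lambda>a \<in> K. a)"
  have k: "k \<in> Hom K1 A1" unfolding k_def K1_def by (rule inclusion_Hom) (use K1 in \<open>auto simp: K1_def K_def\<close>)
  have k_apply: "k a = a" if "a \<in> K" for a using that by (simp add: k_def)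
  have carK: "carrier K1 = K" by (simp add: K1_def)
  have ker: "comp X f \<phi> = hzero X A0 \<longleftrightarrow> (\<exists>\<theta> \<in> Hom X K1. \<phi> = comp X k \<theta>)" if X: "X \<in> fg" and \<phi>: "\<phi> \<in> Hom X A1" for X \<phi>
  proof
    assume 0: "comp X f \<phi> = hzero X A0"
    have in_K: "\<phi> a \<in> K" if "a \<in> carrier X" for a
      using comp_eqD[OF 0 that] that \<phi> by (simp add: K_def)
    have "\<phi> \<in> Hom X K1" unfolding K1_def by (rule corestrict_Hom[OF \<phi> in_K])
    moreover have "\<phi> = comp X k \<phi>"
      by (rule extensionalityI[of _ "carrier X"]) (use \<phi> in_K in \<open>simp_all add: compose_eq k_apply Hom_extensional\<close>)
    ultimately show "\<exists>\<theta> \<in> Hom X K1. \<phi> = comp X k \<theta>" by blast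
  next
    assume "\<exists>\<theta> \<in> Hom X K1. \<phi> = comp X k \<theta>"
    then obtain \<theta> where \<theta>: "\<theta> \<in> Hom X K1" "\<phi> = comp X k \<theta>" by blast
    show "comp X f \<phi> = hzero X A0"
    proof (rule extensionalityI[of _ "carrier X"])
      fix a assume a: "a \<in> carrier X"
      have "\<theta> a \<in> K" using Hom_closed[OF \<theta>(1) a] carK by simp
      then show "comp X f \<phi> a = hzero X A0 a" using a by (simp add: \<theta>(2) compose_eq k_apply K_def)
    qed simp_all
  qed
  have obK: "(K1, A1, k) \<in> maps_ob \<Lambda>" using K1 k by simp
  let ?N = "Phi \<Lambda> (K1, A1, k)"
  obtain n where n: "presents (K1, A1, k) ?N n" using Phi_presents_ex[OF obK] by blast
  obtain Q q where Q: "Q \<in> fun_ob" and q: "presents (zero_map_to A0) Q q" using free_exists[OF A'(2)] .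
  have N: "?N \<in> fun_ob" using Phi_fun_ob[OF obK] .
  have pN: "presheaf ?N" and pQ: "presheaf Q" using N Q by simp_all
  note x' = presentsD[OF x] and q' = presentsD[OF q[unfolded zero_map_to_simps]]
  obtain \<iota> \<beta> where S: "functor_ses \<Lambda> ?N \<iota> Q \<beta> P" and \<beta>q: "\<beta> A0 q = x"
    using ses_of_presentations[OF pP A x pQ q pN obK n ker] by blast
  have \<beta>: "\<beta> \<in> nat_trans \<Lambda> Q P" using functor_sesD(2)[OF S] .
  have "(?N, \<iota>, Q, \<beta>, P) \<in> Ses (mod_mod \<Lambda>)" using N Q P S by (simp add: mod_mod_simps)
  moreover have "nid P \<in> carrier (Mor (mod_mod \<Lambda>) P P)" unfolding mod_mod_simps by (rule nid_nat_trans[OF pP])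
  ultimately obtain s where "s \<in> carrier (Mor (mod_mod \<Lambda>) P Q)" "Comp (mod_mod \<Lambda>) P \<beta> s = nid P"
    using funs.projective_lift[OF proj] by metis
  then have s: "s \<in> nat_trans \<Lambda> P Q" and \<beta>s: "ncomp P \<beta> s = nid P" by (simp_all only: mod_mod_simps)
  have \<beta>s': "\<beta> X (s X z) = z" if "X \<in> fg" "z \<in> val P X" for X z using \<beta>s that by (metis ncomp_apply nid_apply)
  \<comment> \<open>the endomorphism \<open>s \<beta>\<close> of \<open>(-, A0)\<close>, as an endomorphism of \<open>A0\<close>\<close>
  obtain e where e: "e \<in> Hom A0 A0" "s A0 x = far Q A0 A0 e q"
    using q'(2)[OF A'(2) nat_transD(3)[OF s A'(2) x'(1)]] by blast
  have \<beta>\<phi>: "\<beta> X (far Q X A0 \<phi> q) = far P X A0 \<phi> x" if "X \<in> fg" "\<phi> \<in> Hom X A0" for X \<phi>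
    using nat_transD(5)[OF \<beta> that(1) A'(2) that(2) q'(1)] \<beta>q by simp
  have s\<phi>: "s X (far P X A0 \<phi> x) = far Q X A0 (comp X e \<phi>) q" if "X \<in> fg" "\<phi> \<in> Hom X A0" for X \<phi>
    using nat_transD(5)[OF s that(1) A'(2) that(2) x'(1)] far_comp[OF pQ that(1) A'(2,2) that(2) e(1) q'(1)] e(2) by simp
  have e_cl: "comp X e \<phi> \<in> Hom X A0" if "X \<in> fg" "\<phi> \<in> Hom X A0" for X \<phi> using comp_Hom[OF that e(1)] .
  have ee: "far P X A0 (comp X e \<phi>) x = far P X A0 \<phi> x" if "X \<in> fg" "\<phi> \<in> Hom X A0" for X \<phi>
    using \<beta>s'[OF that(1) far_closed[OF pP that(1) A'(2) that(2) x'(1)]] s\<phi>[OF that] \<beta>\<phi>[OF that(1) e_cl[OF that]] by simp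
  have q_inj: "\<phi> = \<psi>" if "X \<in> fg" "\<phi> \<in> Hom X A0" "\<psi> \<in> Hom X A0" "far Q X A0 \<phi> q = far Q X A0 \<psi> q" for X \<phi> \<psi>
  proof -
    interpret QX: group "fob Q X" using pQ that by (simp add: val_group)
    interpret H: comm_group "mod_hom \<Lambda> X A0" using that by (simp add: Hom_comm_group)
    have "far Q X A0 (hadd X A0 \<phi> (hneg X A0 \<psi>)) q = \<one>\<^bsub>fob Q X\<^esub>"
      using additiveD[OF fun_ob_additive[OF Q] that(1) A'(2) that(2) hneg_Hom[OF that(1) A'(2) that(3)] q'(1)]
        additive_far_neg[OF pQ fun_ob_additive[OF Q] that(1) A'(2) q'(1) that(3)] that(4)
        far_closed[OF pQ that(1) A'(2) that(3) q'(1)] QX.r_inv by simp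
    then have "hadd X A0 \<phi> (hneg X A0 \<psi>) = hzero X A0"
      using free_zero_iff[OF q A'(2) that(1)] that hneg_Hom[OF that(1) A'(2) that(3)] by simp
    then show ?thesis using that(2,3) by (metis H.inv_closed H.inv_equality H.inv_inv)
  qed
  have idem: "e (e a) = e a" if "a \<in> carrier A0" for a
  proof -
    have "far Q A0 A0 (comp A0 e e) q = far Q A0 A0 e q"
      using s\<phi>[OF A'(2) e(1)] ee[OF A'(2) mod_id_Hom[OF A'(2)]] s\<phi>[OF A'(2) mod_id_Hom[OF A'(2)]] comp_id(2)[OF e(1)] by simp
    then have "comp A0 e e = e" using q_inj[OF A'(2) e_cl[OF A'(2) e(1)] e(1)] by simp
    from comp_eqD[OF this that] show ?thesis .
  qed
  define M where "M = A0\<lparr>carrier := e ` carrier A0\<rparr>"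
  have M: "M \<in> fg" unfolding M_def by (rule image_fg[OF A'(2,2) e(1)])
  have carM: "carrier M = e ` carrier A0" by (simp add: M_def)
  define m where "m = (\<lambda>a \<in> e ` carrier A0. a)"
  have m: "m \<in> Hom M A0" unfolding m_def M_def
    by (rule inclusion_Hom) (use M Hom_closed[OF e(1)] in \<open>auto simp: M_def\<close>)
  have m_apply: "m a = a" if "a \<in> carrier M" for a using that by (simp add: m_def carM)
  have em: "e (m a) = m a" if "a \<in> carrier M" for a
  proof -
    obtain b where "b \<in> carrier A0" "a = e b" using \<open>a \<in> carrier M\<close> by (auto simp: carM)
    then show ?thesis using m_apply[OF that] idem by simp
  qed
  have m_cl: "comp X m \<phi> \<in> Hom X A0" if "X \<in> fg" "\<phi> \<in> Hom X M" for X \<phi> using comp_Hom[OF that m] .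
  define y where "y = far P M A0 m x"
  have y: "y \<in> val P M" unfolding y_def by (rule far_closed[OF pP M A'(2) m x'(1)])
  have far_y: "far P X M \<phi> y = far P X A0 (comp X m \<phi>) x" if "X \<in> fg" "\<phi> \<in> Hom X M" for X \<phi>
    unfolding y_def using far_comp[OF pP that(1) M A'(2) that(2) m x'(1)] by simp
  have "presents (mod_zero, M, hzero mod_zero M) P y"
    unfolding presents_def prod.case
  proof (intro conjI ballI y)
    fix X assume X: "X \<in> fg"
    show "\<exists>\<phi> \<in> Hom X M. z = far P X M \<phi> y" if z: "z \<in> val P X" for z
    proof -
      obtain \<phi> where \<phi>: "\<phi> \<in> Hom X A0" "z = far P X A0 \<phi> x" using x'(2)[OF X z] by blast
      have in_M: "comp X e \<phi> a \<in> e ` carrier A0" if "a \<in> carrier X" for a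
        using that Hom_closed[OF \<phi>(1) that] by (simp add: compose_eq)
      have \<phi>': "comp X e \<phi> \<in> Hom X M"
        unfolding M_def by (rule corestrict_Hom[OF e_cl[OF X \<phi>(1)] in_M])
      have "comp X m (comp X e \<phi>) = comp X e \<phi>"
        by (rule extensionalityI[of _ "carrier X"]) (use in_M in \<open>simp_all add: compose_eq m_apply carM\<close>)
      then have "far P X M (comp X e \<phi>) y = z" using far_y[OF X \<phi>'] ee[OF X \<phi>(1)] \<phi>(2) by simp
      then show ?thesis using \<phi>' by blast
    qed
    show "far P X M (hadd X M \<phi> \<psi>) y = far P X M \<phi> y \<otimes>\<^bsub>fob P X\<^esub> far P X M \<psi> y"
      if "\<phi> \<in> Hom X M" "\<psi> \<in> Hom X M" for \<phi> \<psi>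
      by (rule additiveD[OF fun_ob_additive[OF P] X M that y])
    show "far P X M \<phi> y = \<one>\<^bsub>fob P X\<^esub> \<longleftrightarrow> (\<exists>\<theta> \<in> Hom X mod_zero. \<phi> = comp X (hzero mod_zero M) \<theta>)"
      if \<phi>: "\<phi> \<in> Hom X M" for \<phi>
    proof -
      have "comp X (hzero mod_zero M) \<theta> = hzero X M" if "\<theta> \<in> Hom X mod_zero" for \<theta> using that M X by simp
      then have factor: "(\<exists>\<theta> \<in> Hom X mod_zero. \<phi> = comp X (hzero mod_zero M) \<theta>) \<longleftrightarrow> \<phi> = hzero X M"
        using hzero_Hom[OF X mod_zero_fg] by metis
      have to_zero: "\<phi> = hzero X M" if 1: "far P X M \<phi> y = \<one>\<^bsub>fob P X\<^esub>"
      proof -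
        have "far Q X A0 (comp X e (comp X m \<phi>)) q = \<one>\<^bsub>fob Q X\<^esub>"
          using s\<phi>[OF X m_cl[OF X \<phi>]] far_y[OF X \<phi>] 1 nat_trans_one[OF pP pQ s X] by simp
        then have 0: "comp X e (comp X m \<phi>) = hzero X A0"
          using free_zero_iff[OF q A'(2) X e_cl[OF X m_cl[OF X \<phi>]]] by simp
        show ?thesis
        proof (rule extensionalityI[of _ "carrier X"])
          fix a assume a: "a \<in> carrier X"
          have "e (m (\<phi> a)) = \<zero>\<^bsub>A0\<^esub>" using comp_eqD[OF 0 a] a by (simp add: compose_eq)
          then have "\<phi> a = \<zero>\<^bsub>A0\<^esub>" using em[OF Hom_closed[OF \<phi> a]] m_apply[OF Hom_closed[OF \<phi> a]] by simp
          then show "\<phi> a = hzero X M a" using a by (simp add: M_def)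
        qed (use \<phi> in \<open>simp_all add: Hom_extensional\<close>)
      qed
      have "far P X M (hzero X M) y = \<one>\<^bsub>fob P X\<^esub>"
        by (rule additive_far_zero[OF pP fun_ob_additive[OF P] X M y])
      then show ?thesis unfolding factor using to_zero by (intro iffI) simp_all
    qed
  qed
  then show thesis using that[OF M, of y] by (simp only: zero_map_to_simps)
qed

text \<open>A projective resolution of length one consists of representable functors, so its first map is
  \<open>(-, f)\<close> for a map \<open>f\<close> of modules. Since \<open>(-, f)\<close> is injective at the kernel of \<open>f\<close>, the inclusion of
  this kernel vanishes.\<close>

lemma mono_presentation:
  assumes U: "U \<in> fun_ob" and pd: "pdim (mod_mod \<Lambda>) U \<le> 1"
  obtains A1 A0 f x where "(A1, A0, f) \<in> maps_ob \<Lambda>" "inj_on f (carrier A1)" "presents (A1, A0, f) U x"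
proof -
  obtain K i P p where "(K, i, P, p, U) \<in> Ses (mod_mod \<Lambda>)"
    and proj: "projective (mod_mod \<Lambda>) K" "projective (mod_mod \<Lambda>) P"
    using pd unfolding funs.pdim_le_1_iff by blast
  then have K: "K \<in> fun_ob" and P: "P \<in> fun_ob" and S: "functor_ses \<Lambda> K i P p U" by (simp_all add: mod_mod_simps)
  have pK: "presheaf K" and pP: "presheaf P" and pU: "presheaf U" using K P U by simp_all
  obtain A k where A: "A \<in> fg" and k: "presents (zero_map_to A) K k" using projective_representable[OF proj(1)] .
  obtain B b where B: "B \<in> fg" and b: "presents (zero_map_to B) P b" using projective_representable[OF proj(2)] .
  note k' = presentsD[OF k[unfolded zero_map_to_simps]] and b' = presentsD[OF b[unfolded zero_map_to_simps]]
  note S' = functor_sesD[OF S]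
  obtain f where f: "f \<in> Hom A B" "i A k = far P A B f b"
    using b'(2)[OF A nat_transD(3)[OF S'(1) A k'(1)]] by blast
  have i\<phi>: "i X (far K X A \<phi> k) = far P X B (comp X f \<phi>) b" if "X \<in> fg" "\<phi> \<in> Hom X A" for X \<phi>
    using nat_transD(5)[OF S'(1) that(1) A that(2) k'(1)] far_comp[OF pP that(1) A B that(2) f(1) b'(1)] f(2) by simp
  have p\<phi>: "p X (far P X B \<phi> b) = far U X B \<phi> (p B b)" if "X \<in> fg" "\<phi> \<in> Hom X B" for X \<phi>
    by (rule nat_transD(5)[OF S'(2) that(1) B that(2) b'(1)])
  have mono: "\<phi> = hzero X A" if X: "X \<in> fg" and \<phi>: "\<phi> \<in> Hom X A" and 0: "comp X f \<phi> = hzero X B" for X \<phi>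
  proof -
    have "i X (far K X A \<phi> k) = i X \<one>\<^bsub>fob K X\<^esub>"
      using i\<phi>[OF X \<phi>] 0 additive_far_zero[OF pP fun_ob_additive[OF P] X B b'(1)] nat_trans_one[OF pK pP S'(1) X] by simp
    then have "far K X A \<phi> k = \<one>\<^bsub>fob K X\<^esub>"
      by (rule inj_onD[OF S'(3)[OF X]]) (use far_closed[OF pK X A \<phi> k'(1)] pK X in simp_all)
    then show ?thesis using free_zero_iff[OF k A X \<phi>] by simp
  qed
  have inj: "inj_on f (carrier A)"
  proof (rule Hom_injective[OF f(1) A B])
    fix a assume a: "a \<in> carrier A" "f a = \<zero>\<^bsub>B\<^esub>"
    let ?K = "{x \<in> carrier A. f x = \<zero>\<^bsub>B\<^esub>}" and ?X = "A\<lparr>carrier := {x \<in> carrier A. f x = \<zero>\<^bsub>B\<^esub>}\<rparr>"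
    have X: "?X \<in> fg" by (rule kernel_fg[OF A B f(1)])
    have j: "(\<lambda>x \<in> ?K. x) \<in> Hom ?X A" by (rule inclusion_Hom) (use X in auto)
    have "comp ?X f (\<lambda>x \<in> ?K. x) = hzero ?X B"
      by (rule Hom_eqI[OF comp_Hom[OF X j f(1)] hzero_Hom[OF X B]]) (simp add: compose_eq)
    from mono[OF X j this] have "(\<lambda>x \<in> ?K. x) a = hzero ?X A a" by simp
    then show "a = \<zero>\<^bsub>A\<^esub>" using a by simp
  qed
  have pb: "p B b \<in> val U B" using nat_transD(3)[OF S'(2) B b'(1)] .
  have "presents (A, B, f) U (p B b)"
    unfolding presents_def prod.case
  proof (intro conjI ballI pb)
    fix X assume X: "X \<in> fg"
    show "\<exists>\<phi> \<in> Hom X B. z = far U X B \<phi> (p B b)" if z: "z \<in> val U X" for z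
    proof -
      obtain w where w: "w \<in> val P X" "p X w = z" using S'(7)[OF X z] by blast
      obtain \<phi> where \<phi>: "\<phi> \<in> Hom X B" "w = far P X B \<phi> b" using b'(2)[OF X w(1)] by blast
      then show ?thesis using p\<phi>[OF X \<phi>(1)] w(2) by auto
    qed
    show "far U X B (hadd X B \<phi> \<psi>) (p B b) = far U X B \<phi> (p B b) \<otimes>\<^bsub>fob U X\<^esub> far U X B \<psi> (p B b)"
      if "\<phi> \<in> Hom X B" "\<psi> \<in> Hom X B" for \<phi> \<psi>
      by (rule additiveD[OF fun_ob_additive[OF U] X B that pb])
    show "far U X B \<phi> (p B b) = \<one>\<^bsub>fob U X\<^esub> \<longleftrightarrow> (\<exists>\<theta> \<in> Hom X A. \<phi> = comp X f \<theta>)" if \<phi>: "\<phi> \<in> Hom X B" for \<phi>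
    proof
      assume "far U X B \<phi> (p B b) = \<one>\<^bsub>fob U X\<^esub>"
      then have "p X (far P X B \<phi> b) = \<one>\<^bsub>fob U X\<^esub>" using p\<phi>[OF X \<phi>] by simp
      then obtain w where w: "w \<in> val K X" "i X w = far P X B \<phi> b"
        using S'(8)[OF X far_closed[OF pP X B \<phi> b'(1)]] by blast
      obtain \<theta> where \<theta>: "\<theta> \<in> Hom X A" "w = far K X A \<theta> k" using k'(2)[OF X w(1)] by blast
      have f\<theta>: "comp X f \<theta> \<in> Hom X B" using comp_Hom[OF X \<theta>(1) f(1)] .
      have eq: "far P X B \<phi> b = far P X B (comp X f \<theta>) b" using w(2) \<theta>(2) i\<phi>[OF X \<theta>(1)] by simp
      interpret PX: group "fob P X" using pP X by (rule val_group)
      interpret H: comm_group "mod_hom \<Lambda> X B" using X B by (simp add: Hom_comm_group)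
      have "far P X B (hadd X B \<phi> (hneg X B (comp X f \<theta>))) b = \<one>\<^bsub>fob P X\<^esub>"
        using additiveD[OF fun_ob_additive[OF P] X B \<phi> hneg_Hom[OF X B f\<theta>] b'(1)]
          additive_far_neg[OF pP fun_ob_additive[OF P] X B b'(1) f\<theta>] eq
          far_closed[OF pP X B f\<theta> b'(1)] PX.r_inv by simp
      then have "hadd X B \<phi> (hneg X B (comp X f \<theta>)) = hzero X B"
        using free_zero_iff[OF b B X] \<phi> hneg_Hom[OF X B f\<theta>] X B by simp
      then have "\<phi> = comp X f \<theta>" using \<phi> f\<theta> by (metis H.inv_closed H.inv_equality H.inv_inv)
      then show "\<exists>\<theta> \<in> Hom X A. \<phi> = comp X f \<theta>" using \<theta>(1) by blast
    next
      assume "\<exists>\<theta> \<in> Hom X A. \<phi> = comp X f \<theta>"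
      then obtain \<theta> where \<theta>: "\<theta> \<in> Hom X A" "\<phi> = comp X f \<theta>" by blast
      have "far U X B \<phi> (p B b) = p X (i X (far K X A \<theta> k))" using p\<phi>[OF X \<phi>] i\<phi>[OF X \<theta>(1)] \<theta>(2) by simp
      then show "far U X B \<phi> (p B b) = \<one>\<^bsub>fob U X\<^esub>" using S'(6)[OF X far_closed[OF pK X A \<theta>(1) k'(1)]] by simp
    qed
  qed
  moreover have "(A, B, f) \<in> maps_ob \<Lambda>" using A B f by simp
  ultimately show thesis using that inj by blast
qed

end

section \<open>Monomorphisms presenting the same functor\<close>

context artin_algebra_modules
begin

lemma mod_id_extensional [simp]: "mod_id X \<in> extensional (carrier X)"
  by (simp add: mod_id_def)

lemma comp_eqI: "\<lbrakk>\<And>x. x \<in> carrier X \<Longrightarrow> g (f x) = k x; k \<in> extensional (carrier X)\<rbrakk> \<Longrightarrow> comp X g f = k"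
  by (rule extensionalityI[of _ "carrier X"]) (simp_all add: compose_eq)

lemma hadd_eqI: "\<lbrakk>\<And>x. x \<in> carrier X \<Longrightarrow> f x \<oplus>\<^bsub>Y\<^esub> g x = k x; k \<in> extensional (carrier X)\<rbrakk> \<Longrightarrow> hadd X Y f g = k"
  by (rule extensionalityI[of _ "carrier X"]) simp_all

lemma comp_eq_compD: "\<lbrakk>comp X g f = comp X k h; x \<in> carrier X\<rbrakk> \<Longrightarrow> g (f x) = k (h x)"
  by (metis compose_eq)

lemma decompositionD:
  assumes "hadd Z Z (comp Z i p) (comp Z j q) = mod_id Z" "z \<in> carrier Z"
  shows "i (p z) \<oplus>\<^bsub>Z\<^esub> j (q z) = z"
  using fun_cong[OF assms(1), of z] assms(2) by (simp add: compose_eq)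

text \<open>Morphisms between monomorphisms are determined by their components on codomains, so a direct
  sum of monomorphisms only has to be checked on codomains.\<close>

lemma mono_biproduct:
  assumes A: "(A1, A0, f) \<in> maps_ob \<Lambda>" and B: "(B1, B0, g) \<in> maps_ob \<Lambda>" and Z: "(Z1, Z0, h) \<in> maps_ob \<Lambda>"
    and inj: "inj_on f (carrier A1)" "inj_on g (carrier B1)" "inj_on h (carrier Z1)"
    and D: "dsum A0 B0 Z0 i0 j0 p0 q0"
    and i1: "i1 \<in> Hom A1 Z1" "comp A1 h i1 = comp A1 i0 f"
    and j1: "j1 \<in> Hom B1 Z1" "comp B1 h j1 = comp B1 j0 g"
    and p1: "p1 \<in> Hom Z1 A1" "comp Z1 f p1 = comp Z1 p0 h"
    and q1: "q1 \<in> Hom Z1 B1" "comp Z1 g q1 = comp Z1 q0 h"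
  shows "is_biproduct (maps_F \<Lambda>) (A1, A0, f) (B1, B0, g) (Z1, Z0, h)"
proof -
  note D' = dsumD[OF D]
  have ob [simp]: "A1 \<in> fg" "A0 \<in> fg" "B1 \<in> fg" "B0 \<in> fg" "Z1 \<in> fg" "Z0 \<in> fg"
    and m: "f \<in> Hom A1 A0" "g \<in> Hom B1 B0" "h \<in> Hom Z1 Z0" using A B Z by simp_all
  have i: "h (i1 x) = i0 (f x)" if "x \<in> carrier A1" for x using comp_eqD[OF i1(2) that] that by (simp add: compose_eq)
  have j: "h (j1 x) = j0 (g x)" if "x \<in> carrier B1" for x using comp_eqD[OF j1(2) that] that by (simp add: compose_eq)
  have p: "f (p1 x) = p0 (h x)" if "x \<in> carrier Z1" for x using comp_eqD[OF p1(2) that] that by (simp add: compose_eq)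
  have q: "g (q1 x) = q0 (h x)" if "x \<in> carrier Z1" for x using comp_eqD[OF q1(2) that] that by (simp add: compose_eq)
  note [simp] = Hom_closed[OF m(1)] Hom_closed[OF m(2)] Hom_closed[OF m(3)] Hom_closed[OF i1(1)] Hom_closed[OF j1(1)]
    Hom_closed[OF p1(1)] Hom_closed[OF q1(1)] Hom_closed[OF D'(2)] Hom_closed[OF D'(3)] Hom_closed[OF D'(4)] Hom_closed[OF D'(5)]
    Hom_zero[OF m(1)] Hom_zero[OF m(2)]
  have 1: "p1 (i1 x) = x" if "x \<in> carrier A1" for x
    by (rule inj_onD[OF inj(1)]) (use that in \<open>simp_all add: p i D'\<close>)
  have 2: "q1 (j1 x) = x" if "x \<in> carrier B1" for x
    by (rule inj_onD[OF inj(2)]) (use that in \<open>simp_all add: q j D'\<close>)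
  have 3: "q1 (i1 x) = \<zero>\<^bsub>B1\<^esub>" if "x \<in> carrier A1" for x
    by (rule inj_onD[OF inj(2)]) (use that in \<open>simp_all add: q i D'\<close>)
  have 4: "p1 (j1 x) = \<zero>\<^bsub>A1\<^esub>" if "x \<in> carrier B1" for x
    by (rule inj_onD[OF inj(1)]) (use that in \<open>simp_all add: p j D'\<close>)
  have 5: "i1 (p1 x) \<oplus>\<^bsub>Z1\<^esub> j1 (q1 x) = x" if "x \<in> carrier Z1" for x
    by (rule inj_onD[OF inj(3)]) (use that in \<open>simp_all add: Hom_add[OF m(3)] i j p q D'\<close>)
  have mor: "(i1, i0) \<in> carrier (maps_mor \<Lambda> (A1, A0, f) (Z1, Z0, h))"
    "(j1, j0) \<in> carrier (maps_mor \<Lambda> (B1, B0, g) (Z1, Z0, h))"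
    "(p1, p0) \<in> carrier (maps_mor \<Lambda> (Z1, Z0, h) (A1, A0, f))"
    "(q1, q0) \<in> carrier (maps_mor \<Lambda> (Z1, Z0, h) (B1, B0, g))"
    using i1 j1 p1 q1 D'(2-5) by simp_all
  have eqs: "comp A1 p1 i1 = mod_id A1" "comp A0 p0 i0 = mod_id A0" "comp B1 q1 j1 = mod_id B1" "comp B0 q0 j0 = mod_id B0"
    "comp A1 q1 i1 = hzero A1 B1" "comp A0 q0 i0 = hzero A0 B0" "comp B1 p1 j1 = hzero B1 A1" "comp B0 p0 j0 = hzero B0 A0"
    "hadd Z1 Z1 (comp Z1 i1 p1) (comp Z1 j1 q1) = mod_id Z1" "hadd Z0 Z0 (comp Z0 i0 p0) (comp Z0 j0 q0) = mod_id Z0"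
    by - ((rule comp_eqI hadd_eqI; simp add: compose_eq 1 2 3 4 5 D')+)
  show ?thesis
    unfolding is_biproduct_def maps_F_simps
    by (intro conjI Z bexI[OF _ mor(1)] bexI[OF _ mor(2)] bexI[OF _ mor(3)] bexI[OF _ mor(4)]) (simp_all add: eqs)
qed

lemma identity_map_simps: "identity_map X = (X, X, mod_id X)"
  by (simp add: identity_map_def)

lemma biproduct_identityD:
  assumes A: "(A1, A0, f) \<in> maps_ob \<Lambda>" and X: "X \<in> fg"
    and bp: "is_biproduct (maps_F \<Lambda>) (A1, A0, f) (identity_map X) (Z1, Z0, h)"
  obtains i1 i0 j1 j0 p1 p0 q1 q0 where "Z1 \<in> fg" "Z0 \<in> fg" "h \<in> Hom Z1 Z0"
    "i1 \<in> Hom A1 Z1" "i0 \<in> Hom A0 Z0" "comp A1 h i1 = comp A1 i0 f"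
    "j1 \<in> Hom X Z1" "j0 \<in> Hom X Z0" "comp X h j1 = comp X j0 (mod_id X)"
    "p1 \<in> Hom Z1 A1" "p0 \<in> Hom Z0 A0" "comp Z1 f p1 = comp Z1 p0 h"
    "q1 \<in> Hom Z1 X" "q0 \<in> Hom Z0 X" "comp Z1 (mod_id X) q1 = comp Z1 q0 h"
    "comp A1 p1 i1 = mod_id A1" "comp A0 p0 i0 = mod_id A0"
    "hadd Z1 Z1 (comp Z1 i1 p1) (comp Z1 j1 q1) = mod_id Z1" "hadd Z0 Z0 (comp Z0 i0 p0) (comp Z0 j0 q0) = mod_id Z0"
proof -
  obtain i j p q where "(Z1, Z0, h) \<in> maps_ob \<Lambda>"
    and "i \<in> carrier (maps_mor \<Lambda> (A1, A0, f) (Z1, Z0, h))" "j \<in> carrier (maps_mor \<Lambda> (X, X, mod_id X) (Z1, Z0, h))"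
      "p \<in> carrier (maps_mor \<Lambda> (Z1, Z0, h) (A1, A0, f))" "q \<in> carrier (maps_mor \<Lambda> (Z1, Z0, h) (X, X, mod_id X))"
      "maps_comp (A1, A0, f) p i = maps_id (A1, A0, f)"
      "maps_comp (Z1, Z0, h) i p \<otimes>\<^bsub>maps_mor \<Lambda> (Z1, Z0, h) (Z1, Z0, h)\<^esub> maps_comp (Z1, Z0, h) j q = maps_id (Z1, Z0, h)"
    using bp unfolding is_biproduct_def maps_F_simps identity_map_simps by blast
  then show thesis
    by (cases i; cases j; cases p; cases q) (auto intro!: that)
qed

lemma biproduct_mono_iff:
  assumes A: "(A1, A0, f) \<in> maps_ob \<Lambda>" and X: "X \<in> fg"
    and bp: "is_biproduct (maps_F \<Lambda>) (A1, A0, f) (identity_map X) (Z1, Z0, h)"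
  shows "inj_on h (carrier Z1) \<longleftrightarrow> inj_on f (carrier A1)"
proof -
  obtain i1 i0 j1 j0 p1 p0 q1 q0 where b: "Z1 \<in> fg" "Z0 \<in> fg" "h \<in> Hom Z1 Z0"
    "i1 \<in> Hom A1 Z1" "i0 \<in> Hom A0 Z0" "comp A1 h i1 = comp A1 i0 f"
    "j1 \<in> Hom X Z1" "j0 \<in> Hom X Z0" "comp X h j1 = comp X j0 (mod_id X)"
    "p1 \<in> Hom Z1 A1" "p0 \<in> Hom Z0 A0" "comp Z1 f p1 = comp Z1 p0 h"
    "q1 \<in> Hom Z1 X" "q0 \<in> Hom Z0 X" "comp Z1 (mod_id X) q1 = comp Z1 q0 h"
    "comp A1 p1 i1 = mod_id A1" "comp A0 p0 i0 = mod_id A0"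
    "hadd Z1 Z1 (comp Z1 i1 p1) (comp Z1 j1 q1) = mod_id Z1" "hadd Z0 Z0 (comp Z0 i0 p0) (comp Z0 j0 q0) = mod_id Z0"
    using biproduct_identityD[OF A X bp] by metis
  have A': "A1 \<in> fg" "A0 \<in> fg" "f \<in> Hom A1 A0" using A by simp_all
  have hi: "h (i1 a) = i0 (f a)" if "a \<in> carrier A1" for a using comp_eq_compD[OF b(6) that] .
  have fp: "f (p1 z) = p0 (h z)" if "z \<in> carrier Z1" for z using comp_eq_compD[OF b(12) that] .
  have qh: "q1 z = q0 (h z)" if "z \<in> carrier Z1" for z
    using comp_eq_compD[OF b(15) that] Hom_closed[OF b(13) that] by simp
  have pi: "p1 (i1 a) = a" if "a \<in> carrier A1" for a using comp_eqD[OF b(16) that] that by simp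
  have dec: "i1 (p1 z) \<oplus>\<^bsub>Z1\<^esub> j1 (q1 z) = z" if "z \<in> carrier Z1" for z
    using decompositionD[OF b(18) that] .
  show ?thesis
  proof
    assume inj: "inj_on h (carrier Z1)"
    show "inj_on f (carrier A1)"
    proof (rule Hom_injective[OF A'(3,1,2)])
      fix a assume a: "a \<in> carrier A1" "f a = \<zero>\<^bsub>A0\<^esub>"
      have "h (i1 a) = \<zero>\<^bsub>Z0\<^esub>" using hi[OF a(1)] a(2) Hom_zero[OF b(5) A'(2) b(2)] by simp
      then have "i1 a = \<zero>\<^bsub>Z1\<^esub>" using injective_zero[OF b(3,1,2) inj Hom_closed[OF b(4) a(1)]] by simp
      then show "a = \<zero>\<^bsub>A1\<^esub>" using pi[OF a(1)] Hom_zero[OF b(10,1) A'(1)] by simp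
    qed
  next
    assume inj: "inj_on f (carrier A1)"
    show "inj_on h (carrier Z1)"
    proof (rule Hom_injective[OF b(3,1,2)])
      fix z assume z: "z \<in> carrier Z1" "h z = \<zero>\<^bsub>Z0\<^esub>"
      have "f (p1 z) = \<zero>\<^bsub>A0\<^esub>" using fp[OF z(1)] z(2) Hom_zero[OF b(11,2) A'(2)] by simp
      then have "p1 z = \<zero>\<^bsub>A1\<^esub>" using injective_zero[OF A'(3,1,2) inj Hom_closed[OF b(10) z(1)]] by simp
      moreover have "q1 z = \<zero>\<^bsub>X\<^esub>" using qh[OF z(1)] z(2) Hom_zero[OF b(14,2) X] by simp
      ultimately show "z = \<zero>\<^bsub>Z1\<^esub>"
        using dec[OF z(1)] Hom_zero[OF b(4) A'(1) b(1)] Hom_zero[OF b(7) X b(1)] b(1) by simp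
    qed
  qed
qed

text \<open>Adding a summand \<open>1\<^sub>X\<close> to \<open>f\<close> does not change the cokernel functor: a map \<open>\<phi>\<close> into \<open>Z0\<close> factors
  through \<open>h\<close> as soon as its component \<open>p0 \<phi>\<close> factors through \<open>f\<close>, since the other component \<open>q0 \<phi>\<close>
  lifts along the identity of \<open>X\<close>.\<close>

lemma presents_add_identity:
  assumes F: "presheaf F" and A: "(A1, A0, f) \<in> maps_ob \<Lambda>" and x: "presents (A1, A0, f) F x" and X: "X \<in> fg"
    and Z: "(Z1, Z0, h) \<in> maps_ob \<Lambda>"
    and t: "i1 \<in> Hom A1 Z1" "i0 \<in> Hom A0 Z0" "j1 \<in> Hom X Z1" "j0 \<in> Hom X Z0" "p1 \<in> Hom Z1 A1" "p0 \<in> Hom Z0 A0" "q0 \<in> Hom Z0 X"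
    and hi: "comp A1 h i1 = comp A1 i0 f" and hj: "comp X h j1 = comp X j0 (mod_id X)" and fp: "comp Z1 f p1 = comp Z1 p0 h"
    and pi: "comp A0 p0 i0 = mod_id A0" and dec: "hadd Z0 Z0 (comp Z0 i0 p0) (comp Z0 j0 q0) = mod_id Z0"
  shows "presents (Z1, Z0, h) F (far F Z0 A0 p0 x)"
proof -
  have A': "A1 \<in> fg" "A0 \<in> fg" "f \<in> Hom A1 A0" and Z': "Z1 \<in> fg" "Z0 \<in> fg" "h \<in> Hom Z1 Z0" using A Z by simp_all
  note x' = presentsD[OF x]
  have add: "additive F" using presents_additive[OF F A x] .
  define z where "z = far F Z0 A0 p0 x"
  have z: "z \<in> val F Z0" unfolding z_def by (rule far_closed[OF F Z'(2) A'(2) t(6) x'(1)])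
  have far_z: "far F Y Z0 \<phi> z = far F Y A0 (comp Y p0 \<phi>) x" if "Y \<in> fg" "\<phi> \<in> Hom Y Z0" for Y \<phi>
    unfolding z_def using far_comp[OF F that(1) Z'(2) A'(2) that(2) t(6) x'(1)] by simp
  have "presents (Z1, Z0, h) F z"
    unfolding presents_def prod.case
  proof (intro conjI ballI z)
    fix Y assume Y: "Y \<in> fg"
    show "\<exists>\<phi> \<in> Hom Y Z0. w = far F Y Z0 \<phi> z" if w: "w \<in> val F Y" for w
    proof -
      obtain \<phi> where \<phi>: "\<phi> \<in> Hom Y A0" "w = far F Y A0 \<phi> x" using x'(2)[OF Y w] by blast
      have "comp Y p0 (comp Y i0 \<phi>) = comp Y (comp A0 p0 i0) \<phi>" by (rule comp_comp[OF \<phi>(1), symmetric])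
      then have "comp Y p0 (comp Y i0 \<phi>) = \<phi>" using pi comp_id(1)[OF \<phi>(1)] by simp
      then have "w = far F Y Z0 (comp Y i0 \<phi>) z"
        using far_z[OF Y comp_Hom[OF Y \<phi>(1) t(2)]] \<phi>(2) by simp
      then show ?thesis using comp_Hom[OF Y \<phi>(1) t(2)] by blast
    qed
    show "far F Y Z0 (hadd Y Z0 \<phi> \<psi>) z = far F Y Z0 \<phi> z \<otimes>\<^bsub>fob F Y\<^esub> far F Y Z0 \<psi> z"
      if "\<phi> \<in> Hom Y Z0" "\<psi> \<in> Hom Y Z0" for \<phi> \<psi>
      by (rule additiveD[OF add Y Z'(2) that z])
    show "far F Y Z0 \<phi> z = \<one>\<^bsub>fob F Y\<^esub> \<longleftrightarrow> (\<exists>\<theta> \<in> Hom Y Z1. \<phi> = comp Y h \<theta>)" if \<phi>: "\<phi> \<in> Hom Y Z0" for \<phi>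
    proof -
      have p\<phi>: "comp Y p0 \<phi> \<in> Hom Y A0" using comp_Hom[OF Y \<phi> t(6)] .
      have "(\<exists>\<theta> \<in> Hom Y A1. comp Y p0 \<phi> = comp Y f \<theta>) \<longleftrightarrow> (\<exists>\<theta> \<in> Hom Y Z1. \<phi> = comp Y h \<theta>)"
      proof
        assume "\<exists>\<theta> \<in> Hom Y Z1. \<phi> = comp Y h \<theta>"
        then obtain \<theta> where \<theta>: "\<theta> \<in> Hom Y Z1" "\<phi> = comp Y h \<theta>" by blast
        have "comp Y p0 \<phi> = comp Y (comp Z1 p0 h) \<theta>" using \<theta> by (simp add: comp_comp[OF \<theta>(1)])
        also have "\<dots> = comp Y f (comp Y p1 \<theta>)" unfolding fp[symmetric] by (rule comp_comp[OF \<theta>(1)])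
        finally show "\<exists>\<theta> \<in> Hom Y A1. comp Y p0 \<phi> = comp Y f \<theta>" using comp_Hom[OF Y \<theta>(1) t(5)] by blast
      next
        assume "\<exists>\<theta> \<in> Hom Y A1. comp Y p0 \<phi> = comp Y f \<theta>"
        then obtain \<theta> where \<theta>: "\<theta> \<in> Hom Y A1" "comp Y p0 \<phi> = comp Y f \<theta>" by blast
        let ?t = "hadd Y Z1 (comp Y i1 \<theta>) (comp Y j1 (comp Y q0 \<phi>))"
        have t': "?t \<in> Hom Y Z1"
          by (rule hadd_Hom[OF Y Z'(1) comp_Hom[OF Y \<theta>(1) t(1)] comp_Hom[OF Y comp_Hom[OF Y \<phi> t(7)] t(3)]])
        have "\<phi> = comp Y h ?t"
        proof (rule Hom_eqI[OF \<phi> comp_Hom[OF Y t' Z'(3)]])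
          fix y assume y: "y \<in> carrier Y"
          have c: "\<phi> y \<in> carrier Z0" "\<theta> y \<in> carrier A1" "q0 (\<phi> y) \<in> carrier X"
            using Hom_closed[OF \<phi> y] Hom_closed[OF \<theta>(1) y] Hom_closed[OF t(7)] by simp_all
          have "p0 (\<phi> y) = f (\<theta> y)" using comp_eq_compD[OF \<theta>(2) y] .
          moreover have "h (i1 (\<theta> y)) = i0 (f (\<theta> y))" using comp_eq_compD[OF hi c(2)] .
          moreover have "h (j1 (q0 (\<phi> y))) = j0 (q0 (\<phi> y))" using comp_eq_compD[OF hj c(3)] c(3) by simp
          moreover have "i0 (p0 (\<phi> y)) \<oplus>\<^bsub>Z0\<^esub> j0 (q0 (\<phi> y)) = \<phi> y"
            using decompositionD[OF dec c(1)] .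
          ultimately show "\<phi> y = comp Y h ?t y"
            using y c Hom_closed[OF t(1)] Hom_closed[OF t(3)] by (simp add: compose_eq Hom_add[OF Z'(3)])
        qed
        then show "\<exists>\<theta> \<in> Hom Y Z1. \<phi> = comp Y h \<theta>" using t' by blast
      qed
      then show ?thesis using far_z[OF Y \<phi>] x'(4)[OF Y p\<phi>] by simp
    qed
  qed
  then show ?thesis by (simp add: z_def)
qed

lemma biproduct_presents:
  assumes F: "presheaf F" and A: "(A1, A0, f) \<in> maps_ob \<Lambda>" and x: "presents (A1, A0, f) F x" and X: "X \<in> fg"
    and bp: "is_biproduct (maps_F \<Lambda>) (A1, A0, f) (identity_map X) (Z1, Z0, h)"
  shows "\<exists>z. presents (Z1, Z0, h) F z"
proof -
  obtain i1 i0 j1 j0 p1 p0 q1 q0 where b: "Z1 \<in> fg" "Z0 \<in> fg" "h \<in> Hom Z1 Z0"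
    "i1 \<in> Hom A1 Z1" "i0 \<in> Hom A0 Z0" "comp A1 h i1 = comp A1 i0 f"
    "j1 \<in> Hom X Z1" "j0 \<in> Hom X Z0" "comp X h j1 = comp X j0 (mod_id X)"
    "p1 \<in> Hom Z1 A1" "p0 \<in> Hom Z0 A0" "comp Z1 f p1 = comp Z1 p0 h"
    "q1 \<in> Hom Z1 X" "q0 \<in> Hom Z0 X" "comp Z1 (mod_id X) q1 = comp Z1 q0 h"
    "comp A1 p1 i1 = mod_id A1" "comp A0 p0 i0 = mod_id A0"
    "hadd Z1 Z1 (comp Z1 i1 p1) (comp Z1 j1 q1) = mod_id Z1" "hadd Z0 Z0 (comp Z0 i0 p0) (comp Z0 j0 q0) = mod_id Z0"
    using biproduct_identityD[OF A X bp] by metis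
  then have "(Z1, Z0, h) \<in> maps_ob \<Lambda>" by simp
  from presents_add_identity[OF F A x X this b(4,5,7,8,10,11,14,6,9,12,17,19)] show ?thesis by blast
qed

text \<open>A form of Schanuel's lemma: the sum \<open>h\<close> of \<open>f\<close> and the identity of \<open>B0\<close> is isomorphic to
  the sum of \<open>g\<close> and the identity of \<open>A0\<close>. Let \<open>u : A0 \<rightarrow> B0\<close> and \<open>v : B0 \<rightarrow> A0\<close> lift the identity of
  the functor. The isomorphism on codomains is the composite of the elementary automorphisms of
  \<open>A0 \<oplus> B0\<close> given by \<open>-v\<close> and \<open>u\<close>. It induces the identity on the functor, and since \<open>f\<close> and \<open>g\<close> are
  monomorphisms, it restricts uniquely to the domains.\<close>

lemma schanuel:
  assumes F: "presheaf F"
    and A: "(A1, A0, f) \<in> maps_ob \<Lambda>" "inj_on f (carrier A1)" and x: "presents (A1, A0, f) F x"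
    and B: "(B1, B0, g) \<in> maps_ob \<Lambda>" "inj_on g (carrier B1)" and y: "presents (B1, B0, g) F y"
  obtains Z where "is_biproduct (maps_F \<Lambda>) (A1, A0, f) (identity_map B0) Z"
    "is_biproduct (maps_F \<Lambda>) (B1, B0, g) (identity_map A0) Z"
proof -
  have ob [simp]: "A1 \<in> fg" "A0 \<in> fg" "B1 \<in> fg" "B0 \<in> fg" and f: "f \<in> Hom A1 A0" and g: "g \<in> Hom B1 B0"
    using A(1) B(1) by simp_all
  note x' = presentsD[OF x] and y' = presentsD[OF y]
  have add: "additive F" using presents_additive[OF F A(1) x] .
  obtain u where u: "u \<in> Hom A0 B0" "x = far F A0 B0 u y" using y'(2)[OF ob(2) x'(1)] by blast
  obtain v where v: "v \<in> Hom B0 A0" "y = far F B0 A0 v x" using x'(2)[OF ob(4) y'(1)] by blast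
  obtain Z1 i1 j1 p1 q1 where D1: "dsum A1 B0 Z1 i1 j1 p1 q1" using dsum_exists[OF ob(1,4)] .
  obtain Z0 i0 j0 p0 q0 where D0: "dsum A0 B0 Z0 i0 j0 p0 q0" using dsum_exists[OF ob(2,4)] .
  note d1 = dsumD[OF D1] and d0 = dsumD[OF D0]
  have Z [simp]: "Z1 \<in> fg" "Z0 \<in> fg" using d1(1) d0(1) by simp_all
  define h where "h = hadd Z1 Z0 (comp Z1 i0 (comp Z1 f p1)) (comp Z1 j0 q1)"
  have h: "h \<in> Hom Z1 Z0" unfolding h_def
    by (rule hadd_Hom[OF Z comp_Hom[OF Z(1) comp_Hom[OF Z(1) d1(4) f] d0(2)] comp_Hom[OF Z(1) d1(5) d0(3)]])
  note cl [simp] = Hom_closed[OF f] Hom_closed[OF g] Hom_closed[OF u(1)] Hom_closed[OF v(1)] Hom_closed[OF h]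
    Hom_closed[OF d1(2)] Hom_closed[OF d1(3)] Hom_closed[OF d1(4)] Hom_closed[OF d1(5)]
    Hom_closed[OF d0(2)] Hom_closed[OF d0(3)] Hom_closed[OF d0(4)] Hom_closed[OF d0(5)]
  note z [simp] = Hom_zero[OF f] Hom_zero[OF g] Hom_zero[OF u(1)] Hom_zero[OF v(1)] Hom_zero[OF h]
    Hom_zero[OF d1(2)] Hom_zero[OF d1(3)] Hom_zero[OF d1(4)] Hom_zero[OF d1(5)]
    Hom_zero[OF d0(2)] Hom_zero[OF d0(3)] Hom_zero[OF d0(4)] Hom_zero[OF d0(5)]
  note ad = Hom_add[OF u(1)] Hom_add[OF v(1)] Hom_add[OF d0(2)] Hom_add[OF d0(3)] Hom_add[OF d0(4)] Hom_add[OF d0(5)]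
    Hom_minus[OF u(1)] Hom_minus[OF v(1)] Hom_minus[OF d0(2)] Hom_minus[OF d0(3)] Hom_minus[OF d0(4)] Hom_minus[OF d0(5)]
  have hx: "h w = i0 (f (p1 w)) \<oplus>\<^bsub>Z0\<^esub> j0 (q1 w)" if "w \<in> carrier Z1" for w
    using that by (simp add: h_def compose_eq)
  have inj_h: "inj_on h (carrier Z1)"
  proof (rule Hom_injective[OF h Z])
    fix w assume w: "w \<in> carrier Z1" "h w = \<zero>\<^bsub>Z0\<^esub>"
    have "p0 (h w) = f (p1 w)" "q0 (h w) = q1 w" using w(1) by (simp_all add: hx ad d0)
    then have "f (p1 w) = \<zero>\<^bsub>A0\<^esub>" "q1 w = \<zero>\<^bsub>B0\<^esub>" using w(2) by simp_all
    then have "p1 w = \<zero>\<^bsub>A1\<^esub>" "q1 w = \<zero>\<^bsub>B0\<^esub>" using injective_zero[OF f ob(1,2) A(2)] w(1) by simp_all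
    then show "w = \<zero>\<^bsub>Z1\<^esub>" using d1(10)[OF w(1)] by simp
  qed
  have obZ: "(Z1, Z0, h) \<in> maps_ob \<Lambda>" using h by simp
  have id_ob: "(X, X, mod_id X) \<in> maps_ob \<Lambda>" "inj_on (mod_id X) (carrier X)" if "X \<in> fg" for X
    using that by (simp_all add: inj_on_def)
  have squares: "comp A1 h i1 = comp A1 i0 f" "comp B0 h j1 = comp B0 j0 (mod_id B0)"
      "comp Z1 f p1 = comp Z1 p0 h" "comp Z1 (mod_id B0) q1 = comp Z1 q0 h"
    by - ((rule comp_eqI; simp add: compose_eq hx d1 d0 ad)+)
  have bpA: "is_biproduct (maps_F \<Lambda>) (A1, A0, f) (identity_map B0) (Z1, Z0, h)"
    unfolding identity_map_simps
  proof (rule mono_biproduct[OF A(1) id_ob(1)[OF ob(4)] obZ A(2) id_ob(2)[OF ob(4)] inj_h D0])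
    show "comp A1 h i1 = comp A1 i0 f" by (rule squares)
    show "comp B0 h j1 = comp B0 j0 (mod_id B0)" by (rule squares)
    show "comp Z1 f p1 = comp Z1 p0 h" by (rule squares)
    show "comp Z1 (mod_id B0) q1 = comp Z1 q0 h" by (rule squares)
  qed (use d1 in simp_all)
  define z where "z = far F Z0 A0 p0 x"
  have pz: "presents (Z1, Z0, h) F z"
    unfolding z_def
  proof (rule presents_add_identity[OF F A(1) x ob(4) obZ d1(2) d0(2) d1(3) d0(3) d1(4) d0(4) d0(5) squares(1,2,3)])
    show "comp A0 p0 i0 = mod_id A0" by (rule comp_eqI) (simp_all add: d0)
    show "hadd Z0 Z0 (comp Z0 i0 p0) (comp Z0 j0 q0) = mod_id Z0" by (rule hadd_eqI) (simp_all add: compose_eq d0)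
  qed
  note z' = presentsD[OF pz]
  have far_z: "far F Y Z0 \<phi> z = far F Y A0 (comp Y p0 \<phi>) x" if "Y \<in> fg" "\<phi> \<in> Hom Y Z0" for Y \<phi>
    unfolding z_def using far_comp[OF F that(1) Z(2) ob(2) that(2) d0(4) x'(1)] by simp
  \<comment> \<open>The second biproduct structure on \<open>Z0\<close>: the coordinates are \<open>d = p0 - v q0\<close> in \<open>A0\<close> and
    \<open>c = q0 + u d\<close> in \<open>B0\<close>, and \<open>b\<close> and \<open>a\<close> are the columns of the inverse automorphism.\<close>
  define a where "a = hadd B0 Z0 (comp B0 i0 v) j0"
  define d where "d = hadd Z0 A0 p0 (hneg Z0 A0 (comp Z0 v q0))"
  define c where "c = hadd Z0 B0 q0 (comp Z0 u d)"
  define b where "b = hadd A0 Z0 i0 (hneg A0 Z0 (comp A0 a u))"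
  have a: "a \<in> Hom B0 Z0" unfolding a_def by (rule hadd_Hom[OF ob(4) Z(2) comp_Hom[OF ob(4) v(1) d0(2)] d0(3)])
  have vq: "comp Z0 v q0 \<in> Hom Z0 A0" by (rule comp_Hom[OF Z(2) d0(5) v(1)])
  have d: "d \<in> Hom Z0 A0" unfolding d_def by (rule hadd_Hom[OF Z(2) ob(2) d0(4) hneg_Hom[OF Z(2) ob(2) vq]])
  have c: "c \<in> Hom Z0 B0" unfolding c_def by (rule hadd_Hom[OF Z(2) ob(4) d0(5) comp_Hom[OF Z(2) d u(1)]])
  have au: "comp A0 a u \<in> Hom A0 Z0" by (rule comp_Hom[OF ob(2) u(1) a])
  have b: "b \<in> Hom A0 Z0" unfolding b_def by (rule hadd_Hom[OF ob(2) Z(2) d0(2) hneg_Hom[OF ob(2) Z(2) au]])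
  have a_apply: "a t = i0 (v t) \<oplus>\<^bsub>Z0\<^esub> j0 t" if "t \<in> carrier B0" for t using that by (simp add: a_def compose_eq)
  have d_apply: "d w = p0 w \<oplus>\<^bsub>A0\<^esub> \<ominus>\<^bsub>A0\<^esub> v (q0 w)" if "w \<in> carrier Z0" for w
    using that vq by (simp add: d_def compose_eq)
  have c_apply: "c w = q0 w \<oplus>\<^bsub>B0\<^esub> u (d w)" if "w \<in> carrier Z0" for w using that by (simp add: c_def compose_eq)
  have b_apply: "b t = i0 t \<oplus>\<^bsub>Z0\<^esub> \<ominus>\<^bsub>Z0\<^esub> a (u t)" if "t \<in> carrier A0" for t using that au by (simp add: b_def compose_eq)
  note cl' [simp] = Hom_closed[OF a] Hom_closed[OF b] Hom_closed[OF c] Hom_closed[OF d]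
  have pa: "p0 (a t) = v t" "q0 (a t) = t" if "t \<in> carrier B0" for t using that by (simp_all add: a_apply ad d0)
  have pb: "p0 (b t) = t \<oplus>\<^bsub>A0\<^esub> \<ominus>\<^bsub>A0\<^esub> v (u t)" "q0 (b t) = \<ominus>\<^bsub>B0\<^esub> u t" if "t \<in> carrier A0" for t
    using that by (simp_all add: b_apply ad pa d0)
  have da: "d (a t) = \<zero>\<^bsub>A0\<^esub>" if "t \<in> carrier B0" for t using that by (simp add: d_apply pa)
  have db: "d (b t) = t" if "t \<in> carrier A0" for t using that by (simp add: d_apply pb ad fg_add_assoc)
  have ca: "c (a t) = t" if "t \<in> carrier B0" for t using that by (simp add: c_apply da pa)
  have cb: "c (b t) = \<zero>\<^bsub>B0\<^esub>" if "t \<in> carrier A0" for t using that by (simp add: c_apply db pb)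
  have ac: "a (c w) \<oplus>\<^bsub>Z0\<^esub> b (d w) = w" if w: "w \<in> carrier Z0" for w
  proof -
    have "a (c w) = a (q0 w) \<oplus>\<^bsub>Z0\<^esub> a (u (d w))" using w by (simp add: c_apply Hom_add[OF a])
    then have "a (c w) \<oplus>\<^bsub>Z0\<^esub> b (d w) = a (q0 w) \<oplus>\<^bsub>Z0\<^esub> i0 (d w)"
      using w by (simp add: b_apply fg_add_assoc fg_add_lcomm[of Z0 "a (u (d w))" "i0 (d w)"])
    also have "\<dots> = i0 (p0 w) \<oplus>\<^bsub>Z0\<^esub> j0 (q0 w)"
      using w by (simp add: a_apply d_apply ad fg_add_ac fg_cancel)
    finally show ?thesis using d0(10)[OF w] by simp
  qed
  have D: "dsum B0 A0 Z0 a b c d"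
    unfolding dsum_def using a b c d ca da db cb ac by simp
  \<comment> \<open>In these coordinates \<open>z\<close> is the generator \<open>y\<close> on \<open>B0\<close> and vanishes on \<open>A0\<close>.\<close>
  have az: "far F B0 Z0 a z = y"
  proof -
    have "comp B0 p0 a = v" by (rule comp_eqI) (simp_all add: pa Hom_extensional[OF v(1)])
    then show ?thesis using far_z[OF ob(4) a] v(2) by simp
  qed
  have bz: "far F A0 Z0 b z = \<one>\<^bsub>fob F A0\<^esub>"
  proof -
    have vu: "comp A0 v u \<in> Hom A0 A0" using comp_Hom[OF ob(2) u(1) v(1)] .
    have eq: "comp A0 p0 b = hadd A0 A0 (mod_id A0) (hneg A0 A0 (comp A0 v u))"
      by (rule comp_eqI) (use vu in \<open>simp_all add: pb compose_eq\<close>)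
    have vux: "far F A0 A0 (comp A0 v u) x = x"
      using far_comp[OF F ob(2,4,2) u(1) v(1) x'(1)] u(2)[symmetric] v(2)[symmetric] by simp
    have "far F A0 Z0 b z = x \<otimes>\<^bsub>fob F A0\<^esub> inv\<^bsub>fob F A0\<^esub> x"
      unfolding far_z[OF ob(2) b] eq
        additiveD[OF add ob(2,2) mod_id_Hom[OF ob(2)] hneg_Hom[OF ob(2,2) vu] x'(1)]
        additive_far_neg[OF F add ob(2,2) x'(1) vu] far_id[OF F ob(2) x'(1)] vux ..
    then show ?thesis using group.r_inv[OF val_group[OF F ob(2)] x'(1)] by simp
  qed
  have cy: "far F Z0 B0 c y = z"
  proof -
    interpret FZ: comm_group "fob F Z0" using F by (simp add: val_comm_group)
    have qy: "far F Z0 B0 q0 y \<in> val F Z0" and px: "far F Z0 A0 p0 x \<in> val F Z0"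
      using far_closed[OF F Z(2) ob(4) d0(5) y'(1)] far_closed[OF F Z(2) ob(2) d0(4) x'(1)] .
    have "far F Z0 B0 (comp Z0 u d) y = far F Z0 A0 d x"
      using far_comp[OF F Z(2) ob(2,4) d u(1) y'(1)] u(2) by simp
    also have "\<dots> = far F Z0 A0 p0 x \<otimes>\<^bsub>fob F Z0\<^esub> inv\<^bsub>fob F Z0\<^esub> far F Z0 A0 (comp Z0 v q0) x"
      unfolding d_def using vq d0(4) x'(1) by (simp add: additiveD[OF add] additive_far_neg[OF F add])
    also have "far F Z0 A0 (comp Z0 v q0) x = far F Z0 B0 q0 y"
      using far_comp[OF F Z(2) ob(4,2) d0(5) v(1) x'(1)] v(2) by simp
    finally have "far F Z0 B0 c y = far F Z0 B0 q0 y \<otimes>\<^bsub>fob F Z0\<^esub>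
        (far F Z0 A0 p0 x \<otimes>\<^bsub>fob F Z0\<^esub> inv\<^bsub>fob F Z0\<^esub> far F Z0 B0 q0 y)"
      unfolding c_def using comp_Hom[OF Z(2) d u(1)] d0(5) y'(1) by (simp add: additiveD[OF add])
    then show ?thesis unfolding z_def using qy px by (simp add: FZ.m_lcomm[of "far F Z0 B0 q0 y"])
  qed
  \<comment> \<open>so \<open>a\<close>, \<open>b\<close> and \<open>c\<close> lift to the domains of the monomorphisms\<close>
  have gy: "far F B1 B0 g y = \<one>\<^bsub>fob F B1\<^esub>"
    using y'(4)[OF ob(3) g] comp_id(2)[OF g] mod_id_Hom[OF ob(3)] by metis
  have hz: "far F Z1 Z0 h z = \<one>\<^bsub>fob F Z1\<^esub>"
    using z'(4)[OF Z(1) h] comp_id(2)[OF h] mod_id_Hom[OF Z(1)] by metis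
  have "far F B1 Z0 (comp B1 a g) z = \<one>\<^bsub>fob F B1\<^esub>"
    using far_comp[OF F ob(3,4) Z(2) g a z'(1)] az gy by simp
  then obtain a1 where a1: "a1 \<in> Hom B1 Z1" "comp B1 a g = comp B1 h a1"
    using z'(4)[OF ob(3) comp_Hom[OF ob(3) g a]] by blast
  obtain b1 where b1: "b1 \<in> Hom A0 Z1" "b = comp A0 h b1" using z'(4)[OF ob(2) b] bz by blast
  have "far F Z1 B0 (comp Z1 c h) y = \<one>\<^bsub>fob F Z1\<^esub>"
    using far_comp[OF F Z ob(4) h c y'(1)] cy hz by simp
  then obtain c1 where c1: "c1 \<in> Hom Z1 B1" "comp Z1 c h = comp Z1 g c1"
    using y'(4)[OF Z(1) comp_Hom[OF Z(1) h c]] by blast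
  have dh: "comp Z1 d h \<in> Hom Z1 A0" using comp_Hom[OF Z(1) h d] .
  have "is_biproduct (maps_F \<Lambda>) (B1, B0, g) (identity_map A0) (Z1, Z0, h)"
    unfolding identity_map_simps
    by (rule mono_biproduct[OF B(1) id_ob(1)[OF ob(2)] obZ B(2) id_ob(2)[OF ob(2)] inj_h D a1(1) a1(2)[symmetric] b1(1) _
          c1(1) c1(2)[symmetric] dh])
      (use b1(2) comp_id(2)[OF b] comp_id(1)[OF dh] in simp_all)
  then show thesis using that bpA by blast
qed

end

section \<open>Tilting subcategories\<close>

context artin_algebra_modules
begin

lemma domain_iso:
  assumes S: "mod_ses \<Lambda> mod_zero i T p T'" and T: "T \<in> fg" "T' \<in> fg"
  obtains r where "r \<in> Hom T' T" "comp T r p = mod_id T" "comp T' p r = mod_id T'"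
proof -
  have i: "i \<in> Hom mod_zero T" and p: "p \<in> Hom T T'" and onto: "p ` carrier T = carrier T'"
    using S by (simp_all add: mod_ses_def)
  have "comp mod_zero (mod_id T) i = hzero mod_zero T"
    using comp_id(1)[OF i] Hom_from_zero[OF mod_zero_fg T(1) mod_zero_carrier] i by simp
  then obtain r where r: "r \<in> Hom T' T" "comp T r p = mod_id T"
    using mod_ses_cokernel[OF S mod_zero_fg T T(1) mod_id_Hom[OF T(1)]] by blast
  have "comp T (comp T' p r) p = comp T (mod_id T') p"
    using comp_comp[OF p, of p r] r(2) comp_id[OF p] by simp
  then have "comp T' p r = mod_id T'"
    by (rule epi_comp_cancel[OF onto comp_Hom[OF T(2) r(1) p] mod_id_Hom[OF T(2)]])
  then show thesis using that r by blast
qed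

text \<open>The split sequence of codomains gives exact sequences \<open>0 \<rightarrow> (X, C) \<rightarrow> (X, T1) \<rightarrow> (X, T1') \<rightarrow> 0\<close>. The
  values of \<open>F\<close> and \<open>G\<close> at \<open>X\<close> are the quotients of the last two groups by copies of \<open>(X, T0)\<close> that
  correspond under the isomorphism \<open>p1\<close>. The first one meets \<open>(X, C)\<close> trivially because \<open>g\<close> is a monomorphism, so the
  sequence of quotients is exact.\<close>

lemma coresolution_functor_ses:
  assumes C: "C \<in> fg" and f: "(T0, T1, f) \<in> maps_ob \<Lambda>" and g: "(T0, T1', g) \<in> maps_ob \<Lambda>"
    and inj: "inj_on f (carrier T0)" "inj_on g (carrier T0)"
    and S: "(zero_map_to C, i, (T0, T1, f), p, (T0, T1', g)) \<in> maps_ses \<Lambda>"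
    and split: "mod_split_ses \<Lambda> C (snd i) T1 (snd p) T1'"
    and F: "F \<in> fun_ob" "presents (T0, T1, f) F x" and G: "G \<in> fun_ob" "presents (T0, T1', g) G y"
  shows "\<exists>\<alpha> \<beta>. functor_ses \<Lambda> (representable \<Lambda> C) \<alpha> F \<beta> G"
proof -
  obtain i1 i0 p1 p0 where ip: "i = (i1, i0)" "p = (p1, p0)" by (metis surj_pair)
  note S = maps_sesD[OF S[unfolded ip zero_map_to_simps]]
  have T: "T0 \<in> fg" "T1 \<in> fg" "T1' \<in> fg" and f': "f \<in> Hom T0 T1" and g': "g \<in> Hom T0 T1'" using f g by simp_all
  have pF: "presheaf F" and pG: "presheaf G" using F G by simp_all
  note x' = presentsD[OF F(2)] and y' = presentsD[OF G(2)]
  have addF: "additive F" and addG: "additive G" using fun_ob_additive F(1) G(1) by blast+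
  obtain s where s: "s \<in> Hom T1' T1" "comp T1' p0 s = mod_id T1'" using split by (auto simp: mod_split_ses_def ip)
  obtain r where r: "r \<in> Hom T0 T0" "comp T0 r p1 = mod_id T0" "comp T0 p1 r = mod_id T0" using domain_iso[OF S(16) T(1,1)] .
  have pi0: "comp C p0 i0 = hzero C T1'" using mod_ses_zero[OF S(17) C T(2,3)] .
  have gp: "comp T0 g p1 = comp T0 p0 f" using S(15) .
  define a where "a = far F C T1 i0 x"
  have a: "a \<in> val F C" unfolding a_def by (rule far_closed[OF pF C T(2) S(11) x'(1)])
  have far_a: "far F X C \<phi> a = far F X T1 (comp X i0 \<phi>) x" if "X \<in> fg" "\<phi> \<in> Hom X C" for X \<phi>
    unfolding a_def using far_comp[OF pF that(1) C T(2) that(2) S(11) x'(1)] by simp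
  define b where "b = far G T1 T1' p0 y"
  have b: "b \<in> val G T1" unfolding b_def by (rule far_closed[OF pG T(2,3) S(14) y'(1)])
  have far_b: "far G X T1 \<phi> b = far G X T1' (comp X p0 \<phi>) y" if "X \<in> fg" "\<phi> \<in> Hom X T1" for X \<phi>
    unfolding b_def using far_comp[OF pG that(1) T(2,3) that(2) S(14) y'(1)] by simp
  have obC: "(mod_zero, C, hzero mod_zero C) \<in> maps_ob \<Lambda>" using C by simp
  note rC = representable_presents[OF C, unfolded zero_map_to_simps] and pC = representable_functor[OF C]
  obtain \<alpha> where \<alpha>: "\<alpha> \<in> nat_trans \<Lambda> (representable \<Lambda> C) F"
    and \<alpha>': "\<And>X \<phi>. \<lbrakk>X \<in> fg; \<phi> \<in> Hom X C\<rbrakk> \<Longrightarrow> \<alpha> X (far (representable \<Lambda> C) X C \<phi> (mod_id C)) = far F X C \<phi> a"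
    using presents_yoneda[OF pC obC rC pF addF a additive_far_zero[OF pF addF mod_zero_fg C a]] by metis
  have \<alpha>_apply: "\<alpha> X \<phi> = far F X T1 (comp X i0 \<phi>) x" if "X \<in> fg" "\<phi> \<in> Hom X C" for X \<phi>
    using \<alpha>'[OF that] far_a[OF that] comp_id(1)[OF that(2)] by simp
  have "far G T0 T1' (comp T0 p0 f) y = \<one>\<^bsub>fob G T0\<^esub>"
    using y'(4)[OF T(1) comp_Hom[OF T(1) f' S(14)]] gp S(13) by metis
  then have "far G T0 T1 f b = \<one>\<^bsub>fob G T0\<^esub>" using far_b[OF T(1) f'] by simp
  then obtain \<beta> where \<beta>: "\<beta> \<in> nat_trans \<Lambda> F G"
    and \<beta>': "\<And>X \<phi>. \<lbrakk>X \<in> fg; \<phi> \<in> Hom X T1\<rbrakk> \<Longrightarrow> \<beta> X (far F X T1 \<phi> x) = far G X T1 \<phi> b"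
    using presents_yoneda[OF pF f F(2) pG addG b] by metis
  have \<beta>_apply: "\<beta> X (far F X T1 \<phi> x) = far G X T1' (comp X p0 \<phi>) y" if "X \<in> fg" "\<phi> \<in> Hom X T1" for X \<phi>
    using \<beta>'[OF that] far_b[OF that] by simp
  have "functor_ses \<Lambda> (representable \<Lambda> C) \<alpha> F \<beta> G"
  proof (rule functor_sesI[OF \<alpha> \<beta> pC pF pG])
    fix X \<phi> assume X: "X \<in> fg" and "\<phi> \<in> val (representable \<Lambda> C) X"
    then have \<phi>: "\<phi> \<in> Hom X C" by simp
    have i\<phi>: "comp X i0 \<phi> \<in> Hom X T1" using comp_Hom[OF X \<phi> S(11)] .
    have pi\<phi>: "comp X p0 (comp X i0 \<phi>) = hzero X T1'"
      using comp_comp[OF \<phi>, of p0 i0] pi0 comp_hzero(1)[OF X C T(3) \<phi>] by simp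
    show "\<beta> X (\<alpha> X \<phi>) = \<one>\<^bsub>fob G X\<^esub>"
      unfolding \<alpha>_apply[OF X \<phi>] \<beta>_apply[OF X i\<phi>] pi\<phi> by (rule additive_far_zero[OF pG addG X T(3) y'(1)])
    assume "\<alpha> X \<phi> = \<one>\<^bsub>fob F X\<^esub>"
    then obtain \<theta> where \<theta>: "\<theta> \<in> Hom X T0" "comp X i0 \<phi> = comp X f \<theta>"
      using \<alpha>_apply[OF X \<phi>] x'(4)[OF X i\<phi>] by auto
    have p\<theta>: "comp X p1 \<theta> \<in> Hom X T0" using comp_Hom[OF X \<theta>(1) S(13)] .
    have "comp X g (comp X p1 \<theta>) = comp X (comp T0 p0 f) \<theta>" unfolding gp[symmetric] by (rule comp_comp[OF \<theta>(1), symmetric])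
    also have "\<dots> = hzero X T1'" using comp_comp[OF \<theta>(1), of p0 f] \<theta>(2) pi\<phi> by simp
    finally have "comp X p1 \<theta> = hzero X T0" using mono_kernel_zero[OF g inj(2) X p\<theta>] by simp
    then have "comp X (comp T0 r p1) \<theta> = hzero X T0"
      using comp_comp[OF \<theta>(1), of r p1] comp_hzero(2)[OF X T(1,1) r(1)] by simp
    then have "\<theta> = hzero X T0" using r(2) comp_id(1)[OF \<theta>(1)] by simp
    then have "comp X i0 \<phi> = hzero X T1" using \<theta>(2) comp_hzero(2)[OF X T(1,2) f'] by simp
    then have "comp X i0 \<phi> = comp X i0 (hzero X C)" using comp_hzero(2)[OF X C T(2) S(11)] by simp
    moreover have "inj_on i0 (carrier C)" using S(17) by (simp add: mod_ses_def)
    ultimately have "\<phi> = hzero X C" using injective_comp_cancel[OF _ \<phi> hzero_Hom[OF X C]] by blast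
    then show "\<phi> = \<one>\<^bsub>fob (representable \<Lambda> C) X\<^esub>" by simp
  next
    fix X z assume X: "X \<in> fg" and z: "z \<in> val G X"
    obtain \<psi> where \<psi>: "\<psi> \<in> Hom X T1'" "z = far G X T1' \<psi> y" using y'(2)[OF X z] by blast
    have s\<psi>: "comp X s \<psi> \<in> Hom X T1" using comp_Hom[OF X \<psi>(1) s(1)] .
    have "comp X p0 (comp X s \<psi>) = \<psi>" using comp_comp[OF \<psi>(1), of p0 s] s(2) comp_id(1)[OF \<psi>(1)] by simp
    then have "\<beta> X (far F X T1 (comp X s \<psi>) x) = z" using \<beta>_apply[OF X s\<psi>] \<psi>(2) by simp
    then show "\<exists>w \<in> val F X. \<beta> X w = z" using far_closed[OF pF X T(2) s\<psi> x'(1)] by blast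
  next
    fix X w assume X: "X \<in> fg" and w: "w \<in> val F X" and 1: "\<beta> X w = \<one>\<^bsub>fob G X\<^esub>"
    obtain \<phi> where \<phi>: "\<phi> \<in> Hom X T1" "w = far F X T1 \<phi> x" using x'(2)[OF X w] by blast
    have p\<phi>: "comp X p0 \<phi> \<in> Hom X T1'" using comp_Hom[OF X \<phi>(1) S(14)] .
    obtain \<theta>' where \<theta>': "\<theta>' \<in> Hom X T0" "comp X p0 \<phi> = comp X g \<theta>'"
      using y'(4)[OF X p\<phi>] \<beta>_apply[OF X \<phi>(1)] 1 \<phi>(2) by auto
    define \<theta> where "\<theta> = comp X r \<theta>'"
    have \<theta>: "\<theta> \<in> Hom X T0" unfolding \<theta>_def by (rule comp_Hom[OF X \<theta>'(1) r(1)])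
    have f\<theta>: "comp X f \<theta> \<in> Hom X T1" using comp_Hom[OF X \<theta> f'] .
    have "comp X p1 \<theta> = \<theta>'" unfolding \<theta>_def using comp_comp[OF \<theta>'(1), of p1 r] r(3) comp_id(1)[OF \<theta>'(1)] by simp
    then have "comp X p0 \<phi> = comp X (comp T0 g p1) \<theta>" using \<theta>'(2) comp_comp[OF \<theta>, of g p1] by simp
    then have eq: "comp X p0 \<phi> = comp X p0 (comp X f \<theta>)" unfolding gp using comp_comp[OF \<theta>, of p0 f] by simp
    let ?d = "hadd X T1 \<phi> (hneg X T1 (comp X f \<theta>))"
    have d: "?d \<in> Hom X T1" using \<phi>(1) f\<theta> X T by simp
    have "comp X p0 ?d = hzero X T1'"
    proof (rule comp_eqI)
      fix t assume t: "t \<in> carrier X"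
      have "p0 (\<phi> t) = p0 (comp X f \<theta> t)" using comp_eq_compD[OF eq t] .
      then show "p0 (?d t) = hzero X T1' t"
        using t X T f\<theta> Hom_closed[OF \<phi>(1) t] Hom_closed[OF f\<theta> t] Hom_closed[OF S(14)]
        by (simp add: Hom_add[OF S(14)] Hom_minus[OF S(14)])
    qed simp
    then obtain \<chi> where \<chi>: "\<chi> \<in> Hom X C" "comp X i0 \<chi> = ?d"
      using mod_ses_kernel[OF S(17) C T(2,3) X d] by blast
    have "far F X T1 (comp X f \<theta>) x = \<one>\<^bsub>fob F X\<^esub>" using x'(4)[OF X f\<theta>] \<theta> by blast
    then have "far F X T1 ?d x = w"
      using additiveD[OF addF X T(2) \<phi>(1) hneg_Hom[OF X T(2) f\<theta>] x'(1)] additive_far_neg[OF pF addF X T(2) x'(1) f\<theta>]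
        \<phi>(2) w monoid.inv_one[OF group.is_monoid[OF val_group[OF pF X]]] monoid.r_one[OF group.is_monoid[OF val_group[OF pF X]] w] by simp
    then have "\<alpha> X \<chi> = w" using \<alpha>_apply[OF X \<chi>(1)] \<chi>(2) by simp
    then show "\<exists>\<chi> \<in> val (representable \<Lambda> C) X. \<alpha> X \<chi> = w" using \<chi>(1) by auto
  qed
  then show ?thesis by blast
qed

text \<open>Conversely, let \<open>0 \<rightarrow> (-, C) \<rightarrow> F \<rightarrow> G \<rightarrow> 0\<close> be exact, and let the monomorphism \<open>g : S0 \<rightarrow> S1\<close>
  present \<open>G\<close>. By the horseshoe lemma \<open>F\<close> has a resolution with terms \<open>(-, S0)\<close> and \<open>(-, C \<oplus> S1)\<close>, given
  by a map \<open>(c, g)\<close>. So \<open>F\<close> is presented by a monomorphism that has the same domain as \<open>g\<close>.\<close>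

lemma horseshoe:
  assumes C: "C \<in> fg" and F: "F \<in> fun_ob" and G: "G \<in> fun_ob"
    and S: "functor_ses \<Lambda> (representable \<Lambda> C) \<alpha> F \<beta> G"
    and g: "(S0, S1, g) \<in> maps_ob \<Lambda>" and inj: "inj_on g (carrier S0)" and t: "presents (S0, S1, g) G t"
  obtains Z f i p w where "(S0, Z, f) \<in> maps_ob \<Lambda>" "inj_on f (carrier S0)" "presents (S0, Z, f) F w"
    "(zero_map_to C, i, (S0, Z, f), p, (S0, S1, g)) \<in> maps_ses \<Lambda>" "mod_split_ses \<Lambda> C (snd i) Z (snd p) S1"
proof -
  have S0 [simp]: "S0 \<in> fg" and S1 [simp]: "S1 \<in> fg" and g': "g \<in> Hom S0 S1" using g by simp_all
  note C [simp]
  have pF: "presheaf F" and pG: "presheaf G" using F G by simp_all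
  have addF: "additive F" using fun_ob_additive[OF F] .
  note S' = functor_sesD[OF S] and t' = presentsD[OF t]
  define a where "a = \<alpha> C (mod_id C)"
  have a: "a \<in> val F C" unfolding a_def using nat_transD(3)[OF S'(1) C, of "mod_id C"] by simp
  have \<alpha>_apply: "\<alpha> X \<phi> = far F X C \<phi> a" if "X \<in> fg" "\<phi> \<in> Hom X C" for X \<phi>
    unfolding a_def using nat_transD(5)[OF S'(1) that(1) C that(2), of "mod_id C"] comp_id(1)[OF that(2)] by simp
  have \<alpha>_inj: "\<phi> = hzero X C" if X: "X \<in> fg" and \<phi>: "\<phi> \<in> Hom X C" and 1: "far F X C \<phi> a = \<one>\<^bsub>fob F X\<^esub>" for X \<phi>
  proof (rule inj_onD[OF S'(3)[OF X]])
    show "\<alpha> X \<phi> = \<alpha> X (hzero X C)"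
      unfolding \<alpha>_apply[OF X \<phi>] \<alpha>_apply[OF X hzero_Hom[OF X C]] 1 using additive_far_zero[OF pF addF X C a] by simp
  qed (use \<phi> X in simp_all)
  obtain y where y: "y \<in> val F S1" "\<beta> S1 y = t" using S'(7)[OF S1 t'(1)] by blast
  have \<beta>y: "\<beta> X (far F X S1 \<phi> y) = far G X S1 \<phi> t" if "X \<in> fg" "\<phi> \<in> Hom X S1" for X \<phi>
    using nat_transD(5)[OF S'(2) that(1) S1 that(2) y(1)] y(2) by simp
  have "far G S0 S1 g t = \<one>\<^bsub>fob G S0\<^esub>"
    using t'(4)[OF S0 g'] comp_id(2)[OF g'] mod_id_Hom[OF S0] by metis
  then have "\<beta> S0 (far F S0 S1 g y) = \<one>\<^bsub>fob G S0\<^esub>" using \<beta>y[OF S0 g'] by simp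
  then obtain c' where "c' \<in> val (representable \<Lambda> C) S0" "\<alpha> S0 c' = far F S0 S1 g y"
    using S'(8)[OF S0 far_closed[OF pF S0 S1 g' y(1)]] by blast
  then have c': "c' \<in> Hom S0 C" "far F S0 C c' a = far F S0 S1 g y" using \<alpha>_apply[OF S0, of c'] by simp_all
  \<comment> \<open>the sign makes the relation \<open>c a + g y = 0\<close> hold in \<open>F S0\<close>\<close>
  define c where "c = hneg S0 C c'"
  have c: "c \<in> Hom S0 C" unfolding c_def by (rule hneg_Hom[OF S0 C c'(1)])
  obtain Z i j p q where D: "dsum C S1 Z i j p q" using dsum_exists[OF C S1] .
  note D' = dsumD[OF D] and Z [simp] = dsumD(1)[OF D]
  define f where "f = hadd S0 Z (comp S0 i c) (comp S0 j g)"
  have ic: "comp S0 i c \<in> Hom S0 Z" and jg: "comp S0 j g \<in> Hom S0 Z" using comp_Hom[OF S0 c D'(2)] comp_Hom[OF S0 g' D'(3)] .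
  have f: "f \<in> Hom S0 Z" unfolding f_def by (rule hadd_Hom[OF S0 Z ic jg])
  note [simp] = Hom_closed[OF c] Hom_closed[OF g'] Hom_closed[OF D'(2)] Hom_closed[OF D'(3)] Hom_closed[OF D'(4)] Hom_closed[OF D'(5)]
    Hom_closed[OF f] Hom_zero[OF D'(2)] Hom_zero[OF D'(3)] Hom_zero[OF D'(4)] Hom_zero[OF D'(5)] D'(6-9)
  note ad = Hom_add[OF D'(4)] Hom_add[OF D'(5)]
  have fx: "f s = i (c s) \<oplus>\<^bsub>Z\<^esub> j (g s)" if "s \<in> carrier S0" for s using that by (simp add: f_def compose_eq)
  have pf: "comp S0 p f = c" by (rule comp_eqI) (simp_all add: fx ad Hom_extensional[OF c])
  have qf: "comp S0 q f = g" by (rule comp_eqI) (simp_all add: fx ad Hom_extensional[OF g'])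
  have injf: "inj_on f (carrier S0)"
  proof (rule inj_onI)
    fix s s' assume s: "s \<in> carrier S0" "s' \<in> carrier S0" "f s = f s'"
    then have "g s = g s'" using comp_eqD[OF qf s(1)] comp_eqD[OF qf s(2)] by simp
    then show "s = s'" using inj s by (meson inj_onD)
  qed
  have ob: "(S0, Z, f) \<in> maps_ob \<Lambda>" using f by simp
  define w where "w = far F Z C p a \<otimes>\<^bsub>fob F Z\<^esub> far F Z S1 q y"
  have pa: "far F Z C p a \<in> val F Z" and qy: "far F Z S1 q y \<in> val F Z"
    using far_closed[OF pF Z C D'(4) a] far_closed[OF pF Z S1 D'(5) y(1)] .
  have w: "w \<in> val F Z" unfolding w_def using val_mult[OF pF Z pa qy] .
  have far_w: "far F X Z \<phi> w = far F X C (comp X p \<phi>) a \<otimes>\<^bsub>fob F X\<^esub> far F X S1 (comp X q \<phi>) y"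
    if "X \<in> fg" "\<phi> \<in> Hom X Z" for X \<phi>
    unfolding w_def far_mult[OF pF that(1) Z that(2) pa qy]
      far_comp[OF pF that(1) Z C that(2) D'(4) a] far_comp[OF pF that(1) Z S1 that(2) D'(5) y(1)] ..
  have "presents (S0, Z, f) F w"
    unfolding presents_def prod.case
  proof (intro conjI ballI w)
    fix X assume X: "X \<in> fg"
    interpret FX: comm_group "fob F X" using pF X by (rule val_comm_group)
    show "\<exists>\<phi> \<in> Hom X Z. z = far F X Z \<phi> w" if z: "z \<in> val F X" for z
    proof -
      obtain \<psi> where \<psi>: "\<psi> \<in> Hom X S1" "\<beta> X z = far G X S1 \<psi> t"
        using t'(2)[OF X nat_transD(3)[OF S'(2) X z]] by blast
      have \<psi>y: "far F X S1 \<psi> y \<in> val F X" using far_closed[OF pF X S1 \<psi>(1) y(1)] .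
      let ?z = "z \<otimes>\<^bsub>fob F X\<^esub> inv\<^bsub>fob F X\<^esub> far F X S1 \<psi> y"
      have z': "?z \<in> val F X" using z \<psi>y by simp
      have "\<beta> X ?z = \<beta> X z \<otimes>\<^bsub>fob G X\<^esub> inv\<^bsub>fob G X\<^esub> \<beta> X (far F X S1 \<psi> y)"
        using nat_transD(4)[OF S'(2) X z FX.inv_closed[OF \<psi>y]] nat_trans_inv[OF pF pG S'(2) X \<psi>y] by simp
      also have "\<dots> = \<one>\<^bsub>fob G X\<^esub>"
        using \<beta>y[OF X \<psi>(1)] \<psi>(2) group.r_inv[OF val_group[OF pG X] nat_transD(3)[OF S'(2) X z]] by simp
      finally obtain \<chi> where "\<chi> \<in> val (representable \<Lambda> C) X" "\<alpha> X \<chi> = ?z" using S'(8)[OF X z'] by blast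
      then have \<chi>: "\<chi> \<in> Hom X C" "far F X C \<chi> a = ?z" using \<alpha>_apply[OF X, of \<chi>] by simp_all
      let ?\<phi> = "hadd X Z (comp X i \<chi>) (comp X j \<psi>)"
      have \<phi>: "?\<phi> \<in> Hom X Z" by (rule hadd_Hom[OF X Z comp_Hom[OF X \<chi>(1) D'(2)] comp_Hom[OF X \<psi>(1) D'(3)]])
      have "comp X p ?\<phi> = \<chi>" "comp X q ?\<phi> = \<psi>"
        by - ((rule comp_eqI; simp add: compose_eq ad Hom_closed[OF \<chi>(1)] Hom_closed[OF \<psi>(1)] Hom_extensional[OF \<chi>(1)] Hom_extensional[OF \<psi>(1)])+)
      then have "far F X Z ?\<phi> w = z" using far_w[OF X \<phi>] \<chi>(2) z \<psi>y by (simp add: FX.m_assoc)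
      then show ?thesis using \<phi> by blast
    qed
    show "far F X Z (hadd X Z \<phi> \<psi>) w = far F X Z \<phi> w \<otimes>\<^bsub>fob F X\<^esub> far F X Z \<psi> w"
      if "\<phi> \<in> Hom X Z" "\<psi> \<in> Hom X Z" for \<phi> \<psi>
      by (rule additiveD[OF addF X Z that w])
    fix \<phi> assume \<phi>: "\<phi> \<in> Hom X Z"
    have p\<phi>: "comp X p \<phi> \<in> Hom X C" and q\<phi>: "comp X q \<phi> \<in> Hom X S1"
      using comp_Hom[OF X \<phi> D'(4)] comp_Hom[OF X \<phi> D'(5)] .
    have p\<phi>a: "far F X C (comp X p \<phi>) a \<in> val F X" and q\<phi>y: "far F X S1 (comp X q \<phi>) y \<in> val F X"
      using far_closed[OF pF X C p\<phi> a] far_closed[OF pF X S1 q\<phi> y(1)] .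
    have gy: "far F X S1 (comp X g \<theta>) y = far F X C (comp X c' \<theta>) a" if \<theta>: "\<theta> \<in> Hom X S0" for \<theta>
      using far_comp[OF pF X S0 S1 \<theta> g' y(1)] far_comp[OF pF X S0 C \<theta> c'(1) a] c'(2) by simp
    have c\<theta>: "hadd X C (comp X c \<theta>) (comp X c' \<theta>) = hzero X C" if \<theta>: "\<theta> \<in> Hom X S0" for \<theta>
      by (rule hadd_eqI) (use c'(1) Hom_closed[OF \<theta>] Hom_closed[OF c'(1)] in \<open>simp_all add: compose_eq c_def\<close>)
    show "far F X Z \<phi> w = \<one>\<^bsub>fob F X\<^esub> \<longleftrightarrow> (\<exists>\<theta> \<in> Hom X S0. \<phi> = comp X f \<theta>)"
    proof
      assume 1: "far F X Z \<phi> w = \<one>\<^bsub>fob F X\<^esub>"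
      have "\<beta> X (far F X C (comp X p \<phi>) a) = \<one>\<^bsub>fob G X\<^esub>"
        using S'(6)[OF X, of "comp X p \<phi>"] \<alpha>_apply[OF X p\<phi>] p\<phi> by simp
      then have "\<beta> X (far F X Z \<phi> w) = \<beta> X (far F X S1 (comp X q \<phi>) y)"
        unfolding far_w[OF X \<phi>] nat_transD(4)[OF S'(2) X p\<phi>a q\<phi>y]
        using monoid.l_one[OF group.is_monoid[OF val_group[OF pG X]] nat_transD(3)[OF S'(2) X q\<phi>y]] by simp
      then have "far G X S1 (comp X q \<phi>) t = \<one>\<^bsub>fob G X\<^esub>"
        using 1 nat_trans_one[OF pF pG S'(2) X] \<beta>y[OF X q\<phi>] by simp
      then obtain \<theta> where \<theta>: "\<theta> \<in> Hom X S0" "comp X q \<phi> = comp X g \<theta>" using t'(4)[OF X q\<phi>] by auto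
      have c'\<theta>: "comp X c' \<theta> \<in> Hom X C" and c\<theta>': "comp X c \<theta> \<in> Hom X C"
        using comp_Hom[OF X \<theta>(1) c'(1)] comp_Hom[OF X \<theta>(1) c] .
      have "far F X C (hadd X C (comp X p \<phi>) (comp X c' \<theta>)) a = \<one>\<^bsub>fob F X\<^esub>"
        using additiveD[OF addF X C p\<phi> c'\<theta> a] 1 far_w[OF X \<phi>] \<theta>(2) gy[OF \<theta>(1)] by simp
      then have "hadd X C (comp X p \<phi>) (comp X c' \<theta>) = hzero X C"
        by (rule \<alpha>_inj[OF X hadd_Hom[OF X C p\<phi> c'\<theta>]])
      then have eq: "comp X p \<phi> = comp X c \<theta>"
        using c\<theta>[OF \<theta>(1)] group.right_cancel[OF comm_group.axioms(2)[OF Hom_comm_group[OF X C]] c'\<theta> p\<phi> c\<theta>'] by simp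
      have "comp X f \<theta> = \<phi>"
      proof (rule comp_eqI)
        fix s assume s: "s \<in> carrier X"
        have "p (\<phi> s) = c (\<theta> s)" "q (\<phi> s) = g (\<theta> s)" using comp_eq_compD[OF eq s] comp_eq_compD[OF \<theta>(2) s] .
        then show "f (\<theta> s) = \<phi> s" using D'(10)[OF Hom_closed[OF \<phi> s]] fx[OF Hom_closed[OF \<theta>(1) s]] by simp
      qed (rule Hom_extensional[OF \<phi>])
      then show "\<exists>\<theta> \<in> Hom X S0. \<phi> = comp X f \<theta>" using \<theta>(1) by blast
    next
      assume "\<exists>\<theta> \<in> Hom X S0. \<phi> = comp X f \<theta>"
      then obtain \<theta> where \<theta>: "\<theta> \<in> Hom X S0" "\<phi> = comp X f \<theta>" by blast
      have c'\<theta>: "comp X c' \<theta> \<in> Hom X C" and c\<theta>': "comp X c \<theta> \<in> Hom X C"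
        using comp_Hom[OF X \<theta>(1) c'(1)] comp_Hom[OF X \<theta>(1) c] .
      have "comp X p \<phi> = comp X c \<theta>" "comp X q \<phi> = comp X g \<theta>"
        unfolding \<theta>(2) using comp_comp[OF \<theta>(1), of p f] comp_comp[OF \<theta>(1), of q f] pf qf by simp_all
      then have "far F X Z \<phi> w = far F X C (hadd X C (comp X c \<theta>) (comp X c' \<theta>)) a"
        unfolding far_w[OF X \<phi>] additiveD[OF addF X C c\<theta>' c'\<theta> a] using gy[OF \<theta>(1)] by simp
      then show "far F X Z \<phi> w = \<one>\<^bsub>fob F X\<^esub>"
        unfolding c\<theta>[OF \<theta>(1)] using additive_far_zero[OF pF addF X C a] by simp
    qed
  qed
  moreover have split: "mod_split_ses \<Lambda> C i Z q S1"
    unfolding mod_split_ses_def mod_ses_def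
  proof (intro conjI bexI[of _ j] D'(2,3,5))
    show "inj_on i (carrier C)" by (rule inj_on_inverseI[of _ p]) simp
    show "q ` carrier Z = carrier S1"
    proof (intro subset_antisym subsetI)
      fix s assume "s \<in> carrier S1" then show "s \<in> q ` carrier Z" by (intro image_eqI[of _ _ "j s"]) simp_all
    qed (use Hom_closed[OF D'(5)] in blast)
    show "comp S1 q j = mod_id S1" by (rule comp_eqI) simp_all
    have "\<exists>x \<in> carrier C. z = i x" if "z \<in> carrier Z" "q z = \<zero>\<^bsub>S1\<^esub>" for z
      using D'(10)[OF that(1)] that by (intro bexI[of _ "p z"]) simp_all
    then show "i ` carrier C = {z \<in> carrier Z. q z = \<zero>\<^bsub>S1\<^esub>}" using Hom_closed[OF D'(2)] D'(7) by blast
  qed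
  moreover have "(zero_map_to C, (hzero mod_zero S0, i), (S0, Z, f), (mod_id S0, q), (S0, S1, g)) \<in> maps_ses \<Lambda>"
  proof -
    have "mod_split_ses \<Lambda> mod_zero (hzero mod_zero S0) S0 (mod_id S0) S0"
      by (rule split_zero_left) (simp_all add: mod_zero_simps)
    moreover have zero: "comp mod_zero f (hzero mod_zero S0) = hzero mod_zero Z" "comp mod_zero i (hzero mod_zero C) = hzero mod_zero Z"
      using comp_hzero(2)[OF mod_zero_fg S0 Z f] comp_hzero(2)[OF mod_zero_fg C Z D'(2)] .
    ultimately show ?thesis
      using split f g' D' qf comp_id(2)[OF g'] by (simp add: maps_ses_def mod_split_ses_def zero)
  qed
  ultimately show thesis using that[OF ob injf] by (metis snd_conv)
qed

subsection \<open>Relative tilting subcategories of monomorphisms\<close>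

lemma all_monomorphismsD: "\<lbrakk>all_monomorphisms \<T>; (T0, T1, f) \<in> \<T>\<rbrakk> \<Longrightarrow> inj_on f (carrier T0)"
  by (auto simp: all_monomorphisms_def)

text \<open>The sequence is \<open>F\<close>-exact, because its terms are monomorphisms, its codomains split, and the map
  between its domains is an isomorphism. It is spliced with \<open>0 \<rightarrow> g \<rightarrow> g \<rightarrow> 0 \<rightarrow> 0\<close> to a coresolution.\<close>

lemma short_coresolution:
  assumes mono: "all_monomorphisms \<T>" and sub: "\<T> \<subseteq> maps_ob \<Lambda>" and short: "short_split_coresolutions \<Lambda> \<T>" and C: "C \<in> fg"
  shows "finite_coresolution (maps_F \<Lambda>) \<T> (zero_map_to C)"
proof -
  obtain T0 T1 T1' f g i p where T: "(T0, T1, f) \<in> \<T>" "(T0, T1', g) \<in> \<T>"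
    and S: "(zero_map_to C, i, (T0, T1, f), p, (T0, T1', g)) \<in> maps_ses \<Lambda>" and split: "mod_split_ses \<Lambda> C (snd i) T1 (snd p) T1'"
    using short C unfolding short_split_coresolutions_def by blast
  obtain i1 i0 p1 p0 where ip: "i = (i1, i0)" "p = (p1, p0)" by (metis surj_pair)
  have ob: "(T0, T1, f) \<in> maps_ob \<Lambda>" "(T0, T1', g) \<in> maps_ob \<Lambda>" using T sub by blast+
  then have fg [simp]: "T0 \<in> fg" "T1 \<in> fg" "T1' \<in> fg" "f \<in> Hom T0 T1" "g \<in> Hom T0 T1'" by simp_all
  have inj: "inj_on f (carrier T0)" "inj_on g (carrier T0)" using all_monomorphismsD[OF mono] T by blast+
  note S' = maps_sesD[OF S[unfolded ip zero_map_to_simps]]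
  obtain r where "r \<in> Hom T0 T0" "comp T0 p1 r = mod_id T0" using domain_iso[OF S'(16) fg(1,1)] by blast
  then have "mod_split_ses \<Lambda> mod_zero i1 T0 p1 T0" using S'(16) by (auto simp: mod_split_ses_def)
  then have 1: "(zero_map_to C, i, (T0, T1, f), p, (T0, T1', g)) \<in> F_ses \<Lambda>"
    unfolding ip zero_map_to_simps
    by (intro F_ses_mono ob inj) (use S' split C in \<open>simp_all add: ip mod_zero_simps\<close>)
  let ?Z = "zero_map_to mod_zero"
  have 2: "((T0, T1', g), (mod_id T0, mod_id T1'), (T0, T1', g), (hzero T0 mod_zero, hzero T1' mod_zero), ?Z) \<in> F_ses \<Lambda>"
    unfolding zero_map_to_simps
  proof (intro F_ses_mono ob inj)
    show "mod_split_ses \<Lambda> T0 (mod_id T0) T0 (hzero T0 mod_zero) mod_zero"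
      "mod_split_ses \<Lambda> T1' (mod_id T1') T1' (hzero T1' mod_zero) mod_zero"
      by (rule split_zero_right; simp add: mod_zero_simps)+
    show "(mod_id T0, mod_id T1') \<in> carrier (maps_mor \<Lambda> (T0, T1', g) (T0, T1', g))"
      using comp_id[OF fg(5)] by simp
    show "(hzero T0 mod_zero, hzero T1' mod_zero) \<in> carrier (maps_mor \<Lambda> (T0, T1', g) (mod_zero, mod_zero, hzero mod_zero mod_zero))"
      using comp_hzero(1)[OF fg(1,3) mod_zero_fg fg(5)] by simp
  qed (simp_all add: mod_zero_simps)
  have Z: "zero_object (maps_F \<Lambda>) ?Z" by (rule zero_object_maps)
  show ?thesis
    unfolding finite_coresolution_def
    by (rule exI[of _ 1], rule exI[of _ "case_nat (T0, T1, f) (\<lambda>_. (T0, T1', g))"],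
        rule exI[of _ "case_nat (zero_map_to C) (case_nat (T0, T1', g) (\<lambda>_. ?Z))"],
        rule exI[of _ "case_nat i (\<lambda>_. (mod_id T0, mod_id T1'))"],
        rule exI[of _ "case_nat p (\<lambda>_. (hzero T0 mod_zero, hzero T1' mod_zero))"])
      (use T 1 2 Z in \<open>auto split: nat.splits simp del: zero_map_to_simps\<close>)
qed

text \<open>The resolution of length one of a monomorphism takes care of the relative projective dimensions and
  of the higher Ext groups, and the short coresolutions are finite coresolutions.\<close>

lemma relative_tilting_by_monos_iff:
  "relative_tilting_by_monos \<Lambda> \<T> \<longleftrightarrow> \<T> \<subseteq> maps_ob \<Lambda> \<and> all_monomorphisms \<T> \<and>
     (\<forall>T \<in> \<T>. \<forall>T' \<in> \<T>. ext_vanishes T T') \<and> short_split_coresolutions \<Lambda> \<T>" (is "?L \<longleftrightarrow> ?R")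
proof
  assume L: ?L
  then have sub: "\<T> \<subseteq> maps_ob \<Lambda>" and mono: "all_monomorphisms \<T>" and ext: "ext1_F_vanishes \<Lambda> \<T>"
    and short: "short_split_coresolutions \<Lambda> \<T>"
    by (simp_all add: relative_tilting_by_monos_def relative_tilting_def)
  have "ext_vanishes T T'" if T: "T \<in> \<T>" "T' \<in> \<T>" for T T'
  proof -
    obtain T1 T0 f where eq: "T = (T1, T0, f)" by (metis prod_cases3)
    have "(T1, T0, f) \<in> maps_ob \<Lambda>" "inj_on f (carrier T1)" "T' \<in> maps_ob \<Lambda>"
      using T sub all_monomorphismsD[OF mono] eq by blast+
    then show ?thesis using Ext1_F_trivial_iff ext T unfolding ext1_F_vanishes_def eq by blast
  qed
  then show ?R using sub mono short by blast
next
  assume R: ?R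
  then have sub: "\<T> \<subseteq> maps_ob \<Lambda>" and mono: "all_monomorphisms \<T>" and ext: "\<And>T T'. \<lbrakk>T \<in> \<T>; T' \<in> \<T>\<rbrakk> \<Longrightarrow> ext_vanishes T T'"
    and short: "short_split_coresolutions \<Lambda> \<T>" by blast+
  have Ext: "trivial_group (Ext (maps_F \<Lambda>) k T T')" and pd: "pdim (maps_F \<Lambda>) T \<le> enat 1"
    if T: "T \<in> \<T>" "T' \<in> \<T>" and k: "k \<ge> 1" for T T' k
  proof -
    obtain T1 T0 f where eq: "T = (T1, T0, f)" by (metis prod_cases3)
    have ob: "(T1, T0, f) \<in> maps_ob \<Lambda>" "inj_on f (carrier T1)" "T' \<in> maps_ob \<Lambda>"
      using T sub all_monomorphismsD[OF mono] eq by blast+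
    show "trivial_group (Ext (maps_F \<Lambda>) k T T')"
    proof (cases "k = 1")
      case True
      then show ?thesis using Ext1_F_trivial_iff[OF ob] ext[OF T] eq by simp
    next
      case False
      then have "k \<ge> 2" using k by simp
      then show ?thesis using Ext_F_trivial[OF ob] eq by simp
    qed
    show "pdim (maps_F \<Lambda>) T \<le> enat 1" using pdim_F_le_1[OF ob(1,2)] eq by (simp add: one_enat_def)
  qed
  have "relative_tilting \<Lambda> \<T>"
    unfolding relative_tilting_def
    using sub Ext pd short_coresolution[OF mono sub short] by (simp del: zero_map_to_simps) blast
  then show ?L
    unfolding relative_tilting_by_monos_def ext1_F_vanishes_def using mono short Ext by blast
qed

subsection \<open>The correspondence\<close>

lemma isomorphic_refl: assumes "F \<in> fun_ob" shows "isomorphic (mod_mod \<Lambda>) F F"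
proof -
  obtain A1 A0 f x where "(A1, A0, f) \<in> maps_ob \<Lambda>" "presents (A1, A0, f) F x" using fun_ob_presents[OF assms] .
  then show ?thesis using presents_isomorphic[OF assms assms] by blast
qed

lemma Phi_image_iff:
  assumes "\<T> \<subseteq> maps_ob \<Lambda>"
  shows "U \<in> Phi_image \<Lambda> \<T> \<longleftrightarrow> U \<in> fun_ob \<and> (\<exists>T \<in> \<T>. \<exists>x. presents T U x)"
proof
  assume "U \<in> Phi_image \<Lambda> \<T>"
  then obtain T where U: "U \<in> fun_ob" and T: "T \<in> \<T>" and iso: "isomorphic (mod_mod \<Lambda>) U (Phi \<Lambda> T)"
    by (auto simp: Phi_image_def iso_closure_def)
  have ob: "T \<in> maps_ob \<Lambda>" using T assms by blast
  have "isomorphic (mod_mod \<Lambda>) (Phi \<Lambda> T) U" using iso unfolding isomorphic_def by blast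
  then show "U \<in> fun_ob \<and> (\<exists>T \<in> \<T>. \<exists>x. presents T U x)"
    using isomorphic_presents[OF Phi_presheaf[OF ob] fun_ob_presheaf[OF U] _ ob] Phi_presents_ex[OF ob] U T by blast
next
  assume "U \<in> fun_ob \<and> (\<exists>T \<in> \<T>. \<exists>x. presents T U x)"
  then obtain T x where U: "U \<in> fun_ob" and T: "T \<in> \<T>" "presents T U x" by blast
  have ob: "T \<in> maps_ob \<Lambda>" using T assms by blast
  obtain y where "presents T (Phi \<Lambda> T) y" using Phi_presents_ex[OF ob] by blast
  then have "isomorphic (mod_mod \<Lambda>) U (Phi \<Lambda> T)" using presents_isomorphic[OF U Phi_fun_ob[OF ob] ob T(2)] by blast
  then show "U \<in> Phi_image \<Lambda> \<T>" using U T(1) by (auto simp: Phi_image_def iso_closure_def)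
qed

text \<open>On tilting subcategories, the inverse of \<open>Phi_image\<close> up to isomorphism and summands \<open>1\<^sub>X\<close>.\<close>

definition monos_presenting :: "'a fpfun set \<Rightarrow> 'a mapobj set" where
  "monos_presenting \<U> = {T \<in> maps_ob \<Lambda>. inj_on (snd (snd T)) (carrier (fst T)) \<and> (\<exists>U \<in> \<U>. \<exists>x. presents T U x)}"

theorem classical_tilting_Phi_image:
  assumes "relative_tilting_by_monos \<Lambda> \<T>"
  shows "classical_tilting \<Lambda> (Phi_image \<Lambda> \<T>)"
proof -
  have sub: "\<T> \<subseteq> maps_ob \<Lambda>" and mono: "all_monomorphisms \<T>" and ext: "\<And>T T'. \<lbrakk>T \<in> \<T>; T' \<in> \<T>\<rbrakk> \<Longrightarrow> ext_vanishes T T'"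
    and short: "short_split_coresolutions \<Lambda> \<T>" using assms unfolding relative_tilting_by_monos_iff by blast+
  note im = Phi_image_iff[OF sub]
  have pres: "\<exists>A1 A0 f x. (A1, A0, f) \<in> \<T> \<and> (A1, A0, f) \<in> maps_ob \<Lambda> \<and> inj_on f (carrier A1) \<and> presents (A1, A0, f) U x"
    if U: "U \<in> Phi_image \<Lambda> \<T>" for U
  proof -
    obtain A1 A0 f x where "(A1, A0, f) \<in> \<T>" "presents (A1, A0, f) U x" using U im by (metis prod_cases3)
    then show ?thesis using sub all_monomorphismsD[OF mono] by blast
  qed
  show ?thesis
    unfolding classical_tilting_def
  proof (intro conjI ballI)
    show "Phi_image \<Lambda> \<T> \<subseteq> fun_ob" using im by blast
    fix U assume U: "U \<in> Phi_image \<Lambda> \<T>"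
    obtain A1 A0 f x where A: "(A1, A0, f) \<in> \<T>" "(A1, A0, f) \<in> maps_ob \<Lambda>" "inj_on f (carrier A1)" "presents (A1, A0, f) U x"
      using pres[OF U] by blast
    have Uob: "U \<in> fun_ob" using U im by blast
    show "pdim (mod_mod \<Lambda>) U \<le> 1" using pdim_presented_by_mono[OF Uob A(2-4)] .
    fix V assume V: "V \<in> Phi_image \<Lambda> \<T>"
    obtain B1 B0 g y where B: "(B1, B0, g) \<in> \<T>" "(B1, B0, g) \<in> maps_ob \<Lambda>" "presents (B1, B0, g) V y"
      using pres[OF V] by blast
    have Vob: "V \<in> fun_ob" using V im by blast
    show "trivial_group (Ext (mod_mod \<Lambda>) 1 U V)"
      using Ext1_presented_by_mono[OF Uob A(2-4) Vob B(2,3)] ext[OF A(1) B(1)] by simp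
  next
    fix C assume C: "C \<in> fg"
    obtain T0 T1 T1' f g i p where T: "(T0, T1, f) \<in> \<T>" "(T0, T1', g) \<in> \<T>"
      and S: "(zero_map_to C, i, (T0, T1, f), p, (T0, T1', g)) \<in> maps_ses \<Lambda>" and split: "mod_split_ses \<Lambda> C (snd i) T1 (snd p) T1'"
      using short C unfolding short_split_coresolutions_def by blast
    have ob: "(T0, T1, f) \<in> maps_ob \<Lambda>" "(T0, T1', g) \<in> maps_ob \<Lambda>" using T sub by blast+
    have inj: "inj_on f (carrier T0)" "inj_on g (carrier T0)" using all_monomorphismsD[OF mono] T by blast+
    obtain x y where xy: "presents (T0, T1, f) (Phi \<Lambda> (T0, T1, f)) x" "presents (T0, T1', g) (Phi \<Lambda> (T0, T1', g)) y"
      using Phi_presents_ex[OF ob(1)] Phi_presents_ex[OF ob(2)] by blast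
    note P = Phi_fun_ob[OF ob(1)] Phi_fun_ob[OF ob(2)]
    have "Phi \<Lambda> (T0, T1, f) \<in> Phi_image \<Lambda> \<T>" "Phi \<Lambda> (T0, T1', g) \<in> Phi_image \<Lambda> \<T>" using im P T xy by blast+
    then show "\<exists>U \<in> Phi_image \<Lambda> \<T>. \<exists>V \<in> Phi_image \<Lambda> \<T>. \<exists>\<alpha> \<beta>. functor_ses \<Lambda> (representable \<Lambda> C) \<alpha> U \<beta> V"
      using coresolution_functor_ses[OF C ob inj S split P(1) xy(1) P(2) xy(2)] by blast
  qed
qed

text \<open>For the coresolutions, present the last term by a monomorphism and apply the horseshoe lemma. The
  resulting monomorphism presents the middle term, and it belongs to the subcategory because that
  contains all monomorphisms presenting a functor in \<open>\<U>\<close>.\<close>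

theorem monos_presenting_tilting:
  assumes "classical_tilting \<Lambda> \<U>"
  shows "relative_tilting_by_monos \<Lambda> (monos_presenting \<U>)"
    and "Phi_image \<Lambda> (monos_presenting \<U>) = iso_closure (mod_mod \<Lambda>) \<U>"
proof -
  let ?T = "monos_presenting \<U>"
  have sub: "\<U> \<subseteq> fun_ob" and pd: "\<And>U. U \<in> \<U> \<Longrightarrow> pdim (mod_mod \<Lambda>) U \<le> 1"
    and ext: "\<And>U V. \<lbrakk>U \<in> \<U>; V \<in> \<U>\<rbrakk> \<Longrightarrow> trivial_group (Ext (mod_mod \<Lambda>) 1 U V)"
    and cores: "\<And>C. C \<in> fg \<Longrightarrow> \<exists>U \<in> \<U>. \<exists>V \<in> \<U>. \<exists>\<alpha> \<beta>. functor_ses \<Lambda> (representable \<Lambda> C) \<alpha> U \<beta> V"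
    using assms by (simp_all add: classical_tilting_def)
  have Tsub: "?T \<subseteq> maps_ob \<Lambda>" by (auto simp: monos_presenting_def)
  have TI: "(A1, A0, f) \<in> ?T" if "(A1, A0, f) \<in> maps_ob \<Lambda>" "inj_on f (carrier A1)" "presents (A1, A0, f) U x" "U \<in> \<U>" for A1 A0 f x U
    using that unfolding monos_presenting_def by auto
  have TD: "\<exists>A1 A0 f U x. T = (A1, A0, f) \<and> (A1, A0, f) \<in> maps_ob \<Lambda> \<and> inj_on f (carrier A1) \<and> U \<in> \<U> \<and> U \<in> fun_ob \<and> presents (A1, A0, f) U x"
    if "T \<in> ?T" for T
    using that sub by (cases T) (auto simp: monos_presenting_def)
  have "ext_vanishes T T'" if T: "T \<in> ?T" "T' \<in> ?T" for T T'
  proof -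
    obtain A1 A0 f U x where A: "T = (A1, A0, f)" "(A1, A0, f) \<in> maps_ob \<Lambda>" "inj_on f (carrier A1)" "U \<in> \<U>" "U \<in> fun_ob"
      "presents (A1, A0, f) U x" using TD[OF T(1)] by blast
    obtain B1 B0 g V y where B: "T' = (B1, B0, g)" "(B1, B0, g) \<in> maps_ob \<Lambda>" "V \<in> \<U>" "V \<in> fun_ob"
      "presents (B1, B0, g) V y" using TD[OF T(2)] by blast
    show ?thesis
      using Ext1_presented_by_mono[OF A(5,2,3,6) B(4,2,5)] ext[OF A(4) B(3)] A(1) B(1) by simp
  qed
  moreover have "short_split_coresolutions \<Lambda> ?T"
    unfolding short_split_coresolutions_def
  proof
    fix C assume C: "C \<in> fg"
    obtain U V \<alpha> \<beta> where U: "U \<in> \<U>" and V: "V \<in> \<U>" and S: "functor_ses \<Lambda> (representable \<Lambda> C) \<alpha> U \<beta> V"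
      using cores[OF C] by blast
    have ob: "U \<in> fun_ob" "V \<in> fun_ob" using U V sub by blast+
    obtain S0 S1 g t where g: "(S0, S1, g) \<in> maps_ob \<Lambda>" "inj_on g (carrier S0)" "presents (S0, S1, g) V t"
      using mono_presentation[OF ob(2) pd[OF V]] .
    obtain Z f i p w where f: "(S0, Z, f) \<in> maps_ob \<Lambda>" "inj_on f (carrier S0)" "presents (S0, Z, f) U w"
      and ses: "(zero_map_to C, i, (S0, Z, f), p, (S0, S1, g)) \<in> maps_ses \<Lambda>" "mod_split_ses \<Lambda> C (snd i) Z (snd p) S1"
      using horseshoe[OF C ob S g] by metis
    show "\<exists>T0 T1 T1' f g i p. (T0, T1, f) \<in> ?T \<and> (T0, T1', g) \<in> ?T \<and>
        (zero_map_to C, i, (T0, T1, f), p, (T0, T1', g)) \<in> maps_ses \<Lambda> \<and> mod_split_ses \<Lambda> C (snd i) T1 (snd p) T1'"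
      using TI[OF f U] TI[OF g V] ses by blast
  qed
  moreover have "all_monomorphisms ?T" by (auto simp: all_monomorphisms_def monos_presenting_def)
  ultimately show "relative_tilting_by_monos \<Lambda> ?T"
    unfolding relative_tilting_by_monos_iff using Tsub by blast
  show "Phi_image \<Lambda> ?T = iso_closure (mod_mod \<Lambda>) \<U>"
  proof (intro subset_antisym subsetI)
    fix F assume "F \<in> Phi_image \<Lambda> ?T"
    then obtain T x where F: "F \<in> fun_ob" and T: "T \<in> ?T" "presents T F x" using Phi_image_iff[OF Tsub] by blast
    obtain U y where U: "U \<in> \<U>" "U \<in> fun_ob" "presents T U y" using TD[OF T(1)] by blast
    have "isomorphic (mod_mod \<Lambda>) F U" using presents_isomorphic[OF F U(2) _ T(2) U(3)] Tsub T(1) by blast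
    then show "F \<in> iso_closure (mod_mod \<Lambda>) \<U>" using F U(1) by (auto simp: iso_closure_def)
  next
    fix F assume "F \<in> iso_closure (mod_mod \<Lambda>) \<U>"
    then obtain U where F: "F \<in> fun_ob" and U: "U \<in> \<U>" and iso: "isomorphic (mod_mod \<Lambda>) F U" by (auto simp: iso_closure_def)
    have Uob: "U \<in> fun_ob" using U sub by blast
    obtain A1 A0 f x where A: "(A1, A0, f) \<in> maps_ob \<Lambda>" "inj_on f (carrier A1)" "presents (A1, A0, f) U x"
      using mono_presentation[OF Uob pd[OF U]] .
    have "isomorphic (mod_mod \<Lambda>) U F" using iso unfolding isomorphic_def by blast
    then obtain y where "presents (A1, A0, f) F y"
      using isomorphic_presents[OF fun_ob_presheaf[OF Uob] fun_ob_presheaf[OF F] _ A(1,3)] by blast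
    then show "F \<in> Phi_image \<Lambda> ?T" using Phi_image_iff[OF Tsub] F TI[OF A U] by blast
  qed
qed

text \<open>Adding and removing summands \<open>1\<^sub>X\<close> does not change the functor, and by Schanuel's lemma any two
  monomorphisms that present the same functor are related in this way.\<close>

lemma identity_closure_eq:
  assumes sub: "\<T> \<subseteq> maps_ob \<Lambda>" and mono: "all_monomorphisms \<T>"
  shows "identity_closure \<Lambda> \<T> = monos_presenting (Phi_image \<Lambda> \<T>)"
proof (intro subset_antisym subsetI)
  fix G assume "G \<in> identity_closure \<Lambda> \<T>"
  then obtain T X Y Z where G: "G \<in> maps_ob \<Lambda>" and T: "T \<in> \<T>" and XY: "X \<in> fg" "Y \<in> fg"
    and bp: "is_biproduct (maps_F \<Lambda>) T (identity_map X) Z" "is_biproduct (maps_F \<Lambda>) G (identity_map Y) Z"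
    unfolding identity_closure_def by blast
  obtain A1 A0 f B1 B0 g Z1 Z0 h where eq: "T = (A1, A0, f)" "G = (B1, B0, g)" "Z = (Z1, Z0, h)" by (metis prod_cases3)
  have A: "(A1, A0, f) \<in> maps_ob \<Lambda>" "inj_on f (carrier A1)" and B: "(B1, B0, g) \<in> maps_ob \<Lambda>"
    using T sub G all_monomorphismsD[OF mono] eq by auto
  note bp = bp[unfolded eq]
  have Z: "(Z1, Z0, h) \<in> maps_ob \<Lambda>" using bp(1) unfolding is_biproduct_def by simp
  have injg: "inj_on g (carrier B1)"
    using A(2) biproduct_mono_iff[OF A(1) XY(1) bp(1)] biproduct_mono_iff[OF B XY(2) bp(2)] by simp
  let ?F = "Phi \<Lambda> (A1, A0, f)" and ?G = "Phi \<Lambda> (B1, B0, g)"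
  have F: "?F \<in> fun_ob" "presheaf ?F" and G: "?G \<in> fun_ob" "presheaf ?G"
    using Phi_fun_ob[OF A(1)] Phi_fun_ob[OF B] by simp_all
  obtain x where x: "presents (A1, A0, f) ?F x" using Phi_presents_ex[OF A(1)] by blast
  obtain y where y: "presents (B1, B0, g) ?G y" using Phi_presents_ex[OF B] by blast
  obtain z where z: "presents (Z1, Z0, h) ?F z" using biproduct_presents[OF F(2) A(1) x XY(1) bp(1)] by blast
  obtain z' where z': "presents (Z1, Z0, h) ?G z'" using biproduct_presents[OF G(2) B y XY(2) bp(2)] by blast
  have "isomorphic (mod_mod \<Lambda>) ?G ?F" using presents_isomorphic[OF G(1) F(1) Z z' z] .
  then obtain y' where "presents (B1, B0, g) ?F y'" using isomorphic_presents[OF G(2) F(2) _ B y] by blast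
  moreover have "?F \<in> Phi_image \<Lambda> \<T>" using Phi_image_iff[OF sub] F(1) x T eq by blast
  ultimately show "G \<in> monos_presenting (Phi_image \<Lambda> \<T>)"
    unfolding monos_presenting_def eq(2) using B injg by auto
next
  fix G assume G: "G \<in> monos_presenting (Phi_image \<Lambda> \<T>)"
  obtain B1 B0 g where eq: "G = (B1, B0, g)" by (metis prod_cases3)
  obtain U y where B: "(B1, B0, g) \<in> maps_ob \<Lambda>" "inj_on g (carrier B1)" and U: "U \<in> Phi_image \<Lambda> \<T>" and y: "presents (B1, B0, g) U y"
    using G unfolding monos_presenting_def eq by auto
  obtain A1 A0 f x where T: "(A1, A0, f) \<in> \<T>" and x: "presents (A1, A0, f) U x" and Uob: "U \<in> fun_ob"
    using U Phi_image_iff[OF sub] by (metis prod_cases3)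
  have A: "(A1, A0, f) \<in> maps_ob \<Lambda>" "inj_on f (carrier A1)" using T sub all_monomorphismsD[OF mono] by auto
  obtain Z where "is_biproduct (maps_F \<Lambda>) (A1, A0, f) (identity_map B0) Z" "is_biproduct (maps_F \<Lambda>) (B1, B0, g) (identity_map A0) Z"
    using schanuel[OF fun_ob_presheaf[OF Uob] A x B y] .
  moreover have "A0 \<in> fg" "B0 \<in> fg" using A B by simp_all
  ultimately show "G \<in> identity_closure \<Lambda> \<T>"
    unfolding identity_closure_def eq using B(1) T by blast
qed

lemma iso_closure_Phi_image:
  assumes "\<T> \<subseteq> maps_ob \<Lambda>"
  shows "iso_closure (mod_mod \<Lambda>) (Phi_image \<Lambda> \<T>) = Phi_image \<Lambda> \<T>"
proof (intro subset_antisym subsetI)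
  fix F assume "F \<in> iso_closure (mod_mod \<Lambda>) (Phi_image \<Lambda> \<T>)"
  then obtain U where F: "F \<in> fun_ob" and U: "U \<in> Phi_image \<Lambda> \<T>" and iso: "isomorphic (mod_mod \<Lambda>) F U" by (auto simp: iso_closure_def)
  obtain T x where Uob: "U \<in> fun_ob" and T: "T \<in> \<T>" "presents T U x" using U Phi_image_iff[OF assms] by blast
  have "isomorphic (mod_mod \<Lambda>) U F" using iso unfolding isomorphic_def by blast
  then obtain y where "presents T F y"
    using isomorphic_presents[OF fun_ob_presheaf[OF Uob] fun_ob_presheaf[OF F] _ _ T(2)] T(1) assms by blast
  then show "F \<in> Phi_image \<Lambda> \<T>" using Phi_image_iff[OF assms] F T(1) by blast
next
  fix F assume F: "F \<in> Phi_image \<Lambda> \<T>"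
  then have "F \<in> fun_ob" using Phi_image_iff[OF assms] by blast
  then show "F \<in> iso_closure (mod_mod \<Lambda>) (Phi_image \<Lambda> \<T>)" using F isomorphic_refl by (auto simp: iso_closure_def)
qed

end

theorem theorem3p5:
  fixes R :: "('r, 's) ring_scheme" and \<sigma> :: "'r \<Rightarrow> 'a" and \<Lambda> :: "('a, 'b) ring_scheme"
  assumes "artin_algebra R \<sigma> \<Lambda>"
  shows "(\<forall>\<T>. relative_tilting_by_monos \<Lambda> \<T> \<longrightarrow> classical_tilting \<Lambda> (Phi_image \<Lambda> \<T>)) \<and>
    (\<forall>\<T>. \<T> \<subseteq> Ob (maps_F \<Lambda>) \<and> all_monomorphisms \<T> \<and> identity_closure \<Lambda> \<T> = \<T> \<longrightarrow>
       classical_tilting \<Lambda> (Phi_image \<Lambda> \<T>) \<longrightarrow> relative_tilting_by_monos \<Lambda> \<T>) \<and>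
    (\<forall>\<U>. classical_tilting \<Lambda> \<U> \<longrightarrow>
       (\<exists>\<T>. relative_tilting_by_monos \<Lambda> \<T> \<and> Phi_image \<Lambda> \<T> = iso_closure (mod_mod \<Lambda>) \<U>)) \<and>
    (\<forall>\<T> \<T>'. relative_tilting_by_monos \<Lambda> \<T> \<longrightarrow> relative_tilting_by_monos \<Lambda> \<T>' \<longrightarrow>
       (Phi_image \<Lambda> \<T> = Phi_image \<Lambda> \<T>' \<longleftrightarrow> identity_closure \<Lambda> \<T> = identity_closure \<Lambda> \<T>'))"
proof -
  interpret artin_algebra_modules R \<sigma> \<Lambda> by unfold_locales (rule assms)
  show ?thesis
  proof (intro conjI allI impI)
    fix \<T> assume "relative_tilting_by_monos \<Lambda> \<T>"
    then show "classical_tilting \<Lambda> (Phi_image \<Lambda> \<T>)" by (rule classical_tilting_Phi_image)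
  next
    fix \<T> assume T: "\<T> \<subseteq> Ob (maps_F \<Lambda>) \<and> all_monomorphisms \<T> \<and> identity_closure \<Lambda> \<T> = \<T>"
      and tilting: "classical_tilting \<Lambda> (Phi_image \<Lambda> \<T>)"
    then have "monos_presenting (Phi_image \<Lambda> \<T>) = \<T>" using identity_closure_eq[of \<T>] by simp
    then show "relative_tilting_by_monos \<Lambda> \<T>" using monos_presenting_tilting(1)[OF tilting] by simp
  next
    fix \<U> assume "classical_tilting \<Lambda> \<U>"
    then show "\<exists>\<T>. relative_tilting_by_monos \<Lambda> \<T> \<and> Phi_image \<Lambda> \<T> = iso_closure (mod_mod \<Lambda>) \<U>"
      using monos_presenting_tilting by blast
  next
    fix \<T> \<T>' assume "relative_tilting_by_monos \<Lambda> \<T>" and "relative_tilting_by_monos \<Lambda> \<T>'"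
    then have T: "\<T> \<subseteq> maps_ob \<Lambda>" "all_monomorphisms \<T>" "classical_tilting \<Lambda> (Phi_image \<Lambda> \<T>)"
      and T': "\<T>' \<subseteq> maps_ob \<Lambda>" "all_monomorphisms \<T>'" "classical_tilting \<Lambda> (Phi_image \<Lambda> \<T>')"
      using classical_tilting_Phi_image by (simp_all add: relative_tilting_by_monos_iff)
    have "Phi_image \<Lambda> (identity_closure \<Lambda> \<T>) = Phi_image \<Lambda> \<T>" "Phi_image \<Lambda> (identity_closure \<Lambda> \<T>') = Phi_image \<Lambda> \<T>'"
      using identity_closure_eq[OF T(1,2)] monos_presenting_tilting(2)[OF T(3)] iso_closure_Phi_image[OF T(1)]
        identity_closure_eq[OF T'(1,2)] monos_presenting_tilting(2)[OF T'(3)] iso_closure_Phi_image[OF T'(1)] by simp_all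
    then show "Phi_image \<Lambda> \<T> = Phi_image \<Lambda> \<T>' \<longleftrightarrow> identity_closure \<Lambda> \<T> = identity_closure \<Lambda> \<T>'"
      using identity_closure_eq[OF T(1,2)] identity_closure_eq[OF T'(1,2)] by metis
  qed
qed

end
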